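(* Let $\varphi(\vec X;\vec Y)$ be a formula of the language of monadic second-order logic over $\omega$-words whose free variables are among the predicate variables $\vec X = X_1,\dots,X_p$ and $\vec Y = Y_1,\dots,Y_q$ (and which has no free individual variables). \begin{enumerate} \item From a derivation in $\mathsf{SMSO}$ of the sequent $\vdash \exists Y_1\cdots\exists Y_q\, \varphi(\vec X;\vec Y)$ one can effectively extract a finite-state synchronous Church-realizer of $\varphi(\vec X;\vec Y)$. \item If $\varphi(\vec X;\vec Y)$ admits a finite-state synchronous Church-realizer, then $\vdash \exists Y_1\cdots\exists Y_q\, \lnot\lnot\varphi(\vec X;\vec Y)$ is derivable in $\mathsf{SMSO}$. \end{enumerate}
   Context: \emph{Language.} Two-sorted: individual variables $x,y,z,t,\dots$ and (monadic) predicate variables $X,Y,Z,Q,\dots$. Atomic formulae $\alpha$: $x\doteq y$, $x\leq y$, $\mathsf{S}(x,y)$, $\mathsf{Zero}(x)$, $x\in X$ (also written $X(x)$), $\top$, $\bot$. Deterministic formulae $\delta ::= \alpha \mid \delta\wedge\delta' \mid \lnot\varphi$; formulae $\varphi,\psi ::= \delta \mid \varphi\wedge\psi \mid \exists x\,\varphi \mid \exists X\,\varphi$ (there is no primitive $\vee,\to,\forall$). Abbreviations: $\varphi\vee\psi := \lnot(\lnot\varphi\wedge\lnot\psi)$, $\varphi\to\psi := \lnot(\varphi\wedge\lnot\psi)$, $\varphi\leftrightarrow\psi := (\varphi\to\psi)\wedge(\psi\to\varphi)$, $\forall x\varphi := \lnot\exists x\lnot\varphi$, $\forall X\varphi:=\lnot\exists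 X\lnot\varphi$, $x<y := x\leq y\wedge\lnot(x\doteq y)$. Standard model $\mathfrak N$: individuals range over $\mathbb N$, predicates over subsets of $\mathbb N$ (identified with $\{0,1\}^\omega$), $\doteq$ is equality, $\leq$ the usual order, $\mathsf S(x,y)$ iff $y=x+1$, $\mathsf{Zero}(x)$ iff $x=0$, $\in$ is membership. \emph{Substitution.} $\varphi[\psi[y]/X]$ denotes capture-avoiding replacement in $\varphi$ of every atom $t\in X$ by $\psi[t/y]$. \emph{Relativization and boundedness.} For formulae $\varphi,\theta$ and variable $y$, $\varphi|\theta[y]$ is defined by: $\alpha|\theta[y]:=\alpha$; it commutes with $\wedge$, $\lnot$, $\exists X$; $(\exists x\varphi)|\theta[y] := \exists x(\theta[x/y]\wedge \varphi|\theta[y])$ (bound variables not free in $\theta$). A formula is \emph{bounded by $x$} if it has the form $\psi|(y\leq x)[y]$ for some $\psi$; it is \emph{uniformly bounded by $x$} if moreover $x$ is its only free individual variable. \emph{Logical rules} (on sequents $\vec\varphi\vdash\varphi$): $\vec\varphi,\varphi\vdash\varphi$; cut (from $\vec\varphi\vdash\psi$ and $\vec\varphi,\psi\vdash\varphi$ infer $\vec\varphi\vdash\varphi$); from $\vec\varphi\vdash\varphi$ and $\vec\varphi\vdash\lnot\varphi$ infer $\vec\varphi\vdash\bot$; from $\vec\varphi,\varphi\vdash\bot$ infer $\vec\varphi\vdash\lnot\varphi$; $\wedge$-introduction and both $\wedge$-eliminations; from $\vec\varphi\vdash\varphi[y/x]$ infer $\vec\varphi\vdash\exists x\varphi$; from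 $\vec\varphi\vdash\varphi[Y/X]$ infer $\vec\varphi\vdash\exists X\varphi$; from $\vec\varphi\vdash\exists x\varphi$ and $\vec\varphi,\varphi\vdash\psi$ infer $\vec\varphi\vdash\psi$ ($x$ not free in $\vec\varphi,\psi$), and likewise for $\exists X$. \emph{Arithmetic rules} (all premises/conclusions share the context $\vec\varphi$): $\vdash x\doteq x$; from $\varphi[y/x]$ and $y\doteq z$ infer $\varphi[z/x]$; $\vdash x\leq x$; from $x\leq y$, $y\leq z$ infer $x\leq z$; from $x\leq y$, $y\leq x$ infer $x\doteq y$; $\vdash\exists y\,\mathsf{Zero}(y)$; from $\mathsf{Zero}(x),\mathsf{Zero}(y)$ infer $x\doteq y$; $\vdash\exists y\,\mathsf S(x,y)$; from $\mathsf S(y,x),\mathsf S(z,x)$ infer $y\doteq z$; from $\mathsf S(x,y),\mathsf S(x,z)$ infer $y\doteq z$; from $\mathsf S(x,y),\mathsf{Zero}(y)$ infer $\bot$; from $\mathsf S(x,y)$ infer $x\leq y$; from $\mathsf S(y,y')$, $x\leq y'$, $\lnot(x\doteq y')$ infer $x\leq y$. \emph{$\mathsf{SMSO}$} is the system with the logical and arithmetic rules plus: negative comprehension (from $\vec\varphi\vdash\varphi[\psi[y]/X]$ infer $\vec\varphi\vdash\lnot\lnot\exists X\varphi$); deterministic induction (from $\vec\varphi,\mathsf{Zero}(z)\vdash\delta[z/x]$ and $\vec\varphi,\mathsf S(y,z),\delta[y/x]\vdash\delta[z/x]$ infer $\vec\varphi\vdash\delta$, for $\delta$ deterministic and $y,z$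 not free in $\vec\varphi,\delta$); deterministic double negation elimination (from $\vec\varphi\vdash\lnot\lnot\delta$ infer $\vec\varphi\vdash\delta$, $\delta$ deterministic); synchronous comprehension (from $\vec\varphi\vdash\psi[\hat\varphi[y]/X]$ infer $\vec\varphi\vdash\exists X\psi$, where $\hat\varphi$ is uniformly bounded by $y$). \emph{Church realizers.} Alphabets are finite nonempty sets. A deterministic Mealy machine (DMM) $\Sigma\to\Gamma$ consists of a finite set of states $Q$, an initial state $q_0$, and $\partial:Q\times\Sigma\to Q\times\Gamma$; it induces $F:\Sigma^\omega\to\Gamma^\omega$ by $F(\sigma)(n)=$ the output of $\partial$ on the letter $\sigma(n)$ from the state reached after reading $\sigma(0)\cdots\sigma(n-1)$ from $q_0$. Functions so induced are called finite-state synchronous. A finite-state synchronous Church-realizer of $\varphi(\vec X;\vec Y)$ is a tuple $F_1,\dots,F_q$ of finite-state synchronous functions $(\{0,1\}^p)^\omega\to\{0,1\}^\omega$ (identifying $(\{0,1\}^\omega)^p$ with $(\{0,1\}^p)^\omega$) such that $\mathfrak N\models\varphi[\vec\sigma/\vec X,F_1(\vec\sigma)/Y_1,\dots,F_q(\vec\sigma)/Y_q]$ for all $\vec\sigma\in(\{0,1\}^\omega)^p$.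
   Formalization: The listed rules of SMSO contain none for the atom ⊤, so ¬¬⊤ would be underivable and part 2 would fail for φ = ⊤; the formal system adds the single rule that ⊤ is derivable in every context. *)

theory Defs
  imports Main "HOL-Library.Nat_Bijection" "HOL-Library.FuncSet"
begin

section \<open>Formulae\<close>

text \<open>
  Formulae are taken modulo renaming of bound variables, in de Bruijn style, with one
  index space for individual variables and one for predicate variables. The constructor
  \<^term>\<open>ExI\<close> binds the individual index 0 and \<^term>\<open>ExP\<close> the predicate index 0.
\<close>

datatype fm =
    Eq nat nat
  | Le nat nat
  | Succ nat nat
  | Zero nat
  | Mem nat nat
  | Tru
  | Fls
  | And fm fm
  | Neg fm
  | ExI fm
  | ExP fm

primrec deterministic :: "fm \<Rightarrow> bool" where
  "deterministic (Eq x y) = True"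
| "deterministic (Le x y) = True"
| "deterministic (Succ x y) = True"
| "deterministic (Zero x) = True"
| "deterministic (Mem x X) = True"
| "deterministic Tru = True"
| "deterministic Fls = True"
| "deterministic (And \<phi> \<psi>) = (deterministic \<phi> \<and> deterministic \<psi>)"
| "deterministic (Neg \<phi>) = True"
| "deterministic (ExI \<phi>) = False"
| "deterministic (ExP \<phi>) = False"

primrec free_ind :: "fm \<Rightarrow> nat set" where
  "free_ind (Eq x y) = {x, y}"
| "free_ind (Le x y) = {x, y}"
| "free_ind (Succ x y) = {x, y}"
| "free_ind (Zero x) = {x}"
| "free_ind (Mem x X) = {x}"
| "free_ind Tru = {}"
| "free_ind Fls = {}"
| "free_ind (And \<phi> \<psi>) = free_ind \<phi> \<union> free_ind \<psi>"
| "free_ind (Neg \<phi>) = free_ind \<phi>"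
| "free_ind (ExI \<phi>) = {x. Suc x \<in> free_ind \<phi>}"
| "free_ind (ExP \<phi>) = free_ind \<phi>"

primrec free_pred :: "fm \<Rightarrow> nat set" where
  "free_pred (Eq x y) = {}"
| "free_pred (Le x y) = {}"
| "free_pred (Succ x y) = {}"
| "free_pred (Zero x) = {}"
| "free_pred (Mem x X) = {X}"
| "free_pred Tru = {}"
| "free_pred Fls = {}"
| "free_pred (And \<phi> \<psi>) = free_pred \<phi> \<union> free_pred \<psi>"
| "free_pred (Neg \<phi>) = free_pred \<phi>"
| "free_pred (ExI \<phi>) = free_pred \<phi>"
| "free_pred (ExP \<phi>) = {X. Suc X \<in> free_pred \<phi>}"

text \<open>Truth in the standard model; a predicate is a subset of the natural numbers, given
  by its characteristic \<open>\<omega>\<close>-word.\<close>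

primrec sat :: "(nat \<Rightarrow> nat) \<Rightarrow> (nat \<Rightarrow> nat \<Rightarrow> bool) \<Rightarrow> fm \<Rightarrow> bool" where
  "sat i P (Eq x y) = (i x = i y)"
| "sat i P (Le x y) = (i x \<le> i y)"
| "sat i P (Succ x y) = (i y = i x + 1)"
| "sat i P (Zero x) = (i x = 0)"
| "sat i P (Mem x X) = P X (i x)"
| "sat i P Tru = True"
| "sat i P Fls = False"
| "sat i P (And \<phi> \<psi>) = (sat i P \<phi> \<and> sat i P \<psi>)"
| "sat i P (Neg \<phi>) = (\<not> sat i P \<phi>)"
| "sat i P (ExI \<phi>) = (\<exists>n. sat (case_nat n i) P \<phi>)"
| "sat i P (ExP \<phi>) = (\<exists>A. sat i (case_nat A P) \<phi>)"


section \<open>Substitution and relativization\<close>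

definition up :: "(nat \<Rightarrow> nat) \<Rightarrow> nat \<Rightarrow> nat" where
  "up r = case_nat 0 (\<lambda>x. Suc (r x))"

text \<open>Simultaneous renaming of the free individual variables by \<open>r\<close> and of the free
  predicate variables by \<open>R\<close>.\<close>

primrec ren :: "(nat \<Rightarrow> nat) \<Rightarrow> (nat \<Rightarrow> nat) \<Rightarrow> fm \<Rightarrow> fm" where
  "ren r R (Eq x y) = Eq (r x) (r y)"
| "ren r R (Le x y) = Le (r x) (r y)"
| "ren r R (Succ x y) = Succ (r x) (r y)"
| "ren r R (Zero x) = Zero (r x)"
| "ren r R (Mem x X) = Mem (r x) (R X)"
| "ren r R Tru = Tru"
| "ren r R Fls = Fls"
| "ren r R (And \<phi> \<psi>) = And (ren r R \<phi>) (ren r R \<psi>)"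
| "ren r R (Neg \<phi>) = Neg (ren r R \<phi>)"
| "ren r R (ExI \<phi>) = ExI (ren (up r) R \<phi>)"
| "ren r R (ExP \<phi>) = ExP (ren r (up R) \<phi>)"

abbreviation lift_ind :: "fm \<Rightarrow> fm" where
  "lift_ind \<equiv> ren Suc id"

abbreviation lift_pred :: "fm \<Rightarrow> fm" where
  "lift_pred \<equiv> ren id Suc"

text \<open>\<^term>\<open>inst_ind y \<phi>\<close> is \<open>\<phi>[y/x]\<close> and \<^term>\<open>inst_pred Y \<phi>\<close> is \<open>\<phi>[Y/X]\<close>, where the
  replaced variable has index 0 in \<open>\<phi>\<close> and the other indices are shifted by one.\<close>

definition inst_ind :: "nat \<Rightarrow> fm \<Rightarrow> fm" where
  "inst_ind y = ren (case_nat y id) id"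

definition inst_pred :: "nat \<Rightarrow> fm \<Rightarrow> fm" where
  "inst_pred Y = ren id (case_nat Y id)"

text \<open>Simultaneous substitution of formulae for predicate variables. In \<^term>\<open>s X\<close> the
  individual index 0 stands for the argument \<open>y\<close> of the substituted formula \<open>\<psi>[y]\<close>, and the
  index \<^term>\<open>Suc x\<close> for the ambient variable \<open>x\<close>.\<close>

primrec subst_pred :: "(nat \<Rightarrow> fm) \<Rightarrow> fm \<Rightarrow> fm" where
  "subst_pred s (Eq x y) = Eq x y"
| "subst_pred s (Le x y) = Le x y"
| "subst_pred s (Succ x y) = Succ x y"
| "subst_pred s (Zero x) = Zero x"
| "subst_pred s (Mem x X) = inst_ind x (s X)"
| "subst_pred s Tru = Tru"
| "subst_pred s Fls = Fls"
| "subst_pred s (And \<phi> \<psi>) = And (subst_pred s \<phi>) (subst_pred s \<psi>)"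
| "subst_pred s (Neg \<phi>) = Neg (subst_pred s \<phi>)"
| "subst_pred s (ExI \<phi>) = ExI (subst_pred (\<lambda>X. ren (up Suc) id (s X)) \<phi>)"
| "subst_pred s (ExP \<phi>) = ExP (subst_pred (case_nat (Mem 0 0) (\<lambda>X. lift_pred (s X))) \<phi>)"

text \<open>\<open>\<phi>[\<psi>[y]/X]\<close>, where \<open>X\<close> is the predicate index 0 of \<open>\<phi>\<close> and \<open>y\<close> the individual index 0
  of \<open>\<psi>\<close>.\<close>

definition inst_fm :: "fm \<Rightarrow> fm \<Rightarrow> fm" where
  "inst_fm \<psi> = subst_pred (case_nat \<psi> (Mem 0))"

text \<open>\<^term>\<open>relativize \<theta> \<phi>\<close> is \<open>\<phi>|\<theta>[y]\<close>, with \<open>y\<close> the individual index 0 of \<open>\<theta>\<close>. Hence, in the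
  scope of the quantifier \<open>\<exists>x\<close>, the formula \<open>\<theta>[x/y]\<close> is \<open>\<theta>\<close> itself.\<close>

primrec relativize :: "fm \<Rightarrow> fm \<Rightarrow> fm" where
  "relativize \<theta> (Eq x y) = Eq x y"
| "relativize \<theta> (Le x y) = Le x y"
| "relativize \<theta> (Succ x y) = Succ x y"
| "relativize \<theta> (Zero x) = Zero x"
| "relativize \<theta> (Mem x X) = Mem x X"
| "relativize \<theta> Tru = Tru"
| "relativize \<theta> Fls = Fls"
| "relativize \<theta> (And \<phi> \<psi>) = And (relativize \<theta> \<phi>) (relativize \<theta> \<psi>)"
| "relativize \<theta> (Neg \<phi>) = Neg (relativize \<theta> \<phi>)"
| "relativize \<theta> (ExI \<phi>) = ExI (And \<theta> (relativize (ren (up Suc) id \<theta>) \<phi>))"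
| "relativize \<theta> (ExP \<phi>) = ExP (relativize (lift_pred \<theta>) \<phi>)"

definition bounded_by :: "nat \<Rightarrow> fm \<Rightarrow> bool" where
  "bounded_by x \<phi> \<longleftrightarrow> (\<exists>\<psi>. \<phi> = relativize (Le 0 (Suc x)) \<psi>)"

definition uniformly_bounded_by :: "nat \<Rightarrow> fm \<Rightarrow> bool" where
  "uniformly_bounded_by x \<phi> \<longleftrightarrow> bounded_by x \<phi> \<and> free_ind \<phi> \<subseteq> {x}"


section \<open>The system SMSO\<close>

type_synonym sequent = "fm list \<times> fm"

text \<open>
  \<^term>\<open>smso_rule ps c\<close>: the sequent \<open>c\<close> follows from the list of premises \<open>ps\<close> by one rule
  instance. Contexts are used up to order and repetition: every member of the context is
  an axiom. Eigenvariable conditions are expressed by lifting.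

  The rule \<open>truth\<close> gives the atom \<^term>\<open>Tru\<close> its meaning: all other rules remain sound when
  \<^term>\<open>Tru\<close> is interpreted as falsity, so they do not derive it.

  In \<open>induction\<close>, \<open>\<delta>\<close> has the induction variable at index 0. In the first premise \<open>z\<close> is the
  index 0; in the second one \<open>z\<close> is the index 0 and \<open>y\<close> the index 1, so that
  \<^term>\<open>lift_ind \<delta>\<close> is \<open>\<delta>[y/x]\<close> and \<^term>\<open>ren (up Suc) id \<delta>\<close> is \<open>\<delta>[z/x]\<close>.
\<close>

inductive smso_rule :: "sequent list \<Rightarrow> sequent \<Rightarrow> bool" where
  ax: "\<phi> \<in> set \<Gamma> \<Longrightarrow> smso_rule [] (\<Gamma>, \<phi>)"
| cut: "smso_rule [(\<Gamma>, \<psi>), (\<psi> # \<Gamma>, \<phi>)] (\<Gamma>, \<phi>)"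
| truth: "smso_rule [] (\<Gamma>, Tru)"
| neg_elim: "smso_rule [(\<Gamma>, \<phi>), (\<Gamma>, Neg \<phi>)] (\<Gamma>, Fls)"
| neg_intro: "smso_rule [(\<phi> # \<Gamma>, Fls)] (\<Gamma>, Neg \<phi>)"
| and_intro: "smso_rule [(\<Gamma>, \<phi>), (\<Gamma>, \<psi>)] (\<Gamma>, And \<phi> \<psi>)"
| and_elim1: "smso_rule [(\<Gamma>, And \<phi> \<psi>)] (\<Gamma>, \<phi>)"
| and_elim2: "smso_rule [(\<Gamma>, And \<phi> \<psi>)] (\<Gamma>, \<psi>)"
| ex_ind_intro: "smso_rule [(\<Gamma>, inst_ind y \<phi>)] (\<Gamma>, ExI \<phi>)"
| ex_pred_intro: "smso_rule [(\<Gamma>, inst_pred Y \<phi>)] (\<Gamma>, ExP \<phi>)"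
| ex_ind_elim:
    "smso_rule [(\<Gamma>, ExI \<phi>), (\<phi> # map lift_ind \<Gamma>, lift_ind \<psi>)] (\<Gamma>, \<psi>)"
| ex_pred_elim:
    "smso_rule [(\<Gamma>, ExP \<phi>), (\<phi> # map lift_pred \<Gamma>, lift_pred \<psi>)] (\<Gamma>, \<psi>)"
| eq_refl: "smso_rule [] (\<Gamma>, Eq x x)"
| eq_subst: "smso_rule [(\<Gamma>, inst_ind y \<phi>), (\<Gamma>, Eq y z)] (\<Gamma>, inst_ind z \<phi>)"
| le_refl: "smso_rule [] (\<Gamma>, Le x x)"
| le_trans: "smso_rule [(\<Gamma>, Le x y), (\<Gamma>, Le y z)] (\<Gamma>, Le x z)"
| le_antisym: "smso_rule [(\<Gamma>, Le x y), (\<Gamma>, Le y x)] (\<Gamma>, Eq x y)"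
| zero_ex: "smso_rule [] (\<Gamma>, ExI (Zero 0))"
| zero_unique: "smso_rule [(\<Gamma>, Zero x), (\<Gamma>, Zero y)] (\<Gamma>, Eq x y)"
| succ_ex: "smso_rule [] (\<Gamma>, ExI (Succ (Suc x) 0))"
| succ_inj: "smso_rule [(\<Gamma>, Succ y x), (\<Gamma>, Succ z x)] (\<Gamma>, Eq y z)"
| succ_unique: "smso_rule [(\<Gamma>, Succ x y), (\<Gamma>, Succ x z)] (\<Gamma>, Eq y z)"
| succ_not_zero: "smso_rule [(\<Gamma>, Succ x y), (\<Gamma>, Zero y)] (\<Gamma>, Fls)"
| succ_le: "smso_rule [(\<Gamma>, Succ x y)] (\<Gamma>, Le x y)"
| le_succ:
    "smso_rule [(\<Gamma>, Succ y y'), (\<Gamma>, Le x y'), (\<Gamma>, Neg (Eq x y'))] (\<Gamma>, Le x y)"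
| negative_comprehension:
    "smso_rule [(\<Gamma>, inst_fm \<psi> \<phi>)] (\<Gamma>, Neg (Neg (ExP \<phi>)))"
| induction: "deterministic \<delta> \<Longrightarrow>
    smso_rule
      [(Zero 0 # map lift_ind \<Gamma>, \<delta>),
       (lift_ind \<delta> # Succ 1 0 # map (\<lambda>\<gamma>. lift_ind (lift_ind \<gamma>)) \<Gamma>, ren (up Suc) id \<delta>)]
      (\<Gamma>, inst_ind x \<delta>)"
| dne: "deterministic \<delta> \<Longrightarrow> smso_rule [(\<Gamma>, Neg (Neg \<delta>))] (\<Gamma>, \<delta>)"
| synchronous_comprehension: "uniformly_bounded_by 0 \<chi> \<Longrightarrow>
    smso_rule [(\<Gamma>, inst_fm \<chi> \<psi>)] (\<Gamma>, ExP \<psi>)"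

datatype deriv = Deriv (conclusion: sequent) (subderivs: "deriv list")

inductive is_derivation :: "deriv \<Rightarrow> bool" where
  "smso_rule (map conclusion ds) c \<Longrightarrow> (\<And>d. d \<in> set ds \<Longrightarrow> is_derivation d) \<Longrightarrow>
     is_derivation (Deriv c ds)"

definition smso_derivable :: "sequent \<Rightarrow> bool" where
  "smso_derivable c \<longleftrightarrow> (\<exists>d. is_derivation d \<and> conclusion d = c)"


section \<open>Mealy machines and Church realizers\<close>

record ('q, 'a, 'b) dmm =
  dmm_states :: "'q set"
  dmm_init :: 'q
  dmm_trans :: "'q \<times> 'a \<Rightarrow> 'q \<times> 'b"

definition is_dmm :: "'a set \<Rightarrow> 'b set \<Rightarrow> ('q, 'a, 'b) dmm \<Rightarrow> bool" where
  "is_dmm \<Sigma> \<Delta> M \<longleftrightarrow>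
     finite \<Sigma> \<and> \<Sigma> \<noteq> {} \<and> finite \<Delta> \<and> \<Delta> \<noteq> {} \<and>
     finite (dmm_states M) \<and> dmm_init M \<in> dmm_states M \<and>
     dmm_trans M \<in> dmm_states M \<times> \<Sigma> \<rightarrow> dmm_states M \<times> \<Delta>"

primrec dmm_state :: "('q, 'a, 'b) dmm \<Rightarrow> (nat \<Rightarrow> 'a) \<Rightarrow> nat \<Rightarrow> 'q" where
  "dmm_state M w 0 = dmm_init M"
| "dmm_state M w (Suc n) = fst (dmm_trans M (dmm_state M w n, w n))"

definition dmm_fun :: "('q, 'a, 'b) dmm \<Rightarrow> (nat \<Rightarrow> 'a) \<Rightarrow> nat \<Rightarrow> 'b" where
  "dmm_fun M w n = snd (dmm_trans M (dmm_state M w n, w n))"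

text \<open>States may be taken to be natural numbers, since only finite state sets are
  considered.\<close>

definition finite_state_synchronous ::
    "'a set \<Rightarrow> 'b set \<Rightarrow> ((nat \<Rightarrow> 'a) \<Rightarrow> nat \<Rightarrow> 'b) \<Rightarrow> bool" where
  "finite_state_synchronous \<Sigma> \<Delta> F \<longleftrightarrow>
     (\<exists>M :: (nat, 'a, 'b) dmm. is_dmm \<Sigma> \<Delta> M \<and>
        (\<forall>w. (\<forall>n. w n \<in> \<Sigma>) \<longrightarrow> F w = dmm_fun M w))"

definition bits :: "nat \<Rightarrow> bool list set" where
  "bits p = {a. length a = p}"

text \<open>The identification of \<open>p\<close>-tuples of \<open>\<omega>\<close>-words over \<open>{0,1}\<close> with \<open>\<omega>\<close>-words over
  \<open>{0,1}\<^sup>p\<close>.\<close>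

definition convolution :: "(nat \<Rightarrow> bool) list \<Rightarrow> nat \<Rightarrow> bool list" where
  "convolution ws n = map (\<lambda>w. w n) ws"

text \<open>
  A formula \<open>\<phi>(X\<^sub>1,\<dots>,X\<^sub>p;Y\<^sub>1,\<dots>,Y\<^sub>q)\<close> has the predicate indices \<open>0,\<dots>,q-1\<close> for
  \<open>Y\<^sub>q,\<dots>,Y\<^sub>1\<close> and \<open>q,\<dots>,q+p-1\<close> for \<open>X\<^sub>1,\<dots>,X\<^sub>p\<close>. Thus \<open>\<exists>Y\<^sub>1\<dots>\<exists>Y\<^sub>q \<phi>\<close> is
  \<^term>\<open>(ExP ^^ q) \<phi>\<close>.
\<close>

definition formula_over :: "nat \<Rightarrow> nat \<Rightarrow> fm \<Rightarrow> bool" where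
  "formula_over p q \<phi> \<longleftrightarrow> free_ind \<phi> = {} \<and> free_pred \<phi> \<subseteq> {..<q + p}"

text \<open>The individual assignment \<open>i\<close>, and the values of the list beyond its length, are
  irrelevant for a formula satisfying \<^term>\<open>formula_over p q \<phi>\<close>.\<close>

definition church_realizer ::
    "nat \<Rightarrow> nat \<Rightarrow> fm \<Rightarrow> ((nat \<Rightarrow> bool list) \<Rightarrow> nat \<Rightarrow> bool) list \<Rightarrow> bool" where
  "church_realizer p q \<phi> Fs \<longleftrightarrow>
     length Fs = q \<and>
     (\<forall>F \<in> set Fs. finite_state_synchronous (bits p) UNIV F) \<and>
     (\<forall>ws i. length ws = p \<longrightarrow>
        sat i (\<lambda>k. (rev (map (\<lambda>F. F (convolution ws)) Fs) @ ws) ! k) \<phi>)"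


section \<open>Effective extraction\<close>

text \<open>Partial recursive functions. An argument list plays the role of an argument tuple;
  primitive recursion and minimization act on the first argument.\<close>

datatype recf = ZeroR | SuccR | Proj nat | Comp recf "recf list" | PrimRec recf recf | Mu recf

inductive recf_eval :: "recf \<Rightarrow> nat list \<Rightarrow> nat \<Rightarrow> bool" where
  zero: "recf_eval ZeroR xs 0"
| succ: "recf_eval SuccR [x] (Suc x)"
| proj: "i < length xs \<Longrightarrow> recf_eval (Proj i) xs (xs ! i)"
| comp: "list_all2 (\<lambda>g y. recf_eval g xs y) gs ys \<Longrightarrow> recf_eval f ys z \<Longrightarrow>
     recf_eval (Comp f gs) xs z"
| primrec_0: "recf_eval f xs y \<Longrightarrow> recf_eval (PrimRec f g) (0 # xs) y"
| primrec_Suc: "recf_eval (PrimRec f g) (n # xs) r \<Longrightarrow> recf_eval g (n # r # xs) y \<Longrightarrow>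
     recf_eval (PrimRec f g) (Suc n # xs) y"
| mu: "recf_eval f (n # xs) 0 \<Longrightarrow> (\<And>m. m < n \<Longrightarrow> \<exists>k. recf_eval f (m # xs) (Suc k)) \<Longrightarrow>
     recf_eval (Mu f) xs n"

text \<open>Explicit Goedel numberings; the encodings of countable types in the library are
  obtained by choice and would not be effective.\<close>

primrec fm_code :: "fm \<Rightarrow> nat" where
  "fm_code (Eq x y) = prod_encode (0, prod_encode (x, y))"
| "fm_code (Le x y) = prod_encode (1, prod_encode (x, y))"
| "fm_code (Succ x y) = prod_encode (2, prod_encode (x, y))"
| "fm_code (Zero x) = prod_encode (3, x)"
| "fm_code (Mem x X) = prod_encode (4, prod_encode (x, X))"
| "fm_code Tru = prod_encode (5, 0)"
| "fm_code Fls = prod_encode (6, 0)"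
| "fm_code (And \<phi> \<psi>) = prod_encode (7, prod_encode (fm_code \<phi>, fm_code \<psi>))"
| "fm_code (Neg \<phi>) = prod_encode (8, fm_code \<phi>)"
| "fm_code (ExI \<phi>) = prod_encode (9, fm_code \<phi>)"
| "fm_code (ExP \<phi>) = prod_encode (10, fm_code \<phi>)"

definition sequent_code :: "sequent \<Rightarrow> nat" where
  "sequent_code c = prod_encode (list_encode (map fm_code (fst c)), fm_code (snd c))"

primrec deriv_code :: "deriv \<Rightarrow> nat" where
  "deriv_code (Deriv c ds) = prod_encode (sequent_code c, list_encode (map deriv_code ds))"

text \<open>Finite presentation of a machine from \<open>{0,1}\<^sup>p\<close> to \<open>{0,1}\<close>: the initial state and the
  transition table. Row \<open>s\<close> lists successor state and output of the state \<open>s\<close> for all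
  \<open>2\<^sup>p\<close> letters, a letter being read as a binary number.\<close>

type_synonym table = "nat \<times> (nat \<times> bool) list list"

definition wf_table :: "nat \<Rightarrow> table \<Rightarrow> bool" where
  "wf_table p T \<longleftrightarrow>
     fst T < length (snd T) \<and>
     (\<forall>row \<in> set (snd T). length row = 2 ^ p \<and> (\<forall>(s, b) \<in> set row. s < length (snd T)))"

definition table_dmm :: "table \<Rightarrow> (nat, bool list, bool) dmm" where
  "table_dmm T =
     \<lparr>dmm_states = {..<length (snd T)}, dmm_init = fst T,
      dmm_trans = (\<lambda>(s, a). snd T ! s ! horner_sum of_bool 2 a)\<rparr>"

definition table_code :: "table \<Rightarrow> nat" where
  "table_code T = prod_encode (fst T,
     list_encode (map (\<lambda>row. list_encode (map (\<lambda>(s, b). prod_encode (s, of_bool b)) row)) (snd T)))"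

lemma recf_eval_deterministic:
  "recf_eval f xs y \<Longrightarrow> recf_eval f xs z \<Longrightarrow> y = z"
proof (induction arbitrary: z rule: recf_eval.induct)
  case (comp xs gs ys f z')
  from comp.prems obtain ys' where ys': "list_all2 (\<lambda>g y. recf_eval g xs y) gs ys'" "recf_eval f ys' z"
    by (cases rule: recf_eval.cases) auto
  have "ys = ys'"
    using comp(1) ys'(1) by (auto simp: list_all2_conv_all_nth intro!: nth_equalityI)
  with comp.IH ys'(2) show ?case by blast
next
  case (mu f n xs)
  from mu.prems have z: "recf_eval f (z # xs) 0" "\<And>m. m < z \<Longrightarrow> \<exists>k. recf_eval f (m # xs) (Suc k)"
    by (cases rule: recf_eval.cases; auto)+
  show ?case
  proof (rule linorder_cases[of n z])
    assume "n < z"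
    with z(2) mu.IH(1) show ?thesis by blast
  next
    assume "z < n"
    with mu.IH(2) z(1) show ?thesis by blast
  qed
next
  case (primrec_Suc f g n xs r y)
  from primrec_Suc.prems show ?case
    by (cases rule: recf_eval.cases) (use primrec_Suc.IH in blast)
next
  case (primrec_0 f xs y g)
  from primrec_0.prems show ?case
    by (cases rule: recf_eval.cases) (use primrec_0.IH in blast)
qed (erule recf_eval.cases; simp)+

lemma fm_code_inject: "fm_code \<phi> = fm_code \<psi> \<longleftrightarrow> \<phi> = \<psi>"
  by (induction \<phi> arbitrary: \<psi>; case_tac \<psi>; auto)

lemma sequent_code_inject: "sequent_code c = sequent_code c' \<longleftrightarrow> c = c'"
  by (auto simp: sequent_code_def prod_eq_iff inj_map_eq_map inj_def fm_code_inject list_encode_eq)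

lemma deriv_code_inject: "deriv_code d = deriv_code d' \<longleftrightarrow> d = d'"
proof (induction d arbitrary: d')
  case (Deriv c ds)
  then show ?case
    by (cases d')
      (auto simp: sequent_code_inject list_encode_eq list_eq_iff_nth_eq)
qed

lemma table_code_inject: "table_code T = table_code T' \<longleftrightarrow> T = T'"
  by (auto simp: table_code_def prod_eq_iff inj_map_eq_map inj_def list_encode_eq)

lemma horner_sum_bits_less: "horner_sum of_bool 2 a < (2 :: nat) ^ length a"
  by (induction a) auto

lemma is_dmm_table_dmm:
  assumes "wf_table p T"
  shows "is_dmm (bits p) UNIV (table_dmm T)"
proof -
  have "finite (bits p)" "bits p \<noteq> {}"
    using finite_lists_length_eq[of "UNIV :: bool set" p] Ex_list_of_length[of p]
    by (auto simp: bits_def)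
  moreover have "dmm_trans (table_dmm T) (s, a) \<in> dmm_states (table_dmm T) \<times> UNIV"
    if s: "s < length (snd T)" and a: "a \<in> bits p" for s a
  proof -
    have "snd T ! s \<in> set (snd T)" using s by simp
    with assms have row: "length (snd T ! s) = 2 ^ p"
      "\<forall>(s', b) \<in> set (snd T ! s). s' < length (snd T)"
      by (auto simp: wf_table_def)
    have "snd T ! s ! horner_sum of_bool 2 a \<in> set (snd T ! s)"
      using row(1) a horner_sum_bits_less[of a] by (auto simp: bits_def)
    with row(2) show ?thesis
      by (cases "snd T ! s ! horner_sum of_bool 2 a") (auto simp: table_dmm_def)
  qed
  ultimately show ?thesis
    using assms by (auto simp: is_dmm_def wf_table_def table_dmm_def)
qed

end

theory Submission
  imports Defs "HOL-Library.Countable_Set"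
begin

text \<open>
  Extraction. Realizability by finite-state synchronous functions, where a deterministic formula
  has no computational content, is sound for SMSO; hence every derivation yields transition tables
  realizing \<open>\<phi>\<close>. To find them effectively, one searches for tables together with a refutation, in
  classical monadic second-order arithmetic, of \<open>\<lnot>\<phi>\<close> from axioms that describe the runs of the
  tables. Soundness in the standard model makes every table found a realizer, and completeness of
  the refutation calculus makes the search terminate. Refutations are checked by a Horn program,
  so that only one total recursive predicate, acceptance of a certificate, has to be constructed.

  Completeness. By Henkin's construction, a formula that cannot be refuted holds in a Henkin model
  of arithmetic with full comprehension. For each quantifier depth, a Henkin model realizes only
  finitely many types of segments, and these compose. The additive Ramsey theorem, proved inside the
  model, factorizes the model into segments \<open>u v v v \<dots>\<close> of constant types; since every type is also
  realized by a finite standard segment, an ultimately periodic standard word satisfies the same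
  formulae. So true closed formulae are derivable up to double negation.

  Converse. The output of a Mealy machine at \<open>y\<close> is defined by a formula uniformly bounded by
  \<open>y\<close>. Synchronous comprehension with these formulae reduces the claim to a double negation that is
  true in the standard model, hence derivable by completeness.
\<close>

section \<open>Henkin structures\<close>

text \<open>A Henkin model may be nonstandard: its order need not be well-founded, and induction
  holds only for sets in \<open>h_sets\<close>. Constructions inside a model therefore come with a
  proof that they are definable; even the choice of one predicate per segment is made definable, by
  taking the lexicographically least candidate. Types are natural numbers coding hereditarily finite
  sets, so that types from models over different carriers can be compared by equality, and
  individuals enter them as singleton predicates. A refutation calculus is used because SMSO is not
  classical: for the goal \<open>Fls\<close> the double negation of an axiom is as good as the
  axiom, and double negations are what negative comprehension provides. Types serve a second
  purpose: the type of an initial segment is the state of a machine that evaluates a uniformly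
  bounded formula, which is why synchronous comprehension has a finite-state realizer.\<close>

record 'a henkin =
  h_le :: "'a \<Rightarrow> 'a \<Rightarrow> bool"
  h_suc :: "'a \<Rightarrow> 'a"
  h_zero :: 'a
  h_sets :: "('a \<Rightarrow> bool) set"

definition h_lt :: "'a henkin \<Rightarrow> 'a \<Rightarrow> 'a \<Rightarrow> bool" where
  "h_lt M x y \<longleftrightarrow> h_le M x y \<and> x \<noteq> y"

primrec hsat :: "'a henkin \<Rightarrow> (nat \<Rightarrow> 'a) \<Rightarrow> (nat \<Rightarrow> 'a \<Rightarrow> bool) \<Rightarrow> fm \<Rightarrow> bool" where
  "hsat M i P (Eq x y) = (i x = i y)"
| "hsat M i P (Le x y) = h_le M (i x) (i y)"
| "hsat M i P (Succ x y) = (i y = h_suc M (i x))"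
| "hsat M i P (Zero x) = (i x = h_zero M)"
| "hsat M i P (Mem x X) = P X (i x)"
| "hsat M i P Tru = True"
| "hsat M i P Fls = False"
| "hsat M i P (And \<phi> \<psi>) = (hsat M i P \<phi> \<and> hsat M i P \<psi>)"
| "hsat M i P (Neg \<phi>) = (\<not> hsat M i P \<phi>)"
| "hsat M i P (ExI \<phi>) = (\<exists>n. hsat M (case_nat n i) P \<phi>)"
| "hsat M i P (ExP \<phi>) = (\<exists>A\<in>h_sets M. hsat M i (case_nat A P) \<phi>)"

lemma up_simps [simp]: "up r 0 = 0" "up r (Suc x) = Suc (r x)"
  by (simp_all add: up_def)

lemma up_id [simp]: "up id = id" "up (\<lambda>x. x) = (\<lambda>x. x)"
  by (auto simp: up_def fun_eq_iff split: nat.split)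

lemma case_nat_comp_up: "case_nat a f \<circ> up r = case_nat a (f \<circ> r)"
  by (auto simp: up_def fun_eq_iff split: nat.split)

lemma hsat_ren: "hsat M i P (ren r R \<phi>) = hsat M (i \<circ> r) (P \<circ> R) \<phi>"
  by (induction \<phi> arbitrary: i P r R) (simp_all add: case_nat_comp_up)

lemma range_case_nat [simp]: "range (case_nat a f) \<subseteq> S \<longleftrightarrow> a \<in> S \<and> range f \<subseteq> S"
proof -
  have "range (case_nat a f) = insert a (range f)"
    by (auto simp: image_iff split: nat.splits)
  then show ?thesis by simp
qed

subsection \<open>Definable relations\<close>

text \<open>Quantifier rules for definability are stated so that backward application
  performs the de Bruijn shift by \<open>\<beta>\<close>-reduction.\<close>

definition definable ::
    "'a henkin \<Rightarrow> ((nat \<Rightarrow> 'a) \<Rightarrow> (nat \<Rightarrow> 'a \<Rightarrow> bool) \<Rightarrow> bool) \<Rightarrow> bool" where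
  "definable M R \<longleftrightarrow> (\<exists>\<phi>. \<forall>i P. range P \<subseteq> h_sets M \<longrightarrow> R i P = hsat M i P \<phi>)"

lemma definable_atoms:
  "definable M (\<lambda>i P. i x = i y)" "definable M (\<lambda>i P. h_le M (i x) (i y))"
  "definable M (\<lambda>i P. i x = h_zero M)" "definable M (\<lambda>i P. i y = h_suc M (i x))"
  "definable M (\<lambda>i P. h_suc M (i x) = i y)" "definable M (\<lambda>i P. P X (i x))"
proof -
  have *: "definable M (\<lambda>i P. hsat M i P \<phi>)" for \<phi> unfolding definable_def by blast
  show "definable M (\<lambda>i P. i x = i y)" "definable M (\<lambda>i P. h_le M (i x) (i y))"
    "definable M (\<lambda>i P. i x = h_zero M)" "definable M (\<lambda>i P. i y = h_suc M (i x))"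
    "definable M (\<lambda>i P. P X (i x))"
    using *[of "Eq x y"] *[of "Le x y"] *[of "Zero x"] *[of "Succ x y"] *[of "Mem x X"] by simp_all
  then show "definable M (\<lambda>i P. h_suc M (i x) = i y)" by (simp only: eq_commute[of "h_suc M _"])
qed

lemma definable_not: "definable M R \<Longrightarrow> definable M (\<lambda>i P. \<not> R i P)"
proof -
  assume "definable M R"
  then obtain \<phi> where "\<forall>i P. range P \<subseteq> h_sets M \<longrightarrow> R i P = hsat M i P \<phi>"
    unfolding definable_def by blast
  then show ?thesis unfolding definable_def by (intro exI[of _ "Neg \<phi>"]) simp
qed

lemma definable_conj:
  assumes "definable M R" "definable M Q" shows "definable M (\<lambda>i P. R i P \<and> Q i P)"
proof -
  obtain \<phi> \<psi> where "\<forall>i P. range P \<subseteq> h_sets M \<longrightarrow> R i P = hsat M i P \<phi>"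
    "\<forall>i P. range P \<subseteq> h_sets M \<longrightarrow> Q i P = hsat M i P \<psi>"
    using assms unfolding definable_def by blast
  then show ?thesis unfolding definable_def by (intro exI[of _ "And \<phi> \<psi>"]) simp
qed

lemma definable_const: "definable M (\<lambda>i P. c)"
proof (cases c)
  case True then show ?thesis unfolding definable_def by (intro exI[of _ Tru]) simp
next
  case False then show ?thesis unfolding definable_def by (intro exI[of _ Fls]) simp
qed

lemma definable_disj:
  assumes "definable M R" "definable M Q" shows "definable M (\<lambda>i P. R i P \<or> Q i P)"
  using definable_not[OF definable_conj[OF definable_not[OF assms(1)] definable_not[OF assms(2)]]]
  by simp

lemma definable_imp:
  assumes "definable M R" "definable M Q" shows "definable M (\<lambda>i P. R i P \<longrightarrow> Q i P)"
  using definable_disj[OF definable_not[OF assms(1)] assms(2)] by simp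

lemma definable_iff:
  assumes "definable M R" "definable M Q" shows "definable M (\<lambda>i P. R i P \<longleftrightarrow> Q i P)"
  using definable_conj[OF definable_imp[OF assms] definable_imp[OF assms(2) assms(1)]]
  by (simp only: iff_conv_conj_imp)

lemma definable_ex:
  assumes "definable M (\<lambda>i P. R (i 0) (\<lambda>n. i (Suc n)) P)"
  shows "definable M (\<lambda>i P. \<exists>a. R a i P)"
proof -
  obtain \<phi> where \<phi>: "\<forall>i P. range P \<subseteq> h_sets M \<longrightarrow> R (i 0) (\<lambda>n. i (Suc n)) P = hsat M i P \<phi>"
    using assms unfolding definable_def by blast
  have "R a i P = hsat M (case_nat a i) P \<phi>" if "range P \<subseteq> h_sets M" for i P a
    using \<phi>[rule_format, OF that, of "case_nat a i"] by simp
  then have "(\<exists>a. R a i P) = hsat M i P (ExI \<phi>)" if "range P \<subseteq> h_sets M" for i P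
    using that by simp
  then show ?thesis unfolding definable_def by blast
qed

lemma definable_all:
  assumes "definable M (\<lambda>i P. R (i 0) (\<lambda>n. i (Suc n)) P)"
  shows "definable M (\<lambda>i P. \<forall>a. R a i P)"
  using definable_not[OF definable_ex[of M "\<lambda>a i P. \<not> R a i P", OF definable_not[OF assms]]] by simp

lemma definable_bex:
  assumes "definable M (\<lambda>i P. R (P 0) i (\<lambda>n. P (Suc n)))"
  shows "definable M (\<lambda>i P. \<exists>B\<in>h_sets M. R B i P)"
proof -
  obtain \<phi> where \<phi>: "\<forall>i P. range P \<subseteq> h_sets M \<longrightarrow> R (P 0) i (\<lambda>n. P (Suc n)) = hsat M i P \<phi>"
    using assms unfolding definable_def by blast
  have "R B i P = hsat M i (case_nat B P) \<phi>" if "range P \<subseteq> h_sets M" "B \<in> h_sets M" for i P B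
    using \<phi>[rule_format, of "case_nat B P" i] that by simp
  then have "(\<exists>B\<in>h_sets M. R B i P) = hsat M i P (ExP \<phi>)" if "range P \<subseteq> h_sets M" for i P
    using that by auto
  then show ?thesis unfolding definable_def by blast
qed

lemma definable_ball:
  assumes "definable M (\<lambda>i P. R (P 0) i (\<lambda>n. P (Suc n)))"
  shows "definable M (\<lambda>i P. \<forall>B\<in>h_sets M. R B i P)"
  using definable_not[OF definable_bex[of M "\<lambda>B i P. \<not> R B i P", OF definable_not[OF assms]]] by simp

lemma definable_finite_all:
  assumes "finite F" "\<And>c. c \<in> F \<Longrightarrow> definable M (R c)"
  shows "definable M (\<lambda>i P. \<forall>c\<in>F. R c i P)"
  using assms by (induction F) (simp_all add: definable_const definable_conj)

lemma definable_finite_ex: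
  assumes "finite F" "\<And>c. c \<in> F \<Longrightarrow> definable M (R c)"
  shows "definable M (\<lambda>i P. \<exists>c\<in>F. R c i P)"
  using assms by (induction F) (simp_all add: definable_const definable_disj)

lemma definable_lt: "definable M (\<lambda>i P. h_lt M (i x) (i y))"
  unfolding h_lt_def by (intro definable_atoms definable_conj definable_not)

text \<open>Successor is a relation of the language, so a term with \<open>h_suc\<close> is
  definable only after unfolding it by an existential quantifier.\<close>

lemma definable_mem_suc: "definable M (\<lambda>i P. P X (h_suc M (i x)))"
proof -
  have "definable M (\<lambda>i P. \<exists>a. a = h_suc M (i x) \<and> P X a)"
    by (intro definable_atoms definable_conj definable_ex)
  then show ?thesis by simp
qed

lemma definable_lt_suc: "definable M (\<lambda>i P. h_lt M (h_suc M (i x)) (i y))"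
proof -
  have "definable M (\<lambda>i P. \<exists>a. a = h_suc M (i x) \<and> h_lt M a (i y))"
    by (intro definable_atoms definable_lt definable_conj definable_ex)
  then show ?thesis by simp
qed

lemmas definable_intros = definable_atoms definable_not definable_conj definable_const
  definable_disj definable_imp definable_iff definable_ex definable_all definable_bex definable_ball
  definable_lt definable_mem_suc definable_lt_suc

subsection \<open>Models of arithmetic with comprehension\<close>

text \<open>The arithmetic rules of SMSO, with a successor function, induction for the sets of the
  model and comprehension with parameters. Linearity of the order and minimality of zero are not
  among them; both are proved below by induction over suitable sets.\<close>

locale henkin_model =
  fixes M :: "'a henkin"
  assumes sets_nonempty: "h_sets M \<noteq> {}"
    and le_refl': "h_le M x x"
    and le_trans': "h_le M x y \<Longrightarrow> h_le M y z \<Longrightarrow> h_le M x z"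
    and le_antisym': "h_le M x y \<Longrightarrow> h_le M y x \<Longrightarrow> x = y"
    and suc_neq_zero: "h_suc M x \<noteq> h_zero M"
    and suc_inj: "h_suc M x = h_suc M y \<Longrightarrow> x = y"
    and le_suc': "h_le M x (h_suc M x)"
    and le_suc_D: "h_le M x (h_suc M y) \<Longrightarrow> x \<noteq> h_suc M y \<Longrightarrow> h_le M x y"
    and induct: "X \<in> h_sets M \<Longrightarrow> X (h_zero M) \<Longrightarrow> (\<And>y. X y \<Longrightarrow> X (h_suc M y)) \<Longrightarrow> X x"
    and comprehension: "range P \<subseteq> h_sets M \<Longrightarrow> (\<lambda>a. hsat M (case_nat a i) P \<phi>) \<in> h_sets M"
begin

text \<open>The gate to induction inside a model: a property becomes a set of the model by being
  definable from an assignment into \<open>h_sets M\<close>, with the individual index 0 as the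
  argument of the set.\<close>

lemma definable_set:
  assumes "definable M R" "range P \<subseteq> h_sets M"
  shows "(\<lambda>a. R (case_nat a i) P) \<in> h_sets M"
proof -
  obtain \<phi> where "\<forall>i. R i P = hsat M i P \<phi>"
    using assms unfolding definable_def by blast
  then show ?thesis using comprehension[OF assms(2), of i \<phi>] by simp
qed

lemma const_set: "(\<lambda>_. c) \<in> h_sets M"
proof -
  obtain X where "X \<in> h_sets M" using sets_nonempty by blast
  then show ?thesis
    using definable_set[OF definable_const[of M c], of "\<lambda>_. X"] by auto
qed


abbreviation le (infix "\<preceq>" 50) where "x \<preceq> y \<equiv> h_le M x y"
abbreviation lt (infix "\<prec>" 50) where "x \<prec> y \<equiv> h_lt M x y"
abbreviation suc where "suc \<equiv> h_suc M"
abbreviation zr where "zr \<equiv> h_zero M"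

lemma zero_le: "zr \<preceq> x"
proof -
  obtain X where X: "X \<in> h_sets M" using sets_nonempty by blast
  have "(\<lambda>x. zr \<preceq> x) \<in> h_sets M"
    using definable_set[OF definable_atoms(2)[of M 1 0], of "\<lambda>_. X" "\<lambda>_. zr"] X by auto
  then show ?thesis by (rule induct) (use le_refl' le_trans' le_suc' in blast)+
qed

lemma suc_leI: "x \<preceq> y \<Longrightarrow> x \<noteq> y \<Longrightarrow> suc x \<preceq> y"
proof -
  obtain X where X: "X \<in> h_sets M" using sets_nonempty by blast
  have "definable M (\<lambda>i P. \<exists>a. a = suc (i 1) \<and> (i 1 \<preceq> i 0 \<longrightarrow> \<not> i 1 = i 0 \<longrightarrow> a \<preceq> i 0))"
    by (intro definable_intros)
  then have "(\<lambda>y. x \<preceq> y \<longrightarrow> x \<noteq> y \<longrightarrow> suc x \<preceq> y) \<in> h_sets M"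
    using definable_set[of "\<lambda>i P. \<exists>a. a = suc (i 1) \<and> (i 1 \<preceq> i 0 \<longrightarrow> \<not> i 1 = i 0 \<longrightarrow> a \<preceq> i 0)"
      "\<lambda>_. X" "\<lambda>_. x"] X by auto
  then have "x \<preceq> y \<longrightarrow> x \<noteq> y \<longrightarrow> suc x \<preceq> y"
  proof (rule induct)
    show "x \<preceq> zr \<longrightarrow> x \<noteq> zr \<longrightarrow> suc x \<preceq> zr" using zero_le le_antisym' by blast
  next
    fix y assume "x \<preceq> y \<longrightarrow> x \<noteq> y \<longrightarrow> suc x \<preceq> y"
    then show "x \<preceq> suc y \<longrightarrow> x \<noteq> suc y \<longrightarrow> suc x \<preceq> suc y"
      by (metis le_suc_D le_refl' le_suc' le_trans')
  qed
  then show "x \<preceq> y \<Longrightarrow> x \<noteq> y \<Longrightarrow> suc x \<preceq> y" by blast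
qed

lemma le_total: "x \<preceq> y \<or> y \<preceq> x"
proof -
  obtain X where X: "X \<in> h_sets M" using sets_nonempty by blast
  have "definable M (\<lambda>i P. i 0 \<preceq> i 1 \<or> i 1 \<preceq> i 0)" by (intro definable_intros)
  then have "(\<lambda>x. x \<preceq> y \<or> y \<preceq> x) \<in> h_sets M"
    using definable_set[of "\<lambda>i P. i 0 \<preceq> i 1 \<or> i 1 \<preceq> i 0" "\<lambda>_. X" "\<lambda>_. y"] X by auto
  then show ?thesis
    by (rule induct) (use zero_le suc_leI le_trans' le_suc' in metis)+
qed

sublocale linorder "h_le M" "h_lt M"
  by unfold_locales (use le_refl' le_trans' le_antisym' le_total in \<open>auto simp: h_lt_def\<close>)

lemma suc_le_iff [simp]: "suc x \<preceq> y \<longleftrightarrow> x \<prec> y"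
proof
  have "suc x \<noteq> x"
  proof
    assume eq: "suc x = x"
    obtain X where X: "X \<in> h_sets M" using sets_nonempty by blast
    have "definable M (\<lambda>i P. \<not> suc (i 0) = i 0)" by (intro definable_intros)
    then have "(\<lambda>x. \<not> suc x = x) \<in> h_sets M"
      using definable_set[of "\<lambda>i P. \<not> suc (i 0) = i 0" "\<lambda>_. X"] X by auto
    then have "\<not> suc x = x" by (rule induct) (use suc_neq_zero suc_inj in metis)+
    with eq show False by simp
  qed
  then show "suc x \<preceq> y \<Longrightarrow> x \<prec> y"
    by (metis h_lt_def le_antisym' le_suc' le_trans')
qed (simp add: h_lt_def suc_leI)

lemma less_suc_iff [simp]: "x \<prec> suc y \<longleftrightarrow> x \<preceq> y"
  by (metis not_less suc_le_iff)

lemma zero_least [simp]: "zr \<preceq> x" "\<not> x \<prec> zr"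
  using zero_le not_less by blast+

lemma suc_eq_iff [simp]: "suc x = suc y \<longleftrightarrow> x = y"
  using suc_inj by blast

lemma least_exists:
  assumes X: "X \<in> h_sets M" and "X x"
  shows "\<exists>m. X m \<and> (\<forall>y. X y \<longrightarrow> m \<preceq> y)"
proof (rule ccontr)
  assume neg: "\<not> ?thesis"
  \<comment> \<open>Strong induction in the form of ordinary induction: the set collects the points
    up to which \<open>X\<close> has no element.\<close>
  have "definable M (\<lambda>i P. \<forall>y. y \<preceq> i 0 \<longrightarrow> \<not> P 0 y)" by (intro definable_intros)
  then have "(\<lambda>x. \<forall>y. y \<preceq> x \<longrightarrow> \<not> X y) \<in> h_sets M"
    using definable_set[of "\<lambda>i P. \<forall>y. y \<preceq> i 0 \<longrightarrow> \<not> P 0 y" "\<lambda>_. X"] X by auto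
  then have "\<forall>y. y \<preceq> x \<longrightarrow> \<not> X y"
  proof (rule induct)
    show "\<forall>y. y \<preceq> zr \<longrightarrow> \<not> X y" using neg le_antisym' zero_le by metis
  next
    fix z assume "\<forall>y. y \<preceq> z \<longrightarrow> \<not> X y"
    then show "\<forall>y. y \<preceq> suc z \<longrightarrow> \<not> X y"
      using neg by (metis le_less less_suc_iff not_le)
  qed
  with \<open>X x\<close> show False by blast
qed

text \<open>Finds the cut that precedes a given one. In a nonstandard order a bounded subset need
  not have a greatest element, so membership of \<open>X\<close> in \<open>h_sets M\<close> is
  essential and the proof is an induction on \<open>h\<close>.\<close>

lemma greatest_below:
  assumes X: "X \<in> h_sets M" and "X g" "g \<prec> h"
  shows "\<exists>m. X m \<and> m \<prec> h \<and> (\<forall>y. X y \<longrightarrow> y \<prec> h \<longrightarrow> y \<preceq> m)"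
proof -
  let ?Q = "\<lambda>h. (\<exists>g. X g \<and> g \<prec> h) \<longrightarrow> (\<exists>m. X m \<and> m \<prec> h \<and> (\<forall>y. X y \<longrightarrow> y \<prec> h \<longrightarrow> y \<preceq> m))"
  have "definable M (\<lambda>i P. (\<exists>g. P 0 g \<and> g \<prec> i 0) \<longrightarrow>
      (\<exists>m. P 0 m \<and> m \<prec> i 0 \<and> (\<forall>y. P 0 y \<longrightarrow> y \<prec> i 0 \<longrightarrow> y \<preceq> m)))"
    by (intro definable_intros)
  from definable_set[OF this, of "\<lambda>_. X"] X have "?Q \<in> h_sets M" by auto
  then have "?Q h"
  proof (rule induct)
    show "?Q zr" by simp
  next
    fix h assume IH: "?Q h"
    show "?Q (suc h)"
    proof (cases "X h")
      case True then show ?thesis by auto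
    next
      case False
      then have "X y \<and> y \<preceq> h \<longleftrightarrow> X y \<and> y \<prec> h" for y by (auto simp: le_less)
      then show ?thesis using IH by auto
    qed
  qed
  with assms show ?thesis by blast
qed

end

section \<open>Types of segments\<close>

text \<open>The tags \<open>0,\<dots>,4\<close> describe how the predicates \<open>e v\<close> and \<open>e w\<close> meet in the segment
  \<open>[x,y)\<close>: at one position, at two positions in order, at two successive positions, and what
  holds at the first and at the last position.\<close>

definition seg_fact :: "'a henkin \<Rightarrow> (nat \<Rightarrow> 'a \<Rightarrow> bool) \<Rightarrow> 'a \<Rightarrow> 'a \<Rightarrow> nat \<Rightarrow> nat \<Rightarrow> nat \<Rightarrow> bool" where
  "seg_fact M e x y t v w = (
     if t = 0 then \<exists>z. h_le M x z \<and> h_lt M z y \<and> e v z \<and> e w z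
     else if t = 1 then \<exists>z z'. h_le M x z \<and> h_lt M z z' \<and> h_lt M z' y \<and> e v z \<and> e w z'
     else if t = 2 then \<exists>z. h_le M x z \<and> h_lt M (h_suc M z) y \<and> e v z \<and> e w (h_suc M z)
     else if t = 3 then e v x
     else \<exists>z. h_suc M z = y \<and> e v z)"

text \<open>The \<open>k\<close>-type of a segment with respect to its first \<open>n\<close> predicates: a hereditarily finite
  set, coded as a number, that determines which formulae of quantifier depth \<open>k\<close> hold there.\<close>

primrec tp :: "'a henkin \<Rightarrow> nat \<Rightarrow> nat \<Rightarrow> (nat \<Rightarrow> 'a \<Rightarrow> bool) \<Rightarrow> 'a \<Rightarrow> 'a \<Rightarrow> nat" where
  "tp M 0 n e x y =
     set_encode {prod_encode (t, prod_encode (v, w)) |t v w. t < 5 \<and> v < n \<and> w < n \<and> seg_fact M e x y t v w}"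
| "tp M (Suc k) n e x y = set_encode {tp M k (Suc n) (case_nat B e) x y |B. B \<in> h_sets M}"

text \<open>A finite superset of all values of \<open>tp\<close> that does not depend on the model;
  quantification over types thereby becomes a finite conjunction or disjunction.\<close>

primrec types :: "nat \<Rightarrow> nat \<Rightarrow> nat set" where
  "types 0 n = set_encode ` Pow ((\<lambda>(t, v, w). prod_encode (t, prod_encode (v, w))) ` ({..<5} \<times> {..<n} \<times> {..<n}))"
| "types (Suc k) n = set_encode ` Pow (types k (Suc n))"

lemma finite_types: "finite (types k n)"
  by (induction k arbitrary: n) auto

lemma facts_image: "{prod_encode (t, prod_encode (v, w)) |t v w. t < 5 \<and> v < n \<and> w < n \<and> seg_fact M e x y t v w}
  = (\<lambda>(t, v, w). prod_encode (t, prod_encode (v, w))) ` {(t, v, w) \<in> {..<5} \<times> {..<n} \<times> {..<n}. seg_fact M e x y t v w}"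
  by (auto simp: image_iff)

lemma tp_in_types: "tp M k n e x y \<in> types k n"
proof (induction k arbitrary: n e)
  case 0
  show ?case unfolding tp.simps types.simps facts_image
    by (intro imageI PowI image_mono) auto
next
  case (Suc k) then show ?case by auto
qed

lemma finite_facts: "finite {prod_encode (t, prod_encode (v, w)) |t v w. t < (5::nat) \<and> v < (n::nat) \<and> w < n \<and> Q t v w}"
  by (rule finite_subset[of _ "(\<lambda>(t, v, w). prod_encode (t, prod_encode (v, w))) ` ({..<5} \<times> {..<n} \<times> {..<n})"])
    (auto simp: image_iff)

lemma finite_tps: "finite {tp M k n (E B) x y |B. B \<in> S}"
  by (rule finite_subset[OF _ finite_types[of k n]]) (auto simp: tp_in_types)

section \<open>Equality of types as a back-and-forth condition\<close>

lemma tp_0_eq_iff: "tp M 0 n e x y = tp M' 0 n e' x' y' \<longleftrightarrow>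
  (\<forall>t<5. \<forall>v<n. \<forall>w<n. seg_fact M e x y t v w = seg_fact M' e' x' y' t v w)"
proof -
  let ?A = "\<lambda>Q. {prod_encode (t, prod_encode (v, w)) |t v w. t < (5::nat) \<and> v < n \<and> w < n \<and> Q t v w}"
  have *: "prod_encode (t, prod_encode (v, w)) \<in> ?A Q \<longleftrightarrow> t < 5 \<and> v < n \<and> w < n \<and> Q t v w" for t v w Q
    by simp
  have "?A Q = ?A Q' \<longleftrightarrow> (\<forall>t<5. \<forall>v<n. \<forall>w<n. Q t v w = Q' t v w)" for Q Q'
  proof
    assume "?A Q = ?A Q'"
    then have "prod_encode (t, prod_encode (v, w)) \<in> ?A Q \<longleftrightarrow> prod_encode (t, prod_encode (v, w)) \<in> ?A Q'" for t v w
      by (simp only:)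
    then show "\<forall>t<5. \<forall>v<n. \<forall>w<n. Q t v w = Q' t v w" unfolding * by blast
  next
    assume "\<forall>t<5. \<forall>v<n. \<forall>w<n. Q t v w = Q' t v w"
    then show "?A Q = ?A Q'" by blast
  qed
  then show ?thesis by (simp add: set_encode_eq finite_facts)
qed

text \<open>Equal codes mean equal sets of \<open>k\<close>-types reachable by adding one predicate,
  which is the back-and-forth condition of an Ehrenfeucht-Fraisse game with set moves.\<close>

lemma tp_Suc_eq_iff: "tp M (Suc k) n e x y = tp M' (Suc k) n e' x' y' \<longleftrightarrow>
  (\<forall>B\<in>h_sets M. \<exists>B'\<in>h_sets M'. tp M k (Suc n) (case_nat B e) x y = tp M' k (Suc n) (case_nat B' e') x' y') \<and>
  (\<forall>B'\<in>h_sets M'. \<exists>B\<in>h_sets M. tp M k (Suc n) (case_nat B e) x y = tp M' k (Suc n) (case_nat B' e') x' y')"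
proof -
  have "{f B |B. B \<in> S} = {g B |B. B \<in> S'} \<longleftrightarrow>
    (\<forall>B\<in>S. \<exists>B'\<in>S'. f B = g B') \<and> (\<forall>B'\<in>S'. \<exists>B\<in>S. f B = g B')"
    for f :: "'c \<Rightarrow> nat" and g :: "'d \<Rightarrow> nat" and S S'
    unfolding Setcompr_eq_image set_eq_subset image_subset_iff image_iff by (simp only: eq_commute[of "g _"])
  then show ?thesis by (simp add: set_encode_eq finite_tps)
qed

lemma tp_Suc_forth:
  "tp M (Suc k) n e x y = tp M' (Suc k) n e' x' y' \<Longrightarrow> B \<in> h_sets M \<Longrightarrow>
    \<exists>B'\<in>h_sets M'. tp M k (Suc n) (case_nat B e) x y = tp M' k (Suc n) (case_nat B' e') x' y'"
  using tp_Suc_eq_iff[of M k n e x y M' e' x' y'] by blast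

section \<open>Definability of types inside a model\<close>

lemma definable_seg_fact: "definable M (\<lambda>i P. seg_fact M (\<lambda>v. P (g v)) (i x) (i y) t v w)"
proof -
  consider "t = 0" | "t = 1" | "t = 2" | "t = 3" | "t \<noteq> 0" "t \<noteq> 1" "t \<noteq> 2" "t \<noteq> 3" by blast
  then show ?thesis
    by cases (simp_all add: seg_fact_def, (intro definable_intros)+)
qed

lemma case_nat_shift: "case_nat (P 0) (\<lambda>v. P (Suc (g v))) = (\<lambda>v. P (case_nat 0 (\<lambda>v. Suc (g v)) v))"
  by (auto simp: fun_eq_iff split: nat.split)

lemma set_encode_eq_decode: "finite A \<Longrightarrow> set_encode A = c \<longleftrightarrow> A = set_decode c"
  by (metis set_decode_inverse set_encode_inverse)

lemma inj_image_Collect_eq: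
  assumes "inj f"
  shows "f ` {u \<in> D. Q u} = C \<longleftrightarrow> C \<subseteq> f ` D \<and> (\<forall>u\<in>D. f u \<in> C \<longleftrightarrow> Q u)"
proof
  assume *: "f ` {u \<in> D. Q u} = C"
  then show "C \<subseteq> f ` D \<and> (\<forall>u\<in>D. f u \<in> C \<longleftrightarrow> Q u)"
    using inj_image_mem_iff[OF assms, of _ "{u \<in> D. Q u}"] by auto
qed auto

lemma range_Collect_eq:
  assumes "\<And>B. f B \<in> T"
  shows "{f B |B. B \<in> S} = C \<longleftrightarrow> C \<subseteq> T \<and> (\<forall>u\<in>T. u \<in> C \<longleftrightarrow> (\<exists>B\<in>S. f B = u))"
proof -
  have "(\<exists>B\<in>S. f B = u) \<longleftrightarrow> u \<in> f ` S" for u by auto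
  moreover have "f ` S \<subseteq> T" using assms by auto
  ultimately show ?thesis unfolding Setcompr_eq_image by (simp only:) blast
qed

text \<open>For a fixed \<open>c\<close> the equation says, for each of the finitely many candidates
  in \<open>types\<close>, whether it is attained; attaining a candidate is one set quantifier. The
  reindexing \<open>g\<close> is general because that quantifier shifts the predicate
  indices.\<close>

lemma definable_tp: "definable M (\<lambda>i P. tp M k n (\<lambda>v. P (g v)) (i x) (i y) = c)"
proof (induction k arbitrary: n g c)
  case 0
  let ?f = "\<lambda>(t, v, w). prod_encode (t, prod_encode (v, w))" and ?D = "{..<5::nat} \<times> {..<n} \<times> {..<n}"
  have "(tp M 0 n e x y = c) \<longleftrightarrow> set_decode c \<subseteq> ?f ` ?D \<and>
      (\<forall>u\<in>?D. ?f u \<in> set_decode c \<longleftrightarrow> seg_fact M e x y (fst u) (fst (snd u)) (snd (snd u)))" for e x y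
  proof -
    let ?A = "{prod_encode (t, prod_encode (v, w)) |t v w. t < 5 \<and> v < n \<and> w < n \<and> seg_fact M e x y t v w}"
    have "(tp M 0 n e x y = c) \<longleftrightarrow> ?A = set_decode c"
      unfolding tp.simps by (rule set_encode_eq_decode[OF finite_facts])
    also have "\<dots> \<longleftrightarrow> set_decode c \<subseteq> ?f ` ?D \<and>
      (\<forall>u\<in>?D. ?f u \<in> set_decode c \<longleftrightarrow> seg_fact M e x y (fst u) (fst (snd u)) (snd (snd u)))"
    proof -
      have "inj ?f" by (auto simp: inj_def)
      then have gen: "?f ` {u \<in> ?D. Q u} = C \<longleftrightarrow> C \<subseteq> ?f ` ?D \<and> (\<forall>u\<in>?D. ?f u \<in> C \<longleftrightarrow> Q u)" for Q C
        by (rule inj_image_Collect_eq)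
      have "{u \<in> ?D. seg_fact M e x y (fst u) (fst (snd u)) (snd (snd u))}
          = {(t, v, w) \<in> ?D. seg_fact M e x y t v w}" by auto
      then show ?thesis
        unfolding facts_image using gen[of "\<lambda>u. seg_fact M e x y (fst u) (fst (snd u)) (snd (snd u))" "set_decode c"] by simp
    qed
    finally show ?thesis .
  qed
  then show ?case
    by (simp only:) (intro definable_conj definable_const definable_finite_all definable_iff definable_seg_fact; simp)
next
  case (Suc k)
  have *: "(tp M (Suc k) n e x y = c) \<longleftrightarrow> set_decode c \<subseteq> types k (Suc n) \<and>
      (\<forall>u\<in>types k (Suc n). u \<in> set_decode c \<longleftrightarrow> (\<exists>B\<in>h_sets M. tp M k (Suc n) (case_nat B e) x y = u))" for e x y
  proof -
    have "(tp M (Suc k) n e x y = c) \<longleftrightarrow> {tp M k (Suc n) (case_nat B e) x y |B. B \<in> h_sets M} = set_decode c"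
      unfolding tp.simps by (rule set_encode_eq_decode[OF finite_tps])
    also have "\<dots> \<longleftrightarrow> set_decode c \<subseteq> types k (Suc n) \<and>
      (\<forall>u\<in>types k (Suc n). u \<in> set_decode c \<longleftrightarrow> (\<exists>B\<in>h_sets M. tp M k (Suc n) (case_nat B e) x y = u))"
      by (rule range_Collect_eq) (rule tp_in_types)
    finally show ?thesis .
  qed
  show ?case unfolding *
    by (intro definable_conj definable_const definable_finite_all finite_types definable_iff definable_bex)
      (simp only: case_nat_shift Suc.IH)
qed

lemma definable_tp_plain: "definable M (\<lambda>i P. tp M k n P (i x) (i y) = c)"
  using definable_tp[of M k n "\<lambda>v. v" x y c] by simp

lemma definable_tp_Suc: "definable M (\<lambda>i P. tp M k n (\<lambda>v. P (Suc v)) (i x) (i y) = c)"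
  by (rule definable_tp)

text \<open>A finite disjunction over the possible common value.\<close>

lemma definable_tp_eq:
  "definable M (\<lambda>i P. tp M k n (\<lambda>v. P (g v)) (i x) (i y) = tp M k n (\<lambda>v. P (h v)) (i x') (i y'))"
proof -
  have "definable M (\<lambda>i P. \<exists>c\<in>types k n. tp M k n (\<lambda>v. P (g v)) (i x) (i y) = c
      \<and> tp M k n (\<lambda>v. P (h v)) (i x') (i y') = c)"
    by (intro definable_finite_ex finite_types definable_conj definable_tp)
  moreover have "(\<exists>c\<in>types k n. a = c \<and> b = c) \<longleftrightarrow> a = b" if "a \<in> types k n" for a b using that by auto
  ultimately show ?thesis by (simp add: tp_in_types)
qed

section \<open>Locality and composition of types\<close>

lemma tp_local:
  assumes "henkin_model M" "h_lt M x y" "\<And>v z. h_le M x z \<Longrightarrow> h_lt M z y \<Longrightarrow> e v z = e' v z"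
  shows "tp M k n e x y = tp M k n e' x y"
  using assms(3)
proof (induction k arbitrary: n e e')
  case 0
  interpret henkin_model M by fact
  have 1: "z \<prec> y \<and> x \<preceq> z'" if "x \<preceq> z" "z \<prec> z'" "z' \<prec> y" for z z'
    using that by (meson less_trans less_imp_le order_trans)
  have 2: "z \<prec> y \<and> x \<preceq> suc z" if "x \<preceq> z" "suc z \<prec> y" for z
    using that by (meson less_suc_iff less_trans order_refl less_imp_le order_trans)
  \<comment> \<open>Here \<open>h_lt M x y\<close> enters: the predecessor of \<open>y\<close>,
    which tag 4 reads, lies in the segment only if the segment is nonempty.\<close>
  have 4: "x \<preceq> z \<and> z \<prec> y" if "suc z = y" for z
    using that assms(2) by auto
  have "seg_fact M e x y t v w = seg_fact M e' x y t v w" for t v w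
  proof -
    have "(\<exists>z. x \<preceq> z \<and> z \<prec> y \<and> e v z \<and> e w z) = (\<exists>z. x \<preceq> z \<and> z \<prec> y \<and> e' v z \<and> e' w z)"
      using 0 by blast
    moreover have "(\<exists>z z'. x \<preceq> z \<and> z \<prec> z' \<and> z' \<prec> y \<and> e v z \<and> e w z') = (\<exists>z z'. x \<preceq> z \<and> z \<prec> z' \<and> z' \<prec> y \<and> e' v z \<and> e' w z')"
      using 0 1 by blast
    moreover have "(\<exists>z. x \<preceq> z \<and> suc z \<prec> y \<and> e v z \<and> e w (suc z)) = (\<exists>z. x \<preceq> z \<and> suc z \<prec> y \<and> e' v z \<and> e' w (suc z))"
      using 0 2 by blast
    moreover have "e v x = e' v x" using 0 assms(2) by blast
    moreover have "(\<exists>z. suc z = y \<and> e v z) = (\<exists>z. suc z = y \<and> e' v z)" using 0 4 by blast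
    ultimately show ?thesis unfolding seg_fact_def by presburger
  qed
  then show ?case by (simp add: tp_0_eq_iff del: tp.simps)
next
  case (Suc k)
  have "tp M k (Suc n) (case_nat B e) x y = tp M k (Suc n) (case_nat B e') x y" for B
    by (rule Suc.IH) (use Suc.prems in \<open>auto split: nat.split\<close>)
  then show ?case by simp
qed


text \<open>Tags 3 and 4 exist for the equation of tag 2: two successive positions may straddle the
  cut \<open>y\<close>, being the last position of the first segment and the first of the second
  one. For tag 1 the straddling case is expressed by tag 0 with equal indices.\<close>

lemma (in henkin_model) seg_fact_append:
  assumes "x \<prec> y" "y \<prec> z"
  shows "seg_fact M e x z 0 v w \<longleftrightarrow> seg_fact M e x y 0 v w \<or> seg_fact M e y z 0 v w" (is ?A)
    and "seg_fact M e x z 1 v w \<longleftrightarrow> seg_fact M e x y 1 v w \<or> seg_fact M e y z 1 v w \<or>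
      seg_fact M e x y 0 v v \<and> seg_fact M e y z 0 w w" (is ?B)
    and "seg_fact M e x z 2 v w \<longleftrightarrow> seg_fact M e x y 2 v w \<or> seg_fact M e y z 2 v w \<or>
      seg_fact M e x y 4 v v \<and> seg_fact M e y z 3 w w" (is ?C)
    and "seg_fact M e x z 3 v w \<longleftrightarrow> seg_fact M e x y 3 v w"
    and "seg_fact M e x z 4 v w \<longleftrightarrow> seg_fact M e y z 4 v w"
proof -
  have xy: "x \<preceq> y" "y \<preceq> z" using assms by auto
  have 0: "(x \<preceq> u \<and> u \<prec> z) \<longleftrightarrow> (x \<preceq> u \<and> u \<prec> y) \<or> (y \<preceq> u \<and> u \<prec> z)" for u
    using assms by (meson le_less_trans less_le_trans not_less order_trans less_imp_le)
  show ?A using 0 unfolding seg_fact_def by simp blast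
  have 1: "(x \<preceq> u \<and> u \<prec> t \<and> t \<prec> z) \<longleftrightarrow> (x \<preceq> u \<and> u \<prec> t \<and> t \<prec> y) \<or> (y \<preceq> u \<and> u \<prec> t \<and> t \<prec> z) \<or>
      (x \<preceq> u \<and> u \<prec> y) \<and> (y \<preceq> t \<and> t \<prec> z)" for u t
    using assms by (meson le_less_trans less_le_trans not_less order_trans less_imp_le less_trans)
  show ?B unfolding seg_fact_def using 1 by simp blast
  have 2: "(x \<preceq> u \<and> suc u \<prec> z) \<longleftrightarrow> (x \<preceq> u \<and> suc u \<prec> y) \<or> (y \<preceq> u \<and> suc u \<prec> z) \<or> suc u = y" for u
  proof (cases "suc u = y")
    case True
    then show ?thesis using assms by auto
  next
    case False
    then show ?thesis using assms
      by (metis le_less_trans less_le_trans not_less order_trans less_imp_le less_trans suc_le_iff antisym less_le)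
  qed
  have "seg_fact M e x z 2 v w \<longleftrightarrow> (\<exists>u. (x \<preceq> u \<and> suc u \<prec> z) \<and> e v u \<and> e w (suc u))"
    unfolding seg_fact_def by simp
  also have "\<dots> \<longleftrightarrow> seg_fact M e x y 2 v w \<or> seg_fact M e y z 2 v w \<or> (\<exists>u. suc u = y \<and> e v u \<and> e w y)"
    unfolding 2 seg_fact_def by auto
  finally show ?C unfolding seg_fact_def by simp blast
qed (simp_all add: seg_fact_def)

lemma less_5_cases: "(t::nat) < 5 \<Longrightarrow> t = 0 \<or> t = 1 \<or> t = 2 \<or> t = 3 \<or> t = 4"
  by arith

lemma (in henkin_model) glue_set:
  assumes "B \<in> h_sets M" "C \<in> h_sets M"
  shows "(\<lambda>u. (u \<prec> y \<longrightarrow> B u) \<and> (\<not> u \<prec> y \<longrightarrow> C u)) \<in> h_sets M"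
proof -
  have "definable M (\<lambda>i P. (i 0 \<prec> i 1 \<longrightarrow> P 0 (i 0)) \<and> (\<not> i 0 \<prec> i 1 \<longrightarrow> P 1 (i 0)))"
    by (intro definable_intros)
  from definable_set[OF this, of "case_nat B (\<lambda>_. C)" "\<lambda>_. y"] assms show ?thesis by auto
qed

lemma tp_append_forth:
  assumes M: "henkin_model M" "h_lt M x y" "h_lt M y z"
    and M': "henkin_model M'" "h_lt M' x' y'" "h_lt M' y' z'"
    and IH: "\<And>e e'. tp M k (Suc n) e x y = tp M' k (Suc n) e' x' y' \<Longrightarrow>
      tp M k (Suc n) e y z = tp M' k (Suc n) e' y' z' \<Longrightarrow> tp M k (Suc n) e x z = tp M' k (Suc n) e' x' z'"
    and eq: "tp M (Suc k) n e x y = tp M' (Suc k) n e' x' y'" "tp M (Suc k) n e y z = tp M' (Suc k) n e' y' z'"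
    and B: "B \<in> h_sets M"
  shows "\<exists>B'\<in>h_sets M'. tp M k (Suc n) (case_nat B e) x z = tp M' k (Suc n) (case_nat B' e') x' z'"
proof -
  interpret M': henkin_model M' by fact
  obtain B1 where B1: "B1 \<in> h_sets M'" "tp M k (Suc n) (case_nat B e) x y = tp M' k (Suc n) (case_nat B1 e') x' y'"
    using tp_Suc_forth[OF eq(1) B] by blast
  obtain B2 where B2: "B2 \<in> h_sets M'" "tp M k (Suc n) (case_nat B e) y z = tp M' k (Suc n) (case_nat B2 e') y' z'"
    using tp_Suc_forth[OF eq(2) B] by blast
  \<comment> \<open>The two answers are pasted together at \<open>y'\<close>; by locality each half
    keeps its type.\<close>
  let ?B = "\<lambda>u. (h_lt M' u y' \<longrightarrow> B1 u) \<and> (\<not> h_lt M' u y' \<longrightarrow> B2 u)"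
  have "tp M' k (Suc n) (case_nat ?B e') x' y' = tp M' k (Suc n) (case_nat B1 e') x' y'"
    by (rule tp_local[OF M'(1,2)]) (simp split: nat.split)
  moreover have "tp M' k (Suc n) (case_nat ?B e') y' z' = tp M' k (Suc n) (case_nat B2 e') y' z'"
    by (rule tp_local[OF M'(1,3)]) (simp split: nat.split add: M'.leD)
  ultimately have "tp M k (Suc n) (case_nat B e) x z = tp M' k (Suc n) (case_nat ?B e') x' z'"
    using B1 B2 by (intro IH) simp_all
  then show ?thesis using M'.glue_set[OF B1(1) B2(1)] by blast
qed

text \<open>The composition theorem for types. The two sides may live in different models, which
  lets standard words imitate nonstandard segments and carries equations between types from one
  model to another.\<close>

lemma tp_append:
  assumes M: "henkin_model M" "h_lt M x y" "h_lt M y z"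
    and M': "henkin_model M'" "h_lt M' x' y'" "h_lt M' y' z'"
    and "tp M k n e x y = tp M' k n e' x' y'" "tp M k n e y z = tp M' k n e' y' z'"
  shows "tp M k n e x z = tp M' k n e' x' z'"
  using assms(7,8)
proof (induction k arbitrary: n e e')
  case 0
  have "seg_fact M e x z t v w = seg_fact M' e' x' z' t v w" if "t < 5" "v < n" "w < n" for t v w
    using less_5_cases[OF that(1)] 0 that
    by (elim disjE; simp only: tp_0_eq_iff henkin_model.seg_fact_append[OF M] henkin_model.seg_fact_append[OF M'])
  then show ?case by (simp add: tp_0_eq_iff del: tp.simps)
next
  case (Suc k)
  have "\<exists>B'\<in>h_sets M'. tp M k (Suc n) (case_nat B e) x z = tp M' k (Suc n) (case_nat B' e') x' z'"
    if "B \<in> h_sets M" for B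
    by (rule tp_append_forth[OF M M' Suc.IH Suc.prems that])
  moreover have "\<exists>B\<in>h_sets M. tp M' k (Suc n) (case_nat B' e') x' z' = tp M k (Suc n) (case_nat B e) x z"
    if "B' \<in> h_sets M'" for B'
    by (rule tp_append_forth[OF M' M Suc.IH[symmetric] Suc.prems[symmetric] that]) simp_all
  ultimately show ?case unfolding tp_Suc_eq_iff by metis
qed

lemma (in henkin_model) seg_fact_letter:
  "seg_fact M e x (suc x) t v w \<longleftrightarrow> (if t = 0 then e v x \<and> e w x else t \<noteq> 1 \<and> t \<noteq> 2 \<and> e v x)"
proof -
  have "x \<preceq> z \<and> z \<preceq> x \<longleftrightarrow> z = x" for z using antisym by auto
  moreover have "\<not> (x \<preceq> z \<and> z \<prec> z' \<and> z' \<preceq> x)" for z z' by (meson leD le_less_trans less_le_trans)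
  moreover have "\<not> (x \<preceq> z \<and> z \<prec> x)" for z by (meson leD)
  ultimately show ?thesis unfolding seg_fact_def by simp (metis order_refl)
qed

text \<open>A one-letter segment sees a predicate only at its single position, so constant sets
  answer every move.\<close>

lemma tp_letter:
  assumes M: "henkin_model M" and M': "henkin_model M'" and "\<And>v. e v x = e' v x'"
  shows "tp M k n e x (h_suc M x) = tp M' k n e' x' (h_suc M' x')"
  using assms(3)
proof (induction k arbitrary: n e e')
  case 0
  have "seg_fact M e x (h_suc M x) t v w = seg_fact M' e' x' (h_suc M' x') t v w" for t v w
    unfolding henkin_model.seg_fact_letter[OF M] henkin_model.seg_fact_letter[OF M'] using 0 by simp
  then show ?case by (simp add: tp_0_eq_iff del: tp.simps)
next
  case (Suc k)
  have "tp M k (Suc n) (case_nat B e) x (h_suc M x) = tp M' k (Suc n) (case_nat (\<lambda>_. B x) e') x' (h_suc M' x')" for B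
    by (rule Suc.IH) (simp add: Suc.prems split: nat.split)
  moreover have "tp M k (Suc n) (case_nat (\<lambda>_. B x') e) x (h_suc M x) = tp M' k (Suc n) (case_nat B e') x' (h_suc M' x')" for B
    by (rule Suc.IH) (simp add: Suc.prems split: nat.split)
  ultimately show ?case unfolding tp_Suc_eq_iff
    using henkin_model.const_set[OF M] henkin_model.const_set[OF M'] by blast
qed

subsection \<open>The standard model\<close>

definition std :: "nat henkin" where
  "std = \<lparr>h_le = (\<le>), h_suc = Suc, h_zero = 0, h_sets = UNIV\<rparr>"

lemma std_simps [simp]: "h_le std = (\<le>)" "h_suc std = Suc" "h_zero std = 0" "h_sets std = UNIV"
  "h_lt std = (<)"
  by (auto simp: std_def h_lt_def fun_eq_iff)

lemma henkin_model_std: "henkin_model std"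
proof (unfold_locales; simp)
  fix X x assume "X (0::nat)" "\<And>y. X y \<Longrightarrow> X (Suc y)"
  then show "X x" by (induction x) auto
qed

lemma hsat_std [simp]: "hsat std i P \<phi> = sat i P \<phi>"
  by (induction \<phi> arbitrary: i P) simp_all

lemma tp_shift:
  assumes "x < y" "\<And>v z. x \<le> z \<Longrightarrow> z < y \<Longrightarrow> e' v (z + d) = e v z"
  shows "tp std k n e' (x + d) (y + d) = tp std k n e x y"
  using assms(2)
proof (induction k arbitrary: n e e')
  case 0
  have *: "(\<exists>z. x + d \<le> z \<and> Q z) \<longleftrightarrow> (\<exists>z\<ge>x. Q (z + d))" for Q
    by (metis add_le_cancel_right le_add_diff_inverse2 le_add2 order_trans)
  have "seg_fact std e' (x + d) (y + d) t v w = seg_fact std e x y t v w" for t v w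
  proof -
    have "(\<exists>z. x + d \<le> z \<and> z < y + d \<and> e' v z \<and> e' w z) = (\<exists>z\<ge>x. z < y \<and> e v z \<and> e w z)"
      unfolding * using 0 by auto
    moreover have "(\<exists>z z'. x + d \<le> z \<and> z < z' \<and> z' < y + d \<and> e' v z \<and> e' w z') =
      (\<exists>z z'. x \<le> z \<and> z < z' \<and> z' < y \<and> e v z \<and> e w z')" (is "?L = ?R")
    proof
      assume ?L
      then obtain z z' where z: "x + d \<le> z" "z < z'" "z' < y + d" "e' v z" "e' w z'" by blast
      then show ?R using 0[of "z - d" v] 0[of "z' - d" w]
        by (intro exI[of _ "z - d"] exI[of _ "z' - d"]) auto
    next
      assume ?R
      then obtain z z' where z: "x \<le> z" "z < z'" "z' < y" "e v z" "e w z'" by blast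
      then show ?L using 0[of z v] 0[of z' w]
        by (intro exI[of _ "z + d"] exI[of _ "z' + d"]) auto
    qed
    moreover have "(\<exists>z. x + d \<le> z \<and> Suc z < y + d \<and> e' v z \<and> e' w (Suc z)) = (\<exists>z\<ge>x. Suc z < y \<and> e v z \<and> e w (Suc z))"
      unfolding * using 0[of "Suc _" w] 0[of _ v] by auto
    moreover have "e' v (x + d) = e v x" using 0 assms(1) by simp
    moreover have "(\<exists>z. Suc z = y + d \<and> e' v z) = (\<exists>z. Suc z = y \<and> e v z)"
      using 0[of "y - 1" v] assms(1) by (cases y) auto
    ultimately show ?thesis unfolding seg_fact_def by simp
  qed
  then show ?case by (simp add: tp_0_eq_iff del: tp.simps)
next
  case (Suc k)
  \<comment> \<open>Truncated subtraction does no harm, because only positions from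
    \<open>x + d\<close> on are inspected.\<close>
  have 1: "tp std k (Suc n) (case_nat (\<lambda>z. B (z - d)) e') (x + d) (y + d) = tp std k (Suc n) (case_nat B e) x y" for B
    by (rule Suc.IH) (simp add: Suc.prems split: nat.split)
  have 2: "tp std k (Suc n) (case_nat B e') (x + d) (y + d) = tp std k (Suc n) (case_nat (\<lambda>z. B (z + d)) e) x y" for B
    by (rule Suc.IH) (simp add: Suc.prems split: nat.split)
  show ?case unfolding tp_Suc_eq_iff std_simps
    by (intro conjI ballI) (rule bexI, rule 2, simp, rule bexI, rule 1, simp)
qed

section \<open>Additive Ramsey theorem inside a model\<close>

text \<open>A Ramsey factorization with cuts \<open>H\<close>. The type \<open>t\<close> is required
  between any two cuts, not only neighbouring ones; three cuts in a row then show that composing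
  \<open>t\<close> with \<open>t\<close> gives \<open>t\<close>, and \<open>s\<close> with
  \<open>t\<close> gives \<open>s\<close>.\<close>

definition factor :: "'a henkin \<Rightarrow> nat \<Rightarrow> nat \<Rightarrow> (nat \<Rightarrow> 'a \<Rightarrow> bool) \<Rightarrow> ('a \<Rightarrow> bool) \<Rightarrow> nat \<Rightarrow> nat \<Rightarrow> bool" where
  "factor M k n e H s t \<longleftrightarrow> H \<in> h_sets M \<and> (\<forall>b. \<exists>h. H h \<and> h_lt M b h) \<and>
     (\<forall>h. H h \<longrightarrow> h_lt M (h_zero M) h \<and> tp M k n e (h_zero M) h = s) \<and>
     (\<forall>g h. H g \<longrightarrow> H h \<longrightarrow> h_lt M g h \<longrightarrow> tp M k n e g h = t)"

context henkin_model
begin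

definition unbounded :: "('a \<Rightarrow> bool) \<Rightarrow> bool" where
  "unbounded X \<longleftrightarrow> (\<forall>b. \<exists>x. X x \<and> b \<prec> x)"

lemma finite_bound: "finite F \<Longrightarrow> \<exists>m. \<forall>x\<in>F. f x \<preceq> m"
proof (induction F rule: finite_induct)
  case (insert x F)
  then obtain m where "\<forall>x\<in>F. f x \<preceq> m" by blast
  then show ?case by (metis insert_iff linear order_trans)
qed simp

text \<open>\<open>T\<close> is finite in the metatheory, so the argument also covers predicates
  outside \<open>h_sets M\<close>, such as those obtained from the arbitrary choice in
  \<open>merging_class\<close>.\<close>

lemma pigeonhole:
  assumes X: "unbounded X" and T: "finite T" and f: "\<And>x. X x \<Longrightarrow> f x \<in> T"
  shows "\<exists>c\<in>T. unbounded (\<lambda>x. X x \<and> f x = c)"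
proof (rule ccontr)
  assume "\<not> ?thesis"
  then have "\<forall>c\<in>T. \<exists>b. \<forall>x. X x \<longrightarrow> f x = c \<longrightarrow> x \<preceq> b"
    unfolding unbounded_def by (metis not_less)
  then obtain b where b: "\<forall>c\<in>T. \<forall>x. X x \<longrightarrow> f x = c \<longrightarrow> x \<preceq> b c" by metis
  obtain m where m: "\<forall>c\<in>T. b c \<preceq> m" using finite_bound[OF T] by blast
  obtain x where "X x" "m \<prec> x" using X unfolding unbounded_def by blast
  with b m f show False by (metis not_less order_trans)
qed

lemma unbounded_above:
  assumes "unbounded X"
  shows "unbounded (\<lambda>x. X x \<and> a \<prec> x)"
  unfolding unbounded_def
proof
  fix b
  obtain m where "a \<preceq> m" "b \<preceq> m" using linear by blast
  then show "\<exists>x. (X x \<and> a \<prec> x) \<and> b \<prec> x"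
    using assms unfolding unbounded_def by (meson le_less_trans)
qed

lemma tp_extend:
  assumes "tp M k n e x z = tp M k n e x' z" "x \<prec> z" "x' \<prec> z" "z \<prec> y"
  shows "tp M k n e x y = tp M k n e x' y"
  by (rule tp_append[OF henkin_model_axioms assms(2,4) henkin_model_axioms assms(3,4) assms(1) refl])

text \<open>Shelah's equivalence from the additive Ramsey theorem: types of segments starting at
  \<open>x\<close> and at \<open>y\<close> that agree at one common end agree at every later end, by
  \<open>tp_extend\<close>.\<close>

definition merges :: "nat \<Rightarrow> nat \<Rightarrow> (nat \<Rightarrow> 'a \<Rightarrow> bool) \<Rightarrow> 'a \<Rightarrow> 'a \<Rightarrow> bool" where
  "merges k n e x y \<longleftrightarrow> (\<exists>z. x \<prec> z \<and> y \<prec> z \<and> tp M k n e x z = tp M k n e y z)"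

text \<open>Pairwise non-merging points have different types up to a common later end, so there are
  at most as many of them as types. A family of maximal size represents every point up to merging,
  and one representative attracts an unbounded part of \<open>H\<close>.\<close>

lemma merging_class:
  assumes "unbounded H"
  shows "\<exists>x0. unbounded (\<lambda>x. H x \<and> merges k n e x x0)"
proof -
  define I where "I F \<longleftrightarrow> finite F \<and> (\<forall>x\<in>F. \<forall>y\<in>F. x \<noteq> y \<longrightarrow> \<not> merges k n e x y)" for F
  have bnd: "card F < Suc (card (types k n))" if "I F" for F
  proof -
    have F: "finite F \<and> (\<forall>x\<in>F. \<forall>y\<in>F. x \<noteq> y \<longrightarrow> \<not> merges k n e x y)" using that unfolding I_def .
    obtain m where m: "\<forall>x\<in>F. x \<preceq> m" using finite_bound[of F "\<lambda>x. x"] F by blast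
    have "inj_on (\<lambda>x. tp M k n e x (suc m)) F"
      using F m unfolding inj_on_def merges_def by (metis less_suc_iff)
    then have "card F \<le> card (types k n)"
      by (rule card_inj_on_le) (auto simp: tp_in_types finite_types)
    then show ?thesis by simp
  qed
  have "I {}" unfolding I_def by simp
  then obtain F where F: "I F" "\<forall>G. I G \<longrightarrow> card G \<le> card F"
    using ex_has_greatest_nat[of I "{}" card "Suc (card (types k n))"] bnd by blast
  have ex: "\<exists>y. y \<in> F \<and> merges k n e x y" for x
  proof (rule ccontr)
    assume neg: "\<not> ?thesis"
    have "merges k n e x x" unfolding merges_def by (metis less_suc_iff order_refl)
    with neg have "x \<notin> F" by blast
    have "merges k n e y x \<longleftrightarrow> merges k n e x y" for x y unfolding merges_def by metis
    then have "I (insert x F)" using F(1) neg unfolding I_def by auto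
    then have "card (insert x F) \<le> card F" using F(2) by blast
    with \<open>x \<notin> F\<close> F(1) show False unfolding I_def by simp
  qed
  define f where "f x = (SOME y. y \<in> F \<and> merges k n e x y)" for x
  have f: "f x \<in> F" "merges k n e x (f x)" for x
    using someI_ex[OF ex[of x]] unfolding f_def by blast+
  obtain c where "unbounded (\<lambda>x. H x \<and> f x = c)"
    using pigeonhole[OF assms, of F f] F(1) f(1) unfolding I_def by blast
  then have "unbounded (\<lambda>x. H x \<and> merges k n e x c)"
    unfolding unbounded_def using f(2) by metis
  then show ?thesis by blast
qed

lemma homogeneous_subset:
  assumes e: "range e \<subseteq> h_sets M" and K: "K \<in> h_sets M" "unbounded K"
    and merge: "\<And>g. K g \<Longrightarrow> \<exists>z. g \<prec> z \<and> (\<forall>y. K y \<longrightarrow> z \<prec> y \<longrightarrow> tp M k n e g y = t)"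
  shows "\<exists>H\<in>h_sets M. unbounded H \<and> (\<forall>h. H h \<longrightarrow> K h) \<and>
    (\<forall>g h. H g \<longrightarrow> H h \<longrightarrow> g \<prec> h \<longrightarrow> tp M k n e g h = t)"
proof -
  let ?C = "tp M k n e"
  have P: "range (case_nat K e) \<subseteq> h_sets M" using e K by simp
  have merge': "\<exists>z. K g \<longrightarrow> (\<forall>y. K y \<longrightarrow> z \<prec> y \<longrightarrow> ?C g y = t)" for g
  proof (cases "K g")
    case True
    from merge[OF this] show ?thesis by blast
  qed simp
  \<comment> \<open>Bounded collection: one \<open>z\<close> serves all \<open>g\<close> up to
    \<open>b\<close> at once. Infinitely many \<open>g\<close> may lie below a nonstandard
    \<open>b\<close>, hence an induction in the model instead of a finite maximum.\<close>
  have collect: "\<exists>z. \<forall>g. K g \<longrightarrow> g \<preceq> b \<longrightarrow> (\<forall>y. K y \<longrightarrow> z \<prec> y \<longrightarrow> ?C g y = t)" for b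
  proof -
    let ?Q = "\<lambda>b. \<exists>z. \<forall>g. K g \<longrightarrow> g \<preceq> b \<longrightarrow> (\<forall>y. K y \<longrightarrow> z \<prec> y \<longrightarrow> ?C g y = t)"
    have "definable M (\<lambda>i P. \<exists>z. \<forall>g. P 0 g \<longrightarrow> g \<preceq> i 0 \<longrightarrow>
        (\<forall>y. P 0 y \<longrightarrow> z \<prec> y \<longrightarrow> tp M k n (\<lambda>v. P (Suc v)) g y = t))"
      by (intro definable_intros definable_tp_Suc)
    from definable_set[OF this P] have "?Q \<in> h_sets M" by auto
    then show "?Q b"
    proof (rule induct)
      obtain z where z: "K zr \<longrightarrow> (\<forall>y. K y \<longrightarrow> z \<prec> y \<longrightarrow> ?C zr y = t)"
        using merge' by blast
      have "g = zr" if "g \<preceq> zr" for g by (rule le_antisym'[OF that zero_le])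
      then show "?Q zr" using z by blast
    next
      fix b assume "?Q b"
      then obtain z where z: "\<forall>g. K g \<longrightarrow> g \<preceq> b \<longrightarrow> (\<forall>y. K y \<longrightarrow> z \<prec> y \<longrightarrow> ?C g y = t)" by blast
      obtain z' where z': "K (suc b) \<longrightarrow> (\<forall>y. K y \<longrightarrow> z' \<prec> y \<longrightarrow> ?C (suc b) y = t)"
        using merge' by blast
      obtain m where m: "z \<preceq> m" "z' \<preceq> m" using linear by blast
      have "?C g y = t" if "K g" "g \<preceq> suc b" "K y" "m \<prec> y" for g y
      proof (cases "g = suc b")
        case True then show ?thesis using z' that m(2) by (meson le_less_trans)
      next
        case False
        then have "g \<preceq> b" using that(2) by (metis le_suc_D)
        then show ?thesis using z that m(1) by (meson le_less_trans)
      qed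
      then show "?Q (suc b)" by blast
    qed
  qed
  \<comment> \<open>\<open>B\<close> obeys the greedy rule below \<open>x\<close>; its values from
    \<open>x\<close> on are left open.\<close>
  define Pfx where "Pfx B x \<longleftrightarrow> (\<forall>h. h \<prec> x \<longrightarrow> (B h \<longleftrightarrow> K h \<and> (\<forall>g. g \<prec> h \<longrightarrow> B g \<longrightarrow> ?C g h = t)))" for B x
  have uniq: "B h = B' h" if B: "B \<in> h_sets M" "B' \<in> h_sets M" "Pfx B x" "Pfx B' x" "h \<prec> x" for B B' x h
  proof (rule ccontr)
    assume "B h \<noteq> B' h"
    have "definable M (\<lambda>i P. i 0 \<prec> i 1 \<and> \<not> (P 0 (i 0) \<longleftrightarrow> P 1 (i 0)))" by (intro definable_intros)
    from definable_set[OF this, of "case_nat B (\<lambda>_. B')" "\<lambda>_. x"]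
    have "(\<lambda>h. h \<prec> x \<and> B h \<noteq> B' h) \<in> h_sets M" using B by auto
    then obtain m where m: "m \<prec> x" "B m \<noteq> B' m" "\<And>y. y \<prec> x \<Longrightarrow> B y \<noteq> B' y \<Longrightarrow> m \<preceq> y"
      using least_exists[of "\<lambda>h. h \<prec> x \<and> B h \<noteq> B' h" h] \<open>B h \<noteq> B' h\<close> \<open>h \<prec> x\<close> by blast
    have "B g = B' g" if "g \<prec> m" for g using m(3)[of g] m(1) that by (meson leD less_trans)
    with B(3,4) m show False unfolding Pfx_def by metis
  qed
  have ex: "\<exists>B\<in>h_sets M. Pfx B x" for x
  proof -
    have "definable M (\<lambda>i P. \<exists>B\<in>h_sets M. \<forall>h. h \<prec> i 0 \<longrightarrow> (B h \<longleftrightarrow> P 0 h \<and>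
        (\<forall>g. g \<prec> h \<longrightarrow> B g \<longrightarrow> tp M k n (\<lambda>v. P (Suc v)) g h = t)))"
      by (intro definable_intros definable_tp)
    from definable_set[OF this P] have "(\<lambda>x. \<exists>B\<in>h_sets M. Pfx B x) \<in> h_sets M"
      unfolding Pfx_def by auto
    then show ?thesis
    proof (rule induct)
      show "\<exists>B\<in>h_sets M. Pfx B zr" using K unfolding Pfx_def by auto
    next
      fix x assume "\<exists>B\<in>h_sets M. Pfx B x"
      then obtain B where B: "B \<in> h_sets M" "Pfx B x" by blast
      \<comment> \<open>Extending the prefix needs a single truth value at \<open>x\<close>, so
        gluing with a constant set suffices.\<close>
      let ?c = "K x \<and> (\<forall>g. g \<prec> x \<longrightarrow> B g \<longrightarrow> ?C g x = t)"
      let ?B = "\<lambda>u. (u \<prec> x \<longrightarrow> B u) \<and> (\<not> u \<prec> x \<longrightarrow> ?c)"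
      have "?B h \<longleftrightarrow> K h \<and> (\<forall>g. g \<prec> h \<longrightarrow> ?B g \<longrightarrow> ?C g h = t)" if "h \<prec> suc x" for h
      proof (cases "h = x")
        case True then show ?thesis by auto
      next
        case False
        then have h: "h \<prec> x" using that by (simp add: le_less)
        have eq: "?B g = B g" if "g \<prec> h" for g using less_trans[OF that h] by simp
        have "B h \<longleftrightarrow> K h \<and> (\<forall>g. g \<prec> h \<longrightarrow> B g \<longrightarrow> ?C g h = t)"
          using h B(2) unfolding Pfx_def by blast
        also have "\<dots> \<longleftrightarrow> K h \<and> (\<forall>g. g \<prec> h \<longrightarrow> ?B g \<longrightarrow> ?C g h = t)"
          using eq by (simp only: cong: imp_cong)
        finally show ?thesis using h by simp
      qed
      then have "Pfx ?B (suc x)" unfolding Pfx_def by blast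
      then show "\<exists>B\<in>h_sets M. Pfx B (suc x)" using glue_set[OF B(1) const_set[of ?c], of x] by blast
    qed
  qed
  define H where "H h \<longleftrightarrow> (\<exists>B\<in>h_sets M. Pfx B (suc h) \<and> B h)" for h
  have "definable M (\<lambda>i P. \<exists>B\<in>h_sets M. \<exists>x. x = suc (i 0) \<and> (\<forall>h. h \<prec> x \<longrightarrow> (B h \<longleftrightarrow> P 0 h \<and>
        (\<forall>g. g \<prec> h \<longrightarrow> B g \<longrightarrow> tp M k n (\<lambda>v. P (Suc v)) g h = t))) \<and> B (i 0))"
    by (intro definable_intros definable_tp)
  from definable_set[OF this P] have "(\<lambda>h. \<exists>B\<in>h_sets M. Pfx B (suc h) \<and> B h) \<in> h_sets M"
    unfolding Pfx_def by auto
  then have H: "H \<in> h_sets M" unfolding H_def[abs_def] .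
  have H_eq: "H h = B h" if B: "B \<in> h_sets M" "Pfx B x" "h \<prec> x" for B x h
  proof -
    have "Pfx B (suc h)" using B unfolding Pfx_def by (meson le_less_trans less_suc_iff)
    moreover have "B' h = B h" if "B' \<in> h_sets M" "Pfx B' (suc h)" for B'
      using uniq[OF that(1) B(1) that(2) \<open>Pfx B (suc h)\<close>, of h] by simp
    ultimately show ?thesis unfolding H_def using B(1) by blast
  qed
  have H_iff: "H h \<longleftrightarrow> K h \<and> (\<forall>g. g \<prec> h \<longrightarrow> H g \<longrightarrow> ?C g h = t)" for h
  proof -
    obtain B where B: "B \<in> h_sets M" "Pfx B (suc h)" using ex by blast
    have "B g = H g" if "g \<preceq> h" for g using H_eq[OF B, of g] that by simp
    moreover have "B h \<longleftrightarrow> K h \<and> (\<forall>g. g \<prec> h \<longrightarrow> B g \<longrightarrow> ?C g h = t)"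
      using B(2) unfolding Pfx_def by simp
    moreover have "B h = H h" "g \<prec> h \<Longrightarrow> B g = H g" for g
      by (simp_all add: \<open>\<And>g. g \<preceq> h \<Longrightarrow> B g = H g\<close>)
    ultimately show ?thesis by (simp cong: imp_cong)
  qed
  have "\<exists>h. H h \<and> b \<prec> h" for b
  proof (rule ccontr)
    assume neg: "\<not> ?thesis"
    obtain z where z: "\<forall>g. K g \<longrightarrow> g \<preceq> b \<longrightarrow> (\<forall>y. K y \<longrightarrow> z \<prec> y \<longrightarrow> ?C g y = t)"
      using collect[of b] by blast
    obtain y where y: "K y" "b \<prec> y" "z \<prec> y"
      using unbounded_above[OF K(2), of b] unfolding unbounded_def by blast
    \<comment> \<open>If \<open>b\<close> bounded \<open>H\<close>, any point of \<open>K\<close>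
      beyond both \<open>b\<close> and the common bound \<open>z\<close> would pass the greedy
      test.\<close>
    have "g \<preceq> b" "K g" if "H g" for g using neg that H_iff[of g] not_less[of b g] by simp_all
    then have "H y" using y z H_iff[of y] by blast
    with neg y show False by blast
  qed
  then show ?thesis using H H_iff unfolding unbounded_def by blast
qed

text \<open>The prescribed unbounded set \<open>H0\<close> is needed in the back-and-forth step:
  after a new predicate has been added, the new cuts must be found among the old ones.\<close>

theorem ramsey:
  assumes e: "range e \<subseteq> h_sets M" and H0: "H0 \<in> h_sets M" "\<forall>b. \<exists>h. H0 h \<and> b \<prec> h"
  shows "\<exists>H s t. factor M k n e H s t \<and> (\<forall>h. H h \<longrightarrow> H0 h)"
proof -
  let ?C = "tp M k n e"
  obtain x0 where x0: "unbounded (\<lambda>x. H0 x \<and> merges k n e x x0)"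
    using merging_class[of H0] H0(2) unfolding unbounded_def by blast
  let ?X = "\<lambda>x. ((H0 x \<and> merges k n e x x0) \<and> x0 \<prec> x) \<and> zr \<prec> x"
  have "unbounded ?X"
    using unbounded_above[OF unbounded_above[OF x0]] .
  from pigeonhole[OF this, of "types k n \<times> types k n" "\<lambda>x. (?C zr x, ?C x0 x)"]
  obtain s t where "unbounded (\<lambda>x. ?X x \<and> (?C zr x, ?C x0 x) = (s, t))"
    by (auto simp: finite_types tp_in_types)
  moreover define K where "K x \<longleftrightarrow> H0 x \<and> merges k n e x x0 \<and> x0 \<prec> x \<and> zr \<prec> x \<and> ?C zr x = s \<and> ?C x0 x = t" for x
  ultimately have unb: "unbounded K" unfolding K_def[abs_def] by (simp add: conj_assoc)
  have "definable M (\<lambda>i P. P 0 (i 0) \<and> (\<exists>z. i 0 \<prec> z \<and> i 1 \<prec> z \<and>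
      tp M k n (\<lambda>v. P (Suc v)) (i 0) z = tp M k n (\<lambda>v. P (Suc v)) (i 1) z) \<and> i 1 \<prec> i 0 \<and> i (Suc 1) \<prec> i 0 \<and>
      tp M k n (\<lambda>v. P (Suc v)) (i (Suc 1)) (i 0) = s \<and> tp M k n (\<lambda>v. P (Suc v)) (i 1) (i 0) = t)"
    by (intro definable_intros definable_tp definable_tp_eq)
  from definable_set[OF this, of "case_nat H0 e" "case_nat x0 (\<lambda>_. zr)"]
  have K: "K \<in> h_sets M" unfolding K_def[abs_def] merges_def using e H0(1) by simp
  \<comment> \<open>As \<open>g\<close> merges with \<open>x0\<close>, from some \<open>z\<close> on
    its types agree with those of \<open>x0\<close>, and up to points of \<open>K\<close> these are
    \<open>t\<close>.\<close>
  have "\<exists>z. g \<prec> z \<and> (\<forall>y. K y \<longrightarrow> z \<prec> y \<longrightarrow> ?C g y = t)" if Kg: "K g" for g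
  proof -
    obtain z where "g \<prec> z" "x0 \<prec> z" "?C g z = ?C x0 z" using Kg unfolding K_def merges_def by blast
    then show ?thesis using tp_extend unfolding K_def by metis
  qed
  from homogeneous_subset[OF e K unb this]
  obtain H where "H \<in> h_sets M" "unbounded H" "\<forall>h. H h \<longrightarrow> K h"
    "\<forall>g h. H g \<longrightarrow> H h \<longrightarrow> g \<prec> h \<longrightarrow> ?C g h = t" by blast
  then have "factor M k n e H s t" "\<forall>h. H h \<longrightarrow> H0 h"
    unfolding factor_def unbounded_def K_def by blast+
  then show ?thesis by blast
qed


section \<open>Gluing predicates along a factorization\<close>

text \<open>Minimality with False before True among the sets giving type \<open>c\<close>, compared
  on the positions from \<open>x\<close> up to \<open>z\<close> only. The least set is definable,
  which replaces choosing one set per segment; the separate bound \<open>z\<close> is the induction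
  variable of the existence proof.\<close>

definition lex_least :: "nat \<Rightarrow> nat \<Rightarrow> (nat \<Rightarrow> 'a \<Rightarrow> bool) \<Rightarrow> nat \<Rightarrow> 'a \<Rightarrow> 'a \<Rightarrow> 'a \<Rightarrow> ('a \<Rightarrow> bool) \<Rightarrow> bool" where
  "lex_least k n e c x y z B \<longleftrightarrow> tp M k (Suc n) (case_nat B e) x y = c \<and>
     (\<forall>C\<in>h_sets M. tp M k (Suc n) (case_nat C e) x y = c \<longrightarrow>
       (\<forall>w. x \<preceq> w \<longrightarrow> w \<prec> z \<longrightarrow> \<not> (B w \<longleftrightarrow> C w) \<longrightarrow> (\<forall>u. x \<preceq> u \<longrightarrow> u \<prec> w \<longrightarrow> (B u \<longleftrightarrow> C u)) \<longrightarrow> C w))"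

lemma definable_lex_least:
  "definable M (\<lambda>i P. lex_least k n (\<lambda>v. P (g v)) c (i x) (i y) (i z) (P X))"
  unfolding lex_least_def
proof (intro definable_intros)
  show "definable M (\<lambda>i P. tp M k (Suc n) (case_nat (P X) (\<lambda>v. P (g v))) (i x) (i y) = c)"
    using definable_tp[of M k "Suc n" "case_nat X g" x y c]
    by (elim back_subst[of "definable M"]) (auto simp: fun_eq_iff split: nat.split intro!: arg_cong[of _ _ "\<lambda>e. tp M k (Suc n) e _ _ = c"])
  show "definable M (\<lambda>i P. tp M k (Suc n) (case_nat (P 0) (\<lambda>v. P (Suc (g v)))) (i x) (i y) = c)"
    unfolding case_nat_shift by (rule definable_tp)
qed

lemma lex_least_exists:
  assumes e: "range e \<subseteq> h_sets M" and "B \<in> h_sets M" "tp M k (Suc n) (case_nat B e) x y = c"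
  shows "\<exists>B\<in>h_sets M. lex_least k n e c x y y B"
proof -
  let ?Q = "\<lambda>z. \<exists>B\<in>h_sets M. lex_least k n e c x y z B"
  have "definable M (\<lambda>i P. \<exists>B\<in>h_sets M. lex_least k n P c (i 1) (i (Suc 1)) (i 0) B)"
    by (intro definable_bex definable_lex_least)
  from definable_set[OF this e, of "case_nat x (\<lambda>_. y)"] have "?Q \<in> h_sets M" by simp
  then show "?Q y"
  proof (rule induct)
    show "?Q zr" using assms(2,3) unfolding lex_least_def by auto
  next
    fix z assume "?Q z"
    then obtain B where B: "B \<in> h_sets M" "lex_least k n e c x y z B" by blast
    show "?Q (suc z)"
    proof (cases "lex_least k n e c x y (suc z) B")
      case True then show ?thesis using B(1) by blast
    next
      case False
      then obtain C w where C: "C \<in> h_sets M" "tp M k (Suc n) (case_nat C e) x y = c"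
        and w: "x \<preceq> w" "w \<preceq> z" "\<not> (B w \<longleftrightarrow> C w)" "\<forall>u. x \<preceq> u \<longrightarrow> u \<prec> w \<longrightarrow> (B u \<longleftrightarrow> C u)" "\<not> C w"
        using B(2) unfolding lex_least_def by auto
      \<comment> \<open>A competitor deviating before \<open>z\<close> would contradict minimality
        up to \<open>z\<close>. So it deviates exactly at \<open>z\<close>, where it is false, and
        is itself least up to \<open>suc z\<close>.\<close>
      have "w = z"
      proof (rule ccontr)
        assume "w \<noteq> z"
        then have "w \<prec> z" using w(2) by (simp add: le_less)
        then show False using B(2) C w unfolding lex_least_def by blast
      qed
      have "lex_least k n e c x y (suc z) C" unfolding lex_least_def
      proof (intro conjI ballI allI impI)
        show "tp M k (Suc n) (case_nat C e) x y = c" by fact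
        fix D u assume D: "D \<in> h_sets M" "tp M k (Suc n) (case_nat D e) x y = c"
          and u: "x \<preceq> u" "u \<prec> suc z" "\<not> (C u \<longleftrightarrow> D u)" "\<forall>t. x \<preceq> t \<longrightarrow> t \<prec> u \<longrightarrow> (C t \<longleftrightarrow> D t)"
        show "D u"
        proof (cases "u = z")
          case True then show ?thesis using u(3) w(5) \<open>w = z\<close> by blast
        next
          case False
          then have uz: "u \<prec> z" using u(2) by (simp add: le_less)
          then have "B t \<longleftrightarrow> C t" if "x \<preceq> t" "t \<preceq> u" for t
            using w(4) \<open>w = z\<close> that le_less_trans[OF that(2) uz] by blast
          then have "\<not> (B u \<longleftrightarrow> D u)" "\<forall>t. x \<preceq> t \<longrightarrow> t \<prec> u \<longrightarrow> (B t \<longleftrightarrow> D t)"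
            using u by (auto simp: less_imp_le)
          then show ?thesis using B(2) D u(1) uz unfolding lex_least_def by blast
        qed
      qed
      then show ?thesis using C(1) by blast
    qed
  qed
qed

lemma lex_least_unique:
  assumes B: "B \<in> h_sets M" "lex_least k n e c x y y B" and C: "C \<in> h_sets M" "lex_least k n e c x y y C"
    and w: "x \<preceq> w" "w \<prec> y"
  shows "B w = C w"
proof (rule ccontr)
  assume neq: "B w \<noteq> C w"
  have "definable M (\<lambda>i P. i 1 \<preceq> i 0 \<and> i 0 \<prec> i (Suc 1) \<and> \<not> (P 0 (i 0) \<longleftrightarrow> P 1 (i 0)))" by (intro definable_intros)
  from definable_set[OF this, of "case_nat B (\<lambda>_. C)" "case_nat x (\<lambda>_. y)"]
  have "(\<lambda>w. x \<preceq> w \<and> w \<prec> y \<and> B w \<noteq> C w) \<in> h_sets M" using B(1) C(1) by auto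
  from least_exists[OF this, of w] obtain m where m: "x \<preceq> m" "m \<prec> y" "B m \<noteq> C m"
    "\<forall>u. x \<preceq> u \<and> u \<prec> y \<and> B u \<noteq> C u \<longrightarrow> m \<preceq> u" using w neq by blast
  have less: "B u \<longleftrightarrow> C u" if "x \<preceq> u" "u \<prec> m" for u
    using m(4) that less_trans[OF that(2) m(2)] leD[of m u] by blast
  \<comment> \<open>At the first difference each of the two sets must contain \<open>m\<close>,
    since the other one is least.\<close>
  have "C m" using B(2) C m(1,2,3) less unfolding lex_least_def by blast
  moreover have "B m" using C(2) B m(1,2,3) less unfolding lex_least_def by blast
  ultimately show False using m(3) by blast
qed

definition segment :: "('a \<Rightarrow> bool) \<Rightarrow> 'a \<Rightarrow> 'a \<Rightarrow> bool" where
  "segment H x y \<longleftrightarrow> x \<prec> y \<and> (x = zr \<or> H x) \<and> H y \<and> (\<forall>z. H z \<longrightarrow> x \<prec> z \<longrightarrow> y \<preceq> z)"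

lemma segment_unique:
  assumes "segment H x y" "segment H x' y'" "x \<preceq> z" "z \<prec> y" "x' \<preceq> z" "z \<prec> y'"
  shows "x = x' \<and> y = y'"
proof -
  have "x = x'" if "segment H x y" "segment H x' y'" "x \<preceq> z" "z \<prec> y" "x' \<preceq> z" "z \<prec> y'" "x \<preceq> x'" for x y x' y'
  proof (rule ccontr)
    assume "x \<noteq> x'"
    then have "x \<prec> x'" using that(7) by (simp add: le_less)
    then have "H x'" using that(2) unfolding segment_def by auto
    then have "y \<preceq> x'" using that(1) \<open>x \<prec> x'\<close> unfolding segment_def by blast
    then show False using that(4,5) by (meson leD order_trans)
  qed
  then have x: "x = x'" using assms linear by metis
  have "y \<preceq> y'" "y' \<preceq> y" using assms(1,2) x unfolding segment_def by blast+
  then show ?thesis using x le_antisym' by blast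
qed

lemma glue_segments:
  assumes e: "range e \<subseteq> h_sets M" and H: "H \<in> h_sets M"
    and ex: "\<And>x y. segment H x y \<Longrightarrow> \<exists>B\<in>h_sets M. tp M k (Suc n) (case_nat B e) x y = (if x = zr then s else t)"
  shows "\<exists>B\<in>h_sets M. \<forall>x y. segment H x y \<longrightarrow> tp M k (Suc n) (case_nat B e) x y = (if x = zr then s else t)"
proof -
  define ok where "ok x y B \<longleftrightarrow> (x = zr \<longrightarrow> lex_least k n e s x y y B) \<and> (\<not> x = zr \<longrightarrow> lex_least k n e t x y y B)" for x y B
  \<comment> \<open>The point \<open>z\<close> is decided by the least solution of the unique block
    containing it. As this description is definable, the blockwise answers form one set of the
    model.\<close>
  define G where "G z \<longleftrightarrow> (\<exists>x y. segment H x y \<and> x \<preceq> z \<and> z \<prec> y \<and> (\<exists>B\<in>h_sets M. ok x y B \<and> B z))" for z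
  have "definable M (\<lambda>i P. \<exists>x y. (x \<prec> y \<and> (x = zr \<or> P 0 x) \<and> P 0 y \<and> (\<forall>z. P 0 z \<longrightarrow> x \<prec> z \<longrightarrow> y \<preceq> z)) \<and>
     x \<preceq> i 0 \<and> i 0 \<prec> y \<and> (\<exists>B\<in>h_sets M. ((x = zr \<longrightarrow> lex_least k n (\<lambda>v. P (Suc v)) s x y y B) \<and>
       (\<not> x = zr \<longrightarrow> lex_least k n (\<lambda>v. P (Suc v)) t x y y B)) \<and> B (i 0)))"
    by (intro definable_intros definable_lex_least)
  from definable_set[OF this, of "case_nat H e"] have G: "G \<in> h_sets M"
    unfolding G_def[abs_def] ok_def segment_def using e H by simp
  have "tp M k (Suc n) (case_nat G e) x y = (if x = zr then s else t)" if seg: "segment H x y" for x y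
  proof -
    obtain B0 where "B0 \<in> h_sets M" "tp M k (Suc n) (case_nat B0 e) x y = (if x = zr then s else t)"
      using ex[OF seg] by blast
    from lex_least_exists[OF e this] obtain B where B: "B \<in> h_sets M" "ok x y B"
      unfolding ok_def by (auto split: if_splits)
    have "G z = B z" if z: "x \<preceq> z" "z \<prec> y" for z
    proof -
      have "B' z = B z" if "B' \<in> h_sets M" "ok x y B'" for B'
        using lex_least_unique[OF that(1) _ B(1) _ z] that(2) B(2) unfolding ok_def by blast
      moreover have "x' = x \<and> y' = y" if "segment H x' y'" "x' \<preceq> z" "z \<prec> y'" for x' y'
        using segment_unique[OF that(1) seg that(2,3) z] .
      ultimately show ?thesis unfolding G_def using seg z B by blast
    qed
    then have "tp M k (Suc n) (case_nat G e) x y = tp M k (Suc n) (case_nat B e) x y"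
      using seg unfolding segment_def
      by (intro tp_local[OF henkin_model_axioms]) (auto split: nat.split)
    also have "\<dots> = (if x = zr then s else t)"
      using B(2) unfolding ok_def lex_least_def by simp
    finally show ?thesis .
  qed
  then show ?thesis using G by blast
qed

lemma segment_ending:
  assumes "H \<in> h_sets M" "H h" "\<And>h. H h \<Longrightarrow> zr \<prec> h"
  shows "(\<exists>g. H g \<and> segment H g h \<and> (\<forall>z. H z \<longrightarrow> z \<prec> h \<longrightarrow> z \<preceq> g)) \<or> segment H zr h \<and> (\<forall>g. H g \<longrightarrow> h \<preceq> g)"
proof (cases "\<exists>g. H g \<and> g \<prec> h")
  case True
  then obtain g where g: "H g" "g \<prec> h" "\<forall>y. H y \<longrightarrow> y \<prec> h \<longrightarrow> y \<preceq> g"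
    using greatest_below[OF assms(1)] by blast
  then have "segment H g h" unfolding segment_def using assms(2) not_less by blast
  then show ?thesis using g by blast
next
  case False
  then have "h \<preceq> g" if "H g" for g using that not_less[of g h] by blast
  then show ?thesis unfolding segment_def using assms(2,3) by blast
qed

text \<open>Types between neighbouring cuts suffice once \<open>s\<close> absorbs \<open>t\<close>
  and \<open>t\<close> is idempotent. The induction along the cuts takes the form of a least
  counterexample, whose last block is split off.\<close>

lemma factor_of_segments:
  assumes e: "range e \<subseteq> h_sets M" and H: "H \<in> h_sets M" "\<forall>b. \<exists>h. H h \<and> b \<prec> h" "\<And>h. H h \<Longrightarrow> zr \<prec> h"
    and seg: "\<And>x y. segment H x y \<Longrightarrow> tp M k n e x y = (if x = zr then s else t)"
    and s: "\<And>x y z. x \<prec> y \<Longrightarrow> y \<prec> z \<Longrightarrow> tp M k n e x y = s \<Longrightarrow> tp M k n e y z = t \<Longrightarrow> tp M k n e x z = s"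
    and t: "\<And>x y z. x \<prec> y \<Longrightarrow> y \<prec> z \<Longrightarrow> tp M k n e x y = t \<Longrightarrow> tp M k n e y z = t \<Longrightarrow> tp M k n e x z = t"
  shows "factor M k n e H s t"
proof -
  have seg': "tp M k n e g h = t" if "H g" "segment H g h" for g h
    using seg[OF that(2)] H(3)[OF that(1)] by auto
  have P: "range (case_nat H e) \<subseteq> h_sets M" using e H by simp
  have "tp M k n e zr h = s" if "H h" for h
  proof (rule ccontr)
    assume neg: "tp M k n e zr h \<noteq> s"
    have "definable M (\<lambda>i P. P 0 (i 0) \<and> \<not> tp M k n (\<lambda>v. P (Suc v)) (i 1) (i 0) = s)"
      by (intro definable_intros definable_tp)
    from definable_set[OF this P, of "\<lambda>_. zr"] have "(\<lambda>h. H h \<and> tp M k n e zr h \<noteq> s) \<in> h_sets M" by simp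
    from least_exists[OF this, of h] neg that obtain m where m: "H m" "tp M k n e zr m \<noteq> s"
      "\<forall>y. H y \<and> tp M k n e zr y \<noteq> s \<longrightarrow> m \<preceq> y" by blast
    from segment_ending[OF H(1) m(1) H(3)] consider g where "H g" "segment H g m" | "segment H zr m" by blast
    then show False
    proof cases
      case 1
      then have "g \<prec> m" unfolding segment_def by blast
      then have "tp M k n e zr g = s" using m(3) 1(1) leD[of m g] by blast
      then show False using s[OF H(3)[OF 1(1)] \<open>g \<prec> m\<close>] seg'[OF 1] m(2) by blast
    next
      case 2 then show False using seg[OF 2] m(2) by simp
    qed
  qed
  moreover have "tp M k n e g h = t" if "H g" "H h" "g \<prec> h" for g h
  proof (rule ccontr)
    assume neg: "tp M k n e g h \<noteq> t"
    have "definable M (\<lambda>i P. P 0 (i 0) \<and> i 1 \<prec> i 0 \<and> \<not> tp M k n (\<lambda>v. P (Suc v)) (i 1) (i 0) = t)"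
      by (intro definable_intros definable_tp)
    from definable_set[OF this P, of "\<lambda>_. g"] have "(\<lambda>h. H h \<and> g \<prec> h \<and> tp M k n e g h \<noteq> t) \<in> h_sets M" by simp
    from least_exists[OF this, of h] neg that obtain m where m: "H m" "g \<prec> m" "tp M k n e g m \<noteq> t"
      "\<forall>y. H y \<and> g \<prec> y \<and> tp M k n e g y \<noteq> t \<longrightarrow> m \<preceq> y" by blast
    have "\<not> m \<preceq> g" using m(2) by (simp add: not_le)
    with segment_ending[OF H(1) m(1) H(3)] that(1) obtain g' where g':
      "H g'" "segment H g' m" "\<forall>z. H z \<longrightarrow> z \<prec> m \<longrightarrow> z \<preceq> g'" by blast
    have "g' \<prec> m" using g'(2) unfolding segment_def by blast
    have "g \<preceq> g'" using g'(3) that(1) m(2) by blast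
    then consider "g = g'" | "g \<prec> g'" by (auto simp: le_less)
    then show False
    proof cases
      case 1 then show False using seg'[OF g'(1,2)] m(3) by simp
    next
      case 2
      then have "tp M k n e g g' = t" using m(4) g'(1) \<open>g' \<prec> m\<close> leD[of m g'] by blast
      then show False using t[OF 2 \<open>g' \<prec> m\<close>] seg'[OF g'(1,2)] m(3) by blast
    qed
  qed
  ultimately show ?thesis unfolding factor_def using H by blast
qed

end

text \<open>A game move on whole factorizations. In \<open>M\<close> the cuts are refined by Ramsey
  for the enlarged predicate list, and the resulting types \<open>s1\<close> and \<open>t1\<close>
  are read off. \<open>M'\<close> keeps its cuts: each block is answered separately, since it has
  the same type as a block of \<open>M\<close>, and the answers are glued. The absorption laws for
  \<open>s1\<close> and \<open>t1\<close> are inherited from three cuts of \<open>M\<close>.\<close>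

lemma factor_forth:
  assumes M: "henkin_model M" and M': "henkin_model M'"
    and e: "range e \<subseteq> h_sets M" and e': "range e' \<subseteq> h_sets M'"
    and f: "factor M (Suc k) n e H s t" and f': "factor M' (Suc k) n e' H' s t" and B: "B \<in> h_sets M"
  shows "\<exists>B'\<in>h_sets M'. \<exists>H1 s1 t1. factor M k (Suc n) (case_nat B e) H1 s1 t1 \<and>
    factor M' k (Suc n) (case_nat B' e') H' s1 t1"
proof -
  interpret M: henkin_model M by fact
  interpret M': henkin_model M' by fact
  let ?e = "case_nat B e"
  have e1: "range ?e \<subseteq> h_sets M" using e B by simp
  obtain H1 s1 t1 where H1: "factor M k (Suc n) ?e H1 s1 t1" "\<forall>h. H1 h \<longrightarrow> H h"
    using M.ramsey[OF e1, of H k "Suc n"] f unfolding factor_def by blast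
  obtain x where x: "H1 x" using H1(1) unfolding factor_def by blast
  obtain y where y: "H1 y" "M.lt x y" using H1(1) unfolding factor_def by blast
  obtain z where z: "H1 z" "M.lt y z" using H1(1) unfolding factor_def by blast
  have x0: "M.lt M.zr x" using H1(1) x unfolding factor_def by blast
  have tps: "tp M k (Suc n) ?e M.zr x = s1" "tp M k (Suc n) ?e M.zr y = s1" "tp M k (Suc n) ?e x y = t1"
    "tp M k (Suc n) ?e y z = t1" "tp M k (Suc n) ?e x z = t1"
    using H1(1) x y z M.less_trans[OF y(2) z(2)] unfolding factor_def by blast+
  have ex: "\<exists>B'\<in>h_sets M'. tp M' k (Suc n) (case_nat B' e') x' y' = (if x' = M'.zr then s1 else t1)"
    if seg: "M'.segment H' x' y'" for x' y'
  proof (cases "x' = M'.zr")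
    case True
    have "tp M (Suc k) n e M.zr x = tp M' (Suc k) n e' x' y'"
      using f f' x H1(2) seg True unfolding factor_def M'.segment_def by metis
    from tp_Suc_forth[OF this B] show ?thesis using tps(1) True by auto
  next
    case False
    have "tp M (Suc k) n e x y = tp M' (Suc k) n e' x' y'"
      using f f' x y H1(2) seg False unfolding factor_def M'.segment_def by metis
    from tp_Suc_forth[OF this B] show ?thesis using tps(3) False by auto
  qed
  have H': "H' \<in> h_sets M'" "\<forall>b. \<exists>h. H' h \<and> M'.lt b h" "\<And>h. H' h \<Longrightarrow> M'.lt M'.zr h"
    using f' unfolding factor_def by blast+
  obtain B' where B': "B' \<in> h_sets M'"
    "\<And>x y. M'.segment H' x y \<Longrightarrow> tp M' k (Suc n) (case_nat B' e') x y = (if x = M'.zr then s1 else t1)"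
    using M'.glue_segments[OF e' H'(1) ex] by blast
  have "factor M' k (Suc n) (case_nat B' e') H' s1 t1"
  proof (rule M'.factor_of_segments[OF _ H' B'(2)])
    show "range (case_nat B' e') \<subseteq> h_sets M'" using e' B' by simp
    fix x' y' z' assume lt: "M'.lt x' y'" "M'.lt y' z'"
    { assume "tp M' k (Suc n) (case_nat B' e') x' y' = s1" "tp M' k (Suc n) (case_nat B' e') y' z' = t1"
      then show "tp M' k (Suc n) (case_nat B' e') x' z' = s1"
        using tp_append[OF M' lt M x0 y(2), of k "Suc n" "case_nat B' e'" ?e] tps by simp }
    { assume "tp M' k (Suc n) (case_nat B' e') x' y' = t1" "tp M' k (Suc n) (case_nat B' e') y' z' = t1"
      then show "tp M' k (Suc n) (case_nat B' e') x' z' = t1"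
        using tp_append[OF M' lt M y(2) z(2), of k "Suc n" "case_nat B' e'" ?e] tps by simp }
  qed
  then show ?thesis using B'(1) H1(1) by blast
qed

section \<open>Types determine satisfaction\<close>

text \<open>Semantics on the domain \<open>D\<close> in which individuals are represented by singletons.\<close>

primrec ssat :: "'a henkin \<Rightarrow> ('a \<Rightarrow> bool) \<Rightarrow> (nat \<Rightarrow> 'a \<Rightarrow> bool) \<Rightarrow> (nat \<Rightarrow> nat) \<Rightarrow> (nat \<Rightarrow> nat) \<Rightarrow> fm \<Rightarrow> bool" where
  "ssat M D e f g (Eq x y) = (\<exists>z. D z \<and> e (f x) z \<and> e (f y) z)"
| "ssat M D e f g (Le x y) = ((\<exists>z. D z \<and> e (f x) z \<and> e (f y) z) \<or>
     (\<exists>z z'. D z \<and> D z' \<and> h_lt M z z' \<and> e (f x) z \<and> e (f y) z'))"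
| "ssat M D e f g (Succ x y) = (\<exists>z. D z \<and> D (h_suc M z) \<and> e (f x) z \<and> e (f y) (h_suc M z))"
| "ssat M D e f g (Zero x) = e (f x) (h_zero M)"
| "ssat M D e f g (Mem x X) = (\<exists>z. D z \<and> e (f x) z \<and> e (g X) z)"
| "ssat M D e f g Tru = True"
| "ssat M D e f g Fls = False"
| "ssat M D e f g (And \<phi> \<psi>) = (ssat M D e f g \<phi> \<and> ssat M D e f g \<psi>)"
| "ssat M D e f g (Neg \<phi>) = (\<not> ssat M D e f g \<phi>)"
| "ssat M D e f g (ExI \<phi>) = (\<exists>B\<in>h_sets M. (\<exists>z. D z \<and> B z \<and> B z) \<and>
     \<not> (\<exists>z z'. D z \<and> D z' \<and> h_lt M z z' \<and> B z \<and> B z') \<and>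
     ssat M D (case_nat B e) (case_nat 0 (\<lambda>x. Suc (f x))) (\<lambda>X. Suc (g X)) \<phi>)"
| "ssat M D e f g (ExP \<phi>) = (\<exists>B\<in>h_sets M.
     ssat M D (case_nat B e) (\<lambda>x. Suc (f x)) (case_nat 0 (\<lambda>X. Suc (g X))) \<phi>)"

primrec depth :: "fm \<Rightarrow> nat" where
  "depth (Eq x y) = 0"
| "depth (Le x y) = 0"
| "depth (Succ x y) = 0"
| "depth (Zero x) = 0"
| "depth (Mem x X) = 0"
| "depth Tru = 0"
| "depth Fls = 0"
| "depth (And \<phi> \<psi>) = max (depth \<phi>) (depth \<psi>)"
| "depth (Neg \<phi>) = depth \<phi>"
| "depth (ExI \<phi>) = Suc (depth \<phi>)"
| "depth (ExP \<phi>) = Suc (depth \<phi>)"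

text \<open>The clauses are literally those of the atomic and singleton conditions in
  \<open>ssat\<close>; for this reason nonemptiness is written there with the doubled conjunct
  \<open>B z \<and> B z\<close>. The domains \<open>D\<close> and \<open>D'\<close> allow initial
  segments as well as whole models.\<close>

definition agree :: "'a henkin \<Rightarrow> ('a \<Rightarrow> bool) \<Rightarrow> 'b henkin \<Rightarrow> ('b \<Rightarrow> bool) \<Rightarrow> nat \<Rightarrow>
    (nat \<Rightarrow> 'a \<Rightarrow> bool) \<Rightarrow> (nat \<Rightarrow> 'b \<Rightarrow> bool) \<Rightarrow> bool" where
  "agree M D M' D' n e e' \<longleftrightarrow> (\<forall>v<n. \<forall>w<n.
     (\<exists>z. D z \<and> e v z \<and> e w z) = (\<exists>z. D' z \<and> e' v z \<and> e' w z) \<and>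
     (\<exists>z z'. D z \<and> D z' \<and> h_lt M z z' \<and> e v z \<and> e w z') =
       (\<exists>z z'. D' z \<and> D' z' \<and> h_lt M' z z' \<and> e' v z \<and> e' w z') \<and>
     (\<exists>z. D z \<and> D (h_suc M z) \<and> e v z \<and> e w (h_suc M z)) =
       (\<exists>z. D' z \<and> D' (h_suc M' z) \<and> e' v z \<and> e' w (h_suc M' z)) \<and>
     e v (h_zero M) = e' v (h_zero M'))"

text \<open>Abstracts from two kinds of similarity: equal types of initial segments, and common
  types of factorizations.\<close>

locale back_and_forth =
  fixes M :: "'a henkin" and D and M' :: "'b henkin" and D'
    and Sim :: "nat \<Rightarrow> nat \<Rightarrow> (nat \<Rightarrow> 'a \<Rightarrow> bool) \<Rightarrow> (nat \<Rightarrow> 'b \<Rightarrow> bool) \<Rightarrow> bool"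
  assumes nonempty: "h_sets M \<noteq> {}"
    and base: "Sim 0 n e e' \<Longrightarrow> agree M D M' D' n e e'"
    and forth_step: "Sim (Suc k) n e e' \<Longrightarrow> B \<in> h_sets M \<Longrightarrow>
      \<exists>B'\<in>h_sets M'. Sim k (Suc n) (case_nat B e) (case_nat B' e')"
    and back_step: "Sim (Suc k) n e e' \<Longrightarrow> B' \<in> h_sets M' \<Longrightarrow>
      \<exists>B\<in>h_sets M. Sim k (Suc n) (case_nat B e) (case_nat B' e')"
begin

text \<open>Play an arbitrary move and forget it: similarity of positive rank thus controls the
  atomic facts as well, which is needed for formulae shallower than \<open>k\<close>.\<close>

lemma Sim_agree: "Sim k n e e' \<Longrightarrow> agree M D M' D' n e e'"
proof (induction k arbitrary: n e e')
  case 0 then show ?case by (rule base)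
next
  case (Suc k)
  obtain B where "B \<in> h_sets M" using nonempty by blast
  with forth_step[OF Suc.prems] obtain B' where "Sim k (Suc n) (case_nat B e) (case_nat B' e')" by blast
  then have ag: "agree M D M' D' (Suc n) (case_nat B e) (case_nat B' e')" by (rule Suc.IH)
  show ?case unfolding agree_def
  proof (intro allI impI)
    fix v w assume "v < n" "w < n"
    with ag[unfolded agree_def, rule_format, of "Suc v" "Suc w"]
    show "(\<exists>z. D z \<and> e v z \<and> e w z) = (\<exists>z. D' z \<and> e' v z \<and> e' w z) \<and>
     (\<exists>z z'. D z \<and> D z' \<and> h_lt M z z' \<and> e v z \<and> e w z') =
       (\<exists>z z'. D' z \<and> D' z' \<and> h_lt M' z z' \<and> e' v z \<and> e' w z') \<and>
     (\<exists>z. D z \<and> D (h_suc M z) \<and> e v z \<and> e w (h_suc M z)) =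
       (\<exists>z. D' z \<and> D' (h_suc M' z) \<and> e' v z \<and> e' w (h_suc M' z)) \<and>
     e v (h_zero M) = e' v (h_zero M')" by simp
  qed
qed

lemma ssat_eq:
  assumes "Sim k n e e'" "depth \<phi> \<le> k" "\<forall>v\<in>free_ind \<phi>. f v < n" "\<forall>X\<in>free_pred \<phi>. g X < n"
  shows "ssat M D e f g \<phi> = ssat M' D' e' f g \<phi>"
  using assms
proof (induction \<phi> arbitrary: k n e e' f g)
  case (ExI \<phi>)
  obtain l where k: "k = Suc l" "depth \<phi> \<le> l" using ExI.prems(2) by (cases k) auto
  have free: "\<forall>v\<in>free_ind \<phi>. case_nat 0 (\<lambda>x. Suc (f x)) v < Suc n" "\<forall>X\<in>free_pred \<phi>. Suc (g X) < Suc n"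
    using ExI.prems(3,4) by (auto split: nat.split)
  define S where "S B \<longleftrightarrow> (\<exists>z. D z \<and> B z \<and> B z) \<and> \<not> (\<exists>z z'. D z \<and> D z' \<and> h_lt M z z' \<and> B z \<and> B z') \<and>
     ssat M D (case_nat B e) (case_nat 0 (\<lambda>x. Suc (f x))) (\<lambda>X. Suc (g X)) \<phi>" for B
  define S' where "S' B \<longleftrightarrow> (\<exists>z. D' z \<and> B z \<and> B z) \<and> \<not> (\<exists>z z'. D' z \<and> D' z' \<and> h_lt M' z z' \<and> B z \<and> B z') \<and>
     ssat M' D' (case_nat B e') (case_nat 0 (\<lambda>x. Suc (f x))) (\<lambda>X. Suc (g X)) \<phi>" for B
  have step: "S B = S' B'" if "Sim l (Suc n) (case_nat B e) (case_nat B' e')" for B B'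
    using ExI.IH[OF that k(2) free] Sim_agree[OF that, unfolded agree_def, rule_format, of 0 0]
    unfolding S_def S'_def by simp
  have "(\<exists>B\<in>h_sets M. S B) = (\<exists>B'\<in>h_sets M'. S' B')"
  proof
    assume "\<exists>B\<in>h_sets M. S B"
    then obtain B where B: "B \<in> h_sets M" "S B" ..
    obtain B' where "B' \<in> h_sets M'" "Sim l (Suc n) (case_nat B e) (case_nat B' e')"
      using forth_step[OF ExI.prems(1)[unfolded k(1)] B(1)] by blast
    with step B(2) show "\<exists>B'\<in>h_sets M'. S' B'" by blast
  next
    assume "\<exists>B'\<in>h_sets M'. S' B'"
    then obtain B' where B: "B' \<in> h_sets M'" "S' B'" ..
    obtain B where "B \<in> h_sets M" "Sim l (Suc n) (case_nat B e) (case_nat B' e')"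
      using back_step[OF ExI.prems(1)[unfolded k(1)] B(1)] by blast
    with step B(2) show "\<exists>B\<in>h_sets M. S B" by blast
  qed
  then show ?case unfolding S_def S'_def by (simp only: ssat.simps)
next
  case (ExP \<phi>)
  obtain l where k: "k = Suc l" "depth \<phi> \<le> l" using ExP.prems(2) by (cases k) auto
  have free: "\<forall>v\<in>free_ind \<phi>. Suc (f v) < Suc n" "\<forall>X\<in>free_pred \<phi>. case_nat 0 (\<lambda>X. Suc (g X)) X < Suc n"
    using ExP.prems(3,4) by (auto split: nat.split)
  define S where "S B \<longleftrightarrow> ssat M D (case_nat B e) (\<lambda>x. Suc (f x)) (case_nat 0 (\<lambda>X. Suc (g X))) \<phi>" for B
  define S' where "S' B \<longleftrightarrow> ssat M' D' (case_nat B e') (\<lambda>x. Suc (f x)) (case_nat 0 (\<lambda>X. Suc (g X))) \<phi>" for B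
  have step: "S B = S' B'" if "Sim l (Suc n) (case_nat B e) (case_nat B' e')" for B B'
    unfolding S_def S'_def by (rule ExP.IH[OF that k(2) free])
  have "(\<exists>B\<in>h_sets M. S B) = (\<exists>B'\<in>h_sets M'. S' B')"
    using forth_step[OF ExP.prems(1)[unfolded k(1)]] back_step[OF ExP.prems(1)[unfolded k(1)]] step by meson
  then show ?case unfolding S_def S'_def by (simp only: ssat.simps)
next
  case (Neg \<phi>)
  then show ?case using Neg.IH[OF Neg.prems(1)] by simp
next
  case (And \<phi> \<psi>)
  then show ?case using And.IH(1)[OF And.prems(1)] And.IH(2)[OF And.prems(1)] by simp
qed (use Sim_agree[unfolded agree_def] in \<open>simp; blast\<close>)+

end

section \<open>Satisfaction determined by types of segments and of factorizations\<close>

lemma tp_ssat: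
  assumes M: "henkin_model M" "h_lt M (h_zero M) y" and M': "henkin_model M'" "h_lt M' (h_zero M') y'"
    and "tp M k n e (h_zero M) y = tp M' k n e' (h_zero M') y'"
    and "depth \<phi> \<le> k" "\<forall>v\<in>free_ind \<phi>. f v < n" "\<forall>X\<in>free_pred \<phi>. g X < n"
  shows "ssat M (\<lambda>z. h_lt M z y) e f g \<phi> = ssat M' (\<lambda>z. h_lt M' z y') e' f g \<phi>"
proof -
  interpret M: henkin_model M by fact
  interpret M': henkin_model M' by fact
  interpret back_and_forth M "\<lambda>z. h_lt M z y" M' "\<lambda>z. h_lt M' z y'"
    "\<lambda>k n e e'. tp M k n e (h_zero M) y = tp M' k n e' (h_zero M') y'"
  proof
    show "h_sets M \<noteq> {}" by (rule M.sets_nonempty)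
  next
    fix n e e' assume eq: "tp M 0 n e (h_zero M) y = tp M' 0 n e' (h_zero M') y'"
    have 1: "(M.lt z y \<and> M.lt z' y \<and> M.lt z z' \<and> Q) \<longleftrightarrow> (M.lt z z' \<and> M.lt z' y \<and> Q)" for z z' Q
      by (auto intro: M.less_trans)
    have 2: "(M.lt z y \<and> M.lt (M.suc z) y \<and> Q) \<longleftrightarrow> (M.lt (M.suc z) y \<and> Q)" for z Q
      by (metis M.less_suc_iff M.less_trans M.order_refl)
    have 3: "(M'.lt z y' \<and> M'.lt z' y' \<and> M'.lt z z' \<and> Q) \<longleftrightarrow> (M'.lt z z' \<and> M'.lt z' y' \<and> Q)" for z z' Q
      by (auto intro: M'.less_trans)
    have 4: "(M'.lt z y' \<and> M'.lt (M'.suc z) y' \<and> Q) \<longleftrightarrow> (M'.lt (M'.suc z) y' \<and> Q)" for z Q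
      by (metis M'.less_suc_iff M'.less_trans M'.order_refl)
    have f: "seg_fact M e (h_zero M) y t v w = seg_fact M' e' (h_zero M') y' t v w" if "t < 5" "v < n" "w < n" for t v w
      using eq that unfolding tp_0_eq_iff by blast
    show "agree M (\<lambda>z. h_lt M z y) M' (\<lambda>z. h_lt M' z y') n e e'"
      unfolding agree_def 1 2 3 4 using f[of 0] f[of 1] f[of 2] f[of 3] by (simp add: seg_fact_def)
  next
    fix k n e e' B assume "tp M (Suc k) n e (h_zero M) y = tp M' (Suc k) n e' (h_zero M') y'" "B \<in> h_sets M"
    then show "\<exists>B'\<in>h_sets M'. tp M k (Suc n) (case_nat B e) (h_zero M) y = tp M' k (Suc n) (case_nat B' e') (h_zero M') y'"
      by (rule tp_Suc_forth)
  next
    fix k n e e' B' assume "tp M (Suc k) n e (h_zero M) y = tp M' (Suc k) n e' (h_zero M') y'" "B' \<in> h_sets M'"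
    then show "\<exists>B\<in>h_sets M. tp M k (Suc n) (case_nat B e) (h_zero M) y = tp M' k (Suc n) (case_nat B' e') (h_zero M') y'"
      unfolding tp_Suc_eq_iff by blast
  qed
  show ?thesis by (rule ssat_eq[OF assms(5-8)])
qed

text \<open>Every atomic fact is visible below some cut, and the initial segments ending at cuts
  have the same type \<open>s\<close> in both models. The auxiliary claim \<open>one\<close> is
  polymorphic in the models so that it can be used in both directions.\<close>

lemma factor_ssat:
  assumes M: "henkin_model M" and M': "henkin_model M'"
    and e: "range e \<subseteq> h_sets M" and e': "range e' \<subseteq> h_sets M'"
    and "factor M k n e H s t" "factor M' k n e' H' s t"
    and "depth \<phi> \<le> k" "\<forall>v\<in>free_ind \<phi>. f v < n" "\<forall>X\<in>free_pred \<phi>. g X < n"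
  shows "ssat M (\<lambda>_. True) e f g \<phi> = ssat M' (\<lambda>_. True) e' f g \<phi>"
proof -
  have one: "(\<exists>z. e v z \<and> e w z) \<longrightarrow> (\<exists>z. e' v z \<and> e' w z)"
    "(\<exists>z z'. h_lt M z z' \<and> e v z \<and> e w z') \<longrightarrow> (\<exists>z z'. h_lt M' z z' \<and> e' v z \<and> e' w z')"
    "(\<exists>z. e v z \<and> e w (h_suc M z)) \<longrightarrow> (\<exists>z. e' v z \<and> e' w (h_suc M' z))"
    "e v (h_zero M) \<longrightarrow> e' v (h_zero M')"
    if M: "henkin_model M" and vw: "v < n" "w < n" and f: "factor M 0 n e H s t" and f': "factor M' 0 n e' H' s t"
    for M :: "'x henkin" and M' :: "'y henkin" and n e e' H H' s t v w
  proof -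
    interpret M: henkin_model M by fact
    obtain h' where h': "H' h'" using f' unfolding factor_def by blast
    have tr: "seg_fact M' e' (h_zero M') h' t v w" if "H h" "seg_fact M e M.zr h t v w" "t < 5" for h t
    proof -
      have "tp M 0 n e M.zr h = tp M' 0 n e' (h_zero M') h'"
        using f f' that(1) h' unfolding factor_def by metis
      then show ?thesis using that vw unfolding tp_0_eq_iff by blast
    qed
    have above: "\<exists>h. H h \<and> M.lt b h" for b using f unfolding factor_def by blast
    show "(\<exists>z. e v z \<and> e w z) \<longrightarrow> (\<exists>z. e' v z \<and> e' w z)"
    proof safe
      fix z assume "e v z" "e w z"
      obtain h where h: "H h" "M.lt z h" using above by blast
      with \<open>e v z\<close> \<open>e w z\<close> have "seg_fact M e M.zr h 0 v w" unfolding seg_fact_def by auto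
      from tr[OF h(1) this] show "\<exists>z. e' v z \<and> e' w z" unfolding seg_fact_def by auto
    qed
    show "(\<exists>z z'. h_lt M z z' \<and> e v z \<and> e w z') \<longrightarrow> (\<exists>z z'. h_lt M' z z' \<and> e' v z \<and> e' w z')"
    proof safe
      fix z z' assume "M.lt z z'" "e v z" "e w z'"
      obtain h where h: "H h" "M.lt z' h" using above by blast
      with \<open>M.lt z z'\<close> \<open>e v z\<close> \<open>e w z'\<close> have "seg_fact M e M.zr h 1 v w" unfolding seg_fact_def by auto
      from tr[OF h(1) this] show "\<exists>z z'. h_lt M' z z' \<and> e' v z \<and> e' w z'" unfolding seg_fact_def by auto
    qed
    show "(\<exists>z. e v z \<and> e w (h_suc M z)) \<longrightarrow> (\<exists>z. e' v z \<and> e' w (h_suc M' z))"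
    proof safe
      fix z assume "e v z" "e w (M.suc z)"
      obtain h where h: "H h" "M.lt (M.suc z) h" using above by blast
      with \<open>e v z\<close> \<open>e w (M.suc z)\<close> have "seg_fact M e M.zr h 2 v w" unfolding seg_fact_def by auto
      from tr[OF h(1) this] show "\<exists>z. e' v z \<and> e' w (h_suc M' z)" unfolding seg_fact_def by auto
    qed
    show "e v (h_zero M) \<longrightarrow> e' v (h_zero M')"
    proof
      assume "e v (h_zero M)"
      moreover obtain h where h: "H h" using above by blast
      ultimately have "seg_fact M e M.zr h 3 v w" unfolding seg_fact_def by auto
      from tr[OF h(1) this] show "e' v (h_zero M')" unfolding seg_fact_def by auto
    qed
  qed
  interpret back_and_forth M "\<lambda>_. True" M' "\<lambda>_. True"
    "\<lambda>k n e e'. range e \<subseteq> h_sets M \<and> range e' \<subseteq> h_sets M' \<and>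
       (\<exists>H H' s t. factor M k n e H s t \<and> factor M' k n e' H' s t)"
  proof
    show "h_sets M \<noteq> {}" using henkin_model.sets_nonempty[OF M] .
  next
    fix n e e' assume "range e \<subseteq> h_sets M \<and> range e' \<subseteq> h_sets M' \<and>
       (\<exists>H H' s t. factor M 0 n e H s t \<and> factor M' 0 n e' H' s t)"
    then obtain H H' s t where f: "factor M 0 n e H s t" "factor M' 0 n e' H' s t" by blast
    have eqs: "(\<exists>z. e v z \<and> e w z) = (\<exists>z. e' v z \<and> e' w z)"
      "(\<exists>z z'. h_lt M z z' \<and> e v z \<and> e w z') = (\<exists>z z'. h_lt M' z z' \<and> e' v z \<and> e' w z')"
      "(\<exists>z. e v z \<and> e w (h_suc M z)) = (\<exists>z. e' v z \<and> e' w (h_suc M' z))"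
      "e v (h_zero M) = e' v (h_zero M')" if vw: "v < n" "w < n" for v w
      using one[OF M vw f] one[OF M' vw f(2,1)] by argo+
    show "agree M (\<lambda>_. True) M' (\<lambda>_. True) n e e'"
      unfolding agree_def simp_thms by (intro allI impI conjI eqs)
  next
    fix k n e e' B assume "range e \<subseteq> h_sets M \<and> range e' \<subseteq> h_sets M' \<and>
       (\<exists>H H' s t. factor M (Suc k) n e H s t \<and> factor M' (Suc k) n e' H' s t)" "B \<in> h_sets M"
    then show "\<exists>B'\<in>h_sets M'. range (case_nat B e) \<subseteq> h_sets M \<and> range (case_nat B' e') \<subseteq> h_sets M' \<and>
       (\<exists>H H' s t. factor M k (Suc n) (case_nat B e) H s t \<and> factor M' k (Suc n) (case_nat B' e') H' s t)"
      using factor_forth[OF M M'] unfolding range_case_nat by meson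
  next
    fix k n e e' B' assume "range e \<subseteq> h_sets M \<and> range e' \<subseteq> h_sets M' \<and>
       (\<exists>H H' s t. factor M (Suc k) n e H s t \<and> factor M' (Suc k) n e' H' s t)" "B' \<in> h_sets M'"
    then show "\<exists>B\<in>h_sets M. range (case_nat B e) \<subseteq> h_sets M \<and> range (case_nat B' e') \<subseteq> h_sets M' \<and>
       (\<exists>H H' s t. factor M k (Suc n) (case_nat B e) H s t \<and> factor M' k (Suc n) (case_nat B' e') H' s t)"
      using factor_forth[OF M' M] unfolding range_case_nat by meson
  qed
  have "range e \<subseteq> h_sets M \<and> range e' \<subseteq> h_sets M' \<and>
       (\<exists>H H' s t. factor M k n e H s t \<and> factor M' k n e' H' s t)" using assms(3-6) by blast
  from ssat_eq[OF this assms(7-9)] show ?thesis .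
qed

lemma ssat_hsat:
  assumes "henkin_model M"
    and "\<forall>v\<in>free_ind \<phi>. \<forall>z. e (f v) z \<longleftrightarrow> z = i v" "\<forall>X. e (g X) = P X" "range P \<subseteq> h_sets M"
  shows "ssat M (\<lambda>_. True) e f g \<phi> = hsat M i P \<phi>"
  using assms(2-4)
proof (induction \<phi> arbitrary: e f g i P)
  case (ExI \<phi>)
  interpret henkin_model M by fact
  have IH: "ssat M (\<lambda>_. True) (case_nat B e) (case_nat 0 (\<lambda>x. Suc (f x))) (\<lambda>X. Suc (g X)) \<phi> = hsat M (case_nat a i) P \<phi>"
    if "\<forall>z. B z \<longleftrightarrow> z = a" for B a
    using ExI.prems that by (intro ExI.IH) (auto split: nat.split)
  have single: "\<exists>a. \<forall>z. B z \<longleftrightarrow> z = a"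
    if "\<exists>z. B z \<and> B z" "\<not> (\<exists>z z'. h_lt M z z' \<and> B z \<and> B z')" for B
    using that neq_iff by metis
  have "definable M (\<lambda>i P. i 0 = i 1)" by (intro definable_intros)
  from definable_set[OF this ExI.prems(3), of "\<lambda>_. _"] have set: "(\<lambda>z. z = a) \<in> h_sets M" for a by simp
  show ?case
  proof
    assume "ssat M (\<lambda>_. True) e f g (ExI \<phi>)"
    then obtain B where B: "\<exists>z. B z \<and> B z" "\<not> (\<exists>z z'. h_lt M z z' \<and> B z \<and> B z')"
      "ssat M (\<lambda>_. True) (case_nat B e) (case_nat 0 (\<lambda>x. Suc (f x))) (\<lambda>X. Suc (g X)) \<phi>" by auto
    with single[OF B(1,2)] IH show "hsat M i P (ExI \<phi>)" by auto
  next
    assume "hsat M i P (ExI \<phi>)"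
    then obtain a where "hsat M (case_nat a i) P \<phi>" by auto
    then show "ssat M (\<lambda>_. True) e f g (ExI \<phi>)"
      using IH[of "\<lambda>z. z = a" a] set[of a] by (auto intro!: bexI[of _ "\<lambda>z. z = a"])
  qed
next
  case (ExP \<phi>)
  have "ssat M (\<lambda>_. True) (case_nat B e) (\<lambda>x. Suc (f x)) (case_nat 0 (\<lambda>X. Suc (g X))) \<phi> = hsat M i (case_nat B P) \<phi>"
    if "B \<in> h_sets M" for B
    using ExP.prems that by (intro ExP.IH) (auto split: nat.split)
  then show ?case by simp
next
  case (Neg \<phi>) then show ?case using Neg.IH[of e f i g P] by simp
next
  case (And \<phi> \<psi>)
  have "ssat M (\<lambda>_. True) e f g \<phi> = hsat M i P \<phi>" by (rule And.IH(1)) (use And.prems in auto)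
  moreover have "ssat M (\<lambda>_. True) e f g \<psi> = hsat M i P \<psi>" by (rule And.IH(2)) (use And.prems in auto)
  ultimately show ?case by simp
next
  case (Le x y)
  interpret henkin_model M by fact
  show ?case using Le by (auto simp: le_less)
qed (auto)

lemma finite_free: "finite (free_ind \<phi>)" "finite (free_pred \<phi>)"
proof -
  have "finite {x. Suc x \<in> A}" if "finite A" for A
    using finite_vimageI[OF that, of Suc] by (simp add: vimage_def)
  then show "finite (free_ind \<phi>)" "finite (free_pred \<phi>)" by (induction \<phi>) auto
qed

lemma free_ind_relativize: "free_ind \<phi> \<subseteq> free_ind (relativize \<theta> \<phi>)"
  by (induction \<phi> arbitrary: \<theta>) (simp_all, blast+)

text \<open>Relativizing to the positions up to \<open>x\<close> is the same as evaluating on the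
  initial segment that ends after \<open>i x\<close>. Together with \<open>tp_ssat\<close> this
  makes the truth of a bounded formula a matter of the type of that segment.\<close>

lemma ssat_relativize:
  assumes "\<forall>v\<in>free_ind \<phi>. i v \<le> i x \<and> (\<forall>z. e (f v) z \<longleftrightarrow> z = i v)" "\<forall>X. e (g X) = P X"
  shows "ssat std (\<lambda>z. z < Suc (i x)) e f g \<phi> = sat i P (relativize (Le 0 (Suc x)) \<phi>)"
  using assms
proof (induction \<phi> arbitrary: e f g i P x)
  case (ExI \<phi>)
  have IH: "ssat std (\<lambda>z. z < Suc (i x)) (case_nat (\<lambda>z. z = a) e) (case_nat 0 (\<lambda>x. Suc (f x))) (\<lambda>X. Suc (g X)) \<phi>
      = sat (case_nat a i) P (relativize (Le 0 (Suc (Suc x))) \<phi>)" if "a \<le> i x" for a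
  proof -
    let ?e = "case_nat (\<lambda>z. z = a) e" and ?f = "case_nat 0 (\<lambda>x. Suc (f x))" and ?g = "\<lambda>X. Suc (g X)"
    have "\<forall>v\<in>free_ind \<phi>. case_nat a i v \<le> case_nat a i (Suc x) \<and> (\<forall>z. ?e (?f v) z \<longleftrightarrow> z = case_nat a i v)"
      using ExI.prems(1) that by (auto split: nat.split)
    moreover have "\<forall>X. ?e (?g X) = P X" using ExI.prems(2) by simp
    ultimately show ?thesis using ExI.IH[of "case_nat a i" "Suc x" ?e ?f ?g P] by simp
  qed
  \<comment> \<open>A set representing an individual is a singleton only as far as the segment
    reaches; by locality its values beyond \<open>i x\<close> can be replaced by those of a true
    singleton.\<close>
  have loc: "ssat std (\<lambda>z. z < Suc (i x)) (case_nat B e) f' g' \<phi> = ssat std (\<lambda>z. z < Suc (i x)) (case_nat C e) f' g' \<phi>"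
    if "\<forall>z\<le>i x. B z = C z" for B C f' g'
  proof -
    obtain n where n: "\<forall>v\<in>f' ` free_ind \<phi> \<union> g' ` free_pred \<phi>. v < n"
      using finite_nat_set_iff_bounded[of "f' ` free_ind \<phi> \<union> g' ` free_pred \<phi>"] finite_free by blast
    have "tp std (depth \<phi>) n (case_nat B e) (h_zero std) (Suc (i x)) = tp std (depth \<phi>) n (case_nat C e) (h_zero std) (Suc (i x))"
      by (rule tp_local[OF henkin_model_std]) (use that in \<open>auto split: nat.split\<close>)
    from tp_ssat[OF henkin_model_std _ henkin_model_std _ this order_refl, of f' g'] n show ?thesis by simp
  qed
  show ?case
  proof
    assume "ssat std (\<lambda>z. z < Suc (i x)) e f g (ExI \<phi>)"
    then obtain B a where B: "\<not> (\<exists>z z'. z \<le> i x \<and> z' \<le> i x \<and> z < z' \<and> B z \<and> B z')" "a \<le> i x" "B a"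
      "ssat std (\<lambda>z. z < Suc (i x)) (case_nat B e) (case_nat 0 (\<lambda>x. Suc (f x))) (\<lambda>X. Suc (g X)) \<phi>"
      by (auto simp: less_Suc_eq_le)
    have "\<forall>z\<le>i x. B z \<longleftrightarrow> z = a" using B(1-3) by (metis nat_neq_iff)
    then show "sat i P (relativize (Le 0 (Suc x)) (ExI \<phi>))"
      using B(4) IH[OF B(2)] loc[of B "\<lambda>z. z = a"] B(2) by auto
  next
    assume "sat i P (relativize (Le 0 (Suc x)) (ExI \<phi>))"
    then obtain a where "a \<le> i x" "sat (case_nat a i) P (relativize (Le 0 (Suc (Suc x))) \<phi>)" by auto
    then show "ssat std (\<lambda>z. z < Suc (i x)) e f g (ExI \<phi>)"
      using IH[of a] by (auto intro!: exI[of _ "\<lambda>z. z = a"])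
  qed
next
  case (ExP \<phi>)
  have "ssat std (\<lambda>z. z < Suc (i x)) (case_nat B e) (\<lambda>x. Suc (f x)) (case_nat 0 (\<lambda>X. Suc (g X))) \<phi> =
      sat i (case_nat B P) (relativize (Le 0 (Suc x)) \<phi>)" for B
    using ExP.prems by (intro ExP.IH) (auto split: nat.split)
  then show ?case by simp
next
  case (Neg \<phi>) then show ?case using Neg.IH[of i x e f g P] by simp
next
  case (And \<phi> \<psi>)
  have "ssat std (\<lambda>z. z < Suc (i x)) e f g \<phi> = sat i P (relativize (Le 0 (Suc x)) \<phi>)"
    by (rule And.IH(1)) (use And.prems in auto)
  moreover have "ssat std (\<lambda>z. z < Suc (i x)) e f g \<psi> = sat i P (relativize (Le 0 (Suc x)) \<psi>)"
    by (rule And.IH(2)) (use And.prems in auto)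
  ultimately show ?case by simp
next
  case (Le y z) then show ?case by (auto simp: le_less)
qed (auto)


section \<open>Transfer to the standard model\<close>

text \<open>Induction on \<open>y\<close> in the model. It is legitimate although the property
  speaks about the standard model: \<open>R\<close> is merely a finite set of numbers, so membership
  in it is definable.\<close>

lemma (in henkin_model) type_realized:
  assumes e: "range e \<subseteq> h_sets M" and "x \<prec> y"
  shows "\<exists>e' m. 0 < m \<and> tp M k n e x y = tp std k n e' 0 m"
proof -
  define R where "R = {c \<in> types k n. \<exists>e' m. 0 < m \<and> c = tp std k n e' 0 m}"
  have R_iff: "tp M k n e x y \<in> R \<longleftrightarrow> (\<exists>e' m. 0 < m \<and> tp M k n e x y = tp std k n e' 0 m)" for y
    unfolding R_def using tp_in_types[of M k n e x y] by simp
  have "finite R" unfolding R_def using finite_types by simp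
  then have "definable M (\<lambda>i P. i 1 \<prec> i 0 \<longrightarrow> (\<exists>c\<in>R. tp M k n P (i 1) (i 0) = c))"
    by (intro definable_intros definable_finite_ex definable_tp_plain)
  from definable_set[OF this e, of "\<lambda>_. x"] have "(\<lambda>y. x \<prec> y \<longrightarrow> tp M k n e x y \<in> R) \<in> h_sets M" by simp
  then have "x \<prec> y \<longrightarrow> tp M k n e x y \<in> R"
  proof (rule induct)
    show "x \<prec> zr \<longrightarrow> tp M k n e x zr \<in> R" by simp
  next
    fix y assume IH: "x \<prec> y \<longrightarrow> tp M k n e x y \<in> R"
    show "x \<prec> suc y \<longrightarrow> tp M k n e x (suc y) \<in> R"
    proof
      assume "x \<prec> suc y"
      then consider "x = y" | "x \<prec> y" by (auto simp: le_less)
      then show "tp M k n e x (suc y) \<in> R"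
      proof cases
        case 1
        have "tp M k n e y (suc y) = tp std k n (\<lambda>v _. e v y) 0 (h_suc std 0)"
          by (rule tp_letter[OF henkin_model_axioms henkin_model_std]) simp
        then show ?thesis unfolding R_iff
          by (intro exI[of _ "\<lambda>v _. e v y"] exI[of _ 1]) (simp add: 1)
      next
        case 2
        with IH obtain e' m where m: "0 < m" "tp M k n e x y = tp std k n e' 0 m" unfolding R_iff by blast
        \<comment> \<open>The standard word is prolonged at position \<open>m\<close> by a copy of
          the letter that the model has at \<open>y\<close>.\<close>
        let ?e = "\<lambda>v z. if z < m then e' v z else e v y"
        have "tp std k n ?e 0 m = tp std k n e' 0 m"
          by (rule tp_local[OF henkin_model_std]) (use m in auto)
        with m(2) have eq1: "tp M k n e x y = tp std k n ?e 0 m" by (simp only:)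
        have eq2: "tp M k n e y (suc y) = tp std k n ?e m (h_suc std m)"
          by (rule tp_letter[OF henkin_model_axioms henkin_model_std]) simp
        have lts: "y \<prec> suc y" "h_lt std 0 m" "h_lt std m (h_suc std m)" using m(1) by simp_all
        from tp_append[OF henkin_model_axioms 2 lts(1) henkin_model_std lts(2,3) eq1 eq2]
        have "0 < Suc m \<and> tp M k n e x (suc y) = tp std k n ?e 0 (Suc m)" unfolding std_simps by (simp only: zero_less_Suc)
        then show ?thesis unfolding R_iff by (intro exI)
      qed
    qed
  qed
  with assms(2) show ?thesis unfolding R_iff by blast
qed

lemma factor_std:
  assumes M: "henkin_model M" and e: "range e \<subseteq> h_sets M" and f: "factor M k n e H s t"
  shows "\<exists>e' H'. factor std k n e' H' s t"
proof -
  interpret henkin_model M by fact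
  interpret std: henkin_model std by (rule henkin_model_std)
  obtain x where x: "H x" using f unfolding factor_def by blast
  obtain y where y: "H y" "x \<prec> y" using f unfolding factor_def by blast
  obtain z where z: "H z" "y \<prec> z" using f unfolding factor_def by blast
  have x0: "zr \<prec> x" using f x unfolding factor_def by blast
  have tps: "tp M k n e zr x = s" "tp M k n e zr y = s" "tp M k n e x y = t"
    "tp M k n e y z = t" "tp M k n e x z = t"
    using f x y z less_trans[OF y(2) z(2)] unfolding factor_def by blast+
  obtain u m where u: "0 < m" "s = tp std k n u 0 m" using type_realized[OF e x0, of k n] tps by auto
  obtain v l where v: "0 < l" "t = tp std k n v 0 l" using type_realized[OF e y(2), of k n] tps by auto
  \<comment> \<open>The word \<open>u\<close> of length \<open>m\<close>, followed by endless
    repetitions of \<open>v\<close> of length \<open>l\<close>; each block between neighbouring cuts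
    is a shifted copy of \<open>v\<close>.\<close>
  define e' where "e' w z = (if z < m then u w z else v w ((z - m) mod l))" for w z
  define H' where "H' z \<longleftrightarrow> (\<exists>j. z = m + j * l)" for z
  have "factor std k n e' H' s t"
  proof (rule std.factor_of_segments)
    show "range e' \<subseteq> h_sets std" "H' \<in> h_sets std" by simp_all
    show "\<forall>b. \<exists>h. H' h \<and> h_lt std b h"
    proof
      fix b
      have "Suc b * 1 \<le> Suc b * l" using v(1) by (intro mult_le_mono2) simp
      then have "Suc b \<le> Suc b * l" by (simp only: mult_1_right)
      then have "b < m + Suc b * l" by (rule Suc_le_lessD[OF trans_le_add2])
      then show "\<exists>h. H' h \<and> h_lt std b h" unfolding H'_def std_simps by blast
    qed
    show "h_lt std (h_zero std) h" if "H' h" for h using that u(1) unfolding H'_def by auto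
  next
    fix x y assume seg: "std.segment H' x y"
    then have xy: "x < y" "x = 0 \<or> H' x" "H' y" "\<forall>z. H' z \<longrightarrow> x < z \<longrightarrow> y \<le> z"
      unfolding std.segment_def by auto
    show "tp std k n e' x y = (if x = h_zero std then s else t)"
    proof (cases "x = 0")
      case True
      have "H' m" unfolding H'_def by (rule exI[of _ 0]) simp
      then have "y \<le> m" using xy(4) True u(1) by auto
      then have "y = m" using xy(3) unfolding H'_def by auto
      moreover have "tp std k n e' 0 m = tp std k n u 0 m"
        by (rule tp_local[OF henkin_model_std]) (use u in \<open>auto simp: e'_def\<close>)
      ultimately show ?thesis using u True by simp
    next
      case False
      then obtain j where j: "x = m + j * l" using xy(2) unfolding H'_def by blast
      obtain j' where j': "y = m + j' * l" using xy(3) unfolding H'_def by blast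
      have "H' (m + Suc j * l)" unfolding H'_def by blast
      then have "y \<le> m + Suc j * l" using xy(4) j v(1) by auto
      moreover have "j < j'" using xy(1) j j' by simp
      then have "Suc j * l \<le> j' * l" by (intro mult_le_mono1) simp
      ultimately have "y = l + x" using j j' by simp
      moreover have "tp std k n e' (0 + x) (l + x) = tp std k n v 0 l"
        by (rule tp_shift) (use v j in \<open>auto simp: e'_def\<close>)
      ultimately show ?thesis using v False by simp
    qed
  next
    \<comment> \<open>The absorption laws hold in \<open>M\<close> because of its cuts
      \<open>x\<close>, \<open>y\<close>, \<open>z\<close>, and \<open>tp_append\<close> transports
      them to arbitrary standard segments of these types.\<close>
    fix x' y' z' assume lt: "h_lt std x' y'" "h_lt std y' z'"
    { assume "tp std k n e' x' y' = s" "tp std k n e' y' z' = t"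
      then show "tp std k n e' x' z' = s"
        using tp_append[OF henkin_model_std lt M x0 y(2), of k n e' e] tps by simp }
    { assume "tp std k n e' x' y' = t" "tp std k n e' y' z' = t"
      then show "tp std k n e' x' z' = t"
        using tp_append[OF henkin_model_std lt M y(2) z(2), of k n e' e] tps by simp }
  qed
  then show ?thesis by blast
qed

text \<open>Ramsey starts from the set of all positions as possible cuts, with types of the
  quantifier depth of \<open>\<phi>\<close>. Predicate values are transferred along with the truth
  of \<open>\<phi>\<close>; nonstandard individuals have no such counterpart, whence
  \<open>free_ind \<phi> = {}\<close>.\<close>

theorem transfer_std:
  assumes M: "henkin_model M" and P: "range P \<subseteq> h_sets M" and "hsat M i P \<phi>" "free_ind \<phi> = {}"
  shows "\<exists>P'. \<forall>i. sat i P' \<phi>"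
proof -
  interpret henkin_model M by fact
  obtain n where n: "\<forall>X\<in>free_pred \<phi>. X < n"
    using finite_nat_set_iff_bounded[of "free_pred \<phi>"] finite_free by blast
  have "\<exists>h. True \<and> b \<prec> h" for b by (rule exI[of _ "suc b"]) simp
  from ramsey[OF P const_set[of True], of "depth \<phi>" n] this
  obtain H s t where f: "factor M (depth \<phi>) n P H s t" by blast
  from factor_std[OF M P f] obtain e' H' where f': "factor std (depth \<phi>) n e' H' s t" by blast
  have eq: "ssat M (\<lambda>_. True) P id id \<phi> = ssat std (\<lambda>_. True) e' id id \<phi>"
    by (rule factor_ssat[OF M henkin_model_std P _ f f']) (use assms(4) n in simp_all)
  have "ssat M (\<lambda>_. True) P id id \<phi> = hsat M i P \<phi>"
    by (rule ssat_hsat[OF M]) (use assms P in simp_all)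
  moreover have "ssat std (\<lambda>_. True) e' id id \<phi> = hsat std i e' \<phi>" for i
    by (rule ssat_hsat[OF henkin_model_std]) (use assms in simp_all)
  ultimately show ?thesis using eq assms(3) by auto
qed

section \<open>A refutation calculus\<close>

lemma up_comp: "up r \<circ> up r' = up (r \<circ> r')" "up r \<circ> Suc = Suc \<circ> r"
  by (auto simp: up_def fun_eq_iff split: nat.split)

lemma case_nat_comp: "case_nat y f \<circ> Suc = f" "case_nat y f \<circ> up r = case_nat y (f \<circ> r)"
  by (auto simp: up_def fun_eq_iff split: nat.split)

lemma comp_case_nat: "f \<circ> case_nat y g = case_nat (f y) (f \<circ> g)"
  by (auto simp: fun_eq_iff split: nat.split)

lemma ren_ren: "ren r R (ren r' R' \<phi>) = ren (r \<circ> r') (R \<circ> R') \<phi>"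
  by (induction \<phi> arbitrary: r R r' R') (simp_all add: up_comp)

lemma ren_id [simp]: "ren id id \<phi> = \<phi>"
  by (induction \<phi>) simp_all

lemma ren_cong:
  "\<forall>x\<in>free_ind \<phi>. r x = r' x \<Longrightarrow> \<forall>X\<in>free_pred \<phi>. R X = R' X \<Longrightarrow> ren r R \<phi> = ren r' R' \<phi>"
proof (induction \<phi> arbitrary: r R r' R')
  case (ExI \<phi>) then show ?case by (auto intro!: ExI.IH simp: up_def split: nat.split)
next
  case (ExP \<phi>) then show ?case by (auto intro!: ExP.IH simp: up_def split: nat.split)
next
  case (And \<phi> \<psi>) then show ?case using And.IH[of r r' R R'] by simp
qed simp_all

lemma ren_inst_ind: "ren r R (inst_ind y \<phi>) = inst_ind (r y) (ren (up r) R \<phi>)"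
  unfolding inst_ind_def ren_ren by (rule arg_cong2[of _ _ _ _ "\<lambda>a b. ren a b \<phi>"])
    (auto simp: fun_eq_iff up_def split: nat.split)

lemma ren_inst_pred: "ren r R (inst_pred Y \<phi>) = inst_pred (R Y) (ren r (up R) \<phi>)"
  unfolding inst_pred_def ren_ren by (rule arg_cong2[of _ _ _ _ "\<lambda>a b. ren a b \<phi>"])
    (auto simp: fun_eq_iff up_def split: nat.split)

lemma ren_lift_ind: "ren (up r) R (lift_ind \<phi>) = lift_ind (ren r R \<phi>)"
  by (simp add: ren_ren up_comp)

lemma ren_lift_pred: "ren r (up R) (lift_pred \<phi>) = lift_pred (ren r R \<phi>)"
  by (simp add: ren_ren up_comp)

lemma sat_ren: "sat i P (ren r R \<phi>) = sat (i \<circ> r) (P \<circ> R) \<phi>"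
  using hsat_ren[of std] by simp

abbreviation fm_all :: "fm \<Rightarrow> fm" where "fm_all \<phi> \<equiv> Neg (ExI (Neg \<phi>))"
abbreviation fm_iff :: "fm \<Rightarrow> fm \<Rightarrow> fm" where
  "fm_iff \<phi> \<psi> \<equiv> And (Neg (And \<phi> (Neg \<psi>))) (Neg (And \<psi> (Neg \<phi>)))"

definition compr_ax :: "fm \<Rightarrow> fm" where
  "compr_ax \<psi> = ExP (fm_all (fm_iff (Mem 0 0) (lift_pred \<psi>)))"

text \<open>Induction for a predicate variable only, in the negated form without a counterexample;
  \<open>compr_ax\<close> extends it to all formulae.\<close>

definition ind_ax :: "nat \<Rightarrow> fm" where
  "ind_ax X = Neg (And (Neg (ExI (And (Zero 0) (Neg (Mem 0 X)))))
     (And (Neg (ExI (ExI (And (Succ (Suc 0) 0) (And (Mem (Suc 0) X) (Neg (Mem 0 X)))))))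
       (ExI (Neg (Mem 0 X)))))"

inductive ax_step :: "fm list \<Rightarrow> fm \<Rightarrow> bool" where
  "ax_step [\<phi>, \<psi>] (And \<phi> \<psi>)"
| "ax_step [And \<phi> \<psi>] \<phi>"
| "ax_step [And \<phi> \<psi>] \<psi>"
| "ax_step [\<phi>, Neg \<phi>] Fls"
| "ax_step [] Tru"
| "ax_step [inst_ind y \<phi>] (ExI \<phi>)"
| "ax_step [inst_pred Y \<phi>] (ExP \<phi>)"
| "ax_step [] (Eq x x)"
| "ax_step [inst_ind y \<phi>, Eq y z] (inst_ind z \<phi>)"
| "ax_step [] (Le x x)"
| "ax_step [Le x y, Le y z] (Le x z)"
| "ax_step [Le x y, Le y x] (Eq x y)"
| "ax_step [] (ExI (Zero 0))"
| "ax_step [Zero x, Zero y] (Eq x y)"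
| "ax_step [] (ExI (Succ (Suc x) 0))"
| "ax_step [Succ y x, Succ z x] (Eq y z)"
| "ax_step [Succ x y, Succ x z] (Eq y z)"
| "ax_step [Succ x y, Zero y] Fls"
| "ax_step [Succ x y] (Le x y)"
| "ax_step [Succ y y', Le x y', Neg (Eq x y')] (Le x y)"
| "ax_step [] (compr_ax \<psi>)"
| "ax_step [] (ind_ax X)"

text \<open>Natural deduction with the goal fixed to \<open>Fls\<close>. The rule
  \<open>split\<close> supplies classical logic, and the witness rules express freshness by lifting,
  as SMSO does.\<close>

inductive refutable :: "fm list \<Rightarrow> bool" where
  falsity: "Fls \<in> set \<Gamma> \<Longrightarrow> refutable \<Gamma>"
| step: "ax_step ps \<phi> \<Longrightarrow> set ps \<subseteq> set \<Gamma> \<Longrightarrow> refutable (\<phi> # \<Gamma>) \<Longrightarrow> refutable \<Gamma>"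
| split: "refutable (\<phi> # \<Gamma>) \<Longrightarrow> refutable (Neg \<phi> # \<Gamma>) \<Longrightarrow> refutable \<Gamma>"
| witness_ind: "ExI \<phi> \<in> set \<Gamma> \<Longrightarrow> refutable (\<phi> # map lift_ind \<Gamma>) \<Longrightarrow> refutable \<Gamma>"
| witness_pred: "ExP \<phi> \<in> set \<Gamma> \<Longrightarrow> refutable (\<phi> # map lift_pred \<Gamma>) \<Longrightarrow> refutable \<Gamma>"

lemma ren_compr_ax: "ren r R (compr_ax \<psi>) = compr_ax (ren (up r) R \<psi>)"
  by (simp add: compr_ax_def ren_lift_pred)

lemma ren_ind_ax: "ren r R (ind_ax X) = ind_ax (R X)"
  by (simp add: ind_ax_def)

lemma ax_step_ren: "ax_step ps \<phi> \<Longrightarrow> ax_step (map (ren r R) ps) (ren r R \<phi>)"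
  by (induction rule: ax_step.induct)
    (auto simp: ren_inst_ind ren_inst_pred ren_compr_ax ren_ind_ax intro: ax_step.intros)

lemma refutable_ren: "refutable \<Gamma> \<Longrightarrow> refutable (map (ren r R) \<Gamma>)"
proof (induction arbitrary: r R rule: refutable.induct)
  case (falsity \<Gamma>)
  then show ?case by (rule_tac refutable.falsity) force
next
  case (step ps \<phi> \<Gamma>)
  show ?case by (rule refutable.step[OF ax_step_ren[OF step(1), of r R]]) (use step in auto)
next
  case (split \<phi> \<Gamma>)
  show ?case by (rule refutable.split[of "ren r R \<phi>"]) (use split.IH[of r R] in auto)
next
  case (witness_ind \<phi> \<Gamma>)
  have "ExI (ren (up r) R \<phi>) \<in> set (map (ren r R) \<Gamma>)"
    using imageI[OF witness_ind.hyps(1), of "ren r R"] by simp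
  moreover have "map (ren (up r) R) (\<phi> # map lift_ind \<Gamma>) = ren (up r) R \<phi> # map lift_ind (map (ren r R) \<Gamma>)"
    by (simp add: ren_lift_ind)
  ultimately show ?case using refutable.witness_ind witness_ind.IH[of "up r" R] by metis
next
  case (witness_pred \<phi> \<Gamma>)
  have "ExP (ren r (up R) \<phi>) \<in> set (map (ren r R) \<Gamma>)"
    using imageI[OF witness_pred.hyps(1), of "ren r R"] by simp
  moreover have "map (ren r (up R)) (\<phi> # map lift_pred \<Gamma>) = ren r (up R) \<phi> # map lift_pred (map (ren r R) \<Gamma>)"
    by (simp add: ren_lift_pred)
  ultimately show ?case using refutable.witness_pred witness_pred.IH[of r "up R"] by metis
qed

lemma refutable_mono: "refutable \<Gamma> \<Longrightarrow> set \<Gamma> \<subseteq> set \<Gamma>' \<Longrightarrow> refutable \<Gamma>'"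
proof (induction arbitrary: \<Gamma>' rule: refutable.induct)
  case (falsity \<Gamma>) then show ?case by (rule_tac refutable.falsity) auto
next
  case (step ps \<phi> \<Gamma>)
  have "refutable (\<phi> # \<Gamma>')" by (rule step.IH) (use step.prems in auto)
  then show ?case using refutable.step[OF step(1)] step by blast
next
  case (split \<phi> \<Gamma>)
  have "refutable (\<phi> # \<Gamma>')" by (rule split.IH(1)) (use split.prems in auto)
  moreover have "refutable (Neg \<phi> # \<Gamma>')" by (rule split.IH(2)) (use split.prems in auto)
  ultimately show ?case by (rule refutable.split)
next
  case (witness_ind \<phi> \<Gamma>)
  have "refutable (\<phi> # map lift_ind \<Gamma>')" by (rule witness_ind.IH) (use witness_ind.prems in auto)
  then show ?case using refutable.witness_ind witness_ind by blast
next
  case (witness_pred \<phi> \<Gamma>)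
  have "refutable (\<phi> # map lift_pred \<Gamma>')" by (rule witness_pred.IH) (use witness_pred.prems in auto)
  then show ?case using refutable.witness_pred witness_pred by blast
qed

lemma sat_inst: "sat i P (inst_ind y \<phi>) = sat (case_nat (i y) i) P \<phi>"
  "sat i P (inst_pred Y \<phi>) = sat i (case_nat (P Y) P) \<phi>"
  by (simp_all add: inst_ind_def inst_pred_def sat_ren comp_case_nat)

lemma ax_step_sound: "ax_step ps \<phi> \<Longrightarrow> \<forall>\<psi>\<in>set ps. sat i P \<psi> \<Longrightarrow> sat i P \<phi>"
proof (induction rule: ax_step.induct)
  case (21 \<psi>)
  show ?case unfolding compr_ax_def
    by (auto simp: sat_ren case_nat_comp intro!: exI[of _ "\<lambda>n. sat (case_nat n i) P \<psi>"])
next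
  case (22 X)
  have *: "P X n" if "P X 0" "\<forall>n. P X n \<longrightarrow> P X (Suc n)" for n
    using that by (induction n) auto
  show ?case by (simp add: ind_ax_def) (use * in blast)
qed (auto simp: sat_inst)

lemma refutable_sound: "refutable \<Gamma> \<Longrightarrow> \<not> (\<forall>\<gamma>\<in>set \<Gamma>. sat i P \<gamma>)"
proof (induction arbitrary: i P rule: refutable.induct)
  case (step ps \<phi> \<Gamma>)
  then show ?case using ax_step_sound[OF step(1), of i P] by auto
next
  case (split \<phi> \<Gamma>)
  show ?case using split.IH(1)[of i P] split.IH(2)[of i P] by auto
next
  case (witness_ind \<phi> \<Gamma>)
  show ?case
  proof
    assume *: "\<forall>\<gamma>\<in>set \<Gamma>. sat i P \<gamma>"
    then obtain n where "sat (case_nat n i) P \<phi>" using witness_ind(1) by force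
    then show False using witness_ind.IH[of "case_nat n i" P] * by (auto simp: sat_ren case_nat_comp)
  qed
next
  case (witness_pred \<phi> \<Gamma>)
  show ?case
  proof
    assume *: "\<forall>\<gamma>\<in>set \<Gamma>. sat i P \<gamma>"
    then obtain A where "sat i (case_nat A P) \<phi>" using witness_pred(1) by force
    then show False using witness_pred.IH[of i "case_nat A P"] * by (auto simp: sat_ren case_nat_comp)
  qed
qed force

section \<open>Henkin completeness\<close>

lemma refutable_inst_ind:
  assumes "ExI \<phi> \<in> set \<Gamma>" "refutable (inst_ind y \<phi> # \<Gamma>)" "\<forall>\<gamma>\<in>set \<Gamma>. y \<notin> free_ind \<gamma>"
  shows "refutable \<Gamma>"
proof -
  \<comment> \<open>Sends \<open>y\<close> to index 0 and shifts all other indices. Where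
    \<open>y\<close> does not occur this is lifting, and on the instance it undoes the
    instantiation.\<close>
  let ?r = "\<lambda>v. if v = y then 0 else Suc v"
  have y: "Suc y \<notin> free_ind \<phi>" using assms(1,3) by force
  have "ren ?r id (inst_ind y \<phi>) = ren id id \<phi>"
    unfolding inst_ind_def ren_ren by (rule ren_cong) (use y in \<open>auto split: nat.split\<close>)
  moreover have "map (ren ?r id) \<Gamma> = map lift_ind \<Gamma>"
    using assms(3) by (auto intro!: ren_cong)
  ultimately have "refutable (\<phi> # map lift_ind \<Gamma>)"
    using refutable_ren[OF assms(2), of ?r id] by (simp del: map_eq_conv)
  then show ?thesis by (rule refutable.witness_ind[OF assms(1)])
qed

lemma refutable_inst_pred:
  assumes "ExP \<phi> \<in> set \<Gamma>" "refutable (inst_pred Y \<phi> # \<Gamma>)" "\<forall>\<gamma>\<in>set \<Gamma>. Y \<notin> free_pred \<gamma>"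
  shows "refutable \<Gamma>"
proof -
  let ?r = "\<lambda>v. if v = Y then 0 else Suc v"
  have y: "Suc Y \<notin> free_pred \<phi>" using assms(1,3) by force
  have "ren id ?r (inst_pred Y \<phi>) = ren id id \<phi>"
    unfolding inst_pred_def ren_ren by (rule ren_cong) (use y in \<open>auto split: nat.split\<close>)
  moreover have "map (ren id ?r) \<Gamma> = map lift_pred \<Gamma>"
    using assms(3) by (auto intro!: ren_cong)
  ultimately have "refutable (\<phi> # map lift_pred \<Gamma>)"
    using refutable_ren[OF assms(2), of id ?r] by (simp del: map_eq_conv)
  then show ?thesis by (rule refutable.witness_pred[OF assms(1)])
qed

definition decides :: "fm \<Rightarrow> fm list \<Rightarrow> bool" where
  "decides \<phi> \<Gamma> \<longleftrightarrow> (\<phi> \<in> set \<Gamma> \<or> Neg \<phi> \<in> set \<Gamma>) \<and>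
     (\<forall>\<psi>. \<phi> = ExI \<psi> \<longrightarrow> \<phi> \<in> set \<Gamma> \<longrightarrow> (\<exists>y. inst_ind y \<psi> \<in> set \<Gamma>)) \<and>
     (\<forall>\<psi>. \<phi> = ExP \<psi> \<longrightarrow> \<phi> \<in> set \<Gamma> \<longrightarrow> (\<exists>Y. inst_pred Y \<psi> \<in> set \<Gamma>))"

lemma decide_step:
  assumes con: "\<not> refutable \<Gamma>"
  shows "\<exists>\<Gamma>'. set \<Gamma> \<subseteq> set \<Gamma>' \<and> \<not> refutable \<Gamma>' \<and> decides \<phi> \<Gamma>'"
proof (cases "refutable (\<phi> # \<Gamma>)")
  case True
  then have neg: "\<not> refutable (Neg \<phi> # \<Gamma>)" using con refutable.split by blast
  show ?thesis
  proof (cases "\<phi> \<in> set \<Gamma>")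
    case True
    then have "refutable \<Gamma>" using refutable_mono[OF \<open>refutable (\<phi> # \<Gamma>)\<close>, of \<Gamma>] by auto
    with con show ?thesis by blast
  next
    case False
    \<comment> \<open>Otherwise adding \<open>Neg \<phi>\<close> would add \<open>\<phi>\<close>
      itself and create a witness obligation.\<close>
    have "\<phi> \<noteq> Neg \<phi>" by (metis add.right_neutral add_Suc_right fm.size(20) n_not_Suc_n)
    then show ?thesis using neg False by (intro exI[of _ "Neg \<phi> # \<Gamma>"]) (auto simp: decides_def)
  qed
next
  case False
  let ?\<Gamma> = "\<phi> # \<Gamma>"
  have fin: "finite (\<Union>\<gamma>\<in>set ?\<Gamma>. free_ind \<gamma>)" "finite (\<Union>\<gamma>\<in>set ?\<Gamma>. free_pred \<gamma>)"
    using finite_free by auto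
  obtain y where y: "\<forall>\<gamma>\<in>set ?\<Gamma>. y \<notin> free_ind \<gamma>"
    using ex_new_if_finite[OF _ fin(1)] by (metis UN_iff infinite_UNIV_nat)
  obtain Y where Y: "\<forall>\<gamma>\<in>set ?\<Gamma>. Y \<notin> free_pred \<gamma>"
    using ex_new_if_finite[OF _ fin(2)] by (metis UN_iff infinite_UNIV_nat)
  consider \<psi> where "\<phi> = ExI \<psi>" | \<psi> where "\<phi> = ExP \<psi>" | "\<forall>\<psi>. \<phi> \<noteq> ExI \<psi> \<and> \<phi> \<noteq> ExP \<psi>" by blast
  then show ?thesis
  proof cases
    case 1
    then have "\<not> refutable (inst_ind y \<psi> # ?\<Gamma>)" using refutable_inst_ind[of \<psi> ?\<Gamma> y] y False by auto
    then show ?thesis using 1 by (intro exI[of _ "inst_ind y \<psi> # ?\<Gamma>"]) (auto simp: decides_def)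
  next
    case 2
    then have "\<not> refutable (inst_pred Y \<psi> # ?\<Gamma>)" using refutable_inst_pred[of \<psi> ?\<Gamma> Y] Y False by auto
    then show ?thesis using 2 by (intro exI[of _ "inst_pred Y \<psi> # ?\<Gamma>"]) (auto simp: decides_def)
  next
    case 3
    then show ?thesis using False by (intro exI[of _ ?\<Gamma>]) (auto simp: decides_def)
  qed
qed

locale henkin_set =
  fixes T :: "fm set"
  assumes con: "set \<Gamma> \<subseteq> T \<Longrightarrow> \<not> refutable \<Gamma>"
    and complete: "\<phi> \<in> T \<or> Neg \<phi> \<in> T"
    and wit_ind: "ExI \<phi> \<in> T \<Longrightarrow> \<exists>y. inst_ind y \<phi> \<in> T"
    and wit_pred: "ExP \<phi> \<in> T \<Longrightarrow> \<exists>Y. inst_pred Y \<phi> \<in> T"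

lemma henkin_set_exists:
  assumes "\<not> refutable \<Gamma>"
  shows "\<exists>T. henkin_set T \<and> set \<Gamma> \<subseteq> T"
proof -
  have "inj fm_code" by (auto simp: inj_def fm_code_inject)
  \<comment> \<open>A number that codes no formula is decoded to an arbitrary one; deciding that
    formula at such a stage does no harm.\<close>
  define d where "d = inv fm_code"
  have d: "d (fm_code \<phi>) = \<phi>" for \<phi> unfolding d_def by (rule inv_f_f[OF \<open>inj fm_code\<close>])
  define next_list where "next_list n \<Gamma> = (SOME \<Gamma>'. set \<Gamma> \<subseteq> set \<Gamma>' \<and> \<not> refutable \<Gamma>' \<and> decides (d n) \<Gamma>')" for n \<Gamma>
  define G where "G = rec_nat \<Gamma> next_list"
  have G0: "G 0 = \<Gamma>" and GS: "G (Suc n) = next_list n (G n)" for n unfolding G_def by simp_all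
  have nl: "set \<Gamma> \<subseteq> set (next_list n \<Gamma>) \<and> \<not> refutable (next_list n \<Gamma>) \<and> decides (d n) (next_list n \<Gamma>)"
    if "\<not> refutable \<Gamma>" for n \<Gamma>
    unfolding next_list_def by (rule someI_ex[OF decide_step[OF that]])
  have conG: "\<not> refutable (G n)" for n by (induction n) (use assms nl in \<open>auto simp: G0 GS\<close>)
  have mono: "set (G m) \<subseteq> set (G n)" if "m \<le> n" for m n
    by (rule lift_Suc_mono_le[OF _ that, of "\<lambda>n. set (G n)"]) (use nl conG GS in auto)
  let ?T = "\<Union>n. set (G n)"
  have dec: "decides \<phi> (G (Suc (fm_code \<phi>)))" for \<phi>
    using nl[OF conG[of "fm_code \<phi>"], of "fm_code \<phi>"] by (simp add: GS d)
  have sub: "\<exists>n. set \<Delta> \<subseteq> set (G n)" if "set \<Delta> \<subseteq> ?T" for \<Delta>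
    using that
  proof (induction \<Delta>)
    case (Cons \<phi> \<Delta>)
    then obtain m n where "set \<Delta> \<subseteq> set (G m)" "\<phi> \<in> set (G n)" by auto
    then have "set (\<phi> # \<Delta>) \<subseteq> set (G (max m n))" using mono[of m "max m n"] mono[of n "max m n"] by auto
    then show ?case by blast
  qed simp
  \<comment> \<open>Witnesses are added only at the stage that decides a formula. A formula entering
    later must already be present then, since otherwise its negation would be.\<close>
  have inT: "\<phi> \<in> set (G (Suc (fm_code \<phi>)))" if "\<phi> \<in> ?T" for \<phi>
  proof (rule ccontr)
    assume "\<phi> \<notin> set (G (Suc (fm_code \<phi>)))"
    then have "Neg \<phi> \<in> ?T" using dec[of \<phi>] unfolding decides_def by auto
    then have "set [\<phi>, Neg \<phi>] \<subseteq> ?T" using that by auto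
    then obtain n where n: "set [\<phi>, Neg \<phi>] \<subseteq> set (G n)" using sub by blast
    have "refutable (Fls # G n)" by (rule refutable.falsity) simp
    then have "refutable (G n)" using refutable.step[OF ax_step.intros(4)[of \<phi>] n] by blast
    with conG show False by blast
  qed
  have "henkin_set ?T"
  proof
    show "\<not> refutable \<Delta>" if "set \<Delta> \<subseteq> ?T" for \<Delta>
      using sub[OF that] refutable_mono conG by blast
    show "\<phi> \<in> ?T \<or> Neg \<phi> \<in> ?T" for \<phi> using dec[of \<phi>] unfolding decides_def by blast
    show "\<exists>y. inst_ind y \<phi> \<in> ?T" if "ExI \<phi> \<in> ?T" for \<phi>
      using dec[of "ExI \<phi>"] inT[OF that] unfolding decides_def by blast
    show "\<exists>Y. inst_pred Y \<phi> \<in> ?T" if "ExP \<phi> \<in> ?T" for \<phi>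
      using dec[of "ExP \<phi>"] inT[OF that] unfolding decides_def by blast
  qed
  moreover have "set \<Gamma> \<subseteq> ?T" using G0 by blast
  ultimately show ?thesis by blast
qed

section \<open>The term model of a Henkin set\<close>

context henkin_set
begin

lemma closed: "ax_step ps \<phi> \<Longrightarrow> set ps \<subseteq> T \<Longrightarrow> \<phi> \<in> T"
proof (rule ccontr)
  assume ax: "ax_step ps \<phi>" "set ps \<subseteq> T" "\<phi> \<notin> T"
  then have "set (Neg \<phi> # ps) \<subseteq> T" using complete[of \<phi>] by auto
  moreover have "refutable (Fls # \<phi> # Neg \<phi> # ps)" by (rule refutable.falsity) simp
  then have "refutable (\<phi> # Neg \<phi> # ps)" by (rule refutable.step[OF ax_step.intros(4)[of \<phi>], rotated]) simp
  then have "refutable (Neg \<phi> # ps)" by (rule refutable.step[OF ax(1), rotated]) auto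
  ultimately show False using con by blast
qed

lemma Fls_notin: "Fls \<notin> T"
  using con[of "[Fls]"] refutable.falsity[of "[Fls]"] by auto

lemma Neg_iff: "Neg \<phi> \<in> T \<longleftrightarrow> \<phi> \<notin> T"
  using complete[of \<phi>] closed[OF ax_step.intros(4)[of \<phi>]] Fls_notin by auto

lemma And_iff: "And \<phi> \<psi> \<in> T \<longleftrightarrow> \<phi> \<in> T \<and> \<psi> \<in> T"
proof -
  have "\<phi> \<in> T \<Longrightarrow> \<psi> \<in> T \<Longrightarrow> And \<phi> \<psi> \<in> T" "And \<phi> \<psi> \<in> T \<Longrightarrow> \<phi> \<in> T" "And \<phi> \<psi> \<in> T \<Longrightarrow> \<psi> \<in> T"
    by (rule closed, rule ax_step.intros(1), simp, rule closed, rule ax_step.intros(2), simp,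
        rule closed, rule ax_step.intros(3), simp)
  then show ?thesis by blast
qed

lemma ExI_iff: "ExI \<phi> \<in> T \<longleftrightarrow> (\<exists>y. inst_ind y \<phi> \<in> T)"
proof
  show "\<exists>y. inst_ind y \<phi> \<in> T \<Longrightarrow> ExI \<phi> \<in> T"
    by (elim exE, rule closed, rule ax_step.intros(6), simp)
qed (rule wit_ind)

lemma ExP_iff: "ExP \<phi> \<in> T \<longleftrightarrow> (\<exists>Y. inst_pred Y \<phi> \<in> T)"
proof
  show "\<exists>Y. inst_pred Y \<phi> \<in> T \<Longrightarrow> ExP \<phi> \<in> T"
    by (elim exE, rule closed, rule ax_step.intros(7), simp)
qed (rule wit_pred)

lemma Eq_refl: "Eq x x \<in> T"
  using closed[OF ax_step.intros(8)] by simp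

lemma Eq_subst: "Eq y z \<in> T \<Longrightarrow> inst_ind y \<phi> \<in> T \<Longrightarrow> inst_ind z \<phi> \<in> T"
  using closed[OF ax_step.intros(9)[of y \<phi> z]] by simp

lemma Eq_sym: "Eq x y \<in> T \<Longrightarrow> Eq y x \<in> T"
  using Eq_subst[of x y "Eq 0 (Suc x)"] Eq_refl by (simp add: inst_ind_def)

lemma Eq_trans: "Eq x y \<in> T \<Longrightarrow> Eq y z \<in> T \<Longrightarrow> Eq x z \<in> T"
  using Eq_subst[of y z "Eq (Suc x) 0"] by (simp add: inst_ind_def)

lemma atom_cong:
  assumes "Eq x x' \<in> T"
  shows "Le x y \<in> T \<longleftrightarrow> Le x' y \<in> T" "Le y x \<in> T \<longleftrightarrow> Le y x' \<in> T"
    "Succ x y \<in> T \<longleftrightarrow> Succ x' y \<in> T" "Succ y x \<in> T \<longleftrightarrow> Succ y x' \<in> T"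
    "Zero x \<in> T \<longleftrightarrow> Zero x' \<in> T" "Mem x X \<in> T \<longleftrightarrow> Mem x' X \<in> T"
proof -
  have *: "inst_ind x \<phi> \<in> T \<longleftrightarrow> inst_ind x' \<phi> \<in> T" for \<phi>
    using Eq_subst assms Eq_sym by blast
  show "Le x y \<in> T \<longleftrightarrow> Le x' y \<in> T" "Le y x \<in> T \<longleftrightarrow> Le y x' \<in> T"
    "Succ x y \<in> T \<longleftrightarrow> Succ x' y \<in> T" "Succ y x \<in> T \<longleftrightarrow> Succ y x' \<in> T"
    "Zero x \<in> T \<longleftrightarrow> Zero x' \<in> T" "Mem x X \<in> T \<longleftrightarrow> Mem x' X \<in> T"
    using *[of "Le 0 (Suc y)"] *[of "Le (Suc y) 0"] *[of "Succ 0 (Suc y)"] *[of "Succ (Suc y) 0"]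
      *[of "Zero 0"] *[of "Mem 0 X"] by (simp_all add: inst_ind_def)
qed

lemma Zero_ex: "\<exists>z. Zero z \<in> T"
  using closed[OF ax_step.intros(13)] ExI_iff by (auto simp: inst_ind_def)

lemma Succ_ex: "\<exists>y. Succ x y \<in> T"
  using closed[OF ax_step.intros(15)[of x]] ExI_iff by (auto simp: inst_ind_def)

lemma Succ_inj: "Succ y x \<in> T \<Longrightarrow> Succ z x \<in> T \<Longrightarrow> Eq y z \<in> T"
  using closed[OF ax_step.intros(16)] by simp

lemma Succ_Zero: "Succ x y \<in> T \<Longrightarrow> Zero y \<notin> T"
  using closed[OF ax_step.intros(18)[of x y]] Fls_notin by auto

text \<open>The classes of \<open>Eq\<close> are in bijection with the natural numbers, since the numerals
  are pairwise distinct.\<close>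

lemma quotient: "\<exists>v :: nat \<Rightarrow> nat. surj v \<and> (\<forall>x y. v x = v y \<longleftrightarrow> Eq x y \<in> T)"
proof -
  define cl where "cl x = {y. Eq x y \<in> T}" for x
  have cl: "cl x = cl y \<longleftrightarrow> Eq x y \<in> T" for x y
    unfolding cl_def using Eq_refl Eq_sym Eq_trans by blast
  obtain z where z: "Zero z \<in> T" using Zero_ex by blast
  obtain s where s: "\<And>x. Succ x (s x) \<in> T" using Succ_ex by metis
  define c where "c n = (s ^^ n) z" for n
  have c: "c 0 = z" "Succ (c n) (c (Suc n)) \<in> T" for n unfolding c_def using s by simp_all
  have inj: "Eq (c m) (c n) \<in> T \<Longrightarrow> m = n" for m n
  proof (induction m arbitrary: n)
    case 0
    then show ?case
      using Succ_Zero[OF c(2)] atom_cong(5)[of "c 0"] z c(1) by (cases n) auto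
  next
    case (Suc m)
    show ?case
    proof (cases n)
      case 0
      then show ?thesis using Suc.prems Succ_Zero[OF c(2)] atom_cong(5)[of "c (Suc m)"] z c(1) by auto
    next
      case (Suc n')
      then have "Succ (c m) (c n) \<in> T" using atom_cong(4)[OF Suc.prems, of "c m"] c(2)[of m] by blast
      then show ?thesis using Suc.IH Succ_inj c(2) Suc by blast
    qed
  qed
  have "inj (cl \<circ> c)" by (rule injI) (use inj cl in auto)
  then have "infinite (range (cl \<circ> c))" by (rule range_inj_infinite)
  then have "infinite (range cl)" by (rule contrapos_nn) (metis finite_subset image_comp image_mono subset_UNIV)
  then have bij: "bij_betw (to_nat_on (range cl)) (range cl) UNIV" by (intro to_nat_on_infinite) auto
  let ?v = "\<lambda>x. to_nat_on (range cl) (cl x)"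
  have "surj ?v" using bij unfolding bij_betw_def by (auto simp: image_image)
  moreover have "?v x = ?v y \<longleftrightarrow> Eq x y \<in> T" for x y
    using bij unfolding bij_betw_def by (metis cl inj_on_def rangeI)
  ultimately show ?thesis by blast
qed

lemma model_exists:
  "\<exists>(M :: nat henkin) v V. henkin_model M \<and> range V \<subseteq> h_sets M \<and> (\<forall>\<phi>\<in>T. hsat M v V \<phi>)"
proof -
  obtain v :: "nat \<Rightarrow> nat" where surj: "surj v" and v: "\<And>x y. v x = v y \<longleftrightarrow> Eq x y \<in> T"
    using quotient by blast
  define w where "w = inv v"
  have vw: "v (w a) = a" for a unfolding w_def using surj by (rule surj_f_inv_f)
  have w: "Eq (w (v x)) x \<in> T" for x using v[of "w (v x)" x] vw by simp
  define V where "V X a \<longleftrightarrow> Mem (w a) X \<in> T" for X a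
  define M where "M = \<lparr>h_le = (\<lambda>a b. Le (w a) (w b) \<in> T), h_suc = (\<lambda>a. v (SOME y. Succ (w a) y \<in> T)),
    h_zero = v (SOME y. Zero y \<in> T), h_sets = range V\<rparr>"
  have M_le: "h_le M (v x) (v y) \<longleftrightarrow> Le x y \<in> T" for x y
    unfolding M_def using atom_cong(1)[OF w] atom_cong(2)[OF w] by simp
  have M_suc: "v y = h_suc M (v x) \<longleftrightarrow> Succ x y \<in> T" for x y
  proof -
    let ?s = "SOME y. Succ (w (v x)) y \<in> T"
    have "Succ (w (v x)) ?s \<in> T" by (rule someI_ex[OF Succ_ex])
    then have s: "Succ x ?s \<in> T" using atom_cong(3)[OF w] by blast
    have "v y = v ?s \<longleftrightarrow> Succ x y \<in> T"
      using v atom_cong(4) s closed[OF ax_step.intros(17)[of x y ?s]] by auto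
    then show ?thesis unfolding M_def by simp
  qed
  have M_zero: "v x = h_zero M \<longleftrightarrow> Zero x \<in> T" for x
  proof -
    let ?z = "SOME y. Zero y \<in> T"
    have z: "Zero ?z \<in> T" by (rule someI_ex[OF Zero_ex])
    have "v x = v ?z \<longleftrightarrow> Zero x \<in> T"
      using v atom_cong(5) z closed[OF ax_step.intros(14)[of x ?z]] by auto
    then show ?thesis unfolding M_def by simp
  qed
  have M_mem: "V X (v x) \<longleftrightarrow> Mem x X \<in> T" for x X
    unfolding V_def using atom_cong(6)[OF w] .
  have M_sets: "h_sets M = range V" unfolding M_def by simp
  \<comment> \<open>Stated for all renamings, because instantiating a bound variable merely changes
    the renaming and leaves the subformula intact for the induction hypothesis.\<close>
  have truth: "hsat M (v \<circ> r) (V \<circ> R) \<phi> \<longleftrightarrow> ren r R \<phi> \<in> T" for r R \<phi>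
  proof (induction \<phi> arbitrary: r R)
    case (ExI \<phi>)
    have "hsat M (v \<circ> r) (V \<circ> R) (ExI \<phi>) \<longleftrightarrow> (\<exists>y. hsat M (case_nat (v y) (v \<circ> r)) (V \<circ> R) \<phi>)"
      by simp (metis vw)
    also have "\<dots> \<longleftrightarrow> (\<exists>y. ren (case_nat y r) R \<phi> \<in> T)"
    proof -
      have "case_nat (v y) (v \<circ> r) = v \<circ> case_nat y r" for y by (auto simp: fun_eq_iff split: nat.split)
      then show ?thesis by (simp only: ExI.IH)
    qed
    also have "\<dots> \<longleftrightarrow> ren r R (ExI \<phi>) \<in> T"
      by (simp add: ExI_iff inst_ind_def ren_ren case_nat_comp)
    finally show ?case .
  next
    case (ExP \<phi>)
    have "hsat M (v \<circ> r) (V \<circ> R) (ExP \<phi>) \<longleftrightarrow> (\<exists>Y. hsat M (v \<circ> r) (case_nat (V Y) (V \<circ> R)) \<phi>)"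
      by (simp add: M_sets)
    also have "\<dots> \<longleftrightarrow> (\<exists>Y. ren r (case_nat Y R) \<phi> \<in> T)"
    proof -
      have "case_nat (V y) (V \<circ> R) = V \<circ> case_nat y R" for y by (auto simp: fun_eq_iff split: nat.split)
      then show ?thesis by (simp only: ExP.IH)
    qed
    also have "\<dots> \<longleftrightarrow> ren r R (ExP \<phi>) \<in> T"
      by (simp add: ExP_iff inst_pred_def ren_ren case_nat_comp)
    finally show ?case .
  qed (simp_all add: v M_le M_suc M_zero M_mem And_iff Neg_iff Fls_notin closed[OF ax_step.intros(5)])
  have valid: "hsat M (v \<circ> r) (V \<circ> R) \<phi>" if "ax_step [] \<phi>" for r R \<phi>
    unfolding truth by (rule closed[OF ax_step_ren[OF that]]) simp
  have "henkin_model M"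
  proof
    show "h_sets M \<noteq> {}" unfolding M_sets by blast
    fix x y z
    obtain a b c where abc: "x = v a" "y = v b" "z = v c" using vw by metis
    show "h_le M x x" unfolding abc M_le using closed[OF ax_step.intros(10)] by simp
    show "h_le M x z" if "h_le M x y" "h_le M y z"
      using that closed[OF ax_step.intros(11)[of a b c]] unfolding abc M_le by simp
    show "x = y" if "h_le M x y" "h_le M y x"
      using that closed[OF ax_step.intros(12)[of a b]] unfolding abc M_le v by simp
    obtain a' where a': "Succ a a' \<in> T" using Succ_ex by blast
    obtain b' where b': "Succ b b' \<in> T" using Succ_ex by blast
    have sa: "h_suc M x = v a'" "h_suc M y = v b'" using M_suc a' b' unfolding abc by metis+
    show "h_suc M x \<noteq> h_zero M" unfolding sa M_zero using Succ_Zero[OF a'] .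
    show "x = y" if "h_suc M x = h_suc M y"
    proof -
      have "Eq a' b' \<in> T" using that unfolding sa v .
      then show ?thesis unfolding abc v using Succ_inj[OF a', of b] b' atom_cong(4)[of a' b' b] by blast
    qed
    show "h_le M x (h_suc M x)" unfolding sa unfolding abc M_le using closed[OF ax_step.intros(19)[of a a']] a' by simp
    show "h_le M x y" if "h_le M x (h_suc M y)" "x \<noteq> h_suc M y"
      using that closed[OF ax_step.intros(20)[of b b' a]] b' unfolding sa unfolding abc M_le v by (simp add: Neg_iff)
  next
    fix X x assume X: "X \<in> h_sets M" "X (h_zero M)" "\<And>y. X y \<Longrightarrow> X (h_suc M y)"
    obtain Y where "X = V Y" using X(1) unfolding M_sets by blast
    with valid[OF ax_step.intros(22)[of Y], of id id] X(2,3) show "X x" unfolding ind_ax_def by auto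
  next
    fix P :: "nat \<Rightarrow> nat \<Rightarrow> bool" and i :: "nat \<Rightarrow> nat" and \<phi> assume P: "range P \<subseteq> h_sets M"
    \<comment> \<open>All individuals and sets of the model are named by variables, so comprehension
      with arbitrary parameters is a renamed instance of the axiom.\<close>
    have "\<forall>n. \<exists>Y. P n = V Y" using P unfolding M_sets by blast
    then obtain R where "P = V \<circ> R" by (metis comp_apply ext)
    moreover have "i = v \<circ> (w \<circ> i)" using vw by (auto simp: fun_eq_iff)
    ultimately have "hsat M i P (compr_ax \<phi>)" using valid[OF ax_step.intros(21)[of \<phi>], of "w \<circ> i" R] by simp
    then obtain A where A: "A \<in> h_sets M" "\<And>a. A a \<longleftrightarrow> hsat M (case_nat a i) P \<phi>"
      unfolding compr_ax_def by (auto simp: hsat_ren case_nat_comp)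
    have "A = (\<lambda>a. hsat M (case_nat a i) P \<phi>)" by (rule ext) (rule A(2))
    with A(1) show "(\<lambda>a. hsat M (case_nat a i) P \<phi>) \<in> h_sets M" by simp
  qed
  moreover have "hsat M v V \<phi>" if "\<phi> \<in> T" for \<phi> using truth[of id id \<phi>] that by simp
  ultimately show ?thesis using M_sets by (metis order_refl)
qed

end

text \<open>The list is replaced by its conjunction, a single formula to which the transfer applies.
  Free predicate variables are allowed: the standard word found by the transfer interprets
  them.\<close>

theorem refutation_complete:
  assumes "\<And>i P. \<not> (\<forall>\<gamma>\<in>set \<Gamma>. sat i P \<gamma>)" "\<forall>\<gamma>\<in>set \<Gamma>. free_ind \<gamma> = {}"
  shows "refutable \<Gamma>"
proof (rule ccontr)
  assume "\<not> refutable \<Gamma>"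
  then obtain T where "henkin_set T" and T: "set \<Gamma> \<subseteq> T" using henkin_set_exists by blast
  then obtain M :: "nat henkin" and v V where M: "henkin_model M" "range V \<subseteq> h_sets M" "\<forall>\<phi>\<in>T. hsat M v V \<phi>"
    using henkin_set.model_exists by blast
  let ?\<phi> = "foldr And \<Gamma> Tru"
  have "hsat M' i P (foldr And \<Delta> Tru) \<longleftrightarrow> (\<forall>\<gamma>\<in>set \<Delta>. hsat M' i P \<gamma>)" for M' :: "nat henkin" and i P \<Delta>
    by (induction \<Delta>) auto
  note conj = this this[of std, unfolded hsat_std]
  have "free_ind ?\<phi> = {}" using assms(2) by (induction \<Gamma>) auto
  then obtain P' where "\<forall>i. sat i P' ?\<phi>" using transfer_std[OF M(1,2), of v ?\<phi>] M(3) T conj(1) by blast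
  then show False using assms(1) conj(2) by blast
qed


section \<open>Refutations as derivations in SMSO\<close>

abbreviation (input) derives :: "fm list \<Rightarrow> fm \<Rightarrow> bool" (infix "\<turnstile>" 45) where
  "\<Gamma> \<turnstile> \<phi> \<equiv> smso_derivable (\<Gamma>, \<phi>)"

lemma derivable_rule:
  assumes "smso_rule ps c" "\<forall>p\<in>set ps. smso_derivable p"
  shows "smso_derivable c"
proof -
  have "\<forall>p\<in>set ps. \<exists>d. is_derivation d \<and> conclusion d = p" using assms(2) unfolding smso_derivable_def .
  then obtain D where D: "\<forall>p\<in>set ps. is_derivation (D p) \<and> conclusion (D p) = p" by metis
  then have "map conclusion (map D ps) = ps" by (simp add: map_idI)
  then have "is_derivation (Deriv c (map D ps))"
    using assms(1) D by (intro is_derivation.intros) auto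
  then show ?thesis unfolding smso_derivable_def by (metis deriv.sel(1))
qed

lemma derivable_rule0: "smso_rule [] c \<Longrightarrow> smso_derivable c"
  by (erule derivable_rule) simp_all

lemma derivable_rule1: "smso_rule [p] c \<Longrightarrow> smso_derivable p \<Longrightarrow> smso_derivable c"
  by (erule derivable_rule) simp_all

lemma derivable_rule2: "smso_rule [p, p'] c \<Longrightarrow> smso_derivable p \<Longrightarrow> smso_derivable p' \<Longrightarrow> smso_derivable c"
  by (erule derivable_rule) simp_all

lemma d_ax: "\<phi> \<in> set \<Gamma> \<Longrightarrow> \<Gamma> \<turnstile> \<phi>"
  by (rule derivable_rule0[OF smso_rule.ax])

lemmas d_neg_elim = derivable_rule2[OF smso_rule.neg_elim]
  and d_neg_intro = derivable_rule1[OF smso_rule.neg_intro]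
  and d_and_intro = derivable_rule2[OF smso_rule.and_intro]
  and d_and_elim1 = derivable_rule1[OF smso_rule.and_elim1]
  and d_and_elim2 = derivable_rule1[OF smso_rule.and_elim2]
  and d_ex_ind_intro = derivable_rule1[OF smso_rule.ex_ind_intro]
  and d_ex_pred_intro = derivable_rule1[OF smso_rule.ex_pred_intro]
  and d_ex_ind_elim = derivable_rule2[OF smso_rule.ex_ind_elim]
  and d_ex_pred_elim = derivable_rule2[OF smso_rule.ex_pred_elim]
  and d_dne = derivable_rule1[OF smso_rule.dne]

lemma subst_pred_ren: "subst_pred s (ren id R \<phi>) = subst_pred (\<lambda>X. s (R X)) \<phi>"
proof (induction \<phi> arbitrary: s R)
  case (ExP \<phi>)
  have "(\<lambda>X. case_nat (Mem 0 0) (\<lambda>X. lift_pred (s X)) (up R X)) = case_nat (Mem 0 0) (\<lambda>X. lift_pred (s (R X)))"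
    by (auto simp: fun_eq_iff up_def split: nat.split)
  then show ?case by (simp only: ren.simps subst_pred.simps ExP.IH)
next
  case (ExI \<phi>) show ?case by (simp only: ren.simps subst_pred.simps up_id ExI.IH)
qed (simp_all)

lemma subst_pred_Mem: "subst_pred (Mem 0) \<phi> = \<phi>"
proof (induction \<phi>)
  case (ExP \<phi>)
  have "case_nat (Mem 0 0) (\<lambda>X. lift_pred (Mem 0 X)) = Mem 0"
    by (auto simp: fun_eq_iff split: nat.split)
  then show ?case using ExP.IH by (simp del: ren.simps)
qed (simp_all add: inst_ind_def)

text \<open>Substituting \<open>\<psi>\<close> for the bound predicate turns the body into the
  derivable equivalence of \<open>\<psi>\<close> with itself. Negative comprehension then gives the
  axiom under a double negation only.\<close>

lemma derives_compr_ax: "\<Gamma> \<turnstile> Neg (Neg (compr_ax \<psi>))"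
proof -
  have "inst_ind 0 (ren (up Suc) id \<psi>) = \<psi>"
    unfolding inst_ind_def ren_ren case_nat_comp by (rule trans[OF ren_cong ren_id]) (auto split: nat.split)
  moreover have "subst_pred (\<lambda>X. ren (up Suc) id (case_nat \<psi> (Mem 0) X)) (lift_pred \<psi>) = \<psi>"
    by (simp add: subst_pred_ren subst_pred_Mem)
  ultimately have "inst_fm \<psi> (fm_all (fm_iff (Mem 0 0) (lift_pred \<psi>))) = fm_all (fm_iff \<psi> \<psi>)"
    unfolding inst_fm_def by simp
  moreover have "\<Gamma> \<turnstile> fm_all (fm_iff \<psi> \<psi>)"
  proof (rule d_neg_intro, rule d_ex_ind_elim)
    let ?\<Delta> = "map lift_ind (ExI (Neg (fm_iff \<psi> \<psi>)) # \<Gamma>)"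
    show "ExI (Neg (fm_iff \<psi> \<psi>)) # \<Gamma> \<turnstile> ExI (Neg (fm_iff \<psi> \<psi>))" by (rule d_ax) simp
    have "\<Delta> \<turnstile> Neg (And \<psi> (Neg \<psi>))" for \<Delta>
      by (rule d_neg_intro, rule d_neg_elim[where \<phi> = \<psi>])
        (rule d_and_elim1[where \<psi> = "Neg \<psi>"], rule d_ax, simp, rule d_and_elim2[where \<phi> = \<psi>], rule d_ax, simp)
    then have "\<Delta> \<turnstile> fm_iff \<psi> \<psi>" for \<Delta> by (rule d_and_intro) fact
    then have "Neg (fm_iff \<psi> \<psi>) # ?\<Delta> \<turnstile> Fls"
      by (rule d_neg_elim) (rule d_ax, simp)
    then show "Neg (fm_iff \<psi> \<psi>) # ?\<Delta> \<turnstile> lift_ind Fls" by simp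
  qed
  ultimately have "\<Gamma> \<turnstile> inst_fm \<psi> (fm_all (fm_iff (Mem 0 0) (lift_pred \<psi>)))" by simp
  then show ?thesis unfolding compr_ax_def by (rule derivable_rule1[OF smso_rule.negative_comprehension])
qed

text \<open>Deterministic induction is applied to the atom \<open>Mem 0 X\<close>; double negation
  elimination for this atom turns the negated existential hypotheses into the two positive premises.
  The hypothesis \<open>?A\<close> has no free individual variable and so survives the lifting of
  contexts.\<close>

lemma derives_ind_ax: "\<Gamma> \<turnstile> ind_ax X"
proof -
  let ?B = "Neg (ExI (And (Zero 0) (Neg (Mem 0 X))))"
    and ?S = "Neg (ExI (ExI (And (Succ (Suc 0) 0) (And (Mem (Suc 0) X) (Neg (Mem 0 X))))))"
    and ?N = "ExI (Neg (Mem 0 X))"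
  let ?A = "And ?B (And ?S ?N)"
  have lift_A: "ren r id ?A = ?A" for r by simp
  have A: "\<Delta> \<turnstile> ?B" "\<Delta> \<turnstile> ?S" "\<Delta> \<turnstile> ?N" if "?A \<in> set \<Delta>" for \<Delta>
    using d_and_elim1[OF d_ax[OF that]] d_and_elim1[OF d_and_elim2[OF d_ax[OF that]]]
      d_and_elim2[OF d_and_elim2[OF d_ax[OF that]]] .
  have mem: "\<Delta> \<turnstile> inst_ind x (Mem 0 X)" if A_in: "?A \<in> set \<Delta>" for x \<Delta>
  proof (rule derivable_rule2[OF smso_rule.induction])
    have in1: "?A \<in> set (map lift_ind \<Delta>)" using imageI[OF A_in, of lift_ind] unfolding lift_A by simp
    have in2: "?A \<in> set (map (\<lambda>\<gamma>. lift_ind (lift_ind \<gamma>)) \<Delta>)"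
      using imageI[OF A_in, of "\<lambda>\<gamma>. lift_ind (lift_ind \<gamma>)"] unfolding lift_A by simp
    show "Zero 0 # map lift_ind \<Delta> \<turnstile> Mem 0 X"
    proof (rule d_dne, simp, rule d_neg_intro, rule d_neg_elim)
      let ?\<Delta> = "Neg (Mem 0 X) # Zero 0 # map lift_ind \<Delta>"
      have "?\<Delta> \<turnstile> inst_ind 0 (And (Zero 0) (Neg (Mem 0 X)))"
        unfolding inst_ind_def by (simp, rule d_and_intro; rule d_ax; simp)
      then show "?\<Delta> \<turnstile> ExI (And (Zero 0) (Neg (Mem 0 X)))" by (rule d_ex_ind_intro)
      show "?\<Delta> \<turnstile> ?B" by (rule A) (use in1 in simp)
    qed
    show "lift_ind (Mem 0 X) # Succ 1 0 # map (\<lambda>\<gamma>. lift_ind (lift_ind \<gamma>)) \<Delta> \<turnstile> ren (up Suc) id (Mem 0 X)"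
    proof (simp, rule d_dne, simp, rule d_neg_intro, rule d_neg_elim)
      let ?\<Delta> = "Neg (Mem 0 X) # Mem (Suc 0) X # Succ (Suc 0) 0 # map (\<lambda>\<gamma>. lift_ind (lift_ind \<gamma>)) \<Delta>"
      let ?C = "And (Succ (Suc 0) 0) (And (Mem (Suc 0) X) (Neg (Mem 0 X)))"
      have "?\<Delta> \<turnstile> inst_ind 0 (And (Succ (Suc (Suc 0)) 0) (And (Mem (Suc (Suc 0)) X) (Neg (Mem 0 X))))"
        unfolding inst_ind_def by (simp, rule d_and_intro, rule d_ax, simp, rule d_and_intro; rule d_ax; simp)
      then have "?\<Delta> \<turnstile> inst_ind (Suc 0) (ExI ?C)"
        unfolding inst_ind_def[of "Suc 0"] by simp (rule d_ex_ind_intro)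
      then show "?\<Delta> \<turnstile> ExI (ExI ?C)" by (rule d_ex_ind_intro)
      show "?\<Delta> \<turnstile> ?S" by (rule A) (use in2 in simp)
    qed
  qed simp
  show ?thesis unfolding ind_ax_def
  proof (rule d_neg_intro, rule d_ex_ind_elim)
    show "?A # \<Gamma> \<turnstile> ?N" by (rule A) simp
    let ?\<Delta> = "Neg (Mem 0 X) # map lift_ind (?A # \<Gamma>)"
    have "?A \<in> set ?\<Delta>" unfolding list.map lift_A by simp
    from mem[OF this, of 0] have "?\<Delta> \<turnstile> Mem 0 X" by (simp add: inst_ind_def)
    moreover have "?\<Delta> \<turnstile> Neg (Mem 0 X)" by (rule d_ax) simp
    ultimately have "?\<Delta> \<turnstile> Fls" by (rule d_neg_elim)
    then show "?\<Delta> \<turnstile> lift_ind Fls" by simp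
  qed
qed

lemma ax_step_derivable:
  assumes "ax_step ps \<phi>" "\<And>p. p \<in> set ps \<Longrightarrow> \<Gamma> \<turnstile> p"
  shows "\<Gamma> \<turnstile> Neg (Neg \<phi>)"
proof -
  have dn: "\<Gamma> \<turnstile> Neg (Neg \<phi>)" if "smso_rule (map (\<lambda>p. (\<Gamma>, p)) ps) (\<Gamma>, \<phi>)"
  proof -
    have "\<Gamma> \<turnstile> \<phi>" by (rule derivable_rule[OF that]) (use assms(2) in auto)
    \<comment> \<open>There is no weakening rule, so a derived formula enters the context that also
      contains \<open>Neg \<phi>\<close> through a cut.\<close>
    then have *: "\<Gamma> \<turnstile> And \<phi> \<phi>" by (intro d_and_intro)
    have "And \<phi> \<phi> # \<Gamma> \<turnstile> Neg (Neg \<phi>)"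
      by (rule d_neg_intro, rule d_neg_elim[where \<phi> = \<phi>])
        (rule d_and_elim1[where \<psi> = \<phi>], rule d_ax, simp, rule d_ax, simp)
    with * show ?thesis by (rule derivable_rule2[OF smso_rule.cut])
  qed
  show ?thesis using assms(1)
  proof cases
    case (21 \<psi>) then show ?thesis using derives_compr_ax by simp
  next
    case (22 X)
    have "Neg (ind_ax X) # \<Gamma> \<turnstile> Fls" by (rule d_neg_elim[OF derives_ind_ax[of _ X]]) (rule d_ax, simp)
    then show ?thesis unfolding 22 by (rule d_neg_intro)
  qed (rule dn, simp, (rule smso_rule.intros)+)+
qed

text \<open>Constructively harmless because the goal is \<open>Fls\<close>: \<open>split\<close>
  yields both \<open>Neg \<phi>\<close> and \<open>Neg (Neg \<phi>)\<close>, and a step uses only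
  the double negation of its conclusion.\<close>

theorem refutable_derivable: "refutable \<Gamma> \<Longrightarrow> \<Gamma> \<turnstile> Fls"
proof (induction rule: refutable.induct)
  case (falsity \<Gamma>) then show ?case by (rule d_ax)
next
  case (step ps \<phi> \<Gamma>)
  have "\<Gamma> \<turnstile> Neg (Neg \<phi>)" by (rule ax_step_derivable[OF step(1)]) (use step(2) in \<open>auto intro: d_ax\<close>)
  with d_neg_intro[OF step.IH] show ?case by (rule d_neg_elim)
next
  case (split \<phi> \<Gamma>)
  from d_neg_intro[OF split.IH(1)] d_neg_intro[OF split.IH(2)] show ?case by (rule d_neg_elim)
next
  case (witness_ind \<phi> \<Gamma>)
  show ?case by (rule d_ex_ind_elim[OF d_ax[OF witness_ind(1)]]) (use witness_ind.IH in simp)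
next
  case (witness_pred \<phi> \<Gamma>)
  show ?case by (rule d_ex_pred_elim[OF d_ax[OF witness_pred(1)]]) (use witness_pred.IH in simp)
qed

corollary valid_derivable:
  assumes "\<And>i P. sat i P \<phi>" "free_ind \<phi> = {}"
  shows "[] \<turnstile> Neg (Neg \<phi>)"
proof -
  have "refutable [Neg \<phi>]" by (rule refutation_complete) (use assms in auto)
  from refutable_derivable[OF this] show ?thesis by (rule d_neg_intro)
qed

section \<open>Machines as uniformly bounded formulae\<close>

lemma free_ind_ren: "free_ind (ren r R \<phi>) = r ` free_ind \<phi>"
proof (induction \<phi> arbitrary: r R)
  case (ExI \<phi>)
  have "{x. Suc x \<in> up r ` A} = r ` {x. Suc x \<in> A}" for A
  proof safe
    fix x y assume "Suc x = up r y" "y \<in> A"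
    then show "x \<in> r ` {x. Suc x \<in> A}" by (cases y) auto
  next
    fix x assume "Suc x \<in> A"
    then show "Suc (r x) \<in> up r ` A" by (metis imageI up_simps(2))
  qed
  then show ?case by (simp add: ExI.IH)
qed auto

lemma relativize_ren:
  "ren r R (relativize (Le 0 (Suc x)) \<phi>) = relativize (Le 0 (Suc (r x))) (ren r R \<phi>)"
  by (induction \<phi> arbitrary: r R x) simp_all

lemma sat_cong:
  "\<forall>x\<in>free_ind \<phi>. i x = i' x \<Longrightarrow> \<forall>X\<in>free_pred \<phi>. P X = P' X \<Longrightarrow> sat i P \<phi> = sat i' P' \<phi>"
proof (induction \<phi> arbitrary: i P i' P')
  case (ExI \<phi>)
  have "sat (case_nat n i) P \<phi> = sat (case_nat n i') P' \<phi>" for n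
    by (rule ExI.IH) (use ExI.prems in \<open>auto split: nat.split\<close>)
  then show ?case by simp
next
  case (ExP \<phi>)
  have "sat i (case_nat A P) \<phi> = sat i' (case_nat A P') \<phi>" for A
    by (rule ExP.IH) (use ExP.prems in \<open>auto split: nat.split\<close>)
  then show ?case by simp
next
  case (And \<phi> \<psi>)
  have "sat i P \<phi> = sat i' P' \<phi>" "sat i P \<psi> = sat i' P' \<psi>"
    by (rule And.IH; use And.prems in auto)+
  then show ?case by simp
next
  case (Neg \<phi>)
  have "sat i P \<phi> = sat i' P' \<phi>" by (rule Neg.IH) (use Neg.prems in auto)
  then show ?case by simp
qed simp_all

text \<open>Bounded counterpart of \<open>definable\<close> in the standard model; the bounding
  variable \<open>x\<close> grows by one under an individual quantifier.\<close>

definition bdefinable :: "nat \<Rightarrow> ((nat \<Rightarrow> nat) \<Rightarrow> (nat \<Rightarrow> nat \<Rightarrow> bool) \<Rightarrow> bool) \<Rightarrow> bool" where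
  "bdefinable x R \<longleftrightarrow> (\<exists>\<psi>. \<forall>i P. R i P = sat i P (relativize (Le 0 (Suc x)) \<psi>))"

lemma bdefinable_atoms:
  "bdefinable x (\<lambda>i P. i y = i z)" "bdefinable x (\<lambda>i P. i y = 0)"
  "bdefinable x (\<lambda>i P. i z = Suc (i y))" "bdefinable x (\<lambda>i P. P X (i y))"
proof -
  have *: "bdefinable x (\<lambda>i P. sat i P (relativize (Le 0 (Suc x)) \<psi>))" for \<psi>
    unfolding bdefinable_def by blast
  show "bdefinable x (\<lambda>i P. i y = i z)" "bdefinable x (\<lambda>i P. i y = 0)"
    "bdefinable x (\<lambda>i P. i z = Suc (i y))" "bdefinable x (\<lambda>i P. P X (i y))"
    using *[of "Eq y z"] *[of "Zero y"] *[of "Succ y z"] *[of "Mem y X"] by simp_all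
qed

lemma bdefinable_not: "bdefinable x R \<Longrightarrow> bdefinable x (\<lambda>i P. \<not> R i P)"
proof -
  assume "bdefinable x R"
  then obtain \<psi> where "\<forall>i P. R i P = sat i P (relativize (Le 0 (Suc x)) \<psi>)"
    unfolding bdefinable_def by blast
  then show ?thesis unfolding bdefinable_def by (intro exI[of _ "Neg \<psi>"]) simp
qed

lemma bdefinable_conj:
  assumes "bdefinable x R" "bdefinable x Q" shows "bdefinable x (\<lambda>i P. R i P \<and> Q i P)"
proof -
  obtain \<phi> \<psi> where "\<forall>i P. R i P = sat i P (relativize (Le 0 (Suc x)) \<phi>)"
    "\<forall>i P. Q i P = sat i P (relativize (Le 0 (Suc x)) \<psi>)"
    using assms unfolding bdefinable_def by blast
  then show ?thesis unfolding bdefinable_def by (intro exI[of _ "And \<phi> \<psi>"]) simp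
qed

lemma bdefinable_const: "bdefinable x (\<lambda>i P. c)"
proof (cases c)
  case True then show ?thesis unfolding bdefinable_def by (intro exI[of _ Tru]) simp
next
  case False then show ?thesis unfolding bdefinable_def by (intro exI[of _ Fls]) simp
qed

lemma bdefinable_imp:
  assumes "bdefinable x R" "bdefinable x Q" shows "bdefinable x (\<lambda>i P. R i P \<longrightarrow> Q i P)"
  using bdefinable_not[OF bdefinable_conj[OF assms(1) bdefinable_not[OF assms(2)]]] by simp

lemma bdefinable_iff_const:
  assumes "bdefinable x R" shows "bdefinable x (\<lambda>i P. R i P \<longleftrightarrow> c)"
  using assms bdefinable_not[OF assms] by (cases c) simp_all

lemma bdefinable_ex:
  assumes "bdefinable (Suc x) (\<lambda>i P. R (i 0) (\<lambda>n. i (Suc n)) P)"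
  shows "bdefinable x (\<lambda>i P. \<exists>a\<le>i x. R a i P)"
proof -
  obtain \<psi> where \<psi>: "\<forall>i P. R (i 0) (\<lambda>n. i (Suc n)) P = sat i P (relativize (Le 0 (Suc (Suc x))) \<psi>)"
    using assms unfolding bdefinable_def by blast
  have "R a i P = sat (case_nat a i) P (relativize (Le 0 (Suc (Suc x))) \<psi>)" for a i P
    using \<psi>[rule_format, of "case_nat a i" P] by simp
  then show ?thesis unfolding bdefinable_def by (intro exI[of _ "ExI \<psi>"]) simp
qed

lemma bdefinable_all:
  assumes "bdefinable (Suc x) (\<lambda>i P. R (i 0) (\<lambda>n. i (Suc n)) P)"
  shows "bdefinable x (\<lambda>i P. \<forall>a\<le>i x. R a i P)"
  using bdefinable_not[OF bdefinable_ex[of x "\<lambda>a i P. \<not> R a i P", OF bdefinable_not[OF assms]]] by simp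

lemma bdefinable_all_pred:
  assumes "bdefinable x (\<lambda>i P. R (P 0) i (\<lambda>n. P (Suc n)))"
  shows "bdefinable x (\<lambda>i P. \<forall>B. R B i P)"
proof -
  obtain \<psi> where \<psi>: "\<forall>i P. R (P 0) i (\<lambda>n. P (Suc n)) = sat i P (relativize (Le 0 (Suc x)) \<psi>)"
    using assms unfolding bdefinable_def by blast
  have "R B i P = sat i (case_nat B P) (relativize (Le 0 (Suc x)) \<psi>)" for B i P
    using \<psi>[rule_format, of "case_nat B P" i] by simp
  then show ?thesis unfolding bdefinable_def by (intro exI[of _ "Neg (ExP (Neg \<psi>))"]) simp
qed

lemma bdefinable_finite_all:
  assumes "finite F" "\<And>c. c \<in> F \<Longrightarrow> bdefinable x (R c)"
  shows "bdefinable x (\<lambda>i P. \<forall>c\<in>F. R c i P)"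
  using assms by (induction F) (simp_all add: bdefinable_const bdefinable_conj)

lemma bdefinable_finite_ex:
  assumes "finite F" "\<And>c. c \<in> F \<Longrightarrow> bdefinable x (R c)"
  shows "bdefinable x (\<lambda>i P. \<exists>c\<in>F. R c i P)"
  using bdefinable_not[OF bdefinable_finite_all[of F x "\<lambda>c i P. \<not> R c i P", OF assms(1) bdefinable_not[OF assms(2)]]]
  by simp

text \<open>A machine needs one predicate per state, hence a block of \<open>m\<close> quantifiers:
  the indices below \<open>m\<close> are bound and the others shifted back.\<close>

lemma bdefinable_all_preds:
  assumes "bdefinable x (\<lambda>i P. R P i (\<lambda>n. P (n + m)))"
  shows "bdefinable x (\<lambda>i P. \<forall>Q. R (\<lambda>k. if k < m then Q k else P (k - m)) i P)"
  using assms
proof (induction m arbitrary: R)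
  case 0 then show ?case by simp
next
  case (Suc m)
  let ?R = "\<lambda>S i P. R S i (\<lambda>n. P (Suc n))"
  have "bdefinable x (\<lambda>i P. ?R P i (\<lambda>n. P (n + m)))" using Suc.prems by simp
  from Suc.IH[of ?R, OF this]
  have "bdefinable x (\<lambda>i P. \<forall>Q. R (\<lambda>k. if k < m then Q k else P (k - m)) i (\<lambda>n. P (Suc n)))" .
  moreover have "(\<lambda>k. if k < m then Q k else P (k - m)) =
      (\<lambda>k. if k < m then Q k else if k = m then P 0 else P (Suc (k - Suc m)))" for Q and P :: "nat \<Rightarrow> nat \<Rightarrow> bool"
  proof
    fix k show "(if k < m then Q k else P (k - m)) =
      (if k < m then Q k else if k = m then P 0 else P (Suc (k - Suc m)))"
      by (cases "m < k") (simp_all add: Suc_diff_Suc)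
  qed
  ultimately have "bdefinable x (\<lambda>i P. \<forall>Q. R (\<lambda>k. if k < m then Q k else if k = m then P 0 else P (Suc (k - Suc m))) i (\<lambda>n. P (Suc n)))"
    by simp
  from bdefinable_all_pred[of x "\<lambda>B i P. \<forall>Q. R (\<lambda>k. if k < m then Q k else if k = m then B else P (k - Suc m)) i P", OF this]
  have "bdefinable x (\<lambda>i P. \<forall>B Q. R (\<lambda>k. if k < m then Q k else if k = m then B else P (k - Suc m)) i P)" .
  moreover have "(\<forall>B Q. R (\<lambda>k. if k < m then Q k else if k = m then B else P (k - Suc m)) i P) \<longleftrightarrow>
      (\<forall>Q. R (\<lambda>k. if k < Suc m then Q k else P (k - Suc m)) i P)" (is "?L \<longleftrightarrow> ?R") for i P
  proof
    assume L: ?L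
    show ?R
    proof
      fix Q
      have "(\<lambda>k. if k < Suc m then Q k else P (k - Suc m)) =
        (\<lambda>k. if k < m then Q k else if k = m then Q m else P (k - Suc m))" by (auto simp: fun_eq_iff less_Suc_eq)
      then show "R (\<lambda>k. if k < Suc m then Q k else P (k - Suc m)) i P" using L by simp
    qed
  next
    assume Rr: ?R
    show ?L
    proof (intro allI)
      fix B Q
      have "(\<lambda>k. if k < Suc m then (Q(m := B)) k else P (k - Suc m)) =
        (\<lambda>k. if k < m then Q k else if k = m then B else P (k - Suc m))" by (auto simp: fun_eq_iff less_Suc_eq)
      then show "R (\<lambda>k. if k < m then Q k else if k = m then B else P (k - Suc m)) i P"
        using Rr[rule_format, of "Q(m := B)"] by simp
    qed
  qed
  ultimately show ?case by simp
qed

section \<open>Runs of Mealy machines described by bounded formulae\<close>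

definition track_letters :: "nat \<Rightarrow> (nat \<Rightarrow> nat \<Rightarrow> bool) \<Rightarrow> nat \<Rightarrow> bool list" where
  "track_letters p P n = map (\<lambda>j. P j n) [0..<p]"

lemma track_letters_in_bits [simp]: "track_letters p P n \<in> bits p"
  by (simp add: track_letters_def bits_def)

lemma finite_bits: "finite (bits p)"
  using finite_lists_length_eq[of "UNIV :: bool set" p] by (simp add: bits_def)

text \<open>Quantifying universally over all predicates that contain the run avoids having to
  describe the run exactly.\<close>

lemma bdefinable_machine:
  fixes M :: "(nat, bool list, bool) dmm"
  assumes M: "is_dmm (bits p) UNIV M"
  shows "bdefinable 0 (\<lambda>i P. dmm_fun M (track_letters p P) (i 0))"
proof -
  have fin: "finite (dmm_states M)" and init: "dmm_init M \<in> dmm_states M"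
    and trans: "\<And>q a. q \<in> dmm_states M \<Longrightarrow> a \<in> bits p \<Longrightarrow> fst (dmm_trans M (q, a)) \<in> dmm_states M"
    using M unfolding is_dmm_def by (auto simp: Pi_iff mem_Times_iff)
  \<comment> \<open>State \<open>q\<close> becomes the predicate index \<open>q\<close>, and the
    input tracks are moved to the indices from \<open>m\<close> on.\<close>
  obtain m where m: "\<And>q. q \<in> dmm_states M \<Longrightarrow> q < m"
    using fin unfolding finite_nat_set_iff_bounded by (elim exE) auto
  define letter where "letter S a z \<longleftrightarrow> (\<forall>j\<in>{..<p}. S (j + m) z \<longleftrightarrow> a ! j)" for S :: "nat \<Rightarrow> nat \<Rightarrow> bool" and a z
  define R where "R S y \<longleftrightarrow>
     ((\<forall>z\<le>y. z = 0 \<longrightarrow> S (dmm_init M) z) \<and>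
     (\<forall>z\<le>y. \<forall>z'\<le>y. z' = Suc z \<longrightarrow> (\<forall>q\<in>dmm_states M. \<forall>a\<in>bits p. S q z \<and> letter S a z \<longrightarrow> S (fst (dmm_trans M (q, a))) z')))
     \<longrightarrow> (\<exists>q\<in>dmm_states M. \<exists>a\<in>{a \<in> bits p. snd (dmm_trans M (q, a))}. S q y \<and> letter S a y)" for S y
  have "bdefinable 0 (\<lambda>i P. R P (i 0))"
    unfolding R_def letter_def
    by (intro bdefinable_imp bdefinable_conj bdefinable_all bdefinable_finite_all bdefinable_finite_ex
        bdefinable_iff_const bdefinable_atoms) (auto simp: fin finite_bits)
  then have bd: "bdefinable 0 (\<lambda>i P. \<forall>Q. R (\<lambda>k. if k < m then Q k else P (k - m)) (i 0))"
    using bdefinable_all_preds[of 0 "\<lambda>S i P. R S (i 0)" m] by simp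
  have "(\<forall>Q. R (\<lambda>k. if k < m then Q k else P (k - m)) y) \<longleftrightarrow> dmm_fun M (track_letters p P) y" for P y
  proof -
    let ?w = "track_letters p P" and ?S = "\<lambda>Q k. if k < m then Q k else P (k - m)"
    have st: "dmm_state M ?w n \<in> dmm_states M" for n
      by (induction n) (simp_all add: init trans)
    have letter: "letter (?S Q) a z \<longleftrightarrow> a = ?w z" if "a \<in> bits p" for Q a z
      using that unfolding letter_def track_letters_def bits_def by (auto simp: list_eq_iff_nth_eq)
    have S: "?S Q q z = Q q z" if "q \<in> dmm_states M" for Q q z using m[OF that] by simp
    show ?thesis
    proof
      \<comment> \<open>Instantiating the quantified predicates by the run itself leaves only its
        actual state and letter at \<open>y\<close> as candidates for the conclusion.\<close>
      let ?Q = "\<lambda>q z. q = dmm_state M ?w z"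
      assume "\<forall>Q. R (?S Q) y"
      from spec[OF this, of ?Q] have RQ: "R (?S ?Q) y" .
      have init': "\<forall>z\<le>y. z = 0 \<longrightarrow> ?S ?Q (dmm_init M) z" using m[OF init] by simp
      have step: "?S ?Q (fst (dmm_trans M (q, a))) (Suc z)"
        if q: "q \<in> dmm_states M" and a: "a \<in> bits p" and "?S ?Q q z" "letter (?S ?Q) a z" for q a z
        using that S[OF q, of ?Q z] S[OF trans[OF q a], of ?Q "Suc z"] letter[OF a] by simp
      have "\<exists>q\<in>dmm_states M. \<exists>a\<in>{a \<in> bits p. snd (dmm_trans M (q, a))}. ?S ?Q q y \<and> letter (?S ?Q) a y"
        by (rule RQ[unfolded R_def, THEN mp], intro conjI init' allI ballI impI) (simp only: step)
      then obtain q a where "q \<in> dmm_states M" "a \<in> bits p" "snd (dmm_trans M (q, a))"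
        "?S ?Q q y" "letter (?S ?Q) a y" by auto
      then show "dmm_fun M ?w y" using S[of q ?Q y] letter[of a ?Q y] unfolding dmm_fun_def by simp
    next
      assume out: "dmm_fun M ?w y"
      show "\<forall>Q. R (?S Q) y"
      proof
        fix Q
        show "R (?S Q) y" unfolding R_def
        proof (rule impI, elim conjE)
          assume init': "\<forall>z\<le>y. z = 0 \<longrightarrow> ?S Q (dmm_init M) z"
            and step: "\<forall>z\<le>y. \<forall>z'\<le>y. z' = Suc z \<longrightarrow> (\<forall>q\<in>dmm_states M. \<forall>a\<in>bits p. ?S Q q z \<and> letter (?S Q) a z
              \<longrightarrow> ?S Q (fst (dmm_trans M (q, a))) z')"
          \<comment> \<open>Conversely, any admissible \<open>Q\<close> contains the run up to
            \<open>y\<close>; whatever else it contains, the actual state and letter witness the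
            output.\<close>
          have "z \<le> y \<Longrightarrow> ?S Q (dmm_state M ?w z) z" for z
          proof (induction z)
            case 0 then show ?case using init' m[OF init] by simp
          next
            case (Suc z)
            then show ?case
              using step[rule_format, of z "Suc z" "dmm_state M ?w z" "?w z"] st[of z] letter[of "?w z" Q z]
                m[OF st[of z]] m[OF st[of "Suc z"]] by simp
          qed
          then have "?S Q (dmm_state M ?w y) y \<and> letter (?S Q) (?w y) y"
            using letter[of "?w y" Q y] by (simp only: track_letters_in_bits order_refl)
          moreover have "?w y \<in> {a \<in> bits p. snd (dmm_trans M (dmm_state M ?w y, a))}"
            using out unfolding dmm_fun_def by simp
          ultimately show "\<exists>q\<in>dmm_states M. \<exists>a\<in>{a \<in> bits p. snd (dmm_trans M (q, a))}. ?S Q q y \<and> letter (?S Q) a y"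
            using st[of y] by (intro bexI)
        qed
      qed
    qed
  qed
  with bd show ?thesis by simp
qed

lemma machine_formula:
  assumes "finite_state_synchronous (bits p) UNIV F"
  shows "\<exists>\<chi>. uniformly_bounded_by 0 \<chi> \<and> (\<forall>i P. sat i P \<chi> = F (track_letters p P) (i 0))"
proof -
  obtain M :: "(nat, bool list, bool) dmm" where M: "is_dmm (bits p) UNIV M" "\<forall>w. (\<forall>n. w n \<in> bits p) \<longrightarrow> F w = dmm_fun M w"
    using assms unfolding finite_state_synchronous_def by blast
  obtain \<psi> where \<psi>: "\<forall>i P. dmm_fun M (track_letters p P) (i 0) = sat i P (relativize (Le 0 (Suc 0)) \<psi>)"
    using bdefinable_machine[OF M(1)] unfolding bdefinable_def by blast
  \<comment> \<open>Collapsing all individual variables to index 0 leaves 0 as the only possible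
    free one. The truth value is unaffected, as it depends on \<open>i 0\<close> alone.\<close>
  let ?\<chi> = "ren (\<lambda>_. 0) id (relativize (Le 0 (Suc 0)) \<psi>)"
  have "uniformly_bounded_by 0 ?\<chi>"
    unfolding uniformly_bounded_by_def bounded_by_def free_ind_ren
    using relativize_ren[of "\<lambda>_. 0" id 0 \<psi>] by auto
  moreover have "sat i P ?\<chi> = F (track_letters p P) (i 0)" for i P
    using M(2) \<psi>[rule_format, of P "i \<circ> (\<lambda>_. 0)"] by (simp add: sat_ren)
  ultimately show ?thesis by blast
qed

section \<open>From realizers to derivations\<close>

lemma sat_subst_pred: "sat i P (subst_pred s \<phi>) = sat i (\<lambda>X n. sat (case_nat n i) P (s X)) \<phi>"
proof (induction \<phi> arbitrary: i P s)
  case (ExI \<phi>)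
  have "case_nat a (case_nat b i) \<circ> up Suc = case_nat a i" for a b and i :: "nat \<Rightarrow> nat"
    by (auto simp: fun_eq_iff up_def split: nat.split)
  then show ?case by (simp add: ExI.IH sat_ren)
next
  case (ExP \<phi>)
  have "(\<lambda>X n. sat (case_nat n i) (case_nat A P) (case_nat (Mem 0 0) (\<lambda>X. lift_pred (s X)) X)) =
      case_nat A (\<lambda>X n. sat (case_nat n i) P (s X))" for A
    by (auto simp: fun_eq_iff sat_ren case_nat_comp split: nat.split)
  then show ?case by (simp add: ExP.IH)
qed (simp_all add: sat_inst)

lemma free_ind_subst_pred: "\<forall>X. free_ind (s X) \<subseteq> {0} \<Longrightarrow> free_ind (subst_pred s \<phi>) \<subseteq> free_ind \<phi>"
proof (induction \<phi> arbitrary: s)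
  case (Mem x X)
  then show ?case by (force simp: inst_ind_def free_ind_ren)
next
  case (ExI \<phi>)
  have "\<forall>X. free_ind (ren (up Suc) id (s X)) \<subseteq> {0}" using ExI.prems by (force simp: free_ind_ren)
  from ExI.IH[OF this] show ?case by auto
next
  case (ExP \<phi>)
  have "\<forall>X. free_ind (case_nat (Mem 0 0) (\<lambda>X. lift_pred (s X)) X) \<subseteq> {0}"
    using ExP.prems by (auto simp: free_ind_ren split: nat.split)
  from ExP.IH[OF this] show ?case by simp
next
  case (And \<phi> \<psi>) then show ?case by (simp add: le_supI1 le_supI2 sup.mono)
qed auto

abbreviation lift_subst :: "(nat \<Rightarrow> fm) \<Rightarrow> nat \<Rightarrow> fm" where
  "lift_subst s \<equiv> case_nat (Mem 0 0) (\<lambda>X. lift_pred (s X))"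

lemma subst_pred_ExP_funpow: "subst_pred s ((ExP ^^ q) \<phi>) = (ExP ^^ q) (subst_pred ((lift_subst ^^ q) s) \<phi>)"
  by (induction q arbitrary: s) (simp_all add: funpow_swap1[of lift_subst])

lemma sat_lift_subst:
  "sat (case_nat n i) P ((lift_subst ^^ q) s X) =
     (if X < q then P X n else sat (case_nat n i) (\<lambda>k. P (k + q)) (s (X - q)))"
proof (induction q arbitrary: P X)
  case (Suc q)
  then show ?case by (cases X) (simp_all add: sat_ren comp_def)
qed simp

lemma free_ind_lift_subst: "\<forall>X. free_ind (s X) \<subseteq> {0} \<Longrightarrow> free_ind ((lift_subst ^^ q) s X) \<subseteq> {0}"
proof (induction q arbitrary: X)
  case (Suc q) then show ?case by (cases X) (simp_all add: free_ind_ren)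
qed simp

text \<open>The outermost quantifier is treated first: the formula of its machine is substituted
  under the remaining \<open>q\<close> quantifiers, and the induction hypothesis applies to the
  substituted formula. Machine formulae read inputs only, so the substitutions do not interact. The
  list is read backwards because index 0 belongs to the innermost quantifier.\<close>

lemma realizable_derivable:
  assumes "length Fs = q" "\<forall>F\<in>set Fs. finite_state_synchronous (bits p) UNIV F" "free_ind \<phi> = {}"
    "\<And>i P. sat i (\<lambda>k. if k < q then (Fs ! (q - 1 - k)) (track_letters p P) else P (k - q)) \<phi>"
  shows "[] \<turnstile> (ExP ^^ q) (Neg (Neg \<phi>))"
  using assms
proof (induction q arbitrary: Fs \<phi>)
  case 0
  then show ?case using valid_derivable by simp
next
  case (Suc q)
  obtain F Fs' where Fs: "Fs = F # Fs'" using Suc.prems(1) by (cases Fs) auto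
  obtain \<chi> where \<chi>: "uniformly_bounded_by 0 \<chi>" "\<And>i P. sat i P \<chi> = F (track_letters p P) (i 0)"
    using machine_formula[of p F] Suc.prems(2) Fs by auto
  define s where "s = case_nat \<chi> (Mem 0)"
  let ?\<phi> = "subst_pred ((lift_subst ^^ q) s) \<phi>"
  have s0: "\<forall>X. free_ind (s X) \<subseteq> {0}" using \<chi>(1) unfolding s_def uniformly_bounded_by_def by (auto split: nat.split)
  have "[] \<turnstile> (ExP ^^ q) (Neg (Neg ?\<phi>))"
  proof (rule Suc.IH)
    show "length Fs' = q" "\<forall>F\<in>set Fs'. finite_state_synchronous (bits p) UNIV F" using Suc.prems Fs by auto
    show "free_ind ?\<phi> = {}"
      using free_ind_subst_pred[of "(lift_subst ^^ q) s" \<phi>] free_ind_lift_subst[OF s0] Suc.prems(3) by auto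
  next
    fix i P
    let ?P = "\<lambda>k. if k < q then (Fs' ! (q - 1 - k)) (track_letters p P) else P (k - q)"
    have "(\<lambda>X n. sat (case_nat n i) ?P ((lift_subst ^^ q) s X)) =
       (\<lambda>k. if k < Suc q then (Fs ! (Suc q - 1 - k)) (track_letters p P) else P (k - Suc q))"
    proof (intro ext)
      fix X n
      consider "X < q" | "X = q" | "X > q" by linarith
      then show "sat (case_nat n i) ?P ((lift_subst ^^ q) s X) =
         (if X < Suc q then (Fs ! (Suc q - 1 - X)) (track_letters p P) else P (X - Suc q)) n"
      proof cases
        case 1
        then have "Fs ! (q - X) = Fs' ! (q - 1 - X)" using Fs by (simp add: nth_Cons')
        with 1 show ?thesis unfolding sat_lift_subst by simp
      next
        case 2 then show ?thesis unfolding sat_lift_subst s_def using \<chi>(2) Fs by simp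
      next
        case 3
        then obtain Y where Y: "X = Suc (Y + q)" by (metis add.commute add_Suc less_iff_Suc_add)
        then show ?thesis unfolding sat_lift_subst s_def by simp
      qed
    qed
    then show "sat i ?P ?\<phi>" unfolding sat_subst_pred using Suc.prems(4)[of i P] by simp
  qed
  then have "[] \<turnstile> inst_fm \<chi> ((ExP ^^ q) (Neg (Neg \<phi>)))"
    unfolding inst_fm_def s_def[symmetric] subst_pred_ExP_funpow by simp
  then have "[] \<turnstile> ExP ((ExP ^^ q) (Neg (Neg \<phi>)))"
    by (rule derivable_rule1[OF smso_rule.synchronous_comprehension[OF \<chi>(1)]])
  then show ?case by simp
qed

theorem church_realizer_derivable:
  assumes "formula_over p q \<phi>" "church_realizer p q \<phi> Fs"
  shows "[] \<turnstile> (ExP ^^ q) (Neg (Neg \<phi>))"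
proof (rule realizable_derivable)
  show len: "length Fs = q" and "\<forall>F\<in>set Fs. finite_state_synchronous (bits p) UNIV F" "free_ind \<phi> = {}"
    using assms unfolding church_realizer_def formula_over_def by auto
  fix i and P :: "nat \<Rightarrow> nat \<Rightarrow> bool"
  let ?ws = "map P [0..<p]"
  have conv: "convolution ?ws = track_letters p P" by (auto simp: fun_eq_iff convolution_def track_letters_def)
  have "sat i (\<lambda>k. (rev (map (\<lambda>F. F (convolution ?ws)) Fs) @ ?ws) ! k) \<phi>"
    using assms(2) unfolding church_realizer_def by simp
  moreover have "(rev (map (\<lambda>F. F (convolution ?ws)) Fs) @ ?ws) ! k =
      (if k < q then (Fs ! (q - 1 - k)) (track_letters p P) else P (k - q))" if "k < q + p" for k
    using that len unfolding conv by (auto simp: nth_append rev_nth)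
  ultimately show "sat i (\<lambda>k. if k < q then (Fs ! (q - 1 - k)) (track_letters p P) else P (k - q)) \<phi>"
    using assms(1) unfolding formula_over_def
    by (subst (asm) sat_cong[of \<phi> i i _ "\<lambda>k. if k < q then (Fs ! (q - 1 - k)) (track_letters p P) else P (k - q)"]) auto
qed

section \<open>Finite-state stream functions\<close>

text \<open>Finite-state functions of a family of streams, described by a congruence instead of a
  transition function: \<open>\<sigma> U n\<close> is the state before reading the letter of \<open>U\<close> at \<open>n\<close>, of which
  only the tracks in \<open>J\<close> matter.\<close>

definition state_map :: "'x set \<Rightarrow> nat set \<Rightarrow> (('x \<Rightarrow> nat \<Rightarrow> bool) \<Rightarrow> nat \<Rightarrow> nat) \<Rightarrow>
    (('x \<Rightarrow> nat \<Rightarrow> bool) \<Rightarrow> nat \<Rightarrow> bool) \<Rightarrow> bool" where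
  "state_map J Q \<sigma> F \<longleftrightarrow> finite J \<and> finite Q \<and> (\<forall>U n. \<sigma> U n \<in> Q) \<and> (\<forall>U U'. \<sigma> U 0 = \<sigma> U' 0) \<and>
     (\<forall>U U' n n'. \<sigma> U n = \<sigma> U' n' \<longrightarrow> (\<forall>j\<in>J. U j n = U' j n') \<longrightarrow>
        \<sigma> U (Suc n) = \<sigma> U' (Suc n') \<and> F U n = F U' n')"

lemma state_mapD:
  assumes "state_map J Q \<sigma> F"
  shows "finite J" "finite Q" "\<sigma> U n \<in> Q" "\<sigma> U 0 = \<sigma> U' 0"
    "\<sigma> U n = \<sigma> U' n' \<Longrightarrow> \<forall>j\<in>J. U j n = U' j n' \<Longrightarrow> \<sigma> U (Suc n) = \<sigma> U' (Suc n') \<and> F U n = F U' n'"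
proof -
  note 1 = assms[unfolded state_map_def]
  note 2 = conjunct2[OF 1] note 3 = conjunct2[OF 2] note 4 = conjunct2[OF 3] note 5 = conjunct2[OF 4]
  show "finite J" "finite Q" "\<sigma> U n \<in> Q" "\<sigma> U 0 = \<sigma> U' 0"
    by (rule conjunct1[OF 1] conjunct1[OF 2] conjunct1[OF 3, rule_format] conjunct1[OF 4, rule_format])+
  show "\<sigma> U (Suc n) = \<sigma> U' (Suc n') \<and> F U n = F U' n'"
    if "\<sigma> U n = \<sigma> U' n'" "\<forall>j\<in>J. U j n = U' j n'"
    using 5 that by (elim allE impE) assumption+
qed

definition finite_state :: "(('x \<Rightarrow> nat \<Rightarrow> bool) \<Rightarrow> nat \<Rightarrow> bool) \<Rightarrow> bool" where
  "finite_state F \<longleftrightarrow> (\<exists>J Q \<sigma>. state_map J Q \<sigma> F)"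

lemma finite_state_track: "finite_state (\<lambda>U. U j)"
  unfolding finite_state_def state_map_def
  by (rule exI[of _ "{j}"], rule exI[of _ "{0}"], rule exI[of _ "\<lambda>_ _. 0"]) auto

lemma finite_state_const: "finite_state (\<lambda>U n. c)"
  unfolding finite_state_def state_map_def
  by (rule exI[of _ "{}"], rule exI[of _ "{0}"], rule exI[of _ "\<lambda>_ _. 0"]) auto

lemma finite_state_zero: "finite_state (\<lambda>U n. n = 0)"
  unfolding finite_state_def state_map_def
  by (rule exI[of _ "{}"], rule exI[of _ "{0, 1}"], rule exI[of _ "\<lambda>_ n. min n 1"]) (auto simp: min_def split: if_splits)

lemma finite_state_delay: "finite_state (\<lambda>U n. \<exists>m. n = Suc m \<and> U j m)"
  unfolding finite_state_def state_map_def
  by (rule exI[of _ "{j}"], rule exI[of _ "{0, 1}"], rule exI[of _ "\<lambda>U n. of_bool (\<exists>m. n = Suc m \<and> U j m)"])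
    (auto simp: of_bool_def split: if_splits)

text \<open>A state of the composition consists of a state of \<open>F\<close> and the states of
  those \<open>G j\<close> whose tracks \<open>F\<close> reads, which are finitely many. Only the
  congruence has to be checked; no transition function is composed.\<close>

lemma finite_state_compose:
  assumes F: "finite_state F" and G: "\<And>j. finite_state (G j)"
  shows "finite_state (\<lambda>U. F (\<lambda>j. G j U))"
proof -
  obtain J Q \<sigma> where F: "state_map J Q \<sigma> F" using F unfolding finite_state_def by blast
  obtain K R \<tau> where G: "\<And>j. state_map (K j) (R j) (\<tau> j) (G j)" using G unfolding finite_state_def by metis
  obtain js where js: "set js = J" using finite_list[OF state_mapD(1)[OF F]] by blast
  define \<rho> where "\<rho> U n = prod_encode (\<sigma> (\<lambda>j. G j U) n, list_encode (map (\<lambda>j. \<tau> j U n) js))" for U n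
  let ?L = "{l. set l \<subseteq> (\<Union>j\<in>J. R j) \<and> length l = length js}"
  have finJ: "finite J" and finQ: "finite Q" and finK: "\<And>j. finite (K j)" and finR: "\<And>j. finite (R j)"
    using state_mapD(1,2)[OF F] state_mapD(1,2)[OF G] by simp_all
  have "finite ?L" by (rule finite_lists_length_eq) (use finJ finR in simp)
  then have fin: "finite ((\<lambda>(a, l). prod_encode (a, list_encode l)) ` (Q \<times> ?L))" using finQ by simp
  have "state_map (\<Union>j\<in>J. K j) ((\<lambda>(a, l). prod_encode (a, list_encode l)) ` (Q \<times> ?L)) \<rho> (\<lambda>U. F (\<lambda>j. G j U))"
    unfolding state_map_def
  proof (intro conjI allI impI)
    show "finite (\<Union>j\<in>J. K j)" using finJ finK by simp
    show "finite ((\<lambda>(a, l). prod_encode (a, list_encode l)) ` (Q \<times> ?L))" by (rule fin)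
    show "\<rho> U n \<in> (\<lambda>(a, l). prod_encode (a, list_encode l)) ` (Q \<times> ?L)" for U n
    proof (rule image_eqI)
      show "\<rho> U n = (\<lambda>(a, l). prod_encode (a, list_encode l)) (\<sigma> (\<lambda>j. G j U) n, map (\<lambda>j. \<tau> j U n) js)"
        unfolding \<rho>_def by simp
      show "(\<sigma> (\<lambda>j. G j U) n, map (\<lambda>j. \<tau> j U n) js) \<in> Q \<times> ?L"
        using state_mapD(3)[OF F] state_mapD(3)[OF G] js by auto
    qed
    show "\<rho> U 0 = \<rho> U' 0" for U U'
    proof -
      have "\<tau> j U 0 = \<tau> j U' 0" for j by (rule state_mapD(4)[OF G])
      moreover have "\<sigma> (\<lambda>j. G j U) 0 = \<sigma> (\<lambda>j. G j U') 0" by (rule state_mapD(4)[OF F])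
      ultimately show ?thesis unfolding \<rho>_def by simp
    qed
    fix U U' n n' assume eq: "\<rho> U n = \<rho> U' n'" and lett: "\<forall>j\<in>(\<Union>j\<in>J. K j). U j n = U' j n'"
    have s: "\<sigma> (\<lambda>j. G j U) n = \<sigma> (\<lambda>j. G j U') n'" and t: "\<And>j. j \<in> J \<Longrightarrow> \<tau> j U n = \<tau> j U' n'"
      using eq js unfolding \<rho>_def by (auto simp: list_encode_eq)
    have g: "\<tau> j U (Suc n) = \<tau> j U' (Suc n') \<and> G j U n = G j U' n'" if "j \<in> J" for j
      by (rule state_mapD(5)[OF G t[OF that]]) (use lett that in blast)
    have f: "\<sigma> (\<lambda>j. G j U) (Suc n) = \<sigma> (\<lambda>j. G j U') (Suc n') \<and> F (\<lambda>j. G j U) n = F (\<lambda>j. G j U') n'"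
      by (rule state_mapD(5)[OF F s]) (use g in blast)
    show "\<rho> U (Suc n) = \<rho> U' (Suc n')" unfolding \<rho>_def using f g js by (auto simp: list_encode_eq)
    show "F (\<lambda>j. G j U) n = F (\<lambda>j. G j U') n'" using f by blast
  qed
  then show ?thesis unfolding finite_state_def by blast
qed

text \<open>The type of the segment before \<open>n\<close> is the state: with the letter at
  \<open>n\<close> it determines the type of the segment up to and including \<open>n\<close>, hence
  the truth of the bounded formula at \<open>n\<close> as well as the next state.\<close>

lemma finite_state_bounded:
  fixes h :: "nat \<Rightarrow> 'x"
  assumes "uniformly_bounded_by 0 \<chi>"
  shows "finite_state (\<lambda>U n. sat (\<lambda>_. n) (\<lambda>X. U (h X)) \<chi>)"
proof -
  obtain \<psi> where \<psi>: "\<chi> = relativize (Le 0 (Suc 0)) \<psi>" and free: "free_ind \<chi> \<subseteq> {0}"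
    using assms unfolding uniformly_bounded_by_def bounded_by_def by blast
  have free\<psi>: "free_ind \<psi> \<subseteq> {0}" using free free_ind_relativize unfolding \<psi> by blast
  obtain N where N: "\<forall>X\<in>free_pred \<chi> \<union> free_pred \<psi>. X < N"
    using finite_free finite_nat_set_iff_bounded[of "free_pred \<chi> \<union> free_pred \<psi>"] by auto
  define k where "k = depth \<psi>"
  \<comment> \<open>Track 0 is reserved for the singleton of the free individual variable. Cutting
    the predicates off at \<open>N\<close> makes the letter finite.\<close>
  define e where "e U B = case_nat B (\<lambda>X z. X < N \<and> U (h X) z)"
    for U :: "'x \<Rightarrow> nat \<Rightarrow> bool" and B
  \<comment> \<open>State 0 stands for the empty segment, to which \<open>tp_append\<close> does not
    apply; \<open>Suc\<close> keeps it apart from the types.\<close>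
  define \<sigma> where "\<sigma> U n = (if n = 0 then 0 else Suc (tp std k (Suc N) (e U (\<lambda>_. False)) 0 n))" for U n
  \<comment> \<open>With \<open>b\<close> false this gives the next state, in which track 0 is
    empty; with \<open>b\<close> true it evaluates the formula, with \<open>n\<close> marked on
    track 0.\<close>
  have step: "tp std k (Suc N) (e U (\<lambda>z. b \<and> z = n)) 0 (Suc n) = tp std k (Suc N) (e U' (\<lambda>z. b \<and> z = n')) 0 (Suc n')"
    if eq: "\<sigma> U n = \<sigma> U' n'" and lett: "\<forall>X<N. U (h X) n = U' (h X) n'" for U U' n n' b
  proof -
    let ?e = "e U (\<lambda>z. b \<and> z = n)" and ?e' = "e U' (\<lambda>z. b \<and> z = n')"
    have letter: "tp std k (Suc N) ?e n (h_suc std n) = tp std k (Suc N) ?e' n' (h_suc std n')"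
      by (rule tp_letter[OF henkin_model_std henkin_model_std]) (use lett in \<open>auto simp: e_def split: nat.split\<close>)
    show ?thesis
    proof (cases "n = 0")
      case True
      then have "n' = 0" using eq unfolding \<sigma>_def by (simp split: if_splits)
      then show ?thesis using letter True by simp
    next
      case False
      then have n': "n' \<noteq> 0" and *: "tp std k (Suc N) (e U (\<lambda>_. False)) 0 n = tp std k (Suc N) (e U' (\<lambda>_. False)) 0 n'"
        using eq unfolding \<sigma>_def by (auto split: if_splits)
      have "tp std k (Suc N) ?e 0 n = tp std k (Suc N) (e U (\<lambda>_. False)) 0 n"
        by (rule tp_local[OF henkin_model_std]) (use False in \<open>auto simp: e_def split: nat.split\<close>)
      moreover have "tp std k (Suc N) ?e' 0 n' = tp std k (Suc N) (e U' (\<lambda>_. False)) 0 n'"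
        by (rule tp_local[OF henkin_model_std]) (use n' in \<open>auto simp: e_def split: nat.split\<close>)
      ultimately have pre: "tp std k (Suc N) ?e 0 n = tp std k (Suc N) ?e' 0 n'" using * by simp
      have "h_lt std 0 n" "h_lt std n (h_suc std n)" "h_lt std 0 n'" "h_lt std n' (h_suc std n')"
        using False n' by auto
      from tp_append[OF henkin_model_std this(1,2) henkin_model_std this(3,4) pre letter] show ?thesis by simp
    qed
  qed
  have "state_map (h ` {..<N}) (insert 0 (Suc ` types k (Suc N))) \<sigma> (\<lambda>U n. sat (\<lambda>_. n) (\<lambda>X. U (h X)) \<chi>)"
    unfolding state_map_def
  proof (intro conjI allI impI)
    show "finite (h ` {..<N})" "finite (insert 0 (Suc ` types k (Suc N)))" using finite_types by auto
    show "\<sigma> U n \<in> insert 0 (Suc ` types k (Suc N))" for U n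
      unfolding \<sigma>_def by (simp add: imageI[OF tp_in_types])
    show "\<sigma> U 0 = \<sigma> U' 0" for U U' unfolding \<sigma>_def by simp
    fix U U' n n' assume eq: "\<sigma> U n = \<sigma> U' n'" and "\<forall>j\<in>h ` {..<N}. U j n = U' j n'"
    then have lett: "\<forall>X<N. U (h X) n = U' (h X) n'" by auto
    from step[OF eq lett, of False] show "\<sigma> U (Suc n) = \<sigma> U' (Suc n')" unfolding \<sigma>_def by simp
    have val: "sat (\<lambda>_. n) (\<lambda>X. U (h X)) \<chi> = ssat std (\<lambda>z. h_lt std z (Suc n)) (e U (\<lambda>z. z = n)) (\<lambda>_. 0) Suc \<psi>" for U n
    proof -
      have "sat (\<lambda>_. n) (\<lambda>X. U (h X)) \<chi> = sat (\<lambda>_. n) (\<lambda>X z. X < N \<and> U (h X) z) \<chi>"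
        by (rule sat_cong) (use N in auto)
      also have "\<dots> = ssat std (\<lambda>z. z < Suc n) (e U (\<lambda>z. z = n)) (\<lambda>_. 0) Suc \<psi>"
        unfolding \<psi> by (rule ssat_relativize[symmetric]) (auto simp: e_def)
      finally show ?thesis by simp
    qed
    show "sat (\<lambda>_. n) (\<lambda>X. U (h X)) \<chi> = sat (\<lambda>_. n') (\<lambda>X. U' (h X)) \<chi>"
      unfolding val
      by (rule tp_ssat[OF henkin_model_std _ henkin_model_std, where k = k and n = "Suc N"])
        (use step[OF eq lett, of True] N in \<open>auto simp: k_def\<close>)
  qed
  then show ?thesis unfolding finite_state_def by blast
qed

section \<open>Realizability\<close>

primrec rk :: "fm \<Rightarrow> nat" where
  "rk (Eq x y) = 0"
| "rk (Le x y) = 0"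
| "rk (Succ x y) = 0"
| "rk (Zero x) = 0"
| "rk (Mem x X) = 0"
| "rk Tru = 0"
| "rk Fls = 0"
| "rk (And \<phi> \<psi>) = rk \<phi> + rk \<psi>"
| "rk (Neg \<phi>) = 0"
| "rk (ExI \<phi>) = Suc (rk \<phi>)"
| "rk (ExP \<phi>) = Suc (rk \<phi>)"

text \<open>The streams \<open>\<rho> 0,\<dots>,\<rho> (rk \<phi> - 1)\<close> realize \<open>\<phi>\<close>; an individual witness is given by the
  characteristic stream of its singleton.\<close>

primrec rz :: "(nat \<Rightarrow> nat) \<Rightarrow> (nat \<Rightarrow> nat \<Rightarrow> bool) \<Rightarrow> (nat \<Rightarrow> nat \<Rightarrow> bool) \<Rightarrow> fm \<Rightarrow> bool" where
  "rz i P \<rho> (Eq x y) = sat i P (Eq x y)"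
| "rz i P \<rho> (Le x y) = sat i P (Le x y)"
| "rz i P \<rho> (Succ x y) = sat i P (Succ x y)"
| "rz i P \<rho> (Zero x) = sat i P (Zero x)"
| "rz i P \<rho> (Mem x X) = sat i P (Mem x X)"
| "rz i P \<rho> Tru = True"
| "rz i P \<rho> Fls = False"
| "rz i P \<rho> (And \<phi> \<psi>) = (rz i P \<rho> \<phi> \<and> rz i P (\<lambda>j. \<rho> (j + rk \<phi>)) \<psi>)"
| "rz i P \<rho> (Neg \<phi>) = (\<not> sat i P \<phi>)"
| "rz i P \<rho> (ExI \<phi>) = (\<exists>n. \<rho> 0 = (\<lambda>m. m = n) \<and> rz (case_nat n i) P (\<lambda>j. \<rho> (Suc j)) \<phi>)"
| "rz i P \<rho> (ExP \<phi>) = rz i (case_nat (\<rho> 0) P) (\<lambda>j. \<rho> (Suc j)) \<phi>"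

lemma rk_ren [simp]: "rk (ren r R \<phi>) = rk \<phi>"
  by (induction \<phi> arbitrary: r R) simp_all

lemma rz_ren: "rz i P \<rho> (ren r R \<phi>) = rz (i \<circ> r) (P \<circ> R) \<rho> \<phi>"
  by (induction \<phi> arbitrary: i P \<rho> r R) (simp_all add: sat_ren case_nat_comp)

lemma rz_cong: "\<forall>j<rk \<phi>. \<rho> j = \<rho>' j \<Longrightarrow> rz i P \<rho> \<phi> = rz i P \<rho>' \<phi>"
proof (induction \<phi> arbitrary: i P \<rho> \<rho>')
  case (And \<phi> \<psi>)
  have "rz i P \<rho> \<phi> = rz i P \<rho>' \<phi>" by (rule And.IH) (use And.prems in auto)
  moreover have "rz i P (\<lambda>j. \<rho> (j + rk \<phi>)) \<psi> = rz i P (\<lambda>j. \<rho>' (j + rk \<phi>)) \<psi>"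
    by (rule And.IH) (use And.prems in auto)
  ultimately show ?case by simp
next
  case (ExI \<phi>)
  have "rz (case_nat n i) P (\<lambda>j. \<rho> (Suc j)) \<phi> = rz (case_nat n i) P (\<lambda>j. \<rho>' (Suc j)) \<phi>" for n
    by (rule ExI.IH) (use ExI.prems in auto)
  then show ?case using ExI.prems by simp
next
  case (ExP \<phi>)
  have "rz i (case_nat (\<rho> 0) P) (\<lambda>j. \<rho> (Suc j)) \<phi> = rz i (case_nat (\<rho> 0) P) (\<lambda>j. \<rho>' (Suc j)) \<phi>"
    by (rule ExP.IH) (use ExP.prems in auto)
  then show ?case using ExP.prems by simp
qed simp_all

lemma rz_sat: "rz i P \<rho> \<phi> \<Longrightarrow> sat i P \<phi>"
  by (induction \<phi> arbitrary: i P \<rho>) auto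

abbreviation prepend :: "nat \<Rightarrow> (nat \<Rightarrow> 'a) \<Rightarrow> (nat \<Rightarrow> 'a) \<Rightarrow> nat \<Rightarrow> 'a" where
  "prepend n A \<rho> \<equiv> \<lambda>j. if j < n then A j else \<rho> (j - n)"

text \<open>Arbitrary streams are meant here, not finite-state functions. This suffices to discharge
  a hypothesis in the introduction of negation, whose conclusion needs no realizer.\<close>

lemma sat_rz: "sat i P \<phi> \<Longrightarrow> \<exists>\<rho>. rz i P \<rho> \<phi>"
proof (induction \<phi> arbitrary: i P)
  case (And \<phi> \<psi>)
  then have s: "sat i P \<phi>" "sat i P \<psi>" by auto
  obtain \<rho> \<rho>' where r: "rz i P \<rho> \<phi>" "rz i P \<rho>' \<psi>"
    using And.IH(1)[OF s(1)] And.IH(2)[OF s(2)] by blast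
  have "rz i P (prepend (rk \<phi>) \<rho> \<rho>') \<phi> = rz i P \<rho> \<phi>" by (rule rz_cong) simp
  with r show ?case by (intro exI[of _ "prepend (rk \<phi>) \<rho> \<rho>'"]) simp
next
  case (ExI \<phi>)
  then obtain n where n: "sat (case_nat n i) P \<phi>" by auto
  obtain \<rho> where "rz (case_nat n i) P \<rho> \<phi>" using ExI.IH[OF n] by blast
  then show ?case by (intro exI[of _ "case_nat (\<lambda>m. m = n) \<rho>"]) auto
next
  case (ExP \<phi>)
  then obtain A where A: "sat i (case_nat A P) \<phi>" by auto
  obtain \<rho> where "rz i (case_nat A P) \<rho> \<phi>" using ExP.IH[OF A] by blast
  then show ?case by (intro exI[of _ "case_nat A \<rho>"]) auto
qed auto

lemma rz_deterministic: "deterministic \<phi> \<Longrightarrow> rz i P \<rho> \<phi> = sat i P \<phi> \<and> rk \<phi> = 0"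
  by (induction \<phi> arbitrary: i P \<rho>) auto

lemma deterministic_ren [simp]: "deterministic (ren r R \<phi>) = deterministic \<phi>"
  by (induction \<phi> arbitrary: r R) simp_all

text \<open>Realizers of the substituted formulae are dropped; the remaining tracks are selected
  by \<open>\<kappa>\<close>.\<close>

lemma rz_subst_pred:
  "\<exists>\<kappa>. \<forall>i P \<rho>. rz i P \<rho> (subst_pred s \<phi>) \<longrightarrow> rz i (\<lambda>X n. sat (case_nat n i) P (s X)) (\<lambda>j. \<rho> (\<kappa> j)) \<phi>"
proof (induction \<phi> arbitrary: s)
  case (Mem x X)
  have "rz i P \<rho> (inst_ind x (s X)) \<Longrightarrow> sat (case_nat (i x) i) P (s X)" for i P \<rho>
    using rz_sat[of i P \<rho> "inst_ind x (s X)"] by (simp add: sat_inst)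
  then show ?case by auto
next
  case (And \<phi> \<psi>)
  obtain \<kappa>1 where k1: "\<And>i P \<rho>. rz i P \<rho> (subst_pred s \<phi>) \<Longrightarrow> rz i (\<lambda>X n. sat (case_nat n i) P (s X)) (\<lambda>j. \<rho> (\<kappa>1 j)) \<phi>"
    using And.IH(1)[of s] by blast
  obtain \<kappa>2 where k2: "\<And>i P \<rho>. rz i P \<rho> (subst_pred s \<psi>) \<Longrightarrow> rz i (\<lambda>X n. sat (case_nat n i) P (s X)) (\<lambda>j. \<rho> (\<kappa>2 j)) \<psi>"
    using And.IH(2)[of s] by blast
  define \<kappa> where "\<kappa> = prepend (rk \<phi>) \<kappa>1 (\<lambda>j. \<kappa>2 j + rk (subst_pred s \<phi>))"
  have "rz i (\<lambda>X n. sat (case_nat n i) P (s X)) (\<lambda>j. \<rho> (\<kappa> j)) (And \<phi> \<psi>)"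
    if "rz i P \<rho> (subst_pred s (And \<phi> \<psi>))" for i P \<rho>
  proof -
    let ?P = "\<lambda>X n. sat (case_nat n i) P (s X)"
    have "rz i ?P (\<lambda>j. \<rho> (\<kappa>1 j)) \<phi>" using k1[of i P \<rho>] that by simp
    moreover have "rz i ?P (\<lambda>j. \<rho> (\<kappa> j)) \<phi> = rz i ?P (\<lambda>j. \<rho> (\<kappa>1 j)) \<phi>"
      by (rule rz_cong) (simp add: \<kappa>_def)
    moreover have "rz i ?P (\<lambda>j. \<rho> (\<kappa> (j + rk \<phi>))) \<psi>"
      using k2[of i P "\<lambda>j. \<rho> (j + rk (subst_pred s \<phi>))"] that by (simp add: \<kappa>_def)
    ultimately show ?thesis by simp
  qed
  then show ?case by blast
next
  case (ExI \<phi>)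
  let ?s = "\<lambda>X. ren (up Suc) id (s X)"
  obtain \<kappa> where k: "\<And>i P \<rho>. rz i P \<rho> (subst_pred ?s \<phi>) \<Longrightarrow> rz i (\<lambda>X n. sat (case_nat n i) P (?s X)) (\<lambda>j. \<rho> (\<kappa> j)) \<phi>"
    using ExI.IH[of ?s] by blast
  have eq: "sat (case_nat n (case_nat a i)) P (?s X) = sat (case_nat n i) P (s X)" for n a i P X
    by (simp add: sat_ren case_nat_comp)
  have "rz i (\<lambda>X n. sat (case_nat n i) P (s X)) (\<lambda>j. \<rho> (case_nat 0 (\<lambda>j. Suc (\<kappa> j)) j)) (ExI \<phi>)"
    if "rz i P \<rho> (subst_pred s (ExI \<phi>))" for i P \<rho>
  proof -
    from that obtain n where "\<rho> 0 = (\<lambda>m. m = n)" "rz (case_nat n i) P (\<lambda>j. \<rho> (Suc j)) (subst_pred ?s \<phi>)" by auto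
    with k[of "case_nat n i" P "\<lambda>j. \<rho> (Suc j)"] show ?thesis unfolding eq by auto
  qed
  then show ?case by blast
next
  case (ExP \<phi>)
  obtain \<kappa> where k: "\<And>i P \<rho>. rz i P \<rho> (subst_pred (lift_subst s) \<phi>) \<Longrightarrow>
      rz i (\<lambda>X n. sat (case_nat n i) P (lift_subst s X)) (\<lambda>j. \<rho> (\<kappa> j)) \<phi>"
    using ExP.IH[of "lift_subst s"] by blast
  have eq: "(\<lambda>X n. sat (case_nat n i) (case_nat A P) (lift_subst s X)) =
      case_nat A (\<lambda>X n. sat (case_nat n i) P (s X))" for A i P
    by (auto simp: fun_eq_iff sat_ren case_nat_comp split: nat.split)
  have "rz i (\<lambda>X n. sat (case_nat n i) P (s X)) (\<lambda>j. \<rho> (case_nat 0 (\<lambda>j. Suc (\<kappa> j)) j)) (ExP \<phi>)"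
    if "rz i P \<rho> (subst_pred s (ExP \<phi>))" for i P \<rho>
    using k[of i "case_nat (\<rho> 0) P" "\<lambda>j. \<rho> (Suc j)"] that unfolding eq by simp
  then show ?case by blast
qed (auto simp: sat_subst_pred)

text \<open>The streams that a realizer may read: individual variables, predicate variables and
  realizers of the context. A synchronous function cannot receive a number at once, so an individual
  is presented as the stream of its singleton.\<close>

datatype track = TI nat | TP nat | TR nat

primrec env :: "(nat \<Rightarrow> nat) \<Rightarrow> (nat \<Rightarrow> nat \<Rightarrow> bool) \<Rightarrow> (nat \<Rightarrow> nat \<Rightarrow> bool) \<Rightarrow> track \<Rightarrow> nat \<Rightarrow> bool" where
  "env i P \<rho> (TI x) = (\<lambda>n. n = i x)"
| "env i P \<rho> (TP X) = P X"
| "env i P \<rho> (TR j) = \<rho> j"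

primrec rzs :: "(nat \<Rightarrow> nat) \<Rightarrow> (nat \<Rightarrow> nat \<Rightarrow> bool) \<Rightarrow> (nat \<Rightarrow> nat \<Rightarrow> bool) \<Rightarrow> fm list \<Rightarrow> bool" where
  "rzs i P \<rho> [] = True"
| "rzs i P \<rho> (\<gamma> # \<Gamma>) = (rz i P \<rho> \<gamma> \<and> rzs i P (\<lambda>j. \<rho> (j + rk \<gamma>)) \<Gamma>)"

definition realizable :: "sequent \<Rightarrow> bool" where
  "realizable c \<longleftrightarrow> (\<exists>F. (\<forall>j. finite_state (F j)) \<and>
     (\<forall>i P \<rho>. rzs i P \<rho> (fst c) \<longrightarrow> rz i P (\<lambda>j. F j (env i P \<rho>)) (snd c)))"

lemma realizableI:
  assumes "\<And>j. finite_state (F j)"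
    and "\<And>i P \<rho>. rzs i P \<rho> \<Gamma> \<Longrightarrow> rz i P (\<lambda>j. F j (env i P \<rho>)) \<phi>"
  shows "realizable (\<Gamma>, \<phi>)"
  using assms unfolding realizable_def by auto

lemma realizableE:
  assumes "realizable (\<Gamma>, \<phi>)"
  obtains F where "\<And>j. finite_state (F j)"
    "\<And>i P \<rho>. rzs i P \<rho> \<Gamma> \<Longrightarrow> rz i P (\<lambda>j. F j (env i P \<rho>)) \<phi>"
  using assms unfolding realizable_def by auto

lemma realizable_sat: "realizable (\<Gamma>, \<phi>) \<Longrightarrow> rzs i P \<rho> \<Gamma> \<Longrightarrow> sat i P \<phi>"
  using rz_sat unfolding realizable_def by fastforce

text \<open>For deterministic conclusions soundness reduces to preservation of truth; the constant
  streams are dummies.\<close>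

lemma realizable_deterministic:
  assumes "deterministic \<phi>" "\<And>i P \<rho>. rzs i P \<rho> \<Gamma> \<Longrightarrow> sat i P \<phi>"
  shows "realizable (\<Gamma>, \<phi>)"
  by (rule realizableI[of "\<lambda>_ _ _. False"]) (use assms rz_deterministic finite_state_const in auto)

lemma rzs_lift:
  "rzs (case_nat n i) P \<rho> (map lift_ind \<Gamma>) = rzs i P \<rho> \<Gamma>"
  "rzs i (case_nat A P) \<rho> (map lift_pred \<Gamma>) = rzs i P \<rho> \<Gamma>"
  by (induction \<Gamma> arbitrary: \<rho>) (simp_all add: rz_ren case_nat_comp)

lemma rzs_prepend: "rz i P A \<gamma> \<Longrightarrow> rzs i P \<rho> \<Gamma> \<Longrightarrow> rzs i P (prepend (rk \<gamma>) A \<rho>) (\<gamma> # \<Gamma>)"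
  using rz_cong[of \<gamma> "prepend (rk \<gamma>) A \<rho>" A i P] by simp

lemma rzs_member: "\<phi> \<in> set \<Gamma> \<Longrightarrow> \<exists>k. \<forall>i P \<rho>. rzs i P \<rho> \<Gamma> \<longrightarrow> rz i P (\<lambda>j. \<rho> (j + k)) \<phi>"
proof (induction \<Gamma>)
  case (Cons \<gamma> \<Gamma>)
  show ?case
  proof (cases "\<phi> = \<gamma>")
    case True then show ?thesis by (intro exI[of _ 0]) simp
  next
    case False
    with Cons obtain k where k: "\<And>i P \<rho>. rzs i P \<rho> \<Gamma> \<Longrightarrow> rz i P (\<lambda>j. \<rho> (j + k)) \<phi>" by auto
    have "rz i P (\<lambda>j. \<rho> (j + (k + rk \<gamma>))) \<phi>" if "rzs i P \<rho> (\<gamma> # \<Gamma>)" for i P \<rho>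
      using k[of i P "\<lambda>j. \<rho> (j + rk \<gamma>)"] that by (simp add: add.assoc)
    then show ?thesis by blast
  qed
qed simp

lemma rz_inst: "rz i P \<rho> (inst_ind y \<phi>) = rz (case_nat (i y) i) P \<rho> \<phi>"
  "rz i P \<rho> (inst_pred Y \<phi>) = rz i (case_nat (P Y) P) \<rho> \<phi>"
  by (simp_all add: inst_ind_def inst_pred_def rz_ren comp_case_nat)

lemma realizable_ex_ind_elim:
  assumes "realizable (\<Gamma>, ExI \<phi>)" "realizable (\<phi> # map lift_ind \<Gamma>, lift_ind \<psi>)"
  shows "realizable (\<Gamma>, \<psi>)"
proof -
  obtain F where F: "\<And>j. finite_state (F j)" "\<And>i P \<rho>. rzs i P \<rho> \<Gamma> \<Longrightarrow> rz i P (\<lambda>j. F j (env i P \<rho>)) (ExI \<phi>)"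
    by (rule realizableE[OF assms(1)], rule that)
  obtain G where G: "\<And>j. finite_state (G j)"
    "\<And>i P \<rho>. rzs i P \<rho> (\<phi> # map lift_ind \<Gamma>) \<Longrightarrow> rz i P (\<lambda>j. G j (env i P \<rho>)) (lift_ind \<psi>)"
    by (rule realizableE[OF assms(2)], rule that)
  \<comment> \<open>Rewires the tracks to the environment of the second premise: the bound variable
    reads the witness stream \<open>F 0\<close>, older variables are shifted back, and the realizers
    of \<open>\<phi>\<close> precede those of the context.\<close>
  define E where "E t = (case t of TI x \<Rightarrow> case_nat (F 0) (\<lambda>x U. U (TI x)) x | TP X \<Rightarrow> (\<lambda>U. U (TP X))
    | TR j \<Rightarrow> prepend (rk \<phi>) (\<lambda>j. F (Suc j)) (\<lambda>j U. U (TR j)) j)" for t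
  show ?thesis
  proof (rule realizableI[of "\<lambda>j U. G j (\<lambda>t. E t U)"])
    fix j
    have "finite_state (E t)" for t
      unfolding E_def using F(1) by (auto split: track.split nat.split simp: finite_state_track)
    then show "finite_state (\<lambda>U. G j (\<lambda>t. E t U))" by (rule finite_state_compose[OF G(1)])
  next
    fix i P \<rho> assume \<rho>: "rzs i P \<rho> \<Gamma>"
    let ?U = "env i P \<rho>"
    from F(2)[OF \<rho>] obtain n where n: "F 0 ?U = (\<lambda>m. m = n)" "rz (case_nat n i) P (\<lambda>j. F (Suc j) ?U) \<phi>" by auto
    let ?\<rho> = "prepend (rk \<phi>) (\<lambda>j. F (Suc j) ?U) \<rho>"
    have "env (case_nat n i) P ?\<rho> t = E t ?U" for t
      unfolding E_def using n(1) by (cases t) (auto split: nat.split)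
    then have "env (case_nat n i) P ?\<rho> = (\<lambda>t. E t ?U)" by (rule ext)
    moreover have "rzs (case_nat n i) P ?\<rho> (\<phi> # map lift_ind \<Gamma>)"
      by (rule rzs_prepend) (use n \<rho> in \<open>simp_all add: rzs_lift\<close>)
    ultimately show "rz i P (\<lambda>j. G j (\<lambda>t. E t ?U)) \<psi>"
      using G(2)[of "case_nat n i" P ?\<rho>] by (simp add: rz_ren case_nat_comp)
  qed
qed

lemma realizable_ex_pred_elim:
  assumes "realizable (\<Gamma>, ExP \<phi>)" "realizable (\<phi> # map lift_pred \<Gamma>, lift_pred \<psi>)"
  shows "realizable (\<Gamma>, \<psi>)"
proof -
  obtain F where F: "\<And>j. finite_state (F j)" "\<And>i P \<rho>. rzs i P \<rho> \<Gamma> \<Longrightarrow> rz i P (\<lambda>j. F j (env i P \<rho>)) (ExP \<phi>)"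
    by (rule realizableE[OF assms(1)], rule that)
  obtain G where G: "\<And>j. finite_state (G j)"
    "\<And>i P \<rho>. rzs i P \<rho> (\<phi> # map lift_pred \<Gamma>) \<Longrightarrow> rz i P (\<lambda>j. G j (env i P \<rho>)) (lift_pred \<psi>)"
    by (rule realizableE[OF assms(2)], rule that)
  define E where "E t = (case t of TI x \<Rightarrow> (\<lambda>U. U (TI x)) | TP X \<Rightarrow> case_nat (F 0) (\<lambda>x U. U (TP x)) X
    | TR j \<Rightarrow> prepend (rk \<phi>) (\<lambda>j. F (Suc j)) (\<lambda>j U. U (TR j)) j)" for t
  show ?thesis
  proof (rule realizableI[of "\<lambda>j U. G j (\<lambda>t. E t U)"])
    fix j
    have "finite_state (E t)" for t
      unfolding E_def using F(1) by (auto split: track.split nat.split simp: finite_state_track)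
    then show "finite_state (\<lambda>U. G j (\<lambda>t. E t U))" by (rule finite_state_compose[OF G(1)])
  next
    fix i P \<rho> assume \<rho>: "rzs i P \<rho> \<Gamma>"
    let ?U = "env i P \<rho>"
    from F(2)[OF \<rho>] have n: "rz i (case_nat (F 0 ?U) P) (\<lambda>j. F (Suc j) ?U) \<phi>" by auto
    let ?\<rho> = "prepend (rk \<phi>) (\<lambda>j. F (Suc j) ?U) \<rho>" and ?P = "case_nat (F 0 ?U) P"
    have "env i ?P ?\<rho> t = E t ?U" for t
      unfolding E_def by (cases t) (auto split: nat.split)
    then have "env i ?P ?\<rho> = (\<lambda>t. E t ?U)" by (rule ext)
    moreover have "rzs i ?P ?\<rho> (\<phi> # map lift_pred \<Gamma>)"
      by (rule rzs_prepend) (use n \<rho> in \<open>simp_all add: rzs_lift\<close>)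
    ultimately show "rz i P (\<lambda>j. G j (\<lambda>t. E t ?U)) \<psi>"
      using G(2)[of i ?P ?\<rho>] by (simp add: rz_ren case_nat_comp)
  qed
qed

lemma realizable_cut:
  assumes "realizable (\<Gamma>, \<psi>)" "realizable (\<psi> # \<Gamma>, \<phi>)"
  shows "realizable (\<Gamma>, \<phi>)"
proof -
  obtain F where F: "\<And>j. finite_state (F j)" "\<And>i P \<rho>. rzs i P \<rho> \<Gamma> \<Longrightarrow> rz i P (\<lambda>j. F j (env i P \<rho>)) \<psi>"
    by (rule realizableE[OF assms(1)], rule that)
  obtain G where G: "\<And>j. finite_state (G j)" "\<And>i P \<rho>. rzs i P \<rho> (\<psi> # \<Gamma>) \<Longrightarrow> rz i P (\<lambda>j. G j (env i P \<rho>)) \<phi>"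
    by (rule realizableE[OF assms(2)], rule that)
  define E where "E t = (case t of TR j \<Rightarrow> prepend (rk \<psi>) F (\<lambda>j U. U (TR j)) j | _ \<Rightarrow> (\<lambda>U. U t))" for t
  show ?thesis
  proof (rule realizableI[of "\<lambda>j U. G j (\<lambda>t. E t U)"])
    fix j
    have "finite_state (E t)" for t
      unfolding E_def using F(1) by (auto split: track.split simp: finite_state_track)
    then show "finite_state (\<lambda>U. G j (\<lambda>t. E t U))" by (rule finite_state_compose[OF G(1)])
  next
    fix i P \<rho> assume \<rho>: "rzs i P \<rho> \<Gamma>"
    let ?U = "env i P \<rho>"
    let ?\<rho> = "prepend (rk \<psi>) (\<lambda>j. F j ?U) \<rho>"
    have "env i P ?\<rho> t = E t ?U" for t unfolding E_def by (cases t) auto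
    then have "env i P ?\<rho> = (\<lambda>t. E t ?U)" by (rule ext)
    moreover have "rzs i P ?\<rho> (\<psi> # \<Gamma>)" by (rule rzs_prepend[OF F(2)[OF \<rho>] \<rho>])
    ultimately show "rz i P (\<lambda>j. G j (\<lambda>t. E t ?U)) \<phi>" using G(2)[of i P ?\<rho>] by simp
  qed
qed

text \<open>The witness stream evaluates \<open>\<chi>\<close> at every position, which
  \<open>finite_state_bounded\<close> turns into a finite-state function. From the realizer of the
  substituted formula, \<open>\<kappa>\<close> selects the streams belonging to
  \<open>\<psi>\<close>.\<close>

lemma realizable_synchronous:
  assumes \<chi>: "uniformly_bounded_by 0 \<chi>" and "realizable (\<Gamma>, inst_fm \<chi> \<psi>)"
  shows "realizable (\<Gamma>, ExP \<psi>)"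
proof -
  obtain F where F: "\<And>j. finite_state (F j)" "\<And>i P \<rho>. rzs i P \<rho> \<Gamma> \<Longrightarrow> rz i P (\<lambda>j. F j (env i P \<rho>)) (inst_fm \<chi> \<psi>)"
    by (rule realizableE[OF assms(2)], rule that)
  obtain \<kappa> where k: "\<And>i P \<rho>. rz i P \<rho> (inst_fm \<chi> \<psi>) \<Longrightarrow>
      rz i (\<lambda>X n. sat (case_nat n i) P (case_nat \<chi> (Mem 0) X)) (\<lambda>j. \<rho> (\<kappa> j)) \<psi>"
    using rz_subst_pred[of "case_nat \<chi> (Mem 0)" \<psi>] unfolding inst_fm_def by blast
  let ?B = "\<lambda>U n. sat (\<lambda>_. n) (\<lambda>X. U (TP X)) \<chi>"
  show ?thesis
  proof (rule realizableI[of "case_nat ?B (\<lambda>j. F (\<kappa> j))"])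
    show "finite_state (case_nat ?B (\<lambda>j. F (\<kappa> j)) j)" for j
      using F(1) finite_state_bounded[OF \<chi>, of TP] by (simp split: nat.split)
  next
    fix i P \<rho> assume \<rho>: "rzs i P \<rho> \<Gamma>"
    \<comment> \<open>Uniform boundedness: only index 0 is free, so the remaining individuals may be
      set to \<open>n\<close> as well.\<close>
    have "sat (case_nat n i) P \<chi> = sat (\<lambda>_. n) P \<chi>" for n
      by (rule sat_cong) (use \<chi> in \<open>auto simp: uniformly_bounded_by_def split: nat.split\<close>)
    then have "(\<lambda>X n. sat (case_nat n i) P (case_nat \<chi> (Mem 0) X)) = case_nat (?B (env i P \<rho>)) P"
      by (auto simp: fun_eq_iff split: nat.split)
    with k[OF F(2)[OF \<rho>]] show "rz i P (\<lambda>j. case_nat ?B (\<lambda>j. F (\<kappa> j)) j (env i P \<rho>)) (ExP \<psi>)" by simp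
  qed
qed

lemma realizable_induction:
  assumes \<delta>: "deterministic \<delta>" and zero: "realizable (Zero 0 # map lift_ind \<Gamma>, \<delta>)"
    and suc: "realizable (lift_ind \<delta> # Succ 1 0 # map (\<lambda>\<gamma>. lift_ind (lift_ind \<gamma>)) \<Gamma>, ren (up Suc) id \<delta>)"
  shows "realizable (\<Gamma>, inst_ind x \<delta>)"
proof (rule realizable_deterministic)
  show "deterministic (inst_ind x \<delta>)" using \<delta> by (simp add: inst_ind_def)
  fix i P \<rho> assume \<rho>: "rzs i P \<rho> \<Gamma>"
  have "sat (case_nat n i) P \<delta>" for n
  proof (induction n)
    case 0
    show ?case by (rule realizable_sat[OF zero, of _ _ \<rho>]) (simp add: rzs_lift \<rho>)
  next
    case (Suc n)
    let ?i = "case_nat (Suc n) (case_nat n i)"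
    have "map (\<lambda>\<gamma>. lift_ind (lift_ind \<gamma>)) \<Gamma> = map lift_ind (map lift_ind \<Gamma>)" by simp
    then have "rzs ?i P \<rho> (map (\<lambda>\<gamma>. lift_ind (lift_ind \<gamma>)) \<Gamma>)" by (simp only: rzs_lift \<rho>)
    moreover have "rz ?i P \<rho> (lift_ind \<delta>)" "rk \<delta> = 0"
      using rz_deterministic[of "lift_ind \<delta>" ?i P \<rho>] rz_deterministic[OF \<delta>] \<delta> Suc.IH
      by (simp_all add: sat_ren case_nat_comp)
    ultimately have "rzs ?i P \<rho> (lift_ind \<delta> # Succ 1 0 # map (\<lambda>\<gamma>. lift_ind (lift_ind \<gamma>)) \<Gamma>)" by simp
    from realizable_sat[OF suc this] show ?case by (simp add: sat_ren case_nat_comp)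
  qed
  then show "sat i P (inst_ind x \<delta>)" by (simp add: sat_inst)
qed

text \<open>Besides dummies for deterministic conclusions, streams that are neither given nor
  composed from given ones arise only for the existence of zero and of successors and for
  synchronous comprehension. A successor witness is the singleton stream of the given individual
  delayed by one position.\<close>

lemma smso_rule_realizable:
  assumes "smso_rule ps c" "\<forall>p\<in>set ps. realizable p"
  shows "realizable c"
  using assms
proof (induction rule: smso_rule.induct)
  case (ax \<phi> \<Gamma>)
  obtain k where "\<And>i P \<rho>. rzs i P \<rho> \<Gamma> \<Longrightarrow> rz i P (\<lambda>j. \<rho> (j + k)) \<phi>" using rzs_member[OF ax(1)] by blast
  then show ?case by (intro realizableI[of "\<lambda>j U. U (TR (j + k))"]) (simp_all add: finite_state_track)
next
  case (cut \<Gamma> \<psi> \<phi>) then show ?case using realizable_cut[of \<Gamma> \<psi> \<phi>] by simp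
next
  case (neg_elim \<Gamma> \<phi>)
  then have "realizable (\<Gamma>, \<phi>)" "realizable (\<Gamma>, Neg \<phi>)" by simp_all
  from realizable_sat[OF this(1)] realizable_sat[OF this(2)] show ?case
    by (intro realizable_deterministic) auto
next
  case (neg_intro \<phi> \<Gamma>)
  then have r: "realizable (\<phi> # \<Gamma>, Fls)" by simp
  show ?case
  proof (rule realizable_deterministic)
    fix i P \<rho> assume \<rho>: "rzs i P \<rho> \<Gamma>"
    show "sat i P (Neg \<phi>)"
    proof (rule ccontr)
      assume "\<not> sat i P (Neg \<phi>)"
      then obtain A where "rz i P A \<phi>" using sat_rz[of i P \<phi>] by auto
      from realizable_sat[OF r rzs_prepend[OF this \<rho>]] show False by simp
    qed
  qed simp
next
  case (and_intro \<Gamma> \<phi> \<psi>)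
  then have r: "realizable (\<Gamma>, \<phi>)" "realizable (\<Gamma>, \<psi>)" by simp_all
  obtain F where F: "\<And>j. finite_state (F j)" "\<And>i P \<rho>. rzs i P \<rho> \<Gamma> \<Longrightarrow> rz i P (\<lambda>j. F j (env i P \<rho>)) \<phi>"
    by (rule realizableE[OF r(1)], rule that)
  obtain G where G: "\<And>j. finite_state (G j)" "\<And>i P \<rho>. rzs i P \<rho> \<Gamma> \<Longrightarrow> rz i P (\<lambda>j. G j (env i P \<rho>)) \<psi>"
    by (rule realizableE[OF r(2)], rule that)
  show ?case
  proof (rule realizableI[of "prepend (rk \<phi>) F G"])
    fix i P \<rho> assume "rzs i P \<rho> \<Gamma>"
    from F(2)[OF this] G(2)[OF this]
    show "rz i P (\<lambda>j. prepend (rk \<phi>) F G j (env i P \<rho>)) (And \<phi> \<psi>)"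
      using rz_cong[of \<phi> "\<lambda>j. prepend (rk \<phi>) F G j (env i P \<rho>)" "\<lambda>j. F j (env i P \<rho>)" i P] by simp
  qed (use F G in auto)
next
  case (and_elim1 \<Gamma> \<phi> \<psi>)
  then have r: "realizable (\<Gamma>, And \<phi> \<psi>)" by simp
  obtain F where F: "\<And>j. finite_state (F j)" "\<And>i P \<rho>. rzs i P \<rho> \<Gamma> \<Longrightarrow> rz i P (\<lambda>j. F j (env i P \<rho>)) (And \<phi> \<psi>)"
    by (rule realizableE[OF r], rule that)
  show ?case by (rule realizableI[of F]) (use F in auto)
next
  case (and_elim2 \<Gamma> \<phi> \<psi>)
  then have r: "realizable (\<Gamma>, And \<phi> \<psi>)" by simp
  obtain F where F: "\<And>j. finite_state (F j)" "\<And>i P \<rho>. rzs i P \<rho> \<Gamma> \<Longrightarrow> rz i P (\<lambda>j. F j (env i P \<rho>)) (And \<phi> \<psi>)"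
    by (rule realizableE[OF r], rule that)
  show ?case by (rule realizableI[of "\<lambda>j. F (j + rk \<phi>)"]) (use F in auto)
next
  case (ex_ind_intro \<Gamma> y \<phi>)
  then have r: "realizable (\<Gamma>, inst_ind y \<phi>)" by simp
  obtain F where F: "\<And>j. finite_state (F j)" "\<And>i P \<rho>. rzs i P \<rho> \<Gamma> \<Longrightarrow> rz i P (\<lambda>j. F j (env i P \<rho>)) (inst_ind y \<phi>)"
    by (rule realizableE[OF r], rule that)
  show ?case
    by (rule realizableI[of "case_nat (\<lambda>U. U (TI y)) F"])
      (use F in \<open>auto simp: finite_state_track rz_inst split: nat.split\<close>)
next
  case (ex_pred_intro \<Gamma> Y \<phi>)
  then have r: "realizable (\<Gamma>, inst_pred Y \<phi>)" by simp
  obtain F where F: "\<And>j. finite_state (F j)" "\<And>i P \<rho>. rzs i P \<rho> \<Gamma> \<Longrightarrow> rz i P (\<lambda>j. F j (env i P \<rho>)) (inst_pred Y \<phi>)"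
    by (rule realizableE[OF r], rule that)
  show ?case
    by (rule realizableI[of "case_nat (\<lambda>U. U (TP Y)) F"])
      (use F in \<open>auto simp: finite_state_track rz_inst split: nat.split\<close>)
next
  case (ex_ind_elim \<Gamma> \<phi> \<psi>) then show ?case using realizable_ex_ind_elim[of \<Gamma> \<phi> \<psi>] by simp
next
  case (ex_pred_elim \<Gamma> \<phi> \<psi>) then show ?case using realizable_ex_pred_elim[of \<Gamma> \<phi> \<psi>] by simp
next
  case (eq_subst \<Gamma> y \<phi> z)
  then have r: "realizable (\<Gamma>, inst_ind y \<phi>)" "realizable (\<Gamma>, Eq y z)" by simp_all
  obtain F where F: "\<And>j. finite_state (F j)" "\<And>i P \<rho>. rzs i P \<rho> \<Gamma> \<Longrightarrow> rz i P (\<lambda>j. F j (env i P \<rho>)) (inst_ind y \<phi>)"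
    by (rule realizableE[OF r(1)], rule that)
  show ?case
  proof (rule realizableI[of F, OF F(1)])
    fix i P \<rho> assume \<rho>: "rzs i P \<rho> \<Gamma>"
    from F(2)[OF \<rho>] realizable_sat[OF r(2) \<rho>] show "rz i P (\<lambda>j. F j (env i P \<rho>)) (inst_ind z \<phi>)"
      by (simp add: rz_inst)
  qed
next
  case (zero_ex \<Gamma>)
  show ?case by (rule realizableI[of "\<lambda>_ U n. n = 0"]) (auto simp: finite_state_zero)
next
  case (succ_ex \<Gamma> x)
  show ?case
    by (rule realizableI[of "\<lambda>_ U n. \<exists>m. n = Suc m \<and> U (TI x) m"]) (auto simp: finite_state_delay)
next
  case (negative_comprehension \<Gamma> \<psi> \<phi>)
  then have r: "realizable (\<Gamma>, inst_fm \<psi> \<phi>)" by simp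
  show ?case
  proof (rule realizable_deterministic)
    fix i P \<rho> assume "rzs i P \<rho> \<Gamma>"
    from realizable_sat[OF r this]
    have "sat i (\<lambda>X n. sat (case_nat n i) P (case_nat \<psi> (Mem 0) X)) \<phi>"
      unfolding inst_fm_def sat_subst_pred .
    moreover have "(\<lambda>X n. sat (case_nat n i) P (case_nat \<psi> (Mem 0) X)) = case_nat (\<lambda>n. sat (case_nat n i) P \<psi>) P"
      by (auto simp: fun_eq_iff split: nat.split)
    ultimately show "sat i P (Neg (Neg (ExP \<phi>)))" by auto
  qed simp
next
  case (induction \<delta> \<Gamma> x) then show ?case using realizable_induction[of \<delta> \<Gamma> x] by simp
next
  case (dne \<delta> \<Gamma>)
  then have r: "realizable (\<Gamma>, Neg (Neg \<delta>))" by simp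
  show ?case by (rule realizable_deterministic[OF dne(1)]) (use realizable_sat[OF r] in auto)
next
  case (synchronous_comprehension \<chi> \<Gamma> \<psi>) then show ?case using realizable_synchronous[of \<chi> \<Gamma> \<psi>] by simp
next
  case (le_trans \<Gamma> x y z)
  then have "realizable (\<Gamma>, Le x y)" "realizable (\<Gamma>, Le y z)" by simp_all
  from realizable_sat[OF this(1)] realizable_sat[OF this(2)] show ?case
    by (intro realizable_deterministic) fastforce+
next
  case (le_antisym \<Gamma> x y)
  then have "realizable (\<Gamma>, Le x y)" "realizable (\<Gamma>, Le y x)" by simp_all
  from realizable_sat[OF this(1)] realizable_sat[OF this(2)] show ?case
    by (intro realizable_deterministic) fastforce+
next
  case (zero_unique \<Gamma> x y)
  then have "realizable (\<Gamma>, Zero x)" "realizable (\<Gamma>, Zero y)" by simp_all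
  from realizable_sat[OF this(1)] realizable_sat[OF this(2)] show ?case
    by (intro realizable_deterministic) fastforce+
next
  case (succ_inj \<Gamma> y x z)
  then have "realizable (\<Gamma>, Succ y x)" "realizable (\<Gamma>, Succ z x)" by simp_all
  from realizable_sat[OF this(1)] realizable_sat[OF this(2)] show ?case
    by (intro realizable_deterministic) fastforce+
next
  case (succ_unique \<Gamma> x y z)
  then have "realizable (\<Gamma>, Succ x y)" "realizable (\<Gamma>, Succ x z)" by simp_all
  from realizable_sat[OF this(1)] realizable_sat[OF this(2)] show ?case
    by (intro realizable_deterministic) fastforce+
next
  case (succ_not_zero \<Gamma> x y)
  then have "realizable (\<Gamma>, Succ x y)" "realizable (\<Gamma>, Zero y)" by simp_all
  from realizable_sat[OF this(1)] realizable_sat[OF this(2)] show ?case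
    by (intro realizable_deterministic) fastforce+
next
  case (succ_le \<Gamma> x y)
  then have "realizable (\<Gamma>, Succ x y)" by simp
  from realizable_sat[OF this] show ?case by (intro realizable_deterministic) fastforce+
next
  case (le_succ \<Gamma> y y' x)
  then have r: "realizable (\<Gamma>, Succ y y')" "realizable (\<Gamma>, Le x y')" "realizable (\<Gamma>, Neg (Eq x y'))" by simp_all
  show ?case
  proof (rule realizable_deterministic)
    fix i P \<rho> assume "rzs i P \<rho> \<Gamma>"
    from realizable_sat[OF r(1) this] realizable_sat[OF r(2) this] realizable_sat[OF r(3) this]
    show "sat i P (Le x y)" by simp
  qed simp
qed (rule realizable_deterministic; simp)+

theorem derivation_realizable: "is_derivation d \<Longrightarrow> realizable (conclusion d)"
proof (induction rule: is_derivation.induct)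
  case (1 ds c)
  then show ?case using smso_rule_realizable[of "map conclusion ds" c] by auto
qed


section \<open>Transition tables\<close>

lemma horner_sum_bits_inj:
  "horner_sum of_bool (2::nat) a = horner_sum of_bool 2 b \<Longrightarrow> length a = length b \<Longrightarrow> a = b"
proof (induction a arbitrary: b)
  case (Cons x a)
  then obtain y b' where b: "b = y # b'" by (cases b) auto
  have eq: "of_bool x + 2 * horner_sum of_bool 2 a = (of_bool y + 2 * horner_sum of_bool 2 b' :: nat)"
    using Cons.prems(1) b by simp
  have "x = y"
  proof (rule ccontr)
    assume "x \<noteq> y"
    with eq show False by (cases x; cases y; simp; presburger)
  qed
  then show ?case using Cons.IH[of b'] Cons.prems b eq by simp
qed simp

text \<open>The table is read off from runs: an entry records the next state and the output of some
  run that meets this state with this letter. The congruence makes all such runs agree, so the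
  choice does not matter.\<close>

lemma table_of_finite_state:
  assumes "finite_state F"
  shows "\<exists>T. wf_table p T \<and> (\<forall>w. (\<forall>n. w n \<in> bits p) \<longrightarrow> dmm_fun (table_dmm T) w = F (\<lambda>k n. k < p \<and> w n ! k))"
proof -
  obtain J Q \<sigma> where F: "state_map J Q \<sigma> F" using assms unfolding finite_state_def by blast
  obtain N where N: "\<forall>s\<in>Q. s < N"
    using state_mapD(2)[OF F] unfolding finite_nat_set_iff_bounded by blast
  define U where "U w k n \<longleftrightarrow> k < p \<and> w n ! k" for w :: "nat \<Rightarrow> bool list" and k n
  have \<sigma>: "\<sigma> V n < N" for V n using N state_mapD(3)[OF F] by blast
  define ok where "ok s m wn \<longleftrightarrow> (\<forall>n. fst wn n \<in> bits p) \<and> \<sigma> (U (fst wn)) (snd wn) = s \<and>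
    horner_sum of_bool 2 (fst wn (snd wn)) = m" for s m :: nat and wn
  \<comment> \<open>Pairs of state and letter that no run meets get the default
    \<open>(0, False)\<close>, which is well-formed since \<open>0 < N\<close>.\<close>
  define entry where "entry s m = (if \<exists>wn. ok s m wn
    then (let wn = SOME wn. ok s m wn in (\<sigma> (U (fst wn)) (Suc (snd wn)), F (U (fst wn)) (snd wn))) else (0, False))" for s m
  define T where "T = (\<sigma> (\<lambda>_ _. False) 0, map (\<lambda>s. map (entry s) [0..<2 ^ p]) [0..<N])"
  have "0 < N" using \<sigma>[of "\<lambda>_ _. False" 0] by simp
  have "fst (entry s m) < N" for s m unfolding entry_def using \<sigma> \<open>0 < N\<close> by (auto simp: Let_def)
  then have wf: "wf_table p T" unfolding wf_table_def T_def using \<sigma> by (auto simp: split_beta)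
  have entry: "entry (\<sigma> (U w) n) (horner_sum of_bool 2 (w n)) = (\<sigma> (U w) (Suc n), F (U w) n)"
    if w: "\<forall>n. w n \<in> bits p" for w n
  proof -
    let ?s = "\<sigma> (U w) n" and ?m = "horner_sum of_bool 2 (w n)"
    have ex: "ok ?s ?m (w, n)" unfolding ok_def using w by simp
    obtain w' n' where w': "(SOME wn. ok ?s ?m wn) = (w', n')" by fastforce
    have "ok ?s ?m (w', n')" using someI[of "ok ?s ?m", OF ex] unfolding w' .
    then have "\<sigma> (U w') n' = ?s" and "w' n' = w n"
      unfolding ok_def using w horner_sum_bits_inj[of "w' n'" "w n"] by (auto simp: bits_def)
    then have "\<sigma> (U w') (Suc n') = \<sigma> (U w) (Suc n) \<and> F (U w') n' = F (U w) n"
      by (intro state_mapD(5)[OF F]) (simp_all add: U_def)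
    moreover have "entry ?s ?m = (\<sigma> (U w') (Suc n'), F (U w') n')"
      unfolding entry_def using ex w' by (auto simp: Let_def)
    ultimately show ?thesis by simp
  qed
  have "dmm_fun (table_dmm T) w = F (U w)" if w: "\<forall>n. w n \<in> bits p" for w
  proof -
    have hs: "horner_sum of_bool 2 (w n) < (2::nat) ^ p" for n
      using horner_sum_bits_less[of "w n"] w by (simp add: bits_def)
    have tr: "dmm_trans (table_dmm T) (\<sigma> (U w) n, w n) = (\<sigma> (U w) (Suc n), F (U w) n)" for n
      using entry[OF w, of n] \<sigma>[of "U w" n] hs[of n] unfolding table_dmm_def T_def by simp
    have st: "dmm_state (table_dmm T) w n = \<sigma> (U w) n" for n
    proof (induction n)
      case 0
      have "\<sigma> (\<lambda>_ _. False) 0 = \<sigma> (U w) 0" by (rule state_mapD(4)[OF F])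
      then show ?case by (simp add: table_dmm_def T_def)
    next
      case (Suc n) then show ?case using tr[of n] by simp
    qed
    show ?thesis by (rule ext) (simp add: dmm_fun_def st tr)
  qed
  moreover have "U w = (\<lambda>k n. k < p \<and> w n ! k)" for w unfolding U_def by (intro ext) simp
  ultimately show ?thesis using wf by (intro exI[of _ T]) simp
qed

lemma rz_ExP_funpow:
  "rz i P \<rho> ((ExP ^^ q) \<phi>) \<Longrightarrow> sat i (\<lambda>k. if k < q then \<rho> (q - 1 - k) else P (k - q)) \<phi>"
proof (induction q arbitrary: P \<rho>)
  case 0 then show ?case using rz_sat by simp
next
  case (Suc q)
  then have "sat i (\<lambda>k. if k < q then \<rho> (Suc (q - 1 - k)) else case_nat (\<rho> 0) P (k - q)) \<phi>" by auto
  moreover have "(\<lambda>k. if k < q then \<rho> (Suc (q - 1 - k)) else case_nat (\<rho> 0) P (k - q)) =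
      (\<lambda>k. if k < Suc q then \<rho> (Suc q - 1 - k) else P (k - Suc q))"
  proof
    fix k
    consider "k < q" | "k = q" | "q < k" by linarith
    then show "(if k < q then \<rho> (Suc (q - 1 - k)) else case_nat (\<rho> 0) P (k - q)) =
        (if k < Suc q then \<rho> (Suc q - 1 - k) else P (k - Suc q))"
    proof cases
      case 1
      then have "Suc (q - 1 - k) = q - k" by simp
      with 1 show ?thesis by simp
    next
      case 3
      then have "k - q = Suc (k - Suc q)" by simp
      with 3 show ?thesis by simp
    qed simp
  qed
  ultimately show ?case by simp
qed

theorem derivation_tables:
  assumes "is_derivation d" "conclusion d = ([], (ExP ^^ q) \<phi>)" "formula_over p q \<phi>"
  shows "\<exists>Ts. (\<forall>T\<in>set Ts. wf_table p T) \<and> church_realizer p q \<phi> (map (\<lambda>T. dmm_fun (table_dmm T)) Ts)"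
proof -
  have r: "realizable ([], (ExP ^^ q) \<phi>)" using derivation_realizable[OF assms(1)] assms(2) by simp
  obtain F where F: "\<And>j. finite_state (F j)"
    "\<And>i P \<rho>. rzs i P \<rho> [] \<Longrightarrow> rz i P (\<lambda>j. F j (env i P \<rho>)) ((ExP ^^ q) \<phi>)"
    by (rule realizableE[OF r], rule that)
  \<comment> \<open>\<open>\<phi>\<close> has no free individual variable and the context is empty,
    so all individuals are set to 0 and the tracks of context realizers are empty; only the inputs
    remain.\<close>
  define E :: "track \<Rightarrow> (nat \<Rightarrow> nat \<Rightarrow> bool) \<Rightarrow> nat \<Rightarrow> bool"
    where "E t = (case t of TI x \<Rightarrow> (\<lambda>U n. n = 0) | TP X \<Rightarrow> (\<lambda>U. U X) | TR j \<Rightarrow> (\<lambda>U n. False))" for t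
  have "finite_state (E t)" for t
    unfolding E_def by (cases t) (simp_all add: finite_state_zero finite_state_track finite_state_const)
  then have "finite_state (\<lambda>U. F j (\<lambda>t. E t U))" for j by (rule finite_state_compose[OF F(1)])
  from table_of_finite_state[OF this, of p]
  have "\<forall>j. \<exists>T. wf_table p T \<and> (\<forall>w. (\<forall>n. w n \<in> bits p) \<longrightarrow>
      dmm_fun (table_dmm T) w = F j (\<lambda>t. E t (\<lambda>k n. k < p \<and> w n ! k)))" by (rule allI)
  from choice[OF this] obtain T where T': "\<forall>j. wf_table p (T j) \<and> (\<forall>w. (\<forall>n. w n \<in> bits p) \<longrightarrow>
      dmm_fun (table_dmm (T j)) w = F j (\<lambda>t. E t (\<lambda>k n. k < p \<and> w n ! k)))" by (elim exE)
  have T: "wf_table p (T j)" for j by (rule conjunct1[OF spec[OF T']])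
  have T2: "dmm_fun (table_dmm (T j)) w = F j (\<lambda>t. E t (\<lambda>k n. k < p \<and> w n ! k))"
    if "\<forall>n. w n \<in> bits p" for j w
    by (rule mp[OF spec[OF conjunct2[OF spec[OF T']]] that])
  let ?Ts = "map T [0..<q]" and ?Fs = "map (\<lambda>j. dmm_fun (table_dmm (T j))) [0..<q]"
  have "church_realizer p q \<phi> ?Fs"
    unfolding church_realizer_def
  proof (intro conjI ballI allI impI)
    show "length ?Fs = q" by simp
    fix G assume "G \<in> set ?Fs"
    then obtain j where "G = dmm_fun (table_dmm (T j))" by auto
    then show "finite_state_synchronous (bits p) UNIV G"
      unfolding finite_state_synchronous_def using is_dmm_table_dmm[OF T] by blast
  next
    fix ws :: "(nat \<Rightarrow> bool) list" and i assume len: "length ws = p"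
    define P where "P X n \<longleftrightarrow> X < p \<and> (ws ! X) n" for X n
    have bits: "\<forall>n. convolution ws n \<in> bits p" using len by (simp add: convolution_def bits_def)
    have P: "(\<lambda>k n. k < p \<and> convolution ws n ! k) = P"
      using len unfolding P_def convolution_def by (auto simp: fun_eq_iff)
    have env: "env (\<lambda>_. 0) P (\<lambda>_ _. False) = (\<lambda>t. E t P)"
    proof
      fix t show "env (\<lambda>_. 0) P (\<lambda>_ _. False) t = E t P" unfolding E_def by (cases t) auto
    qed
    have "sat (\<lambda>_. 0) (\<lambda>k. if k < q then F (q - 1 - k) (\<lambda>t. E t P) else P (k - q)) \<phi>"
      using rz_ExP_funpow[OF F(2)[of "\<lambda>_. 0" P "\<lambda>_ _. False"]] unfolding env by simp
    moreover have "(rev (map (\<lambda>F. F (convolution ws)) ?Fs) @ ws) ! k =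
        (if k < q then F (q - 1 - k) (\<lambda>t. E t P) else P (k - q))" if "k < q + p" for k
      using that len T2[OF bits] unfolding P by (auto simp: nth_append rev_nth P_def fun_eq_iff)
    ultimately show "sat i (\<lambda>k. (rev (map (\<lambda>F. F (convolution ws)) ?Fs) @ ws) ! k) \<phi>"
      using assms(3) unfolding formula_over_def
      by (subst sat_cong[of \<phi> i "\<lambda>_. 0" _ "\<lambda>k. if k < q then F (q - 1 - k) (\<lambda>t. E t P) else P (k - q)"]) auto
  qed
  then show ?thesis using T by (intro exI[of _ ?Ts]) (simp add: comp_def)
qed

section \<open>Total recursive functions\<close>

text \<open>Arguments are entries of an assignment, so that recursive functions can be written as
  terms with de Bruijn variables. Only the first \<open>n\<close> entries are passed to the
  program.\<close>

definition rec_fn :: "nat \<Rightarrow> ((nat \<Rightarrow> nat) \<Rightarrow> nat) \<Rightarrow> bool" where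
  "rec_fn n f \<longleftrightarrow> (\<exists>e. \<forall>s. recf_eval e (map s [0..<n]) (f s))"

definition rec_pred :: "nat \<Rightarrow> ((nat \<Rightarrow> nat) \<Rightarrow> bool) \<Rightarrow> bool" where
  "rec_pred n P \<longleftrightarrow> rec_fn n (\<lambda>s. of_bool (P s))"

lemma rec_fn_var: "i < n \<Longrightarrow> rec_fn n (\<lambda>s. s i)"
  unfolding rec_fn_def using recf_eval.proj[of i "map _ [0..<n]"] by (intro exI[of _ "Proj i"]) force

lemma rec_fn_compose:
  assumes g: "rec_fn (length fs) g" and fs: "\<forall>f\<in>set fs. rec_fn n f"
  shows "rec_fn n (\<lambda>s. g (\<lambda>i. (fs ! i) s))"
proof -
  obtain e where e: "\<And>s. recf_eval e (map s [0..<length fs]) (g s)" using g unfolding rec_fn_def by blast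
  have "\<forall>f\<in>set fs. \<exists>d. \<forall>s. recf_eval d (map s [0..<n]) (f s)" using fs unfolding rec_fn_def .
  then obtain D where D: "\<forall>f\<in>set fs. \<forall>s. recf_eval (D f) (map s [0..<n]) (f s)" by (rule bchoice[THEN exE])
  have "recf_eval (Comp e (map D fs)) (map s [0..<n]) (g (\<lambda>i. (fs ! i) s))" for s
  proof (rule recf_eval.comp)
    show "list_all2 (\<lambda>g y. recf_eval g (map s [0..<n]) y) (map D fs) (map (\<lambda>i. (fs ! i) s) [0..<length fs])"
      using D by (auto simp: list_all2_conv_all_nth)
    show "recf_eval e (map (\<lambda>i. (fs ! i) s) [0..<length fs]) (g (\<lambda>i. (fs ! i) s))" by (rule e)
  qed
  then show ?thesis unfolding rec_fn_def by blast
qed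

lemma rec_fn_local:
  assumes "rec_fn n h" "\<forall>i<n. s i = t i"
  shows "h s = h t"
proof -
  obtain e where e: "\<And>s. recf_eval e (map s [0..<n]) (h s)" using assms(1) unfolding rec_fn_def by blast
  have "map s [0..<n] = map t [0..<n]" using assms(2) by simp
  then have "recf_eval e (map s [0..<n]) (h t)" using e[of t] by (simp only:)
  then show ?thesis by (rule recf_eval_deterministic[OF e])
qed

lemma rec_fn_subst:
  assumes g: "rec_fn m g" and F: "\<And>i. i < m \<Longrightarrow> rec_fn n (F i)"
  shows "rec_fn n (\<lambda>s. g (\<lambda>i. F i s))"
proof -
  have "rec_fn n (\<lambda>s. g (\<lambda>i. (map F [0..<m] ! i) s))"
    by (rule rec_fn_compose) (use g F in auto)
  moreover have "g (\<lambda>i. (map F [0..<m] ! i) s) = g (\<lambda>i. F i s)" for s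
    by (rule rec_fn_local[OF g]) simp
  ultimately show ?thesis by simp
qed

lemma rec_fn_app1:
  assumes "rec_fn 1 (\<lambda>s. g (s 0))" "rec_fn n a"
  shows "rec_fn n (\<lambda>s. g (a s))"
  using rec_fn_compose[of "[a]" "\<lambda>s. g (s 0)" n] assms by simp

lemma rec_fn_app2:
  assumes "rec_fn 2 (\<lambda>s. g (s 0) (s (Suc 0)))" "rec_fn n a" "rec_fn n b"
  shows "rec_fn n (\<lambda>s. g (a s) (b s))"
  using rec_fn_compose[of "[a, b]" "\<lambda>s. g (s 0) (s (Suc 0))" n] assms by (simp add: numeral_2_eq_2)

lemma rec_fn_Suc:
  assumes "rec_fn n a" shows "rec_fn n (\<lambda>s. Suc (a s))"
proof (rule rec_fn_app1[OF _ assms])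
  show "rec_fn 1 (\<lambda>s. Suc (s 0))"
    unfolding rec_fn_def using recf_eval.succ by (intro exI[of _ SuccR]) simp
qed

lemma rec_fn_const: "rec_fn n (\<lambda>s. c)"
proof (induction c)
  case 0
  show ?case unfolding rec_fn_def using recf_eval.zero by blast
next
  case (Suc c) then show ?case by (rule rec_fn_Suc)
qed

lemma map_case_nat_upt: "map (case_nat a s) [0..<Suc n] = a # map s [0..<n]"
  by (simp add: map_upt_Suc del: upt_Suc)

lemma rec_fn_rec_nat:
  assumes m: "rec_fn n m" and f: "rec_fn n f"
    and g: "rec_fn (Suc (Suc n)) (\<lambda>s. g (s 0) (s (Suc 0)) (\<lambda>i. s (Suc (Suc i))))"
  shows "rec_fn n (\<lambda>s. rec_nat (f s) (\<lambda>k r. g k r s) (m s))"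
proof -
  obtain ef where ef: "\<And>s. recf_eval ef (map s [0..<n]) (f s)" using f unfolding rec_fn_def by blast
  obtain eg where eg: "\<And>s. recf_eval eg (map s [0..<Suc (Suc n)]) (g (s 0) (s (Suc 0)) (\<lambda>i. s (Suc (Suc i))))"
    using g unfolding rec_fn_def by blast
  have eg': "recf_eval eg (k # r # map s [0..<n]) (g k r s)" for k r s
    using eg[of "case_nat k (case_nat r s)"] unfolding map_case_nat_upt by simp
  have "recf_eval (PrimRec ef eg) (k # map s [0..<n]) (rec_nat (f s) (\<lambda>k r. g k r s) k)" for k s
    by (induction k) (auto intro: recf_eval.primrec_0 recf_eval.primrec_Suc ef eg')
  then have "recf_eval (PrimRec ef eg) (map s [0..<Suc n]) (rec_nat (f (\<lambda>i. s (Suc i))) (\<lambda>k r. g k r (\<lambda>i. s (Suc i))) (s 0))" for s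
    by (simp add: map_upt_Suc del: upt_Suc)
  then have *: "rec_fn (Suc n) (\<lambda>s. rec_nat (f (\<lambda>i. s (Suc i))) (\<lambda>k r. g k r (\<lambda>i. s (Suc i))) (s 0))"
    unfolding rec_fn_def by blast
  have "rec_fn n (case_nat m (\<lambda>i s. s i) i)" if "i < Suc n" for i
    using that m by (auto intro: rec_fn_var split: nat.split)
  from rec_fn_subst[where F = "case_nat m (\<lambda>i s. s i)", OF * this] show ?thesis by simp
qed

lemma rec_fn_add: "rec_fn n a \<Longrightarrow> rec_fn n b \<Longrightarrow> rec_fn n (\<lambda>s. a s + b s)"
proof (rule rec_fn_app2[of "(+)"])
  have "rec_nat x (\<lambda>k r. Suc r) y = x + y" for x y :: nat by (induction y) auto
  moreover have "rec_fn 2 (\<lambda>s. rec_nat (s 0) (\<lambda>k r. Suc r) (s (Suc 0)))"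
    by (intro rec_fn_rec_nat rec_fn_Suc rec_fn_var) simp_all
  ultimately show "rec_fn 2 (\<lambda>s. s 0 + s (Suc 0))" by simp
qed

lemma rec_fn_mult: "rec_fn n a \<Longrightarrow> rec_fn n b \<Longrightarrow> rec_fn n (\<lambda>s. a s * b s)"
proof (rule rec_fn_app2[of times])
  have "rec_nat 0 (\<lambda>k r. r + x) y = x * y" for x y :: nat by (induction y) auto
  moreover have "rec_fn 2 (\<lambda>s. rec_nat 0 (\<lambda>k r. r + s 0) (s (Suc 0)))"
    by (intro rec_fn_rec_nat rec_fn_add rec_fn_const rec_fn_var) simp_all
  ultimately show "rec_fn 2 (\<lambda>s. s 0 * s (Suc 0))" by simp
qed

lemma rec_fn_diff: "rec_fn n a \<Longrightarrow> rec_fn n b \<Longrightarrow> rec_fn n (\<lambda>s. a s - b s)"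
proof (rule rec_fn_app2[of "(-)"])
  have p: "rec_nat 0 (\<lambda>k r. k) y = y - 1" for y :: nat by (cases y) auto
  have "rec_nat x (\<lambda>k r. rec_nat 0 (\<lambda>k r. k) r) y = x - y" for x y :: nat unfolding p by (induction y) auto
  moreover have "rec_fn 2 (\<lambda>s. rec_nat (s 0) (\<lambda>k r. rec_nat 0 (\<lambda>k r. k) r) (s (Suc 0)))"
    by (intro rec_fn_rec_nat rec_fn_const rec_fn_var) simp_all
  ultimately show "rec_fn 2 (\<lambda>s. s 0 - s (Suc 0))" by simp
qed

lemma rec_pred_eq: "rec_fn n a \<Longrightarrow> rec_fn n b \<Longrightarrow> rec_pred n (\<lambda>s. a s = b s)"
proof -
  assume "rec_fn n a" "rec_fn n b"
  then have "rec_fn n (\<lambda>s. 1 - ((a s - b s) + (b s - a s)))"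
    by (intro rec_fn_diff rec_fn_add rec_fn_const)
  moreover have "1 - ((x - y) + (y - x)) = of_bool (x = y)" for x y :: nat by auto
  ultimately show ?thesis unfolding rec_pred_def by simp
qed

lemma rec_pred_not: "rec_pred n P \<Longrightarrow> rec_pred n (\<lambda>s. \<not> P s)"
proof -
  assume "rec_pred n P"
  then have "rec_fn n (\<lambda>s. 1 - of_bool (P s))" unfolding rec_pred_def by (intro rec_fn_diff rec_fn_const)
  moreover have "1 - of_bool p = (of_bool (\<not> p) :: nat)" for p by simp
  ultimately show ?thesis unfolding rec_pred_def by simp
qed

lemma rec_pred_conj: "rec_pred n P \<Longrightarrow> rec_pred n Q \<Longrightarrow> rec_pred n (\<lambda>s. P s \<and> Q s)"
  unfolding rec_pred_def using rec_fn_mult[of n "\<lambda>s. of_bool (P s)" "\<lambda>s. of_bool (Q s)"]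
  by (simp add: of_bool_conj)

lemma rec_pred_const: "rec_pred n (\<lambda>s. c)"
  unfolding rec_pred_def by (rule rec_fn_const)

lemma rec_pred_finite_all:
  "finite F \<Longrightarrow> (\<And>c. c \<in> F \<Longrightarrow> rec_pred n (P c)) \<Longrightarrow> rec_pred n (\<lambda>s. \<forall>c\<in>F. P c s)"
  by (induction F rule: finite_induct) (simp_all add: rec_pred_const rec_pred_conj)

lemma rec_pred_finite_ex:
  assumes "finite F" "\<And>c. c \<in> F \<Longrightarrow> rec_pred n (P c)"
  shows "rec_pred n (\<lambda>s. \<exists>c\<in>F. P c s)"
  using rec_pred_not[OF rec_pred_finite_all[OF assms(1) rec_pred_not[OF assms(2)]]] by simp

lemma rec_pred_ball:
  assumes m: "rec_fn n m" and P: "rec_pred (Suc n) (\<lambda>s. P (s 0) (\<lambda>i. s (Suc i)))"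
  shows "rec_pred n (\<lambda>s. \<forall>k<m s. P k s)"
proof -
  have "rec_fn (Suc (Suc n)) (\<lambda>s. of_bool (P (s 0) (\<lambda>i. s (Suc (Suc i)))))"
  proof -
    have "rec_fn (Suc (Suc n)) (case_nat (\<lambda>s. s 0) (\<lambda>i s. s (Suc (Suc i))) i)" if "i < Suc n" for i
      using that by (auto intro: rec_fn_var split: nat.split)
    from rec_fn_subst[where F = "case_nat (\<lambda>s. s 0) (\<lambda>i s. s (Suc (Suc i)))", OF P[unfolded rec_pred_def] this]
    show ?thesis by simp
  qed
  then have "rec_fn n (\<lambda>s. rec_nat 1 (\<lambda>k r. r * of_bool (P k s)) (m s))"
    by (intro rec_fn_rec_nat rec_fn_mult rec_fn_const rec_fn_var m) simp_all
  moreover have "rec_nat 1 (\<lambda>k r. r * of_bool (Q k)) m = (of_bool (\<forall>k<m. Q k) :: nat)" for Q m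
    by (induction m) (auto simp: less_Suc_eq)
  ultimately show ?thesis unfolding rec_pred_def by simp
qed

lemma rec_pred_bex:
  assumes m: "rec_fn n m" and P: "rec_pred (Suc n) (\<lambda>s. P (s 0) (\<lambda>i. s (Suc i)))"
  shows "rec_pred n (\<lambda>s. \<exists>k<m s. P k s)"
  using rec_pred_not[OF rec_pred_ball[of n m "\<lambda>k s. \<not> P k s", OF m rec_pred_not[OF P]]] by simp

lemma recf_eval_search:
  assumes "rec_pred (Suc n) (\<lambda>s. P (s 0) (\<lambda>i. s (Suc i)))"
  shows "\<exists>e. \<forall>s. (\<exists>k. P k s) \<longrightarrow> recf_eval e (map s [0..<n]) (LEAST k. P k s)"
proof -
  \<comment> \<open>Minimization looks for the value 0, hence the negation.\<close>
  obtain e where "\<And>s. recf_eval e (map s [0..<Suc n]) (of_bool (\<not> P (s 0) (\<lambda>i. s (Suc i))))"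
    using rec_pred_not[OF assms] unfolding rec_pred_def rec_fn_def by blast
  then have e: "recf_eval e (k # map s [0..<n]) (of_bool (\<not> P k s))" for k s
    using \<open>\<And>s. recf_eval e (map s [0..<Suc n]) _\<close>[of "case_nat k s"] unfolding map_case_nat_upt by simp
  have "recf_eval (Mu e) (map s [0..<n]) (LEAST k. P k s)" if "\<exists>k. P k s" for s
  proof (rule recf_eval.mu)
    show "recf_eval e ((LEAST k. P k s) # map s [0..<n]) 0" using e[of "LEAST k. P k s" s] LeastI_ex[OF that] by simp
    show "\<exists>k. recf_eval e (m # map s [0..<n]) (Suc k)" if "m < (LEAST k. P k s)" for m
      using e[of m s] not_less_Least[OF that] by auto
  qed
  then show ?thesis by blast
qed

lemma rec_fn_least:
  assumes "rec_pred (Suc n) (\<lambda>s. P (s 0) (\<lambda>i. s (Suc i)))" "\<And>s. \<exists>k. P k s"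
  shows "rec_fn n (\<lambda>s. LEAST k. P k s)"
  using recf_eval_search[OF assms(1)] assms(2) unfolding rec_fn_def by blast

section \<open>Pairs and sequences by recursive functions\<close>

lemma rec_fn_prod_encode: "rec_fn n a \<Longrightarrow> rec_fn n b \<Longrightarrow> rec_fn n (\<lambda>s. prod_encode (a s, b s))"
proof -
  assume ab: "rec_fn n a" "rec_fn n b"
  have t: "rec_nat 0 (\<lambda>k r. r + Suc k) m = triangle m" for m by (induction m) auto
  have "rec_fn n (\<lambda>s. rec_nat 0 (\<lambda>k r. r + Suc k) (a s + b s) + a s)"
    by (intro rec_fn_add rec_fn_rec_nat rec_fn_const rec_fn_Suc rec_fn_var ab) simp_all
  then show ?thesis unfolding t prod_encode_def by simp
qed

definition pfst :: "nat \<Rightarrow> nat" where "pfst z = fst (prod_decode z)"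
definition psnd :: "nat \<Rightarrow> nat" where "psnd z = snd (prod_decode z)"

lemma pfst_psnd_simps [simp]: "pfst (prod_encode (a, b)) = a" "psnd (prod_encode (a, b)) = b"
  by (simp_all add: pfst_def psnd_def)

lemma prod_encode_pfst_psnd: "prod_encode (a, b) = z \<longleftrightarrow> a = pfst z \<and> b = psnd z"
  unfolding pfst_def psnd_def by (metis prod.collapse prod_decode_inverse prod_encode_inverse fst_conv snd_conv)

lemma rec_fn_pfst:
  assumes "rec_fn n a" shows "rec_fn n (\<lambda>s. pfst (a s))"
proof (rule rec_fn_app1[OF _ assms])
  \<comment> \<open>A component never exceeds its pair, so the search for the partner is
    bounded.\<close>
  have ex: "(\<exists>b<Suc z. prod_encode (a, b) = z) \<longleftrightarrow> a = pfst z" for a z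
    using le_prod_encode_2[of "psnd z" "pfst z"] prod_encode_pfst_psnd[of a _ z] prod_encode_pfst_psnd[of "pfst z" "psnd z" z]
    by auto
  have "rec_fn 1 (\<lambda>s. LEAST a. \<exists>b<Suc (s 0). prod_encode (a, b) = s 0)"
    by (rule rec_fn_least, intro rec_pred_bex rec_pred_eq rec_fn_prod_encode rec_fn_Suc rec_fn_var)
      (simp_all add: ex)
  moreover have "(LEAST a. a = z) = z" for z :: nat by (rule Least_equality) auto
  ultimately show "rec_fn 1 (\<lambda>s. pfst (s 0))" by (simp add: ex)
qed

lemma rec_fn_psnd:
  assumes "rec_fn n a" shows "rec_fn n (\<lambda>s. psnd (a s))"
proof (rule rec_fn_app1[OF _ assms])
  have ex: "(\<exists>a<Suc z. prod_encode (a, b) = z) \<longleftrightarrow> b = psnd z" for b z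
    using le_prod_encode_1[of "pfst z" "psnd z"] prod_encode_pfst_psnd[of _ b z] prod_encode_pfst_psnd[of "pfst z" "psnd z" z]
    by auto
  have "rec_fn 1 (\<lambda>s. LEAST b. \<exists>a<Suc (s 0). prod_encode (a, b) = s 0)"
    by (rule rec_fn_least, intro rec_pred_bex rec_pred_eq rec_fn_prod_encode rec_fn_Suc rec_fn_var)
      (simp_all add: ex)
  moreover have "(LEAST a. a = z) = z" for z :: nat by (rule Least_equality) auto
  ultimately show "rec_fn 1 (\<lambda>s. psnd (s 0))" by (simp add: ex)
qed

text \<open>Reads any number as an assignment of values to all indices, by iterated projection. Both
  the bindings of a clause instance and the entries of a certificate are stored this way.\<close>

definition item :: "nat \<Rightarrow> nat \<Rightarrow> nat" where
  "item c j = pfst (rec_nat c (\<lambda>_. psnd) j)"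

lemma rec_fn_item: "rec_fn n a \<Longrightarrow> rec_fn n b \<Longrightarrow> rec_fn n (\<lambda>s. item (a s) (b s))"
  unfolding item_def by (intro rec_fn_pfst rec_fn_rec_nat rec_fn_psnd rec_fn_var) simp_all

primrec items :: "nat list \<Rightarrow> nat" where
  "items [] = 0"
| "items (x # xs) = prod_encode (x, items xs)"

lemma item_items: "j < length xs \<Longrightarrow> item (items xs) j = xs ! j"
proof -
  have shift: "rec_nat (psnd c) (\<lambda>_. psnd) j = rec_nat c (\<lambda>_. psnd) (Suc j)" for c j
    by (induction j) auto
  then have Suc: "item c (Suc j) = item (psnd c) j" for c j unfolding item_def by (simp only:)
  show "j < length xs \<Longrightarrow> item (items xs) j = xs ! j"
  proof (induction xs arbitrary: j)
    case (Cons x xs)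
    then show ?case by (cases j) (simp_all add: Suc, simp add: item_def)
  qed simp
qed

section \<open>Horn programs\<close>

text \<open>Patterns are only evaluated, never matched: the bindings are part of the certificate.
  Hence a non-injective constructor such as the sum \<open>PA\<close> is unproblematic.\<close>

datatype pat = PV nat | PK nat | PP pat pat | PS pat | PA pat pat

primrec ev :: "(nat \<Rightarrow> nat) \<Rightarrow> pat \<Rightarrow> nat" where
  "ev v (PV i) = v i"
| "ev v (PK c) = c"
| "ev v (PP a b) = prod_encode (ev v a, ev v b)"
| "ev v (PS a) = Suc (ev v a)"
| "ev v (PA a b) = ev v a + ev v b"

type_synonym clause = "pat \<times> pat list"

inductive holds :: "clause list \<Rightarrow> nat \<Rightarrow> bool" for prog where
  clause: "(h, bs) \<in> set prog \<Longrightarrow> (\<And>b. b \<in> set bs \<Longrightarrow> holds prog (ev v b)) \<Longrightarrow> holds prog (ev v h)"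

lemma rec_fn_ev: "rec_fn n a \<Longrightarrow> rec_fn n (\<lambda>s. ev (item (a s)) p)"
  by (induction p) (simp_all add: rec_fn_item rec_fn_const rec_fn_prod_encode rec_fn_Suc rec_fn_add)

definition proves :: "clause list \<Rightarrow> nat \<Rightarrow> nat \<Rightarrow> bool" where
  "proves prog e x \<longleftrightarrow> (\<exists>k\<in>{..<length prog}. pfst e = k \<and> x = ev (item (psnd e)) (fst (prog ! k)))"

text \<open>A certificate is a number of entries together with the entries, each consisting of a
  clause number and bindings. Every body atom must be the head of an earlier entry, which makes the
  check bounded and excludes circular proofs.\<close>

definition accepts :: "clause list \<Rightarrow> nat \<Rightarrow> nat \<Rightarrow> bool" where
  "accepts prog c x \<longleftrightarrow>
     (\<forall>j<pfst c. \<exists>k\<in>{..<length prog}. pfst (item (psnd c) j) = k \<and> (\<forall>b\<in>set (snd (prog ! k)).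
        \<exists>i<j. proves prog (item (psnd c) i) (ev (item (psnd (item (psnd c) j))) b))) \<and>
     (\<exists>j<pfst c. proves prog (item (psnd c) j) x)"

lemma rec_pred_proves: "rec_fn n a \<Longrightarrow> rec_fn n b \<Longrightarrow> rec_pred n (\<lambda>s. proves prog (a s) (b s))"
  unfolding proves_def
  by (intro rec_pred_finite_ex rec_pred_conj rec_pred_eq rec_fn_pfst rec_fn_psnd rec_fn_ev rec_fn_const) auto

lemma rec_pred_accepts:
  assumes "c < n" "rec_fn n a"
  shows "rec_pred n (\<lambda>s. accepts prog (psnd (s c)) (a s))"
proof -
  \<comment> \<open>Shown recursive as a binary relation first; substituting \<open>a\<close>
    afterwards avoids lifting it over the bound variable \<open>j\<close>.\<close>
  let ?b = "\<lambda>s x. \<exists>j<pfst (psnd s). proves prog (item (psnd (psnd s)) j) x"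
  have "rec_fn 2 (\<lambda>s. of_bool (?b (s 0) (s (Suc 0))))"
    unfolding rec_pred_def[symmetric]
    by (intro rec_pred_bex rec_pred_proves rec_fn_item rec_fn_pfst rec_fn_psnd rec_fn_const rec_fn_var) simp_all
  from rec_fn_app2[OF this rec_fn_var[OF assms(1)] assms(2)]
  have 1: "rec_pred n (\<lambda>s. ?b (s c) (a s))" unfolding rec_pred_def .
  have 2: "rec_pred n (\<lambda>s. \<forall>j<pfst (psnd (s c)). \<exists>k\<in>{..<length prog}. pfst (item (psnd (psnd (s c))) j) = k \<and>
      (\<forall>b\<in>set (snd (prog ! k)). \<exists>i<j. proves prog (item (psnd (psnd (s c))) i)
        (ev (item (psnd (item (psnd (psnd (s c))) j))) b)))"
    by (intro rec_pred_ball rec_pred_bex rec_pred_finite_ex rec_pred_finite_all rec_pred_conj rec_pred_eq rec_pred_proves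
        rec_fn_item rec_fn_pfst rec_fn_psnd rec_fn_ev rec_fn_const rec_fn_var) (use assms in auto)
  show ?thesis unfolding accepts_def by (rule rec_pred_conj[OF 2 1])
qed

lemma accepts_sound:
  assumes "accepts prog c x"
  shows "holds prog x"
proof -
  let ?e = "item (psnd c)"
  have chk: "\<exists>k\<in>{..<length prog}. pfst (?e j) = k \<and> (\<forall>b\<in>set (snd (prog ! k)).
      \<exists>i<j. proves prog (?e i) (ev (item (psnd (?e j))) b))" if "j < pfst c" for j
    using assms that unfolding accepts_def by blast
  have "j < pfst c \<Longrightarrow> proves prog (?e j) x \<Longrightarrow> holds prog x" for j x
  proof (induction j arbitrary: x rule: less_induct)
    case (less j)
    obtain k where k: "k < length prog" "pfst (?e j) = k" "\<And>b. b \<in> set (snd (prog ! k)) \<Longrightarrow>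
        \<exists>i<j. proves prog (?e i) (ev (item (psnd (?e j))) b)" using chk[OF less.prems(1)] by blast
    have x: "x = ev (item (psnd (?e j))) (fst (prog ! k))" using less.prems(2) k(2) unfolding proves_def by blast
    show ?case unfolding x
    proof (rule holds.clause)
      show "(fst (prog ! k), snd (prog ! k)) \<in> set prog" using k(1) by simp
      fix b assume "b \<in> set (snd (prog ! k))"
      from k(3)[OF this] obtain i where i: "i < j" "proves prog (?e i) (ev (item (psnd (?e j))) b)" by blast
      from less.IH[OF i(1) _ i(2)] less.prems(1) i(1) show "holds prog (ev (item (psnd (?e j))) b)" by simp
    qed
  qed
  then show ?thesis using assms unfolding accepts_def by blast
qed

text \<open>Ensures that finitely many bindings suffice for a clause instance, so that a single
  number can store them.\<close>

lemma ev_finite: "\<exists>n. \<forall>v v'. (\<forall>i<n. v i = v' i) \<longrightarrow> ev v p = ev v' p"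
proof (induction p)
  case (PV i) show ?case by (intro exI[of _ "Suc i"]) simp
next
  case (PP a b)
  then obtain m n where "\<forall>v v'. (\<forall>i<m. v i = v' i) \<longrightarrow> ev v a = ev v' a" "\<forall>v v'. (\<forall>i<n. v i = v' i) \<longrightarrow> ev v b = ev v' b"
    by blast
  then show ?case by (intro exI[of _ "m + n"]) (simp add: trans_less_add1 trans_less_add2)
next
  case (PA a b)
  then obtain m n where mn: "\<forall>v v'. (\<forall>i<m. v i = v' i) \<longrightarrow> ev v a = ev v' a"
    "\<forall>v v'. (\<forall>i<n. v i = v' i) \<longrightarrow> ev v b = ev v' b" by blast
  have "ev v (PA a b) = ev v' (PA a b)" if "\<forall>i<m + n. v i = v' i" for v v'
    using mn(1)[rule_format, of v v'] mn(2)[rule_format, of v v'] that by simp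
  then show ?case by blast
qed auto

lemma ev_finite_list: "\<exists>n. \<forall>v v'. (\<forall>i<n. v i = v' i) \<longrightarrow> (\<forall>p\<in>set ps. ev v p = ev v' p)"
proof (induction ps)
  case (Cons p ps)
  obtain m n where "\<forall>v v'. (\<forall>i<m. v i = v' i) \<longrightarrow> ev v p = ev v' p"
    "\<forall>v v'. (\<forall>i<n. v i = v' i) \<longrightarrow> (\<forall>p\<in>set ps. ev v p = ev v' p)" using ev_finite[of p] Cons by blast
  then show ?case by (intro exI[of _ "m + n"]) (simp add: trans_less_add1 trans_less_add2)
qed simp

text \<open>Certificates as lists, which can be concatenated to join the certificates of several
  body atoms.\<close>

inductive chain :: "clause list \<Rightarrow> nat list \<Rightarrow> bool" for prog where
  "chain prog []"
| "chain prog L \<Longrightarrow> k < length prog \<Longrightarrow> (\<And>b. b \<in> set (snd (prog ! k)) \<Longrightarrow> \<exists>e\<in>set L. proves prog e (ev (item \<sigma>) b)) \<Longrightarrow>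
     chain prog (L @ [prod_encode (k, \<sigma>)])"

lemma chain_append: "chain prog L' \<Longrightarrow> chain prog L \<Longrightarrow> chain prog (L @ L')"
proof (induction rule: chain.induct)
  case (2 L' k \<sigma>)
  have "chain prog ((L @ L') @ [prod_encode (k, \<sigma>)])"
    by (rule chain.intros(2)) (use 2 in force)+
  then show ?case by simp
qed simp

lemma chain_nth:
  "chain prog L \<Longrightarrow> j < length L \<Longrightarrow> \<exists>k\<in>{..<length prog}. pfst (L ! j) = k \<and> (\<forall>b\<in>set (snd (prog ! k)).
    \<exists>i<j. proves prog (L ! i) (ev (item (psnd (L ! j))) b))"
proof (induction rule: chain.induct)
  case (2 L k \<sigma>)
  show ?case
  proof (cases "j < length L")
    case True
    let ?L = "L @ [prod_encode (k, \<sigma>)]"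
    obtain k' where k': "k' \<in> {..<length prog}" "pfst (L ! j) = k'"
      "\<And>b. b \<in> set (snd (prog ! k')) \<Longrightarrow> \<exists>i<j. proves prog (L ! i) (ev (item (psnd (L ! j))) b)"
      using 2(4)[OF True] by blast
    have nth: "?L ! i = L ! i" if "i \<le> j" for i using that True by (simp add: nth_append)
    have "\<exists>i<j. proves prog (?L ! i) (ev (item (psnd (?L ! j))) b)" if b: "b \<in> set (snd (prog ! k'))" for b
    proof -
      obtain i where "i < j" "proves prog (L ! i) (ev (item (psnd (L ! j))) b)" using k'(3)[OF b] by blast
      then show ?thesis using nth[of i] nth[of j] by (intro exI[of _ i]) simp
    qed
    then show ?thesis using k'(1,2) nth[of j] by (intro bexI[of _ k']) simp_all
  next
    case False
    then have j: "j = length L" using 2(5) by simp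
    have "\<exists>i<j. proves prog ((L @ [prod_encode (k, \<sigma>)]) ! i) (ev (item \<sigma>) b)" if b: "b \<in> set (snd (prog ! k))" for b
    proof -
      obtain e where "e \<in> set L" "proves prog e (ev (item \<sigma>) b)" using 2(3)[OF b] by blast
      then show ?thesis unfolding j in_set_conv_nth by (auto simp: nth_append)
    qed
    then show ?thesis using 2(2) j by simp
  qed
qed simp

lemma holds_chain: "holds prog x \<Longrightarrow> \<exists>L. chain prog L \<and> (\<exists>e\<in>set L. proves prog e x)"
proof (induction rule: holds.induct)
  case (clause h bs v)
  have "\<exists>L. chain prog L \<and> (\<forall>b\<in>set bs'. \<exists>e\<in>set L. proves prog e (ev v b))" if "set bs' \<subseteq> set bs" for bs'
    using that
  proof (induction bs')
    case Nil show ?case using chain.intros(1) by auto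
  next
    case (Cons b bs')
    then obtain L where L: "chain prog L" "\<forall>b\<in>set bs'. \<exists>e\<in>set L. proves prog e (ev v b)" by auto
    obtain L' where L': "chain prog L'" "\<exists>e\<in>set L'. proves prog e (ev v b)" using clause.IH[of b] Cons.prems by auto
    show ?case using chain_append[OF L(1) L'(1)] L(2) L'(2) by (intro exI[of _ "L' @ L"]) auto
  qed
  from this[of bs] obtain L where L: "chain prog L" "\<And>b. b \<in> set bs \<Longrightarrow> \<exists>e\<in>set L. proves prog e (ev v b)" by auto
  obtain k where k: "k < length prog" "prog ! k = (h, bs)" using clause.hyps by (auto simp: in_set_conv_nth)
  obtain n where n: "\<forall>v v'. (\<forall>i<n. v i = v' i) \<longrightarrow> (\<forall>p\<in>set (h # bs). ev v p = ev v' p)"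
    using ev_finite_list[of "h # bs"] by blast
  define \<sigma> where "\<sigma> = items (map v [0..<n])"
  have "\<forall>i<n. item \<sigma> i = v i" unfolding \<sigma>_def by (simp add: item_items)
  then have ev: "\<forall>p\<in>set (h # bs). ev (item \<sigma>) p = ev v p" using n by blast
  have "chain prog (L @ [prod_encode (k, \<sigma>)])"
    by (rule chain.intros(2)[OF L(1) k(1)]) (use L(2) ev k(2) in auto)
  moreover have "proves prog (prod_encode (k, \<sigma>)) (ev v h)" unfolding proves_def using k ev by simp
  ultimately show ?case by (intro exI[of _ "L @ [prod_encode (k, \<sigma>)]"]) auto
qed

lemma accepts_complete:
  assumes "holds prog x"
  shows "\<exists>c. accepts prog c x"
proof -
  obtain L e where L: "chain prog L" "e \<in> set L" "proves prog e x" using holds_chain[OF assms] by blast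
  obtain j where j: "j < length L" "L ! j = e" using L(2) by (auto simp: in_set_conv_nth)
  have it: "item (items L) i = L ! i" if "i < length L" for i by (rule item_items[OF that])
  have "accepts prog (prod_encode (length L, items L)) x"
    unfolding accepts_def pfst_psnd_simps
  proof (intro conjI allI impI)
    fix i assume i: "i < length L"
    obtain k where k: "k \<in> {..<length prog}" "pfst (L ! i) = k"
      "\<And>b. b \<in> set (snd (prog ! k)) \<Longrightarrow> \<exists>i'<i. proves prog (L ! i') (ev (item (psnd (L ! i))) b)"
      using chain_nth[OF L(1) i] by blast
    have "\<exists>i'<i. proves prog (item (items L) i') (ev (item (psnd (item (items L) i))) b)"
      if b: "b \<in> set (snd (prog ! k))" for b
    proof -
      obtain i' where i': "i' < i" "proves prog (L ! i') (ev (item (psnd (L ! i))) b)" using k(3)[OF b] by blast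
      then have "i' < length L" using i by simp
      then show ?thesis using i' it[OF i] it[of i'] by (intro exI[of _ i']) simp
    qed
    then show "\<exists>k\<in>{..<length prog}. pfst (item (items L) i) = k \<and> (\<forall>b\<in>set (snd (prog ! k)).
      \<exists>i'<i. proves prog (item (items L) i') (ev (item (psnd (item (items L) i))) b))"
      using k(1,2) it[OF i] by (intro bexI[of _ k]) simp_all
  next
    show "\<exists>j<length L. proves prog (item (items L) j) x" using j L(3) it by auto
  qed
  then show ?thesis by blast
qed

text \<open>Searching for a pair of an output and an accepted certificate.\<close>

theorem holds_search:
  assumes "rec_fn (Suc n) (\<lambda>s. q (s 0) (\<lambda>i. s (Suc i)))"
  shows "\<exists>e. \<forall>s. (\<exists>y. holds prog (q y s)) \<longrightarrow> (\<exists>y. recf_eval e (map s [0..<n]) y \<and> holds prog (q y s))"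
proof -
  have *: "rec_pred (Suc n) (\<lambda>s. accepts prog (psnd (s 0)) (q (pfst (s 0)) (\<lambda>i. s (Suc i))))"
  proof (rule rec_pred_accepts)
    have "rec_fn (Suc n) (case_nat (\<lambda>s. pfst (s 0)) (\<lambda>i s. s (Suc i)) i)" if "i < Suc n" for i
      using that by (auto intro: rec_fn_var rec_fn_pfst split: nat.split)
    from rec_fn_subst[where F = "case_nat (\<lambda>s. pfst (s 0)) (\<lambda>i s. s (Suc i))", OF assms this]
    show "rec_fn (Suc n) (\<lambda>s. q (pfst (s 0)) (\<lambda>i. s (Suc i)))" by simp
  qed simp
  let ?P = "\<lambda>k s. accepts prog (psnd k) (q (pfst k) s)"
  obtain e where e: "\<And>s. \<exists>k. ?P k s \<Longrightarrow> recf_eval e (map s [0..<n]) (LEAST k. ?P k s)"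
    using recf_eval_search[of n ?P, OF *] by blast
  have "rec_fn 1 (\<lambda>s. pfst (s 0))" by (intro rec_fn_pfst rec_fn_var) simp
  then obtain d where d: "\<And>s. recf_eval d (map s [0..<1]) (pfst (s 0))" unfolding rec_fn_def by blast
  have "\<exists>y. recf_eval (Comp d [e]) (map s [0..<n]) y \<and> holds prog (q y s)" if h: "holds prog (q y s)" for y s
  proof -
    obtain c where "accepts prog c (q y s)" using accepts_complete[OF h] by blast
    then have ex: "\<exists>k. ?P k s" by (intro exI[of _ "prod_encode (y, c)"]) simp
    let ?k = "LEAST k. ?P k s"
    have "recf_eval (Comp d [e]) (map s [0..<n]) (pfst ?k)"
      by (rule recf_eval.comp[of _ _ "[?k]"]) (use e[OF ex] d[of "\<lambda>_. ?k"] in auto)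
    moreover have "holds prog (q (pfst ?k) s)" by (rule accepts_sound[OF LeastI_ex[OF ex]])
    ultimately show ?thesis by blast
  qed
  then show ?thesis by blast
qed

section \<open>Realizers described by formulae\<close>

primrec letter_fm :: "nat \<Rightarrow> bool list \<Rightarrow> fm" where
  "letter_fm x [] = Tru"
| "letter_fm x (b # bs) = And (if b then Mem 0 x else Neg (Mem 0 x)) (letter_fm (Suc x) bs)"

definition init_fm :: "nat \<Rightarrow> fm" where
  "init_fm Q = Neg (ExI (And (Zero 0) (Neg (Mem 0 Q))))"

text \<open>Index 0 is the position and index 1 its successor, so that the letter formula
  \<open>a\<close>, which reads index 0, can stand under two quantifiers without renaming.\<close>

definition step_fm :: "nat \<Rightarrow> fm \<Rightarrow> nat \<Rightarrow> fm" where
  "step_fm Q a Q' = Neg (ExI (ExI (And (Succ 0 (Suc 0)) (And (Mem 0 Q) (And a (Neg (Mem (Suc 0) Q')))))))"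

definition out_fm :: "nat \<Rightarrow> fm \<Rightarrow> bool \<Rightarrow> nat \<Rightarrow> fm" where
  "out_fm Q a b Y = Neg (ExI (And (Mem 0 Q) (And a (if b then Neg (Mem 0 Y) else Mem 0 Y))))"

text \<open>The state \<open>s\<close> of the \<open>j\<close>-th machine is described by the predicate variable
  \<open>q + p + \<langle>j, s\<rangle>\<close>. Only upper bounds for the runs are described.\<close>

inductive hyp :: "nat \<Rightarrow> nat \<Rightarrow> table list \<Rightarrow> fm \<Rightarrow> bool" for p q Ts where
  init: "j < length Ts \<Longrightarrow> hyp p q Ts (init_fm (q + p + prod_encode (j, fst (Ts ! j))))"
| step: "j < length Ts \<Longrightarrow> s < length (snd (Ts ! j)) \<Longrightarrow> m < length (snd (Ts ! j) ! s) \<Longrightarrow>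
    snd (Ts ! j) ! s ! m = (s', b) \<Longrightarrow> length a = p \<Longrightarrow> horner_sum of_bool 2 a = m \<Longrightarrow>
    hyp p q Ts (step_fm (q + p + prod_encode (j, s)) (letter_fm q a) (q + p + prod_encode (j, s')))"
| out: "j < length Ts \<Longrightarrow> s < length (snd (Ts ! j)) \<Longrightarrow> m < length (snd (Ts ! j) ! s) \<Longrightarrow>
    snd (Ts ! j) ! s ! m = (s', b) \<Longrightarrow> length a = p \<Longrightarrow> horner_sum of_bool 2 a = m \<Longrightarrow> q = Suc (j + j') \<Longrightarrow>
    hyp p q Ts (out_fm (q + p + prod_encode (j, s)) (letter_fm q a) b j')"

lemma sat_letter_fm: "sat i P (letter_fm x a) \<longleftrightarrow> (\<forall>k<length a. P (x + k) (i 0) = a ! k)"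
proof (induction a arbitrary: x)
  case (Cons b a)
  have "(\<forall>k<Suc (length a). P (x + k) (i 0) = (b # a) ! k) \<longleftrightarrow>
      P x (i 0) = b \<and> (\<forall>k<length a. P (Suc x + k) (i 0) = a ! k)"
    unfolding All_less_Suc2 by simp
  then show ?case using Cons.IH[of "Suc x"] by auto
qed simp

lemma free_ind_letter_fm: "free_ind (letter_fm x a) \<subseteq> {0}"
  by (induction a arbitrary: x) auto

lemma free_ind_hyp: "hyp p q Ts \<gamma> \<Longrightarrow> free_ind \<gamma> = {}"
  by (induction rule: hyp.induct)
    (use free_ind_letter_fm in \<open>auto simp: init_fm_def step_fm_def out_fm_def\<close>)

text \<open>Allows all hypotheses to be collected in one context.\<close>

lemma finite_hyp: "finite {\<gamma>. hyp p q Ts \<gamma>}"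
proof -
  let ?J = "{..<length Ts}" and ?A = "{a. set a \<subseteq> (UNIV :: bool set) \<and> length a = p}"
  let ?E = "\<Union>T\<in>set Ts. \<Union>row\<in>set (snd T). set row"
  let ?S = "\<Union>T\<in>set Ts. {..<length (snd T)}"
  let ?X = "?J \<times> ?S \<times> ?E \<times> ?A"
  let ?f = "\<lambda>(j, s, e, a). step_fm (q + p + prod_encode (j, s)) (letter_fm q a) (q + p + prod_encode (j, fst e))"
  let ?g = "\<lambda>(j, s, e, a). out_fm (q + p + prod_encode (j, s)) (letter_fm q a) (snd e) (q - Suc j)"
  have "finite ?A" by (rule finite_lists_length_eq) simp
  then have "finite ?X" by simp
  moreover have "{\<gamma>. hyp p q Ts \<gamma>} \<subseteq> (\<lambda>j. init_fm (q + p + prod_encode (j, fst (Ts ! j)))) ` ?J \<union> ?f ` ?X \<union> ?g ` ?X"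
  proof
    fix \<gamma> assume "\<gamma> \<in> {\<gamma>. hyp p q Ts \<gamma>}"
    then have "hyp p q Ts \<gamma>" by simp
    then show "\<gamma> \<in> (\<lambda>j. init_fm (q + p + prod_encode (j, fst (Ts ! j)))) ` ?J \<union> ?f ` ?X \<union> ?g ` ?X"
    proof cases
      case (init j) then show ?thesis by auto
    next
      case (step j s m s' b a)
      have "(s', b) \<in> set (snd (Ts ! j) ! s)" using step nth_mem by metis
      then have "(s', b) \<in> ?E"
        by (intro UN_I[OF nth_mem[OF \<open>j < length Ts\<close>]] UN_I[OF nth_mem[OF \<open>s < length (snd (Ts ! j))\<close>]])
      moreover have "s \<in> ?S" by (rule UN_I[OF nth_mem[OF \<open>j < length Ts\<close>]]) (use step in simp)
      ultimately have "(j, s, (s', b), a) \<in> ?X" using step by simp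
      moreover have "\<gamma> = ?f (j, s, (s', b), a)" using step by simp
      ultimately show ?thesis by blast
    next
      case (out j s m s' b a j')
      have "(s', b) \<in> set (snd (Ts ! j) ! s)" using out nth_mem by metis
      then have "(s', b) \<in> ?E"
        by (intro UN_I[OF nth_mem[OF \<open>j < length Ts\<close>]] UN_I[OF nth_mem[OF \<open>s < length (snd (Ts ! j))\<close>]])
      moreover have "s \<in> ?S" by (rule UN_I[OF nth_mem[OF \<open>j < length Ts\<close>]]) (use out in simp)
      ultimately have "(j, s, (s', b), a) \<in> ?X" using out by simp
      moreover have "\<gamma> = ?g (j, s, (s', b), a)" using out by simp
      ultimately show ?thesis by blast
    qed
  qed
  ultimately show ?thesis by (meson finite_UnI finite_imageI finite_lessThan finite_subset)
qed

lemma wf_table_entry: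
  assumes "wf_table p T" "s < length (snd T)" "length a = p"
  shows "horner_sum of_bool 2 a < length (snd T ! s)" "fst (snd T ! s ! horner_sum of_bool 2 a) < length (snd T)"
proof -
  have row: "length (snd T ! s) = 2 ^ p" "\<forall>(s', b)\<in>set (snd T ! s). s' < length (snd T)"
    using assms(1,2) nth_mem[OF assms(2)] unfolding wf_table_def by auto
  show 1: "horner_sum of_bool 2 a < length (snd T ! s)" using row(1) horner_sum_bits_less[of a] assms(3) by simp
  show "fst (snd T ! s ! horner_sum of_bool 2 a) < length (snd T)"
    using row(2) nth_mem[OF 1] by (auto simp: split_beta)
qed

lemma table_state_less:
  assumes "wf_table p T" "\<And>n. length (w n) = p"
  shows "dmm_state (table_dmm T) w n < length (snd T)"
proof (induction n)
  case 0 then show ?case using assms(1) by (simp add: wf_table_def table_dmm_def)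
next
  case (Suc n)
  then show ?case using wf_table_entry(2)[OF assms(1) Suc assms(2)[of n]] by (simp add: table_dmm_def)
qed

lemma hyp_outputs:
  assumes wf: "\<forall>T\<in>set Ts. wf_table p T" and len: "length Ts = q"
    and sat: "\<And>\<gamma>. hyp p q Ts \<gamma> \<Longrightarrow> sat i P \<gamma>" and j: "j < q"
  shows "P (q - 1 - j) = dmm_fun (table_dmm (Ts ! j)) (\<lambda>n. map (\<lambda>k. P (q + k) n) [0..<p])"
proof -
  let ?T = "Ts ! j" and ?w = "\<lambda>n. map (\<lambda>k. P (q + k) n) [0..<p]"
  have T: "wf_table p ?T" using wf j len by simp
  have st: "dmm_state (table_dmm ?T) ?w n < length (snd ?T)" for n by (rule table_state_less[OF T]) simp
  let ?q = "\<lambda>n. dmm_state (table_dmm ?T) ?w n" and ?m = "\<lambda>n. horner_sum of_bool 2 (?w n)"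
  have m: "?m n < length (snd ?T ! ?q n)" for n by (rule wf_table_entry(1)[OF T st]) simp
  have lt: "sat (case_nat n i') P (letter_fm q (?w n))" for n i' by (simp add: sat_letter_fm)
  have Q: "P (q + p + prod_encode (j, ?q n)) n" for n
  proof (induction n)
    case 0
    have "hyp p q Ts (init_fm (q + p + prod_encode (j, fst ?T)))" by (rule hyp.init) (use j len in simp)
    from sat[OF this] show ?case by (simp add: init_fm_def table_dmm_def)
  next
    case (Suc n)
    obtain s' b where e: "snd ?T ! ?q n ! ?m n = (s', b)" by fastforce
    have "hyp p q Ts (step_fm (q + p + prod_encode (j, ?q n)) (letter_fm q (?w n)) (q + p + prod_encode (j, s')))"
      by (rule hyp.step[OF _ st m e]) (use j len in simp_all)
    from sat[OF this] have "\<forall>a b. \<not> (a = b + 1 \<and> P (q + p + prod_encode (j, ?q n)) b \<and>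
        sat (case_nat b (case_nat a i)) P (letter_fm q (?w n)) \<and> \<not> P (q + p + prod_encode (j, s')) a)"
      by (simp add: step_fm_def)
    then have "P (q + p + prod_encode (j, s')) (Suc n)" using Suc lt[of n "case_nat (Suc n) i"] by auto
    moreover have "?q (Suc n) = s'" using e by (simp add: table_dmm_def)
    ultimately show ?case by (simp only:)
  qed
  show ?thesis
  proof
    fix n
    obtain s' b where e: "snd ?T ! ?q n ! ?m n = (s', b)" by fastforce
    have "hyp p q Ts (out_fm (q + p + prod_encode (j, ?q n)) (letter_fm q (?w n)) b (q - 1 - j))"
      by (rule hyp.out[OF _ st m e]) (use j len in simp_all)
    from sat[OF this] have "\<forall>u. \<not> (P (q + p + prod_encode (j, ?q n)) u \<and> sat (case_nat u i) P (letter_fm q (?w n)) \<and>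
        sat (case_nat u i) P (if b then Neg (Mem 0 (q - 1 - j)) else Mem 0 (q - 1 - j)))"
      by (simp only: out_fm_def sat.simps nat.case not_ex) simp
    then have "\<not> (P (q + p + prod_encode (j, ?q n)) n \<and> sat (case_nat n i) P (letter_fm q (?w n)) \<and>
        sat (case_nat n i) P (if b then Neg (Mem 0 (q - 1 - j)) else Mem 0 (q - 1 - j)))" by (rule spec)
    then have "P (q - 1 - j) n = b" using Q[of n] lt[of n i] by (cases b) auto
    then show "P (q - 1 - j) n = dmm_fun (table_dmm ?T) ?w n" using e by (simp add: dmm_fun_def table_dmm_def)
  qed
qed

text \<open>The intended interpretation, with exactly the run as state predicates, shows the
  hypotheses consistent with every input.\<close>

lemma sat_hyp:
  fixes w :: "nat \<Rightarrow> bool list"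
  assumes len: "length Ts = q" "\<And>n. length (w n) = p"
    and X: "\<And>k n. k < p \<Longrightarrow> P (q + k) n = w n ! k"
    and Y: "\<And>j. j < q \<Longrightarrow> P (q - 1 - j) = dmm_fun (table_dmm (Ts ! j)) w"
    and Q: "\<And>j s n. P (q + p + prod_encode (j, s)) n \<longleftrightarrow> dmm_state (table_dmm (Ts ! j)) w n = s"
    and "hyp p q Ts \<gamma>"
  shows "sat i P \<gamma>"
  using assms(6)
proof cases
  case (init j)
  then show ?thesis by (auto simp: init_fm_def Q table_dmm_def)
next
  case (step j s m s' b a)
  have letter: "sat i' P (letter_fm q a) \<Longrightarrow> w (i' 0) = a" for i'
    using step(6) len(2)[of "i' 0"] X by (auto simp: sat_letter_fm list_eq_iff_nth_eq)
  show ?thesis unfolding step(1) step_fm_def using step(5,7)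
    by (auto simp: Q table_dmm_def dest!: letter)
next
  case (out j s m s' b a j')
  have letter: "sat i' P (letter_fm q a) \<Longrightarrow> w (i' 0) = a" for i'
    using out(6) len(2)[of "i' 0"] X by (auto simp: sat_letter_fm list_eq_iff_nth_eq)
  have Yj: "P j' = dmm_fun (table_dmm (Ts ! j)) w" using Y[of j] out(8) by simp
  show ?thesis unfolding out(1) out_fm_def using out(5,7)
    by (auto simp: Q Yj dmm_fun_def table_dmm_def dest!: letter)
qed

text \<open>Correctness of the tables says that finitely many hypotheses imply \<open>\<phi>\<close>
  for all values of the free predicates in the standard model. Completeness turns this into a
  refutation; for the converse, soundness is applied to the intended interpretation.\<close>

lemma realizer_iff_refutable:
  assumes wf: "\<forall>T\<in>set Ts. wf_table p T" and len: "length Ts = q" and \<phi>: "formula_over p q \<phi>"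
  shows "church_realizer p q \<phi> (map (\<lambda>T. dmm_fun (table_dmm T)) Ts) \<longleftrightarrow>
    (\<exists>\<Gamma>. (\<forall>\<gamma>\<in>set \<Gamma>. hyp p q Ts \<gamma>) \<and> refutable (Neg \<phi> # \<Gamma>))" (is "?R \<longleftrightarrow> ?L")
proof
  let ?Fs = "map (\<lambda>T. dmm_fun (table_dmm T)) Ts"
  have free: "free_ind \<phi> = {}" "free_pred \<phi> \<subseteq> {..<q + p}" using \<phi> unfolding formula_over_def by auto
  { assume R: ?R
    obtain \<Gamma> where \<Gamma>: "set \<Gamma> = {\<gamma>. hyp p q Ts \<gamma>}" using finite_list[OF finite_hyp] by blast
    have "refutable (Neg \<phi> # \<Gamma>)"
    proof (rule refutation_complete)
      show "\<forall>\<gamma>\<in>set (Neg \<phi> # \<Gamma>). free_ind \<gamma> = {}" using free free_ind_hyp \<Gamma> by auto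
      fix i P
      show "\<not> (\<forall>\<gamma>\<in>set (Neg \<phi> # \<Gamma>). sat i P \<gamma>)"
      proof
        assume all: "\<forall>\<gamma>\<in>set (Neg \<phi> # \<Gamma>). sat i P \<gamma>"
        let ?ws = "map (\<lambda>k. P (q + k)) [0..<p]"
        have conv: "convolution ?ws = (\<lambda>n. map (\<lambda>k. P (q + k) n) [0..<p])"
          by (auto simp: fun_eq_iff convolution_def)
        have out: "P (q - 1 - j) = dmm_fun (table_dmm (Ts ! j)) (convolution ?ws)" if "j < q" for j
          unfolding conv by (rule hyp_outputs[OF wf len _ that, where i = i]) (use all \<Gamma> in auto)
        have "sat i (\<lambda>k. (rev (map (\<lambda>F. F (convolution ?ws)) ?Fs) @ ?ws) ! k) \<phi>"
          using R unfolding church_realizer_def by simp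
        moreover have "(rev (map (\<lambda>F. F (convolution ?ws)) ?Fs) @ ?ws) ! k = P k" if "k < q + p" for k
        proof (cases "k < q")
          case True
          then show ?thesis using out[of "q - 1 - k"] len by (simp add: nth_append rev_nth)
        next
          case False
          then have "k - q < p" using that by simp
          then show ?thesis using False len by (simp add: nth_append)
        qed
        ultimately have "sat i P \<phi>" using free by (subst (asm) sat_cong[of \<phi> i i _ P]) auto
        then show False using all by simp
      qed
    qed
    then show ?L using \<Gamma> by blast }
  { assume ?L
    then obtain \<Gamma> where \<Gamma>: "\<forall>\<gamma>\<in>set \<Gamma>. hyp p q Ts \<gamma>" "refutable (Neg \<phi> # \<Gamma>)" by blast
    show ?R unfolding church_realizer_def
    proof (intro conjI ballI allI impI)
      show "length ?Fs = q" using len by simp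
      fix F assume "F \<in> set ?Fs"
      then obtain T where "T \<in> set Ts" "F = dmm_fun (table_dmm T)" by auto
      then show "finite_state_synchronous (bits p) UNIV F"
        unfolding finite_state_synchronous_def using is_dmm_table_dmm wf by blast
    next
      fix ws :: "(nat \<Rightarrow> bool) list" and i assume ws: "length ws = p"
      let ?w = "convolution ws"
      \<comment> \<open>Beyond \<open>q + p\<close> the index is unpaired into the machine and its
        state.\<close>
      define P where "P k = (if k < q then dmm_fun (table_dmm (Ts ! (q - 1 - k))) ?w
        else if k < q + p then ws ! (k - q)
        else (\<lambda>n. dmm_state (table_dmm (Ts ! pfst (k - (q + p)))) ?w n = psnd (k - (q + p))))" for k
      have "sat i P \<gamma>" if "hyp p q Ts \<gamma>" for \<gamma>
        by (rule sat_hyp[OF len _ _ _ _ that, of ?w]) (use ws in \<open>auto simp: P_def convolution_def\<close>)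
      then have "sat i P \<phi>" using refutable_sound[OF \<Gamma>(2), of i P] \<Gamma>(1) by auto
      moreover have "(rev (map (\<lambda>F. F ?w) ?Fs) @ ws) ! k = P k" if "k < q + p" for k
        using that len ws by (auto simp: nth_append rev_nth P_def)
      ultimately show "sat i (\<lambda>k. (rev (map (\<lambda>F. F ?w) ?Fs) @ ws) ! k) \<phi>"
        using free by (subst sat_cong[of \<phi> i i _ P]) auto
    qed }
qed

section \<open>A Horn program for certificates\<close>

text \<open>First-order codes for the renamings that occur: identity, lifting and instantiation,
  closed under passing a binder.\<close>

datatype rmap = RId | RSuc | RInst nat | RUp rmap

primrec rfun :: "rmap \<Rightarrow> nat \<Rightarrow> nat" where
  "rfun RId = id"
| "rfun RSuc = Suc"
| "rfun (RInst y) = case_nat y id"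
| "rfun (RUp r) = up (rfun r)"

primrec rcode :: "rmap \<Rightarrow> nat" where
  "rcode RId = prod_encode (0, 0)"
| "rcode RSuc = prod_encode (1, 0)"
| "rcode (RInst y) = prod_encode (2, y)"
| "rcode (RUp r) = prod_encode (3, rcode r)"

definition lcode :: "fm list \<Rightarrow> nat" where "lcode \<Gamma> = list_encode (map fm_code \<Gamma>)"

definition row_code :: "(nat \<times> bool) list \<Rightarrow> nat" where
  "row_code row = list_encode (map (\<lambda>(s, b). prod_encode (s, of_bool b)) row)"

section \<open>Patterns for codes of renamings, formulae and lists\<close>

abbreviation "pid \<equiv> PP (PK 0) (PK 0)"
abbreviation "psuc \<equiv> PP (PK 1) (PK 0)"
abbreviation "pinst y \<equiv> PP (PK 2) y"
abbreviation "pup r \<equiv> PP (PK 3) r"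
abbreviation "pEq x y \<equiv> PP (PK 0) (PP x y)"
abbreviation "pLe x y \<equiv> PP (PK 1) (PP x y)"
abbreviation "pSucc x y \<equiv> PP (PK 2) (PP x y)"
abbreviation "pZero x \<equiv> PP (PK 3) x"
abbreviation "pMem x X \<equiv> PP (PK 4) (PP x X)"
abbreviation "pTru \<equiv> PP (PK 5) (PK 0)"
abbreviation "pFls \<equiv> PP (PK 6) (PK 0)"
abbreviation "pAnd a b \<equiv> PP (PK 7) (PP a b)"
abbreviation "pNeg a \<equiv> PP (PK 8) a"
abbreviation "pExI a \<equiv> PP (PK 9) a"
abbreviation "pExP a \<equiv> PP (PK 10) a"
text \<open>Follows \<open>list_encode\<close>: a nonempty list is the successor of a pair, the
  empty list is 0.\<close>

abbreviation "pcons x l \<equiv> PS (PP x l)"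
abbreviation "pnil \<equiv> PK 0"

section \<open>The judgements of the program, distinguished by a leading tag\<close>

abbreviation "jMem x l \<equiv> PP (PK 0) (PP x l)"
abbreviation "jSub l g \<equiv> PP (PK 1) (PP l g)"
abbreviation "jApp r x y \<equiv> PP (PK 2) (PP r (PP x y))"
abbreviation "jRen r s a b \<equiv> PP (PK 3) (PP r (PP s (PP a b)))"
abbreviation "jRens r s g h \<equiv> PP (PK 4) (PP r (PP s (PP g h)))"
abbreviation "jAx l a \<equiv> PP (PK 5) (PP l a)"
abbreviation "jRef g \<equiv> PP (PK 6) g"
abbreviation "jNth l i x \<equiv> PP (PK 7) (PP l (PP i x))"
abbreviation "jLetter x k m f \<equiv> PP (PK 8) (PP x (PP k (PP m f)))"
abbreviation "jHyp p q t g \<equiv> PP (PK 9) (PP p (PP q (PP t g)))"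
abbreviation "jHyps p q t g \<equiv> PP (PK 10) (PP p (PP q (PP t g)))"
abbreviation "jLen l n \<equiv> PP (PK 11) (PP l n)"
abbreviation "jPow k m \<equiv> PP (PK 12) (PP k m)"
abbreviation "jRow t r \<equiv> PP (PK 13) (PP t r)"
abbreviation "jRows t m l \<equiv> PP (PK 14) (PP t (PP m l))"
abbreviation "jTables m l \<equiv> PP (PK 15) (PP m l)"
abbreviation "jMain p q f t \<equiv> PP (PK 16) (PP p (PP q (PP f t)))"

abbreviation "v0 \<equiv> PV 0"
abbreviation "v1 \<equiv> PV 1"
abbreviation "v2 \<equiv> PV 2"
abbreviation "v3 \<equiv> PV 3"
abbreviation "v4 \<equiv> PV 4"
abbreviation "v5 \<equiv> PV 5"
abbreviation "v6 \<equiv> PV 6"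
abbreviation "v7 \<equiv> PV 7"
abbreviation "v8 \<equiv> PV 8"

text \<open>The order of clauses matters here and below, since the completeness proofs address a
  clause by its position. Powers of two are computed by doubling with \<open>PA\<close>.\<close>

definition prog_list :: "clause list" where "prog_list = [
  (jMem v0 (pcons v0 v1), []),
  (jMem v0 (pcons v1 v2), [jMem v0 v2]),
  (jSub pnil v0, []),
  (jSub (pcons v0 v1) v2, [jMem v0 v2, jSub v1 v2]),
  (jNth (pcons v0 v1) (PK 0) v0, []),
  (jNth (pcons v0 v1) (PS v2) v3, [jNth v1 v2 v3]),
  (jLen pnil (PK 0), []),
  (jLen (pcons v0 v1) (PS v2), [jLen v1 v2]),
  (jPow (PK 0) (PK 1), []),
  (jPow (PS v0) (PA v1 v1), [jPow v0 v1])]"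

definition prog_ren :: "clause list" where "prog_ren = [
  (jApp pid v0 v0, []),
  (jApp psuc v0 (PS v0), []),
  (jApp (pinst v0) (PK 0) v0, []),
  (jApp (pinst v0) (PS v1) v1, []),
  (jApp (pup v0) (PK 0) (PK 0), []),
  (jApp (pup v0) (PS v1) (PS v2), [jApp v0 v1 v2]),
  (jRen v0 v1 (pEq v2 v3) (pEq v4 v5), [jApp v0 v2 v4, jApp v0 v3 v5]),
  (jRen v0 v1 (pLe v2 v3) (pLe v4 v5), [jApp v0 v2 v4, jApp v0 v3 v5]),
  (jRen v0 v1 (pSucc v2 v3) (pSucc v4 v5), [jApp v0 v2 v4, jApp v0 v3 v5]),
  (jRen v0 v1 (pZero v2) (pZero v4), [jApp v0 v2 v4]),
  (jRen v0 v1 (pMem v2 v3) (pMem v4 v5), [jApp v0 v2 v4, jApp v1 v3 v5]),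
  (jRen v0 v1 pTru pTru, []),
  (jRen v0 v1 pFls pFls, []),
  (jRen v0 v1 (pAnd v2 v3) (pAnd v4 v5), [jRen v0 v1 v2 v4, jRen v0 v1 v3 v5]),
  (jRen v0 v1 (pNeg v2) (pNeg v4), [jRen v0 v1 v2 v4]),
  (jRen v0 v1 (pExI v2) (pExI v4), [jRen (pup v0) v1 v2 v4]),
  (jRen v0 v1 (pExP v2) (pExP v4), [jRen v0 (pup v1) v2 v4]),
  (jRens v0 v1 pnil pnil, []),
  (jRens v0 v1 (pcons v2 v3) (pcons v4 v5), [jRen v0 v1 v2 v4, jRens v0 v1 v3 v5])]"

abbreviation "pnil1 x \<equiv> pcons x pnil"
abbreviation "pnil2 x y \<equiv> pcons x (pcons y pnil)"
abbreviation "pone \<equiv> PK (Suc 0)"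

text \<open>One clause per rule of \<open>ax_step\<close>, in the same order. Instances and lifted
  formulae are not computed but certified by renaming judgements.\<close>

definition prog_ax :: "clause list" where "prog_ax = [
  (jAx (pnil2 v0 v1) (pAnd v0 v1), []),
  (jAx (pnil1 (pAnd v0 v1)) v0, []),
  (jAx (pnil1 (pAnd v0 v1)) v1, []),
  (jAx (pnil2 v0 (pNeg v0)) pFls, []),
  (jAx pnil pTru, []),
  (jAx (pnil1 v0) (pExI v1), [jRen (pinst v2) pid v1 v0]),
  (jAx (pnil1 v0) (pExP v1), [jRen pid (pinst v2) v1 v0]),
  (jAx pnil (pEq v0 v0), []),
  (jAx (pnil2 v0 (pEq v1 v2)) v3, [jRen (pinst v1) pid v4 v0, jRen (pinst v2) pid v4 v3]),
  (jAx pnil (pLe v0 v0), []),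
  (jAx (pnil2 (pLe v0 v1) (pLe v1 v2)) (pLe v0 v2), []),
  (jAx (pnil2 (pLe v0 v1) (pLe v1 v0)) (pEq v0 v1), []),
  (jAx pnil (pExI (pZero (PK 0))), []),
  (jAx (pnil2 (pZero v0) (pZero v1)) (pEq v0 v1), []),
  (jAx pnil (pExI (pSucc (PS v0) (PK 0))), []),
  (jAx (pnil2 (pSucc v0 v1) (pSucc v2 v1)) (pEq v0 v2), []),
  (jAx (pnil2 (pSucc v0 v1) (pSucc v0 v2)) (pEq v1 v2), []),
  (jAx (pnil2 (pSucc v0 v1) (pZero v1)) pFls, []),
  (jAx (pnil1 (pSucc v0 v1)) (pLe v0 v1), []),
  (jAx (pcons (pSucc v0 v1) (pnil2 (pLe v2 v1) (pNeg (pEq v2 v1)))) (pLe v2 v0), []),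
  (jAx pnil (pExP (pNeg (pExI (pNeg (pAnd (pNeg (pAnd (pMem (PK 0) (PK 0)) (pNeg v0)))
      (pNeg (pAnd v0 (pNeg (pMem (PK 0) (PK 0)))))))))), [jRen pid psuc v1 v0]),
  (jAx pnil (pNeg (pAnd (pNeg (pExI (pAnd (pZero (PK 0)) (pNeg (pMem (PK 0) v0)))))
     (pAnd (pNeg (pExI (pExI (pAnd (pSucc pone (PK 0)) (pAnd (pMem pone v0) (pNeg (pMem (PK 0) v0)))))))
       (pExI (pNeg (pMem (PK 0) v0)))))), [])]"

text \<open>In the first clause the identity renaming certifies that \<open>v0\<close> codes a list
  of formulae; membership of \<open>Fls\<close> alone would admit arbitrary other entries.\<close>

definition prog_ref :: "clause list" where "prog_ref = [
  (jRef v0, [jMem pFls v0, jRens pid pid v0 v1]),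
  (jRef v0, [jAx v1 v2, jSub v1 v0, jRef (pcons v2 v0)]),
  (jRef v0, [jRef (pcons v1 v0), jRef (pcons (pNeg v1) v0)]),
  (jRef v0, [jMem (pExI v1) v0, jRens psuc pid v0 v2, jRef (pcons v1 v2)]),
  (jRef v0, [jMem (pExP v1) v0, jRens pid psuc v0 v2, jRef (pcons v1 v2)])]"

abbreviation "pst p q j s \<equiv> PA (PA q p) (PP j s)"

text \<open>That a state is in range is expressed by reading the row with its number. In the output
  clauses \<open>q\<close> is written as \<open>PS (PA v3 v1)\<close>, so that machine
  \<open>j\<close> owns the output index \<open>q - 1 - j\<close>. Letters are binary numbers with
  the least significant bit first, whence the doubling of \<open>v2\<close>.\<close>

definition prog_table :: "clause list" where "prog_table = [
  (jLetter v0 (PK 0) (PK 0) pTru, []),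
  (jLetter v0 (PS v1) (PA v2 v2) (pAnd (pNeg (pMem (PK 0) v0)) v3), [jLetter (PS v0) v1 v2 v3]),
  (jLetter v0 (PS v1) (PS (PA v2 v2)) (pAnd (pMem (PK 0) v0) v3), [jLetter (PS v0) v1 v2 v3]),
  (jHyp v0 v1 v2 (pNeg (pExI (pAnd (pZero (PK 0)) (pNeg (pMem (PK 0) (pst v0 v1 v3 v4)))))), [jNth v2 v3 (PP v4 v5)]),
  (jHyp v0 v1 v2 (pNeg (pExI (pExI (pAnd (pSucc (PK 0) pone) (pAnd (pMem (PK 0) (pst v0 v1 v3 v4))
     (pAnd v5 (pNeg (pMem pone (pst v0 v1 v3 v6))))))))),
    [jNth v2 v3 (PP (PV 9) (PV 10)), jNth (PV 10) v4 (PV 11), jNth (PV 11) v7 (PP v6 v8), jLetter v1 v0 v7 v5]),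
  (jHyp v0 (PS (PA v3 v1)) v2 (pNeg (pExI (pAnd (pMem (PK 0) (pst v0 (PS (PA v3 v1)) v3 v4))
     (pAnd v5 (pNeg (pMem (PK 0) v1)))))),
    [jNth v2 v3 (PP (PV 9) (PV 10)), jNth (PV 10) v4 (PV 11), jNth (PV 11) v7 (PP v6 (PK 1)), jLetter (PS (PA v3 v1)) v0 v7 v5]),
  (jHyp v0 (PS (PA v3 v1)) v2 (pNeg (pExI (pAnd (pMem (PK 0) (pst v0 (PS (PA v3 v1)) v3 v4))
     (pAnd v5 (pMem (PK 0) v1))))),
    [jNth v2 v3 (PP (PV 9) (PV 10)), jNth (PV 10) v4 (PV 11), jNth (PV 11) v7 (PP v6 (PK 0)), jLetter (PS (PA v3 v1)) v0 v7 v5]),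
  (jHyps v0 v1 v2 pnil, []),
  (jHyps v0 v1 v2 (pcons v3 v4), [jHyp v0 v1 v2 v3, jHyps v0 v1 v2 v4]),
  (jRow v0 pnil, []),
  (jRow v0 (pcons (PP v1 (PK 0)) v2), [jNth v0 v1 v3, jRow v0 v2]),
  (jRow v0 (pcons (PP v1 (PK 1)) v2), [jNth v0 v1 v3, jRow v0 v2]),
  (jRows v0 v1 pnil, []),
  (jRows v0 v1 (pcons v2 v3), [jLen v2 v1, jRow v0 v2, jRows v0 v1 v3]),
  (jTables v0 pnil, []),
  (jTables v0 (pcons (PP v1 v2) v3), [jNth v2 v1 v4, jRows v2 v0 v2, jTables v0 v3]),
  (jMain v0 v1 v2 v3, [jPow v0 v4, jTables v4 v3, jLen v3 v1, jHyps v0 v1 v3 v5, jRef (pcons (pNeg v2) v5)])]"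

definition prog :: "clause list" where
  "prog = prog_list @ prog_ren @ prog_ax @ prog_ref @ prog_table"

abbreviation pair (infixr "\<star>" 60) where "a \<star> b \<equiv> prod_encode (a, b)"

subsection \<open>Soundness\<close>

text \<open>Assumes that \<open>r\<close> and \<open>s\<close> are codes but asserts that
  \<open>a\<close> and \<open>b\<close> are; a renaming judgement thus also certifies well-formed
  formulae.\<close>

definition sem_ren :: "nat \<Rightarrow> nat \<Rightarrow> nat \<Rightarrow> nat \<Rightarrow> bool" where
  "sem_ren r s a b \<longleftrightarrow> (\<forall>\<rho> \<tau>. r = rcode \<rho> \<longrightarrow> s = rcode \<tau> \<longrightarrow>
     (\<exists>\<phi>. a = fm_code \<phi> \<and> b = fm_code (ren (rfun \<rho>) (rfun \<tau>) \<phi>)))"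

definition sem_rens :: "nat \<Rightarrow> nat \<Rightarrow> nat \<Rightarrow> nat \<Rightarrow> bool" where
  "sem_rens r s g h \<longleftrightarrow> (\<forall>\<rho> \<tau>. r = rcode \<rho> \<longrightarrow> s = rcode \<tau> \<longrightarrow>
     (\<exists>\<Gamma>. g = lcode \<Gamma> \<and> h = lcode (map (ren (rfun \<rho>) (rfun \<tau>)) \<Gamma>)))"

text \<open>Conditional in both arguments, since the clauses for axioms do not check that their
  arguments are codes.\<close>

definition sem_ax :: "nat \<Rightarrow> nat \<Rightarrow> bool" where
  "sem_ax l a \<longleftrightarrow> (\<forall>ps \<phi>. l = lcode ps \<longrightarrow> a = fm_code \<phi> \<longrightarrow> ax_step ps \<phi>)"

definition sem_ref :: "nat \<Rightarrow> bool" where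
  "sem_ref g \<longleftrightarrow> (\<exists>\<Gamma>. g = lcode \<Gamma> \<and> refutable \<Gamma>)"

definition sem_letter :: "nat \<Rightarrow> nat \<Rightarrow> nat \<Rightarrow> nat \<Rightarrow> bool" where
  "sem_letter x k m f \<longleftrightarrow> (\<exists>a. length a = k \<and> horner_sum of_bool 2 a = m \<and> f = fm_code (letter_fm x a))"

definition sem_nth :: "nat \<Rightarrow> nat \<Rightarrow> nat \<Rightarrow> bool" where
  "sem_nth l i x \<longleftrightarrow> i < length (list_decode l) \<and> list_decode l ! i = x"

definition sem_hyp :: "nat \<Rightarrow> nat \<Rightarrow> nat \<Rightarrow> nat \<Rightarrow> bool" where
  "sem_hyp p q t g \<longleftrightarrow> (\<forall>Ts. t = list_encode (map table_code Ts) \<longrightarrow> (\<exists>\<gamma>. g = fm_code \<gamma> \<and> hyp p q Ts \<gamma>))"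

definition sem_hyps :: "nat \<Rightarrow> nat \<Rightarrow> nat \<Rightarrow> nat \<Rightarrow> bool" where
  "sem_hyps p q t g \<longleftrightarrow> (\<forall>Ts. t = list_encode (map table_code Ts) \<longrightarrow>
     (\<exists>\<Gamma>. g = lcode \<Gamma> \<and> (\<forall>\<gamma>\<in>set \<Gamma>. hyp p q Ts \<gamma>)))"

definition sem_row :: "nat \<Rightarrow> nat \<Rightarrow> bool" where
  "sem_row t r \<longleftrightarrow> (\<exists>row. r = row_code row \<and> (\<forall>(s, b)\<in>set row. s < length (list_decode t)))"

definition sem_rows :: "nat \<Rightarrow> nat \<Rightarrow> nat \<Rightarrow> bool" where
  "sem_rows t m l \<longleftrightarrow> (\<exists>rows. l = list_encode (map row_code rows) \<and>
     (\<forall>row\<in>set rows. length row = m \<and> (\<forall>(s, b)\<in>set row. s < length (list_decode t))))"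

definition sem_tables :: "nat \<Rightarrow> nat \<Rightarrow> bool" where
  "sem_tables m l \<longleftrightarrow> (\<exists>Ts. l = list_encode (map table_code Ts) \<and> (\<forall>T\<in>set Ts. fst T < length (snd T) \<and>
     (\<forall>row\<in>set (snd T). length row = m \<and> (\<forall>(s, b)\<in>set row. s < length (snd T)))))"

definition sem_main :: "nat \<Rightarrow> nat \<Rightarrow> nat \<Rightarrow> nat \<Rightarrow> bool" where
  "sem_main p q f t \<longleftrightarrow> (\<forall>\<phi>. f = fm_code \<phi> \<longrightarrow> (\<exists>Ts. t = list_encode (map table_code Ts) \<and>
     (\<forall>T\<in>set Ts. wf_table p T) \<and> length Ts = q \<and> (\<exists>\<Gamma>. (\<forall>\<gamma>\<in>set \<Gamma>. hyp p q Ts \<gamma>) \<and> refutable (Neg \<phi> # \<Gamma>))))"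

text \<open>The numbers \<open>a\<close>, \<open>b\<close>, \<open>c\<close> are components of the
  nested pair and \<open>z\<close>, \<open>y\<close>, \<open>x\<close>, \<open>d\<close> its
  successive rests, so that judgements of every arity are decoded by the same projections.\<close>

definition sem :: "nat \<Rightarrow> bool" where
  "sem n \<longleftrightarrow> (let t = pfst n; z = psnd n; a = pfst z; y = psnd z; b = pfst y; x = psnd y; c = pfst x; d = psnd x in
     (t = 0 \<longrightarrow> a \<in> set (list_decode y)) \<and>
     (t = 1 \<longrightarrow> set (list_decode a) \<subseteq> set (list_decode y)) \<and>
     (t = 2 \<longrightarrow> (\<forall>\<rho>. a = rcode \<rho> \<longrightarrow> x = rfun \<rho> b)) \<and>
     (t = 3 \<longrightarrow> sem_ren a b c d) \<and>
     (t = 4 \<longrightarrow> sem_rens a b c d) \<and>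
     (t = 5 \<longrightarrow> sem_ax a y) \<and>
     (t = 6 \<longrightarrow> sem_ref z) \<and>
     (t = 7 \<longrightarrow> sem_nth a b x) \<and>
     (t = 8 \<longrightarrow> sem_letter a b c d) \<and>
     (t = 9 \<longrightarrow> sem_hyp a b c d) \<and>
     (t = 10 \<longrightarrow> sem_hyps a b c d) \<and>
     (t = 11 \<longrightarrow> length (list_decode a) = y) \<and>
     (t = 12 \<longrightarrow> y = 2 ^ a) \<and>
     (t = 13 \<longrightarrow> sem_row a y) \<and>
     (t = 14 \<longrightarrow> sem_rows a b x) \<and>
     (t = 15 \<longrightarrow> sem_tables a y) \<and>
     (t = 16 \<longrightarrow> sem_main a b c d))"

lemma sem_simps [simp]:
  "sem (0 \<star> x \<star> l) \<longleftrightarrow> x \<in> set (list_decode l)"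
  "sem (Suc 0 \<star> l \<star> g) \<longleftrightarrow> set (list_decode l) \<subseteq> set (list_decode g)"
  "sem (2 \<star> r \<star> u \<star> y) \<longleftrightarrow> (\<forall>\<rho>. r = rcode \<rho> \<longrightarrow> y = rfun \<rho> u)"
  "sem (3 \<star> r \<star> s \<star> a \<star> b) \<longleftrightarrow> sem_ren r s a b"
  "sem (4 \<star> r \<star> s \<star> a \<star> b) \<longleftrightarrow> sem_rens r s a b"
  "sem (5 \<star> l \<star> a) \<longleftrightarrow> sem_ax l a"
  "sem (6 \<star> g) \<longleftrightarrow> sem_ref g"
  "sem (7 \<star> l \<star> i \<star> x) \<longleftrightarrow> sem_nth l i x"
  "sem (8 \<star> x \<star> k \<star> m \<star> f) \<longleftrightarrow> sem_letter x k m f"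
  "sem (9 \<star> p \<star> q \<star> t \<star> g) \<longleftrightarrow> sem_hyp p q t g"
  "sem (10 \<star> p \<star> q \<star> t \<star> g) \<longleftrightarrow> sem_hyps p q t g"
  "sem (11 \<star> l \<star> n) \<longleftrightarrow> length (list_decode l) = n"
  "sem (12 \<star> k \<star> n) \<longleftrightarrow> n = 2 ^ k"
  "sem (13 \<star> t \<star> r) \<longleftrightarrow> sem_row t r"
  "sem (14 \<star> t \<star> m \<star> l) \<longleftrightarrow> sem_rows t m l"
  "sem (15 \<star> m \<star> l) \<longleftrightarrow> sem_tables m l"
  "sem (16 \<star> p \<star> q \<star> f \<star> t) \<longleftrightarrow> sem_main p q f t"
  unfolding sem_def by (simp_all add: Let_def)

lemma lcode_simps: "lcode [] = 0" "lcode (\<phi> # \<Gamma>) = Suc (fm_code \<phi> \<star> lcode \<Gamma>)"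
  "list_decode (lcode \<Gamma>) = map fm_code \<Gamma>"
  by (simp_all add: lcode_def)

lemma lcode_eq: "0 = lcode \<Gamma> \<longleftrightarrow> \<Gamma> = []"
  "Suc (x \<star> y) = lcode \<Gamma> \<longleftrightarrow> (\<exists>\<phi> \<Delta>. \<Gamma> = \<phi> # \<Delta> \<and> x = fm_code \<phi> \<and> y = lcode \<Delta>)"
  by (cases \<Gamma>; simp add: lcode_simps)+

lemma lcode_inject: "lcode \<Gamma> = lcode \<Delta> \<longleftrightarrow> \<Gamma> = \<Delta>"
  by (simp add: lcode_def list_encode_eq inj_map_eq_map inj_def fm_code_inject)

lemma fm_code_eq:
  "0 \<star> z = fm_code \<phi> \<longleftrightarrow> (\<exists>x y. \<phi> = Eq x y \<and> z = x \<star> y)"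
  "Suc 0 \<star> z = fm_code \<phi> \<longleftrightarrow> (\<exists>x y. \<phi> = Le x y \<and> z = x \<star> y)"
  "2 \<star> z = fm_code \<phi> \<longleftrightarrow> (\<exists>x y. \<phi> = Succ x y \<and> z = x \<star> y)"
  "3 \<star> z = fm_code \<phi> \<longleftrightarrow> \<phi> = Zero z"
  "4 \<star> z = fm_code \<phi> \<longleftrightarrow> (\<exists>x y. \<phi> = Mem x y \<and> z = x \<star> y)"
  "5 \<star> z = fm_code \<phi> \<longleftrightarrow> \<phi> = Tru \<and> z = 0"
  "6 \<star> z = fm_code \<phi> \<longleftrightarrow> \<phi> = Fls \<and> z = 0"
  "7 \<star> z = fm_code \<phi> \<longleftrightarrow> (\<exists>x y. \<phi> = And x y \<and> z = fm_code x \<star> fm_code y)"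
  "8 \<star> z = fm_code \<phi> \<longleftrightarrow> (\<exists>x. \<phi> = Neg x \<and> z = fm_code x)"
  "9 \<star> z = fm_code \<phi> \<longleftrightarrow> (\<exists>x. \<phi> = ExI x \<and> z = fm_code x)"
  "10 \<star> z = fm_code \<phi> \<longleftrightarrow> (\<exists>x. \<phi> = ExP x \<and> z = fm_code x)"
  by (cases \<phi>; auto)+

lemma rcode_eq: "0 \<star> z = rcode \<rho> \<longleftrightarrow> \<rho> = RId \<and> z = 0" "Suc 0 \<star> z = rcode \<rho> \<longleftrightarrow> \<rho> = RSuc \<and> z = 0"
  "2 \<star> z = rcode \<rho> \<longleftrightarrow> \<rho> = RInst z" "3 \<star> z = rcode \<rho> \<longleftrightarrow> (\<exists>\<tau>. \<rho> = RUp \<tau> \<and> z = rcode \<tau>)"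
  by (cases \<rho>; auto)+

section \<open>Soundness clause by clause\<close>

definition sound :: "clause list \<Rightarrow> bool" where
  "sound cs \<longleftrightarrow> (\<forall>(h, bs)\<in>set cs. \<forall>v. (\<forall>b\<in>set bs. sem (ev v b)) \<longrightarrow> sem (ev v h))"

lemma sound_prog_list: "sound prog_list"
  unfolding sound_def prog_list_def by (simp add: sem_nth_def)

lemma sem_ren_intros:
  "\<forall>\<rho>. r = rcode \<rho> \<longrightarrow> x' = rfun \<rho> x \<Longrightarrow> \<forall>\<rho>. r = rcode \<rho> \<longrightarrow> y' = rfun \<rho> y \<Longrightarrow> sem_ren r s (0 \<star> x \<star> y) (0 \<star> x' \<star> y')"
  "\<forall>\<rho>. r = rcode \<rho> \<longrightarrow> x' = rfun \<rho> x \<Longrightarrow> \<forall>\<rho>. r = rcode \<rho> \<longrightarrow> y' = rfun \<rho> y \<Longrightarrow> sem_ren r s (Suc 0 \<star> x \<star> y) (Suc 0 \<star> x' \<star> y')"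
  "\<forall>\<rho>. r = rcode \<rho> \<longrightarrow> x' = rfun \<rho> x \<Longrightarrow> \<forall>\<rho>. r = rcode \<rho> \<longrightarrow> y' = rfun \<rho> y \<Longrightarrow> sem_ren r s (2 \<star> x \<star> y) (2 \<star> x' \<star> y')"
  "\<forall>\<rho>. r = rcode \<rho> \<longrightarrow> x' = rfun \<rho> x \<Longrightarrow> sem_ren r s (3 \<star> x) (3 \<star> x')"
  "\<forall>\<rho>. r = rcode \<rho> \<longrightarrow> x' = rfun \<rho> x \<Longrightarrow> \<forall>\<rho>. s = rcode \<rho> \<longrightarrow> y' = rfun \<rho> y \<Longrightarrow> sem_ren r s (4 \<star> x \<star> y) (4 \<star> x' \<star> y')"
  "sem_ren r s (5 \<star> 0) (5 \<star> 0)" "sem_ren r s (6 \<star> 0) (6 \<star> 0)"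
  unfolding sem_ren_def by (simp_all add: fm_code_eq)

lemma sem_ren_connectives:
  "sem_ren r s a a' \<Longrightarrow> sem_ren r s b b' \<Longrightarrow> sem_ren r s (7 \<star> a \<star> b) (7 \<star> a' \<star> b')"
  "sem_ren r s a a' \<Longrightarrow> sem_ren r s (8 \<star> a) (8 \<star> a')"
proof -
  assume a: "sem_ren r s a a'" and b: "sem_ren r s b b'"
  show "sem_ren r s (7 \<star> a \<star> b) (7 \<star> a' \<star> b')" unfolding sem_ren_def
  proof (intro allI impI)
    fix \<rho> \<tau> assume c: "r = rcode \<rho>" "s = rcode \<tau>"
    obtain \<phi> where "a = fm_code \<phi>" "a' = fm_code (ren (rfun \<rho>) (rfun \<tau>) \<phi>)" using a c unfolding sem_ren_def by blast
    moreover obtain \<psi> where "b = fm_code \<psi>" "b' = fm_code (ren (rfun \<rho>) (rfun \<tau>) \<psi>)" using b c unfolding sem_ren_def by blast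
    ultimately show "\<exists>\<phi>. 7 \<star> a \<star> b = fm_code \<phi> \<and> 7 \<star> a' \<star> b' = fm_code (ren (rfun \<rho>) (rfun \<tau>) \<phi>)"
      by (intro exI[of _ "And \<phi> \<psi>"]) simp
  qed
next
  assume a: "sem_ren r s a a'"
  show "sem_ren r s (8 \<star> a) (8 \<star> a')" unfolding sem_ren_def
  proof (intro allI impI)
    fix \<rho> \<tau> assume c: "r = rcode \<rho>" "s = rcode \<tau>"
    obtain \<phi> where "a = fm_code \<phi>" "a' = fm_code (ren (rfun \<rho>) (rfun \<tau>) \<phi>)" using a c unfolding sem_ren_def by blast
    then show "\<exists>\<phi>. 8 \<star> a = fm_code \<phi> \<and> 8 \<star> a' = fm_code (ren (rfun \<rho>) (rfun \<tau>) \<phi>)"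
      by (intro exI[of _ "Neg \<phi>"]) simp
  qed
qed

lemma sem_ren_quantifiers:
  "sem_ren (3 \<star> r) s a a' \<Longrightarrow> sem_ren r s (9 \<star> a) (9 \<star> a')"
  "sem_ren r (3 \<star> s) a a' \<Longrightarrow> sem_ren r s (10 \<star> a) (10 \<star> a')"
proof -
  assume a: "sem_ren (3 \<star> r) s a a'"
  show "sem_ren r s (9 \<star> a) (9 \<star> a')" unfolding sem_ren_def
  proof (intro allI impI)
    fix \<rho> \<tau> assume c: "r = rcode \<rho>" "s = rcode \<tau>"
    then have "3 \<star> r = rcode (RUp \<rho>)" by simp
    then obtain \<phi> where "a = fm_code \<phi>" "a' = fm_code (ren (rfun (RUp \<rho>)) (rfun \<tau>) \<phi>)"
      using a c(2) unfolding sem_ren_def by blast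
    then show "\<exists>\<phi>. 9 \<star> a = fm_code \<phi> \<and> 9 \<star> a' = fm_code (ren (rfun \<rho>) (rfun \<tau>) \<phi>)"
      by (intro exI[of _ "ExI \<phi>"]) simp
  qed
next
  assume a: "sem_ren r (3 \<star> s) a a'"
  show "sem_ren r s (10 \<star> a) (10 \<star> a')" unfolding sem_ren_def
  proof (intro allI impI)
    fix \<rho> \<tau> assume c: "r = rcode \<rho>" "s = rcode \<tau>"
    then have "3 \<star> s = rcode (RUp \<tau>)" by simp
    then obtain \<phi> where "a = fm_code \<phi>" "a' = fm_code (ren (rfun \<rho>) (rfun (RUp \<tau>)) \<phi>)"
      using a c(1) unfolding sem_ren_def by blast
    then show "\<exists>\<phi>. 10 \<star> a = fm_code \<phi> \<and> 10 \<star> a' = fm_code (ren (rfun \<rho>) (rfun \<tau>) \<phi>)"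
      by (intro exI[of _ "ExP \<phi>"]) simp
  qed
qed

lemma sem_rens_intros: "sem_rens r s 0 0"
  "sem_ren r s a a' \<Longrightarrow> sem_rens r s g g' \<Longrightarrow> sem_rens r s (Suc (a \<star> g)) (Suc (a' \<star> g'))"
proof -
  show "sem_rens r s 0 0" unfolding sem_rens_def by (simp add: lcode_eq)
  assume a: "sem_ren r s a a'" and g: "sem_rens r s g g'"
  show "sem_rens r s (Suc (a \<star> g)) (Suc (a' \<star> g'))" unfolding sem_rens_def
  proof (intro allI impI)
    fix \<rho> \<tau> assume c: "r = rcode \<rho>" "s = rcode \<tau>"
    obtain \<phi> where "a = fm_code \<phi>" "a' = fm_code (ren (rfun \<rho>) (rfun \<tau>) \<phi>)" using a c unfolding sem_ren_def by blast
    moreover obtain \<Gamma> where "g = lcode \<Gamma>" "g' = lcode (map (ren (rfun \<rho>) (rfun \<tau>)) \<Gamma>)" using g c unfolding sem_rens_def by blast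
    ultimately show "\<exists>\<Gamma>. Suc (a \<star> g) = lcode \<Gamma> \<and> Suc (a' \<star> g') = lcode (map (ren (rfun \<rho>) (rfun \<tau>)) \<Gamma>)"
      by (intro exI[of _ "\<phi> # \<Gamma>"]) (simp add: lcode_simps)
  qed
qed

lemma sound_prog_ren: "sound prog_ren"
  unfolding sound_def prog_ren_def
  by (simp add: sem_ren_intros sem_ren_connectives sem_ren_quantifiers sem_rens_intros rcode_eq)
    auto

lemma sem_ren_inst:
  "sem_ren (2 \<star> y) (0 \<star> 0) a b \<Longrightarrow> \<exists>\<phi>. a = fm_code \<phi> \<and> b = fm_code (inst_ind y \<phi>)"
  "sem_ren (0 \<star> 0) (2 \<star> y) a b \<Longrightarrow> \<exists>\<phi>. a = fm_code \<phi> \<and> b = fm_code (inst_pred y \<phi>)"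
  "sem_ren (0 \<star> 0) (Suc 0 \<star> 0) a b \<Longrightarrow> \<exists>\<phi>. a = fm_code \<phi> \<and> b = fm_code (lift_pred \<phi>)"
  unfolding sem_ren_def inst_ind_def inst_pred_def
  by (drule spec[of _ "RInst y"], drule spec[of _ RId], simp,
      drule spec[of _ RId], drule spec[of _ "RInst y"], simp,
      drule spec[of _ RId], drule spec[of _ RSuc], simp)

lemma sem_ax_renaming:
  "sem_ren (2 \<star> y) (0 \<star> 0) a b \<Longrightarrow> sem_ax (Suc (b \<star> 0)) (9 \<star> a)"
  "sem_ren (0 \<star> 0) (2 \<star> y) a b \<Longrightarrow> sem_ax (Suc (b \<star> 0)) (10 \<star> a)"
  "sem_ren (2 \<star> y) (0 \<star> 0) a b \<Longrightarrow> sem_ren (2 \<star> z) (0 \<star> 0) a c \<Longrightarrow> sem_ax (Suc (b \<star> Suc ((0 \<star> y \<star> z) \<star> 0))) c"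
  "sem_ren (0 \<star> 0) (Suc 0 \<star> 0) a b \<Longrightarrow>
    sem_ax 0 (10 \<star> 8 \<star> 9 \<star> 8 \<star> 7 \<star> (8 \<star> 7 \<star> (4 \<star> 0 \<star> 0) \<star> 8 \<star> b) \<star> 8 \<star> 7 \<star> b \<star> 8 \<star> 4 \<star> 0 \<star> 0)"
  unfolding sem_ax_def
  by (drule sem_ren_inst, clarsimp simp: lcode_eq fm_code_eq fm_code_inject, rule ax_step.intros,
      drule sem_ren_inst, clarsimp simp: lcode_eq fm_code_eq fm_code_inject, rule ax_step.intros,
      drule sem_ren_inst, drule sem_ren_inst, clarsimp simp: lcode_eq fm_code_eq fm_code_inject, rule ax_step.intros,
      drule sem_ren_inst, clarsimp simp: lcode_eq fm_code_eq fm_code_inject,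
      rule ax_step.intros(21)[unfolded compr_ax_def])

lemma sound_prog_ax: "sound prog_ax"
proof -
  have plain: "sem_ax (ev v l) (ev v a)"
    if "(jAx l a, []) \<in> set prog_ax" for l a v
    using that unfolding prog_ax_def sem_ax_def
    by (simp, elim disjE;
      clarsimp simp: lcode_eq fm_code_eq fm_code_inject ax_step.intros ax_step.intros(22)[unfolded ind_ax_def])
  show ?thesis
    unfolding sound_def
  proof (intro ballI, clarify)
    fix h bs v assume c: "(h, bs) \<in> set prog_ax" and b: "\<forall>b\<in>set bs. sem (ev v b)"
    show "sem (ev v h)"
    proof (cases "bs = []")
      case True
      then obtain l a where "h = jAx l a" using c unfolding prog_ax_def by auto
      then show ?thesis using plain[of l a v] c True by simp
    next
      case False
      then show ?thesis using c b sem_ax_renaming unfolding prog_ax_def by auto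
    qed
  qed
qed


lemma codes_subset: "set xs \<subseteq> fm_code ` S \<Longrightarrow> \<exists>ps. xs = map fm_code ps \<and> set ps \<subseteq> S"
proof (induction xs)
  case (Cons x xs)
  then obtain ps \<phi> where "xs = map fm_code ps" "set ps \<subseteq> S" "\<phi> \<in> S" "x = fm_code \<phi>" by auto
  then show ?case by (intro exI[of _ "\<phi> # ps"]) simp
qed simp

lemma mem_lcode: "fm_code \<phi> \<in> set (list_decode (lcode \<Gamma>)) \<longleftrightarrow> \<phi> \<in> set \<Gamma>"
  by (auto simp: lcode_simps fm_code_inject)

lemma sem_ref_falsity:
  assumes "6 \<star> 0 \<in> set (list_decode g)" "sem_rens (0 \<star> 0) (0 \<star> 0) g h"
  shows "sem_ref g"
proof -
  have "0 \<star> 0 = rcode RId" by simp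
  then obtain \<Gamma> where g: "g = lcode \<Gamma>" using assms(2) unfolding sem_rens_def by blast
  then have "Fls \<in> set \<Gamma>" using assms(1) mem_lcode[of Fls \<Gamma>] by simp
  then show ?thesis unfolding sem_ref_def using g refutable.falsity by blast
qed

text \<open>That the premises and the conclusion of the axiom are codes of formulae is inferred
  here: the premises occur in \<open>g\<close>, and the conclusion heads a list already known to be
  refutable.\<close>

lemma sem_ref_step:
  assumes "sem_ax l a" "set (list_decode l) \<subseteq> set (list_decode g)" "sem_ref (Suc (a \<star> g))"
  shows "sem_ref g"
proof -
  obtain \<phi> \<Gamma> where c: "a = fm_code \<phi>" "g = lcode \<Gamma>" "refutable (\<phi> # \<Gamma>)"
    using assms(3) unfolding sem_ref_def lcode_eq by blast
  have "set (list_decode l) \<subseteq> fm_code ` set \<Gamma>" using assms(2) c(2) by (simp add: lcode_simps)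
  then obtain ps where ps: "list_decode l = map fm_code ps" "set ps \<subseteq> set \<Gamma>" using codes_subset by blast
  have "l = lcode ps" unfolding lcode_def ps(1)[symmetric] by simp
  then have "ax_step ps \<phi>" using assms(1) c(1) unfolding sem_ax_def by blast
  then show ?thesis unfolding sem_ref_def using c refutable.step ps(2) by blast
qed

lemma sem_ref_split:
  assumes "sem_ref (Suc (a \<star> g))" "sem_ref (Suc ((8 \<star> a) \<star> g))"
  shows "sem_ref g"
proof -
  obtain \<phi> \<Gamma> where c: "a = fm_code \<phi>" "g = lcode \<Gamma>" "refutable (\<phi> # \<Gamma>)"
    using assms(1) unfolding sem_ref_def lcode_eq by blast
  obtain \<psi> \<Delta> where d: "8 \<star> a = fm_code \<psi>" "g = lcode \<Delta>" "refutable (\<psi> # \<Delta>)"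
    using assms(2) unfolding sem_ref_def lcode_eq by blast
  have "\<psi> = Neg \<phi>" using d(1) c(1) by (auto simp: fm_code_eq fm_code_inject)
  moreover have "\<Delta> = \<Gamma>" using c(2) d(2) by (simp add: lcode_inject)
  ultimately show ?thesis unfolding sem_ref_def using c d refutable.split by blast
qed

lemma sem_ref_witness_ind:
  assumes "9 \<star> a \<in> set (list_decode g)" "sem_rens (Suc 0 \<star> 0) (0 \<star> 0) g h" "sem_ref (Suc (a \<star> h))"
  shows "sem_ref g"
proof -
  have "Suc 0 \<star> 0 = rcode RSuc" "0 \<star> 0 = rcode RId" by simp_all
  then obtain \<Gamma> where g: "g = lcode \<Gamma>" "h = lcode (map lift_ind \<Gamma>)"
    using assms(2) unfolding sem_rens_def by (metis rfun.simps(1,2))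
  obtain \<phi> \<Delta> where c: "a = fm_code \<phi>" "h = lcode \<Delta>" "refutable (\<phi> # \<Delta>)"
    using assms(3) unfolding sem_ref_def lcode_eq by blast
  have "\<Delta> = map lift_ind \<Gamma>" using g(2) c(2) by (simp add: lcode_inject)
  moreover have "ExI \<phi> \<in> set \<Gamma>" using assms(1) mem_lcode[of "ExI \<phi>" \<Gamma>] g(1) c(1) by simp
  ultimately show ?thesis unfolding sem_ref_def using c g refutable.witness_ind by blast
qed

lemma sem_ref_witness_pred:
  assumes "10 \<star> a \<in> set (list_decode g)" "sem_rens (0 \<star> 0) (Suc 0 \<star> 0) g h" "sem_ref (Suc (a \<star> h))"
  shows "sem_ref g"
proof -
  have "Suc 0 \<star> 0 = rcode RSuc" "0 \<star> 0 = rcode RId" by simp_all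
  then obtain \<Gamma> where g: "g = lcode \<Gamma>" "h = lcode (map lift_pred \<Gamma>)"
    using assms(2) unfolding sem_rens_def by (metis rfun.simps(1,2))
  obtain \<phi> \<Delta> where c: "a = fm_code \<phi>" "h = lcode \<Delta>" "refutable (\<phi> # \<Delta>)"
    using assms(3) unfolding sem_ref_def lcode_eq by blast
  have "\<Delta> = map lift_pred \<Gamma>" using g(2) c(2) by (simp add: lcode_inject)
  moreover have "ExP \<phi> \<in> set \<Gamma>" using assms(1) mem_lcode[of "ExP \<phi>" \<Gamma>] g(1) c(1) by simp
  ultimately show ?thesis unfolding sem_ref_def using c g refutable.witness_pred by blast
qed

lemma sound_prog_ref: "sound prog_ref"
  unfolding sound_def prog_ref_def
  by (simp, intro conjI allI impI; elim conjE)
    (erule (1) sem_ref_falsity, erule (2) sem_ref_step, erule (1) sem_ref_split,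
      erule (2) sem_ref_witness_ind, erule (2) sem_ref_witness_pred)

lemma sem_letter_intros: "sem_letter x 0 0 (5 \<star> 0)"
  "sem_letter (Suc x) k m f \<Longrightarrow> sem_letter x (Suc k) (m + m) (7 \<star> (8 \<star> 4 \<star> 0 \<star> x) \<star> f)"
  "sem_letter (Suc x) k m f \<Longrightarrow> sem_letter x (Suc k) (Suc (m + m)) (7 \<star> (4 \<star> 0 \<star> x) \<star> f)"
proof -
  show "sem_letter x 0 0 (5 \<star> 0)" unfolding sem_letter_def by simp
  assume "sem_letter (Suc x) k m f"
  then obtain a where a: "length a = k" "horner_sum of_bool 2 a = m" "f = fm_code (letter_fm (Suc x) a)"
    unfolding sem_letter_def by blast
  show "sem_letter x (Suc k) (m + m) (7 \<star> (8 \<star> 4 \<star> 0 \<star> x) \<star> f)"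
    unfolding sem_letter_def using a by (intro exI[of _ "False # a"]) simp
  show "sem_letter x (Suc k) (Suc (m + m)) (7 \<star> (4 \<star> 0 \<star> x) \<star> f)"
    unfolding sem_letter_def using a by (intro exI[of _ "True # a"]) simp
qed

lemma table_code_rows: "table_code T = fst T \<star> list_encode (map row_code (snd T))"
  by (simp add: table_code_def row_code_def[abs_def])

lemma sem_nth_table:
  assumes "sem_nth (list_encode (map table_code Ts)) j (x \<star> rows)"
  shows "j < length Ts" "x = fst (Ts ! j)" "rows = list_encode (map row_code (snd (Ts ! j)))"
  using assms unfolding sem_nth_def by (auto simp: table_code_rows)

lemma sem_nth_entry:
  assumes "sem_nth (list_encode (map table_code Ts)) j (x \<star> rows)" "sem_nth rows s row" "sem_nth row m (s' \<star> c)"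
  shows "s < length (snd (Ts ! j)) \<and> m < length (snd (Ts ! j) ! s) \<and>
    (\<exists>b. c = of_bool b \<and> snd (Ts ! j) ! s ! m = (s', b))"
proof -
  note T = sem_nth_table[OF assms(1)]
  have s: "s < length (snd (Ts ! j))" "row = row_code (snd (Ts ! j) ! s)"
    using assms(2) unfolding sem_nth_def T(3) by auto
  have "m < length (snd (Ts ! j) ! s)" "s' \<star> c = (\<lambda>(s, b). s \<star> of_bool b) (snd (Ts ! j) ! s ! m)"
    using assms(3) unfolding sem_nth_def s(2) row_code_def by auto
  then show ?thesis using s by (cases "snd (Ts ! j) ! s ! m") auto
qed

lemma sem_hyp_init:
  assumes "sem_nth t j (s \<star> rows)"
  shows "sem_hyp p q t (8 \<star> 9 \<star> 7 \<star> (3 \<star> 0) \<star> 8 \<star> 4 \<star> 0 \<star> (q + p + (j \<star> s)))"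
  unfolding sem_hyp_def
proof (intro allI impI)
  fix Ts assume t: "t = list_encode (map table_code Ts)"
  note T = sem_nth_table[OF assms[unfolded t]]
  show "\<exists>\<gamma>. 8 \<star> 9 \<star> 7 \<star> (3 \<star> 0) \<star> 8 \<star> 4 \<star> 0 \<star> (q + p + (j \<star> s)) = fm_code \<gamma> \<and> hyp p q Ts \<gamma>"
    using hyp.init[OF T(1), of p q] unfolding T(2)
    by (intro exI[of _ "init_fm (q + p + (j \<star> fst (Ts ! j)))"]) (simp add: init_fm_def)
qed

lemma sem_hyp_step:
  assumes "sem_nth t j (x \<star> rows)" "sem_nth rows s row" "sem_nth row m (s' \<star> c)" "sem_letter q p m f"
  shows "sem_hyp p q t (8 \<star> 9 \<star> 9 \<star> 7 \<star> (2 \<star> 0 \<star> Suc 0) \<star> 7 \<star> (4 \<star> 0 \<star> (q + p + (j \<star> s))) \<star>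
    7 \<star> f \<star> 8 \<star> 4 \<star> Suc 0 \<star> (q + p + (j \<star> s')))" (is "sem_hyp p q t ?g")
  unfolding sem_hyp_def
proof (intro allI impI)
  fix Ts assume t: "t = list_encode (map table_code Ts)"
  note T = sem_nth_table[OF assms(1)[unfolded t]]
  obtain b where E: "s < length (snd (Ts ! j))" "m < length (snd (Ts ! j) ! s)" "snd (Ts ! j) ! s ! m = (s', b)"
    using sem_nth_entry[OF assms(1)[unfolded t] assms(2,3)] by blast
  obtain a where a: "length a = p" "horner_sum of_bool 2 a = m" "f = fm_code (letter_fm q a)"
    using assms(4) unfolding sem_letter_def by blast
  show "\<exists>\<gamma>. ?g = fm_code \<gamma> \<and> hyp p q Ts \<gamma>"
    using hyp.step[OF T(1) E a(1,2), of q] a(3)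
    by (intro exI[of _ "step_fm (q + p + (j \<star> s)) (letter_fm q a) (q + p + (j \<star> s'))"]) (simp add: step_fm_def)
qed

lemma sem_hyp_out_gen:
  assumes "sem_nth t j (x \<star> rows)" "sem_nth rows s row" "sem_nth row m (s' \<star> of_bool b)"
    "sem_letter (Suc (j + y)) p m f"
    and g: "\<And>a. f = fm_code a \<Longrightarrow> g = fm_code (out_fm (Suc (j + y) + p + (j \<star> s)) a b y)"
  shows "sem_hyp p (Suc (j + y)) t g"
  unfolding sem_hyp_def
proof (intro allI impI)
  fix Ts assume t: "t = list_encode (map table_code Ts)"
  note T = sem_nth_table[OF assms(1)[unfolded t]]
  obtain b' where E: "s < length (snd (Ts ! j))" "m < length (snd (Ts ! j) ! s)" "snd (Ts ! j) ! s ! m = (s', b')"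
    and b: "(of_bool b :: nat) = of_bool b'"
    using sem_nth_entry[OF assms(1)[unfolded t] assms(2,3)] by blast
  have b': "b' = b" using b by (cases b; cases b') auto
  obtain a where a: "length a = p" "horner_sum of_bool 2 a = m" "f = fm_code (letter_fm (Suc (j + y)) a)"
    using assms(4) unfolding sem_letter_def by blast
  show "\<exists>\<gamma>. g = fm_code \<gamma> \<and> hyp p (Suc (j + y)) Ts \<gamma>"
    using hyp.out[OF T(1) E a(1,2), of "Suc (j + y)" y] g[OF a(3)] unfolding b' by blast
qed

lemma sem_hyp_outs:
  "sem_nth t j (x \<star> rows) \<Longrightarrow> sem_nth rows s row \<Longrightarrow> sem_nth row m (s' \<star> Suc 0) \<Longrightarrow> sem_letter (Suc (j + y)) p m f \<Longrightarrow>
    sem_hyp p (Suc (j + y)) t (8 \<star> 9 \<star> 7 \<star> (4 \<star> 0 \<star> Suc (j + y + p + (j \<star> s))) \<star> 7 \<star> f \<star> 8 \<star> 4 \<star> 0 \<star> y)"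
  "sem_nth t j (x \<star> rows) \<Longrightarrow> sem_nth rows s row \<Longrightarrow> sem_nth row m (s' \<star> 0) \<Longrightarrow> sem_letter (Suc (j + y)) p m f \<Longrightarrow>
    sem_hyp p (Suc (j + y)) t (8 \<star> 9 \<star> 7 \<star> (4 \<star> 0 \<star> Suc (j + y + p + (j \<star> s))) \<star> 7 \<star> f \<star> 4 \<star> 0 \<star> y)"
  by (rule sem_hyp_out_gen[where b = True]; simp add: out_fm_def)
    (rule sem_hyp_out_gen[where b = False]; simp add: out_fm_def)

lemma sem_hyps_intros: "sem_hyps p q t 0"
  "sem_hyp p q t g \<Longrightarrow> sem_hyps p q t h \<Longrightarrow> sem_hyps p q t (Suc (g \<star> h))"
proof -
  show "sem_hyps p q t 0" unfolding sem_hyps_def by (intro allI impI exI[of _ "[]"]) (simp add: lcode_simps)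
  assume g: "sem_hyp p q t g" and h: "sem_hyps p q t h"
  show "sem_hyps p q t (Suc (g \<star> h))" unfolding sem_hyps_def
  proof (intro allI impI)
    fix Ts assume t: "t = list_encode (map table_code Ts)"
    obtain \<gamma> \<Gamma> where "g = fm_code \<gamma>" "hyp p q Ts \<gamma>" "h = lcode \<Gamma>" "\<forall>\<gamma>\<in>set \<Gamma>. hyp p q Ts \<gamma>"
      using g h t unfolding sem_hyp_def sem_hyps_def by blast
    then show "\<exists>\<Gamma>. Suc (g \<star> h) = lcode \<Gamma> \<and> (\<forall>\<gamma>\<in>set \<Gamma>. hyp p q Ts \<gamma>)"
      by (intro exI[of _ "\<gamma> # \<Gamma>"]) (simp add: lcode_simps)
  qed
qed

lemma sem_row_intros: "sem_row t 0"
  "sem_nth t s x \<Longrightarrow> sem_row t r \<Longrightarrow> sem_row t (Suc ((s \<star> 0) \<star> r))"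
  "sem_nth t s x \<Longrightarrow> sem_row t r \<Longrightarrow> sem_row t (Suc ((s \<star> Suc 0) \<star> r))"
proof -
  show "sem_row t 0" unfolding sem_row_def by (intro exI[of _ "[]"]) (simp add: row_code_def)
  assume s: "sem_nth t s x" and "sem_row t r"
  then obtain row where r: "r = row_code row" "\<forall>(s, b)\<in>set row. s < length (list_decode t)" unfolding sem_row_def by blast
  show "sem_row t (Suc ((s \<star> 0) \<star> r))" unfolding sem_row_def
    by (intro exI[of _ "(s, False) # row"]) (use r s in \<open>simp add: row_code_def sem_nth_def\<close>)
  show "sem_row t (Suc ((s \<star> Suc 0) \<star> r))" unfolding sem_row_def
    by (intro exI[of _ "(s, True) # row"]) (use r s in \<open>simp add: row_code_def sem_nth_def\<close>)
qed

lemma sem_rows_intros: "sem_rows t m 0"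
  "length (list_decode r) = m \<Longrightarrow> sem_row t r \<Longrightarrow> sem_rows t m l \<Longrightarrow> sem_rows t m (Suc (r \<star> l))"
proof -
  show "sem_rows t m 0" unfolding sem_rows_def by (intro exI[of _ "[]"]) simp
  assume m: "length (list_decode r) = m" and "sem_row t r" "sem_rows t m l"
  then obtain row rows where r: "r = row_code row" "\<forall>(s, b)\<in>set row. s < length (list_decode t)"
    "l = list_encode (map row_code rows)"
    "\<forall>row\<in>set rows. length row = m \<and> (\<forall>(s, b)\<in>set row. s < length (list_decode t))"
    unfolding sem_row_def sem_rows_def by blast
  have "length row = m" using m r(1) by (simp add: row_code_def)
  then show "sem_rows t m (Suc (r \<star> l))" unfolding sem_rows_def
    by (intro exI[of _ "row # rows"]) (use r in simp)
qed

lemma sem_tables_intros: "sem_tables m 0"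
  "sem_nth t s x \<Longrightarrow> sem_rows t m t \<Longrightarrow> sem_tables m l \<Longrightarrow> sem_tables m (Suc ((s \<star> t) \<star> l))"
proof -
  show "sem_tables m 0" unfolding sem_tables_def by (intro exI[of _ "[]"]) simp
  assume s: "sem_nth t s x" and "sem_rows t m t" "sem_tables m l"
  then obtain rows Ts where r: "t = list_encode (map row_code rows)"
    "\<forall>row\<in>set rows. length row = m \<and> (\<forall>(s, b)\<in>set row. s < length (list_decode t))"
    "l = list_encode (map table_code Ts)" "\<forall>T\<in>set Ts. fst T < length (snd T) \<and>
     (\<forall>row\<in>set (snd T). length row = m \<and> (\<forall>(s, b)\<in>set row. s < length (snd T)))"
    unfolding sem_rows_def sem_tables_def by blast
  have len: "length (list_decode t) = length rows" unfolding r(1) by simp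
  have "s < length rows" using s len unfolding sem_nth_def by simp
  then show "sem_tables m (Suc ((s \<star> t) \<star> l))" unfolding sem_tables_def
    by (intro exI[of _ "(s, rows) # Ts"]) (use r(2-4) len in \<open>simp add: table_code_rows r(1)\<close>)
qed

lemma sem_main_intro:
  assumes "sem_tables (2 ^ p) t" "length (list_decode t) = q" "sem_hyps p q t g" "sem_ref (Suc ((8 \<star> f) \<star> g))"
  shows "sem_main p q f t"
  unfolding sem_main_def
proof (intro allI impI)
  fix \<phi> assume f: "f = fm_code \<phi>"
  obtain Ts where Ts: "t = list_encode (map table_code Ts)" "\<forall>T\<in>set Ts. wf_table p T"
    using assms(1) unfolding sem_tables_def wf_table_def by blast
  obtain \<Gamma> where \<Gamma>: "g = lcode \<Gamma>" "\<forall>\<gamma>\<in>set \<Gamma>. hyp p q Ts \<gamma>" using assms(3) Ts(1) unfolding sem_hyps_def by blast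
  obtain \<psi> \<Delta> where d: "8 \<star> f = fm_code \<psi>" "g = lcode \<Delta>" "refutable (\<psi> # \<Delta>)"
    using assms(4) unfolding sem_ref_def lcode_eq by blast
  have "\<psi> = Neg \<phi>" using d(1) f by (auto simp: fm_code_eq fm_code_inject)
  moreover have "\<Delta> = \<Gamma>" using \<Gamma>(1) d(2) by (simp add: lcode_inject)
  moreover have "length Ts = q" using assms(2) Ts(1) by simp
  ultimately show "\<exists>Ts. t = list_encode (map table_code Ts) \<and> (\<forall>T\<in>set Ts. wf_table p T) \<and> length Ts = q \<and>
      (\<exists>\<Gamma>. (\<forall>\<gamma>\<in>set \<Gamma>. hyp p q Ts \<gamma>) \<and> refutable (Neg \<phi> # \<Gamma>))"
    using Ts \<Gamma>(2) d(3) by blast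
qed

lemma sound_prog_table: "sound prog_table"
  unfolding sound_def prog_table_def
  by (simp add: sem_letter_intros sem_hyps_intros sem_rows_intros sem_row_intros(1) sem_tables_intros(1))
    (auto intro: sem_hyp_init sem_hyp_step sem_hyp_outs sem_row_intros sem_tables_intros sem_main_intro)

theorem holds_sem: "holds prog x \<Longrightarrow> sem x"
proof (induction rule: holds.induct)
  case (clause h bs v)
  have "sound prog"
    using sound_prog_list sound_prog_ren sound_prog_ax sound_prog_ref sound_prog_table
    unfolding sound_def prog_def by (auto simp only: set_append Un_iff)
  then show ?case using clause unfolding sound_def by blast
qed

subsection \<open>Completeness\<close>

text \<open>Bindings are given as a list. A literal \<open>0\<close> in the lists below fills a
  variable that does not occur in the clause.\<close>

lemma holds_clause:
  assumes "k < length cs" "set cs \<subseteq> set prog" "\<forall>b\<in>set (snd (cs ! k)). holds prog (ev ((!) vs) b)"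
  shows "holds prog (ev ((!) vs) (fst (cs ! k)))"
proof (rule holds.clause)
  show "(fst (cs ! k), snd (cs ! k)) \<in> set prog" using assms(1,2) nth_mem[OF assms(1)] by auto
qed (use assms(3) in blast)

lemma prog_subsets: "set prog_list \<subseteq> set prog" "set prog_ren \<subseteq> set prog" "set prog_ax \<subseteq> set prog"
  "set prog_ref \<subseteq> set prog" "set prog_table \<subseteq> set prog"
  unfolding prog_def by auto

lemmas clause_list = holds_clause[OF _ prog_subsets(1), unfolded prog_list_def]
  and clause_ren = holds_clause[OF _ prog_subsets(2), unfolded prog_ren_def]
  and clause_ax = holds_clause[OF _ prog_subsets(3), unfolded prog_ax_def]
  and clause_ref = holds_clause[OF _ prog_subsets(4), unfolded prog_ref_def]
  and clause_table = holds_clause[OF _ prog_subsets(5), unfolded prog_table_def]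

lemma holds_mem: "x \<in> set xs \<Longrightarrow> holds prog (0 \<star> x \<star> list_encode xs)"
proof (induction xs)
  case (Cons y ys)
  show ?case
  proof (cases "x = y")
    case True then show ?thesis using clause_list[of 0 "[x, list_encode ys]"] by simp
  next
    case False then show ?thesis using clause_list[of 1 "[x, y, list_encode ys]"] Cons by simp
  qed
qed simp

lemma holds_sub: "set xs \<subseteq> set ys \<Longrightarrow> holds prog (1 \<star> list_encode xs \<star> list_encode ys)"
proof (induction xs)
  case Nil show ?case using clause_list[of 2 "[list_encode ys]"] by simp
next
  case (Cons x xs)
  then show ?case using clause_list[of 3 "[x, list_encode xs, list_encode ys]"] holds_mem[of x ys] by simp
qed

lemma holds_nth: "i < length xs \<Longrightarrow> holds prog (7 \<star> list_encode xs \<star> i \<star> xs ! i)"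
proof (induction xs arbitrary: i)
  case (Cons x xs)
  then show ?case
    using clause_list[of 4 "[x, list_encode xs]"] clause_list[of 5 "[x, list_encode xs, i - 1, xs ! (i - 1)]"]
    by (cases i) simp_all
qed simp

lemma holds_len: "holds prog (11 \<star> list_encode xs \<star> length xs)"
proof (induction xs)
  case Nil show ?case using clause_list[of 6 "[]"] by simp
next
  case (Cons x xs)
  then show ?case using clause_list[of 7 "[x, list_encode xs, length xs]"] by simp
qed

lemma holds_pow: "holds prog (12 \<star> k \<star> 2 ^ k)"
proof (induction k)
  case 0 show ?case using clause_list[of 8 "[]"] by simp
next
  case (Suc k)
  then show ?case using clause_list[of 9 "[k, 2 ^ k]"] by (simp add: mult_2)
qed

lemma holds_app: "holds prog (2 \<star> rcode \<rho> \<star> x \<star> rfun \<rho> x)"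
proof (induction \<rho> arbitrary: x)
  case RId show ?case using clause_ren[of 0 "[x]"] by simp
next
  case RSuc show ?case using clause_ren[of 1 "[x]"] by simp
next
  case (RInst y)
  show ?case using clause_ren[of 2 "[y]"] clause_ren[of 3 "[y, x - 1]"] by (cases x) simp_all
next
  case (RUp \<rho>)
  show ?case using clause_ren[of 4 "[rcode \<rho>]"] clause_ren[of 5 "[rcode \<rho>, x - 1, rfun \<rho> (x - 1)]"] RUp[of "x - 1"]
    by (cases x) simp_all
qed

lemma holds_ren: "holds prog (3 \<star> rcode \<rho> \<star> rcode \<tau> \<star> fm_code \<phi> \<star> fm_code (ren (rfun \<rho>) (rfun \<tau>) \<phi>))"
proof (induction \<phi> arbitrary: \<rho> \<tau>)
  case (Eq x y)
  show ?case using clause_ren[of 6 "[rcode \<rho>, rcode \<tau>, x, y, rfun \<rho> x, rfun \<rho> y]"] by (simp add: holds_app)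
next
  case (Le x y)
  show ?case using clause_ren[of 7 "[rcode \<rho>, rcode \<tau>, x, y, rfun \<rho> x, rfun \<rho> y]"] by (simp add: holds_app)
next
  case (Succ x y)
  show ?case using clause_ren[of 8 "[rcode \<rho>, rcode \<tau>, x, y, rfun \<rho> x, rfun \<rho> y]"] by (simp add: holds_app)
next
  case (Zero x)
  show ?case using clause_ren[of 9 "[rcode \<rho>, rcode \<tau>, x, 0, rfun \<rho> x]"] by (simp add: holds_app)
next
  case (Mem x X)
  show ?case using clause_ren[of 10 "[rcode \<rho>, rcode \<tau>, x, X, rfun \<rho> x, rfun \<tau> X]"] by (simp add: holds_app)
next
  case Tru show ?case using clause_ren[of 11 "[rcode \<rho>, rcode \<tau>]"] by simp
next
  case Fls show ?case using clause_ren[of 12 "[rcode \<rho>, rcode \<tau>]"] by simp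
next
  case (And \<phi> \<psi>)
  then show ?case
    using clause_ren[of 13 "[rcode \<rho>, rcode \<tau>, fm_code \<phi>, fm_code \<psi>, fm_code (ren (rfun \<rho>) (rfun \<tau>) \<phi>),
      fm_code (ren (rfun \<rho>) (rfun \<tau>) \<psi>)]"] by simp
next
  case (Neg \<phi>)
  then show ?case
    using clause_ren[of 14 "[rcode \<rho>, rcode \<tau>, fm_code \<phi>, 0, fm_code (ren (rfun \<rho>) (rfun \<tau>) \<phi>)]"] by simp
next
  case (ExI \<phi>)
  from ExI[of "RUp \<rho>" \<tau>] show ?case
    using clause_ren[of 15 "[rcode \<rho>, rcode \<tau>, fm_code \<phi>, 0, fm_code (ren (up (rfun \<rho>)) (rfun \<tau>) \<phi>)]"] by simp
next
  case (ExP \<phi>)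
  from ExP[of \<rho> "RUp \<tau>"] show ?case
    using clause_ren[of 16 "[rcode \<rho>, rcode \<tau>, fm_code \<phi>, 0, fm_code (ren (rfun \<rho>) (up (rfun \<tau>)) \<phi>)]"] by simp
qed

lemma holds_rens: "holds prog (4 \<star> rcode \<rho> \<star> rcode \<tau> \<star> lcode \<Gamma> \<star> lcode (map (ren (rfun \<rho>) (rfun \<tau>)) \<Gamma>))"
proof (induction \<Gamma>)
  case Nil show ?case using clause_ren[of 17 "[rcode \<rho>, rcode \<tau>]"] by (simp add: lcode_simps)
next
  case (Cons \<phi> \<Gamma>)
  then show ?case
    using clause_ren[of 18 "[rcode \<rho>, rcode \<tau>, fm_code \<phi>, lcode \<Gamma>, fm_code (ren (rfun \<rho>) (rfun \<tau>) \<phi>),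
      lcode (map (ren (rfun \<rho>) (rfun \<tau>)) \<Gamma>)]"] holds_ren[of \<rho> \<tau> \<phi>] by (simp add: lcode_simps)
qed

lemma holds_ax: "ax_step ps \<phi> \<Longrightarrow> holds prog (5 \<star> lcode ps \<star> fm_code \<phi>)"
proof (induction rule: ax_step.induct)
  case (1 \<phi> \<psi>)
  show ?case using clause_ax[of 0 "[fm_code \<phi>, fm_code \<psi>]"] by (simp add: lcode_simps)
next
  case (2 \<phi> \<psi>)
  show ?case using clause_ax[of 1 "[fm_code \<phi>, fm_code \<psi>]"] by (simp add: lcode_simps)
next
  case (3 \<phi> \<psi>)
  show ?case using clause_ax[of 2 "[fm_code \<phi>, fm_code \<psi>]"] by (simp add: lcode_simps)
next
  case (4 \<phi>)
  show ?case using clause_ax[of 3 "[fm_code \<phi>]"] by (simp add: lcode_simps)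
next
  case (5)
  show ?case using clause_ax[of 4 "[]"] by (simp add: lcode_simps)
next
  case (6 y \<phi>)
  show ?case using clause_ax[of 5 "[fm_code (inst_ind y \<phi>), fm_code \<phi>, y]"] holds_ren[of "RInst y" RId \<phi>] by (simp add: lcode_simps inst_ind_def inst_pred_def)
next
  case (7 Y \<phi>)
  show ?case using clause_ax[of 6 "[fm_code (inst_pred Y \<phi>), fm_code \<phi>, Y]"] holds_ren[of RId "RInst Y" \<phi>] by (simp add: lcode_simps inst_ind_def inst_pred_def)
next
  case (8 x)
  show ?case using clause_ax[of 7 "[x]"] by (simp add: lcode_simps)
next
  case (9 y \<phi> z)
  show ?case using clause_ax[of 8 "[fm_code (inst_ind y \<phi>), y, z, fm_code (inst_ind z \<phi>), fm_code \<phi>]"] holds_ren[of "RInst y" RId \<phi>] holds_ren[of "RInst z" RId \<phi>] by (simp add: lcode_simps inst_ind_def inst_pred_def)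
next
  case (10 x)
  show ?case using clause_ax[of 9 "[x]"] by (simp add: lcode_simps)
next
  case (11 x y z)
  show ?case using clause_ax[of 10 "[x, y, z]"] by (simp add: lcode_simps)
next
  case (12 x y)
  show ?case using clause_ax[of 11 "[x, y]"] by (simp add: lcode_simps)
next
  case (13)
  show ?case using clause_ax[of 12 "[]"] by (simp add: lcode_simps)
next
  case (14 x y)
  show ?case using clause_ax[of 13 "[x, y]"] by (simp add: lcode_simps)
next
  case (15 x)
  show ?case using clause_ax[of 14 "[x]"] by (simp add: lcode_simps)
next
  case (16 y x z)
  show ?case using clause_ax[of 15 "[y, x, z]"] by (simp add: lcode_simps)
next
  case (17 x y z)
  show ?case using clause_ax[of 16 "[x, y, z]"] by (simp add: lcode_simps)
next
  case (18 x y)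
  show ?case using clause_ax[of 17 "[x, y]"] by (simp add: lcode_simps)
next
  case (19 x y)
  show ?case using clause_ax[of 18 "[x, y]"] by (simp add: lcode_simps)
next
  case (20 y y' x)
  show ?case using clause_ax[of 19 "[y, y', x]"] by (simp add: lcode_simps)
next
  case (21 \<psi>)
  show ?case using clause_ax[of 20 "[fm_code (lift_pred \<psi>), fm_code \<psi>]"] holds_ren[of RId RSuc \<psi>] by (simp add: lcode_simps compr_ax_def)
next
  case (22 X)
  show ?case using clause_ax[of 21 "[X]"] by (simp add: lcode_simps ind_ax_def)
qed

lemma holds_refutable: "refutable \<Gamma> \<Longrightarrow> holds prog (6 \<star> lcode \<Gamma>)"
proof (induction rule: refutable.induct)
  case (falsity \<Gamma>)
  then have "6 \<star> 0 \<in> set (map fm_code \<Gamma>)" using imageI[of Fls "set \<Gamma>" fm_code] by simp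
  from holds_mem[OF this] have "holds prog (0 \<star> (6 \<star> 0) \<star> lcode \<Gamma>)" by (simp add: lcode_def)
  moreover have "map (ren id id) \<Gamma> = \<Gamma>" by (rule map_idI) simp
  ultimately show ?case
    using clause_ref[of 0 "[lcode \<Gamma>, lcode \<Gamma>]"] holds_rens[of RId RId \<Gamma>] by simp
next
  case (step ps \<phi> \<Gamma>)
  have "holds prog (1 \<star> lcode ps \<star> lcode \<Gamma>)" unfolding lcode_def by (rule holds_sub) (use step in auto)
  then show ?case
    using clause_ref[of 1 "[lcode \<Gamma>, lcode ps, fm_code \<phi>]"] holds_ax[OF step(1)] step.IH by (simp add: lcode_simps)
next
  case (split \<phi> \<Gamma>)
  then show ?case using clause_ref[of 2 "[lcode \<Gamma>, fm_code \<phi>]"] by (simp add: lcode_simps)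
next
  case (witness_ind \<phi> \<Gamma>)
  then have "9 \<star> fm_code \<phi> \<in> set (map fm_code \<Gamma>)" using imageI[of "ExI \<phi>" "set \<Gamma>" fm_code] by simp
  from holds_mem[OF this] have "holds prog (0 \<star> (9 \<star> fm_code \<phi>) \<star> lcode \<Gamma>)" by (simp add: lcode_def)
  then show ?case
    using clause_ref[of 3 "[lcode \<Gamma>, fm_code \<phi>, lcode (map lift_ind \<Gamma>)]"] holds_rens[of RSuc RId \<Gamma>] witness_ind.IH
    by (simp add: lcode_simps)
next
  case (witness_pred \<phi> \<Gamma>)
  then have "10 \<star> fm_code \<phi> \<in> set (map fm_code \<Gamma>)" using imageI[of "ExP \<phi>" "set \<Gamma>" fm_code] by simp
  from holds_mem[OF this] have "holds prog (0 \<star> (10 \<star> fm_code \<phi>) \<star> lcode \<Gamma>)" by (simp add: lcode_def)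
  then show ?case
    using clause_ref[of 4 "[lcode \<Gamma>, fm_code \<phi>, lcode (map lift_pred \<Gamma>)]"] holds_rens[of RId RSuc \<Gamma>] witness_pred.IH
    by (simp add: lcode_simps)
qed

lemma holds_letter: "holds prog (8 \<star> x \<star> length a \<star> horner_sum of_bool 2 a \<star> fm_code (letter_fm x a))"
proof (induction a arbitrary: x)
  case Nil show ?case using clause_table[of 0 "[x]"] by simp
next
  case (Cons b a)
  let ?vs = "[x, length a, horner_sum of_bool 2 a, fm_code (letter_fm (Suc x) a)]"
  show ?case using clause_table[of 1 ?vs] clause_table[of 2 ?vs] Cons.IH[of "Suc x"] by (cases b) (simp_all add: mult_2)
qed

lemma holds_entry:
  assumes "j < length Ts" "s < length (snd (Ts ! j))" "m < length (snd (Ts ! j) ! s)" "snd (Ts ! j) ! s ! m = (s', b)"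
  shows "holds prog (7 \<star> list_encode (map table_code Ts) \<star> j \<star> fst (Ts ! j) \<star> list_encode (map row_code (snd (Ts ! j))))"
    "holds prog (7 \<star> list_encode (map row_code (snd (Ts ! j))) \<star> s \<star> row_code (snd (Ts ! j) ! s))"
    "holds prog (7 \<star> row_code (snd (Ts ! j) ! s) \<star> m \<star> s' \<star> of_bool b)"
proof -
  show "holds prog (7 \<star> list_encode (map table_code Ts) \<star> j \<star> fst (Ts ! j) \<star> list_encode (map row_code (snd (Ts ! j))))"
    using holds_nth[of j "map table_code Ts"] assms(1) by (simp add: table_code_rows)
  show "holds prog (7 \<star> list_encode (map row_code (snd (Ts ! j))) \<star> s \<star> row_code (snd (Ts ! j) ! s))"
    using holds_nth[of s "map row_code (snd (Ts ! j))"] assms(2) by simp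
  show "holds prog (7 \<star> row_code (snd (Ts ! j) ! s) \<star> m \<star> s' \<star> of_bool b)"
    using holds_nth[of m "map (\<lambda>(s, b). s \<star> of_bool b) (snd (Ts ! j) ! s)"] assms(3,4) by (simp add: row_code_def)
qed

lemma holds_hyp: "hyp p q Ts \<gamma> \<Longrightarrow> holds prog (9 \<star> p \<star> q \<star> list_encode (map table_code Ts) \<star> fm_code \<gamma>)"
proof (induction rule: hyp.induct)
  case (init j)
  have "holds prog (7 \<star> list_encode (map table_code Ts) \<star> j \<star> fst (Ts ! j) \<star> list_encode (map row_code (snd (Ts ! j))))"
    using holds_nth[of j "map table_code Ts"] init by (simp add: table_code_rows)
  then show ?case
    using clause_table[of 3 "[p, q, list_encode (map table_code Ts), j, fst (Ts ! j), list_encode (map row_code (snd (Ts ! j)))]"]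
    by (simp add: init_fm_def)
next
  case (step j s m s' b a)
  note E = holds_entry[OF step(1-4)]
  show ?case
    using clause_table[of 4 "[p, q, list_encode (map table_code Ts), j, s, fm_code (letter_fm q a), s', m, of_bool b,
      fst (Ts ! j), list_encode (map row_code (snd (Ts ! j))), row_code (snd (Ts ! j) ! s)]"] E holds_letter[of q a] step(5,6)
    by (simp add: step_fm_def)
next
  case (out j s m s' b a j')
  note E = holds_entry[OF out(1-4)]
  let ?vs = "[p, j', list_encode (map table_code Ts), j, s, fm_code (letter_fm q a), s', m, of_bool b,
      fst (Ts ! j), list_encode (map row_code (snd (Ts ! j))), row_code (snd (Ts ! j) ! s)]"
  show ?case
    using clause_table[of 5 ?vs] clause_table[of 6 ?vs] E holds_letter[of q a] out(5-7)
    by (cases b) (simp_all add: out_fm_def)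
qed

lemma holds_hyps: "\<forall>\<gamma>\<in>set \<Gamma>. hyp p q Ts \<gamma> \<Longrightarrow> holds prog (10 \<star> p \<star> q \<star> list_encode (map table_code Ts) \<star> lcode \<Gamma>)"
proof (induction \<Gamma>)
  case Nil show ?case using clause_table[of 7 "[p, q, list_encode (map table_code Ts)]"] by (simp add: lcode_simps)
next
  case (Cons \<gamma> \<Gamma>)
  then show ?case
    using clause_table[of 8 "[p, q, list_encode (map table_code Ts), fm_code \<gamma>, lcode \<Gamma>]"] holds_hyp[of p q Ts \<gamma>]
    by (simp add: lcode_simps)
qed

lemma holds_row: "\<forall>(s, b)\<in>set row. s < length xs \<Longrightarrow> holds prog (13 \<star> list_encode xs \<star> row_code row)"
proof (induction row)
  case Nil show ?case using clause_table[of 9 "[list_encode xs]"] by (simp add: row_code_def)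
next
  case (Cons e row)
  obtain s b where e: "e = (s, b)" by fastforce
  let ?vs = "[list_encode xs, s, row_code row, xs ! s]"
  show ?case
    using clause_table[of 10 ?vs] clause_table[of 11 ?vs] Cons holds_nth[of s xs] e
    by (cases b) (simp_all add: row_code_def)
qed

lemma holds_rows:
  "\<forall>row\<in>set rows. length row = m \<and> (\<forall>(s, b)\<in>set row. s < length xs) \<Longrightarrow>
    holds prog (14 \<star> list_encode xs \<star> m \<star> list_encode (map row_code rows))"
proof (induction rows)
  case Nil show ?case using clause_table[of 12 "[list_encode xs, m]"] by simp
next
  case (Cons row rows)
  have "holds prog (11 \<star> row_code row \<star> m)"
    using holds_len[of "map (\<lambda>(s, b). s \<star> of_bool b) row"] Cons.prems by (simp add: row_code_def)
  then show ?case
    using clause_table[of 13 "[list_encode xs, m, row_code row, list_encode (map row_code rows)]"]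
      Cons holds_row[of row xs] by simp
qed

lemma holds_tables:
  "\<forall>T\<in>set Ts. wf_table p T \<Longrightarrow> holds prog (15 \<star> 2 ^ p \<star> list_encode (map table_code Ts))"
proof (induction Ts)
  case Nil show ?case using clause_table[of 14 "[2 ^ p]"] by simp
next
  case (Cons T Ts)
  have wf: "fst T < length (snd T)"
    "\<forall>row\<in>set (snd T). length row = 2 ^ p \<and> (\<forall>(s, b)\<in>set row. s < length (map row_code (snd T)))"
    using Cons.prems by (auto simp: wf_table_def)
  show ?case
    using clause_table[of 15 "[2 ^ p, fst T, list_encode (map row_code (snd T)), list_encode (map table_code Ts),
        row_code (snd T ! fst T)]"]
      Cons holds_nth[of "fst T" "map row_code (snd T)"] wf(1) holds_rows[OF wf(2)] by (simp add: table_code_rows[of T])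
qed

theorem holds_main:
  assumes "\<forall>T\<in>set Ts. wf_table p T" "length Ts = q" "\<forall>\<gamma>\<in>set \<Gamma>. hyp p q Ts \<gamma>" "refutable (Neg \<phi> # \<Gamma>)"
  shows "holds prog (16 \<star> p \<star> q \<star> fm_code \<phi> \<star> list_encode (map table_code Ts))"
proof -
  have "holds prog (11 \<star> list_encode (map table_code Ts) \<star> q)"
    using holds_len[of "map table_code Ts"] assms(2) by simp
  then show ?thesis
    using clause_table[of 16 "[p, q, fm_code \<phi>, list_encode (map table_code Ts), 2 ^ p, lcode \<Gamma>]"]
      holds_pow[of p] holds_tables[OF assms(1)] holds_hyps[OF assms(3)] holds_refutable[OF assms(4)]
    by (simp add: lcode_simps)
qed

section \<open>Extraction\<close>

theorem extraction:
  "\<exists>e. \<forall>p q \<phi> d. formula_over p q \<phi> \<longrightarrow> is_derivation d \<longrightarrow> conclusion d = ([], (ExP ^^ q) \<phi>) \<longrightarrow>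
     (\<exists>Ts. recf_eval e [p, q, fm_code \<phi>, deriv_code d] (list_encode (map table_code Ts)) \<and>
        (\<forall>T\<in>set Ts. wf_table p T) \<and> church_realizer p q \<phi> (map (\<lambda>T. dmm_fun (table_dmm T)) Ts))"
proof -
  \<comment> \<open>The tag 16 is that of \<open>jMain\<close>; the output \<open>y\<close> sought
    is its last argument, the code of the list of tables.\<close>
  let ?q = "\<lambda>y s. 16 \<star> s 0 \<star> s (Suc 0) \<star> s (Suc (Suc 0)) \<star> y"
  have "rec_fn (Suc 4) (\<lambda>s. ?q (s 0) (\<lambda>i. s (Suc i)))"
    by (intro rec_fn_prod_encode rec_fn_const rec_fn_var) simp_all
  from holds_search[of 4 ?q, OF this] obtain e where e:
    "\<And>s. \<exists>y. holds prog (?q y s) \<Longrightarrow> \<exists>y. recf_eval e (map s [0..<4]) y \<and> holds prog (?q y s)" by blast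
  have "\<exists>Ts. recf_eval e [p, q, fm_code \<phi>, deriv_code d] (list_encode (map table_code Ts)) \<and>
        (\<forall>T\<in>set Ts. wf_table p T) \<and> church_realizer p q \<phi> (map (\<lambda>T. dmm_fun (table_dmm T)) Ts)"
    if \<phi>: "formula_over p q \<phi>" and d: "is_derivation d" "conclusion d = ([], (ExP ^^ q) \<phi>)" for p q \<phi> d
  proof -
    obtain Ts where Ts: "\<forall>T\<in>set Ts. wf_table p T" "church_realizer p q \<phi> (map (\<lambda>T. dmm_fun (table_dmm T)) Ts)"
      using derivation_tables[OF d \<phi>] by blast
    have len: "length Ts = q" using Ts(2) unfolding church_realizer_def by simp
    obtain \<Gamma> where \<Gamma>: "\<forall>\<gamma>\<in>set \<Gamma>. hyp p q Ts \<gamma>" "refutable (Neg \<phi> # \<Gamma>)"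
      using realizer_iff_refutable[OF Ts(1) len \<phi>] Ts(2) by blast
    let ?s = "(!) [p, q, fm_code \<phi>, deriv_code d]"
    have "holds prog (?q (list_encode (map table_code Ts)) ?s)" using holds_main[OF Ts(1) len \<Gamma>] by simp
    then obtain y where y: "recf_eval e (map ?s [0..<4]) y" "holds prog (?q y ?s)" using e[of ?s] by blast
    \<comment> \<open>The tables found need not be \<open>Ts\<close>; what the accepted certificate
      says about them is enough for the converse direction of
      \<open>realizer_iff_refutable\<close>.\<close>
    from holds_sem[OF y(2)] have "sem_main p q (fm_code \<phi>) y" by simp
    then obtain Us where Us: "y = list_encode (map table_code Us)" "\<forall>T\<in>set Us. wf_table p T" "length Us = q"
      "\<exists>\<Gamma>. (\<forall>\<gamma>\<in>set \<Gamma>. hyp p q Us \<gamma>) \<and> refutable (Neg \<phi> # \<Gamma>)" unfolding sem_main_def by blast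
    have "map ?s [0..<4] = [p, q, fm_code \<phi>, deriv_code d]"
      by (simp add: upt_rec[of _ 4] numeral_eq_Suc)
    then have "recf_eval e [p, q, fm_code \<phi>, deriv_code d] (list_encode (map table_code Us))" using y(1) Us(1) by simp
    moreover have "church_realizer p q \<phi> (map (\<lambda>T. dmm_fun (table_dmm T)) Us)"
      using realizer_iff_refutable[OF Us(2,3) \<phi>] Us(4) by blast
    ultimately show ?thesis using Us(2) by blast
  qed
  then show ?thesis by blast
qed

theorem theorem3p7:
  shows
    "(\<exists>e. \<forall>p q \<phi> d.
        formula_over p q \<phi> \<longrightarrow> is_derivation d \<longrightarrow> conclusion d = ([], (ExP ^^ q) \<phi>) \<longrightarrow>
        (\<exists>Ts. recf_eval e [p, q, fm_code \<phi>, deriv_code d] (list_encode (map table_code Ts)) \<and>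
              (\<forall>T \<in> set Ts. wf_table p T) \<and>
              church_realizer p q \<phi> (map (\<lambda>T. dmm_fun (table_dmm T)) Ts))) \<and>
     (\<forall>p q \<phi>.
        formula_over p q \<phi> \<longrightarrow> (\<exists>Fs. church_realizer p q \<phi> Fs) \<longrightarrow>
        smso_derivable ([], (ExP ^^ q) (Neg (Neg \<phi>))))"
  using extraction church_realizer_derivable by blast

end
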